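(* The following assignment, with the central element $c$ acting as $1$, defines a $\mathrm{DY}_\hbar(\mathfrak o_{2n})$-module structure on the Fock space $\mathcal F$ described in the context. For $1\le j\le n-3$, $$E_j(u)\mapsto \exp\Big[\sum_{k>0}\tfrac{a_{j,-k}}k\{(u-\tfrac14\hbar)^k+(u+\tfrac34\hbar)^k\}-\sum_{k>0}\tfrac{a_{j+1,-k}+a_{j-1,-k}}k(u+\tfrac14\hbar)^k\Big]\exp\Big[-\sum_{k>0}\tfrac{a_{j,k}}k(u-\tfrac14\hbar)^{-k}\Big]e^{\alpha_j}[(-1)^{j-1}(u-\tfrac14\hbar)]^{\partial\alpha_j},$$ $$F_j(u)\mapsto \exp\Big[-\sum_{k>0}\tfrac{a_{j,-k}}k\{(u+\tfrac14\hbar)^k+(u-\tfrac34\hbar)^k\}+\sum_{k>0}\tfrac{a_{j+1,-k}+a_{j-1,-k}}k(u-\tfrac14\hbar)^k\Big]\exp\Big[\sum_{k>0}\tfrac{a_{j,k}}k(u+\tfrac14\hbar)^{-k}\Big]e^{-\alpha_j}[(-1)^{j-1}(u+\tfrac14\hbar)]^{-\partial\alpha_j},$$ $$H_j^-(u)\mapsto \exp\Big[-\sum_{k>0}\tfrac{a_{j,-k}}k\{(u-\hbar)^k-(u+\hbar)^k\}+\sum_{k>0}\tfrac{a_{j+1,-k}+a_{j-1,-k}}k\{(u-\tfrac12\hbar)^k-(u+\tfrac12\hbar)^k\}\Big];$$ for $j=n-2$, $$E_{n-2}(u)\mapsto \exp\Big[\sum_{k>0}\tfrac{a_{n-2,-k}}k\{(u-\tfrac14\hbar)^k+(u+\tfrac34\hbar)^k\}-\sum_{k>0}\tfrac{a_{n-1,-k}+a_{n-3,-k}+a_{n,-k}}k(u+\tfrac14\hbar)^k\Big]$$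 $$\cdot\exp\Big[-\sum_{k>0}\tfrac{a_{n-2,k}}k(u-\tfrac14\hbar)^{-k}\Big]e^{\alpha_{n-2}}[(-1)^{n-3}(u-\tfrac14\hbar)]^{\partial\alpha_{n-2}},$$ $$F_{n-2}(u)\mapsto \exp\Big[-\sum_{k>0}\tfrac{a_{n-2,-k}}k\{(u+\tfrac14\hbar)^k+(u-\tfrac34\hbar)^k\}+\sum_{k>0}\tfrac{a_{n-1,-k}+a_{n-3,-k}+a_{n,-k}}k(u-\tfrac14\hbar)^k\Big]$$ $$\cdot\exp\Big[\sum_{k>0}\tfrac{a_{n-2,k}}k(u+\tfrac14\hbar)^{-k}\Big]e^{-\alpha_{n-2}}[(-1)^{n-3}(u+\tfrac14\hbar)]^{-\partial\alpha_{n-2}},$$ $$H_{n-2}^-(u)\mapsto \exp\Big[-\sum_{k>0}\tfrac{a_{n-2,-k}}k\{(u-\hbar)^k-(u+\hbar)^k\}+\sum_{k>0}\tfrac{a_{n-1,-k}+a_{n-3,-k}+a_{n,-k}}k\{(u-\tfrac12\hbar)^k-(u+\tfrac12\hbar)^k\}\Big];$$ for $j\in\{n-1,n\}$, with $s_{n-1}=n-2$ and $s_n=n$, $$E_j(u)\mapsto \exp\Big[\sum_{k>0}\tfrac{a_{j,-k}}k\{(u-\tfrac14\hbar)^k+(u+\tfrac34\hbar)^k\}-\sum_{k>0}\tfrac{a_{n-2,-k}}k(u+\tfrac14\hbar)^k\Big]\exp\Big[-\sum_{k>0}\tfrac{a_{j,k}}k(u-\tfrac14\hbar)^{-k}\Big]e^{\alpha_j}[(-1)^{s_j}(u-\tfrac14\hbar)]^{\partial\alpha_j},$$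 $$F_j(u)\mapsto \exp\Big[-\sum_{k>0}\tfrac{a_{j,-k}}k\{(u+\tfrac14\hbar)^k+(u-\tfrac34\hbar)^k\}+\sum_{k>0}\tfrac{a_{n-2,-k}}k(u-\tfrac14\hbar)^k\Big]\exp\Big[\sum_{k>0}\tfrac{a_{j,k}}k(u+\tfrac14\hbar)^{-k}\Big]e^{-\alpha_j}[(-1)^{s_j}(u+\tfrac14\hbar)]^{-\partial\alpha_j},$$ $$H_j^-(u)\mapsto \exp\Big[-\sum_{k>0}\tfrac{a_{j,-k}}k\{(u-\hbar)^k-(u+\hbar)^k\}+\sum_{k>0}\tfrac{a_{n-2,-k}}k\{(u-\tfrac12\hbar)^k-(u+\tfrac12\hbar)^k\}\Big];$$ and for all $1\le j\le n$, $$H_j^+(u)\mapsto \exp\Big[-\sum_{k>0}\tfrac{a_{j,k}}k\{(u-\tfrac12\hbar)^{-k}-(u+\tfrac12\hbar)^{-k}\}\Big]\Big(\tfrac{u+\frac12\hbar}{u-\frac12\hbar}\Big)^{-\partial\alpha_j}.$$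
   Context: $\mathcal A=\mathbb C[[\hbar]]$, $n\ge3$. Bosons $a_{i,k}$ ($k\in\mathbb Z\setminus\{0\}$) satisfy $[a_{i,k},a_{j,l}]=k\delta_{ij}\delta_{k+l,0}$; set $a_{0,k}=0$. Let $\epsilon_1,\dots,\epsilon_n$ be orthonormal, $\alpha_j=\epsilon_j-\epsilon_{j+1}$ ($1\le j\le n-1$), $\alpha_n=\epsilon_{n-1}+\epsilon_n$, $Q=\bigoplus_{i=1}^n\mathbb Z\alpha_i$. The Fock space is the $\hbar$-adically completed tensor product $\mathcal F=\mathcal A[a_{j,-k}\ (1\le j\le n,\ k>0)]\,\widetilde\otimes\,\mathcal A[Q]$, $\mathcal A[Q]$ being the group algebra with basis $e^\beta$. Operators: $a_{j,k}(f\otimes e^\beta)=a_{j,k}f\otimes e^\beta$ for $k<0$ and $[a_{j,k},f]\otimes e^\beta$ for $k>0$; $\partial\epsilon_j(f\otimes e^\beta)=(\epsilon_j,\beta)f\otimes e^\beta$ and $e^{\epsilon_j}(f\otimes e^\beta)=f\otimes e^{\epsilon_j+\beta}$, extended so that $\partial\gamma$ acts by $(\gamma,\beta)$ and $e^\gamma$ by $e^\beta\mapsto e^{\gamma+\beta}$ for $\gamma\in Q$. Negative powers $(u+a\hbar)^{-k}$ are expanded in powers of $\hbar$. $\mathrm{DY}_\hbar(\mathfrak o_{2n})$ is the $\mathcal A$-algebra topologically generated by $h_{ir},\xi^\pm_{ir}$ ($1\le i\le n$, $r\in\mathbb Z$) and a central $c$; with $H_i^+(u)=1+\hbar\sum_{r\ge0}h_{ir}u^{-r-1}$,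 $H_i^-(u)=1-\hbar\sum_{r\ge1}h_{i,-r}u^{r-1}$, $E_i(u)=\sum_{r\in\mathbb Z}\xi^+_{ir}u^{-r-1}$, $F_i(u)=\sum_{r\in\mathbb Z}\xi^-_{ir}u^{-r-1}$, $u_\pm=u\pm\frac14\hbar c$, $\delta(u-v)=\sum_{k\in\mathbb Z}u^{-k-1}v^k$, $B_{ij}=\frac12(\alpha_i,\alpha_j)$, $(a_{ij})$ the Cartan matrix of type $D_n$, the relations are: $[H_i^\pm(u),H_j^\pm(v)]=0$; $(u_\pm-v_\mp-B_{ij}\hbar)(u_\mp-v_\pm+B_{ij}\hbar)H_i^\pm(u)H_j^\mp(v)=(u_\pm-v_\mp+B_{ij}\hbar)(u_\mp-v_\pm-B_{ij}\hbar)H_j^\mp(v)H_i^\pm(u)$; $H_i^\pm(u)^{-1}E_j(v)H_i^\pm(u)=\frac{u_\mp-v+B_{ij}\hbar}{u_\mp-v-B_{ij}\hbar}E_j(v)$; $H_i^\pm(u)F_j(v)H_i^\pm(u)^{-1}=\frac{u_\pm-v+B_{ij}\hbar}{u_\pm-v-B_{ij}\hbar}F_j(v)$ (rational functions expanded in powers of $u^{-1}$ for $H_i^+(u)$ and in nonnegative powers of $u$ for $H_i^-(u)$); $(u-v+B_{ij}\hbar)E_i(u)E_j(v)=(u-v-B_{ij}\hbar)E_j(v)E_i(u)$; $(u-v-B_{ij}\hbar)F_i(u)F_j(v)=(u-v+B_{ij}\hbar)F_j(v)F_i(u)$; $\sum_{\sigma\in\mathfrak S_m}[E_i(u_{\sigma(1)}),\cdots,[E_i(u_{\sigma(m)}),E_j(v)]\cdots]=0$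 and likewise for $F$, for $i\ne j$, $m=1-a_{ij}$; $[E_i(u),F_j(v)]=\frac1\hbar\delta_{ij}\{\delta(u_--v_+)H_i^-(v_+)-\delta(u_+-v_-)H_i^+(u_+)\}$. *)

theory Defs
  imports
    Complex_Main
    "HOL-Computational_Algebra.Formal_Power_Series"
    "HOL-Library.Poly_Mapping"
    "HOL-Library.Product_Plus"
    "HOL-Library.Function_Algebras"
    "HOL-Combinatorics.Permutations"
    "HOL-Algebra.QuotRing"
begin

unbundle fps_syntax

section \<open>\<open>\<hbar>\<close>-adic formal series\<close>

text \<open>
  The base ring \<open>\<A> = \<complex>[[\<hbar>]]\<close> is \<^typ>\<open>complex fps\<close> with \<open>\<hbar> = fps_X\<close>. The \<open>\<hbar>\<close>-adic completion of a
  free \<open>\<A>\<close>-module with basis \<open>K\<close> is \<open>V[[\<hbar>]]\<close>, where \<open>V\<close> is the complex vector space with basis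
  \<open>K\<close>, i.e. \<^typ>\<open>('k \<Rightarrow>\<^sub>0 complex) fps\<close>; if \<open>K\<close> is a monoid this is the completed monoid algebra.
\<close>

definition hb :: "complex \<Rightarrow> complex fps" where
  "hb c = fps_const c * fps_X"

definition scl :: "complex fps \<Rightarrow> ('k::zero \<Rightarrow>\<^sub>0 complex) fps" where
  "scl f = Abs_fps (\<lambda>p. Poly_Mapping.single 0 (f $ p))"

text \<open>
  \<open>\<hbar>\<close>-adically convergent sum of a family: each coefficient of \<open>\<hbar>\<^sup>p\<close> is a sum with finitely many
  nonzero terms. (\<^const>\<open>Sum_any\<close> gives \<open>0\<close> for a divergent family; the families summed
  in the relators and in the vertex operators acting on the Fock space all converge.)
\<close>

definition hsum :: "('i \<Rightarrow> 'a::comm_monoid_add fps) \<Rightarrow> 'a fps" where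
  "hsum f = Abs_fps (\<lambda>p. Sum_any (\<lambda>i. f i $ p))"

text \<open>
  A formal series in \<open>u\<^sup>\<plusminus>\<^sup>1\<close> is a function from exponents in \<^typ>\<open>int\<close> to coefficients, a series in
  \<open>u\<^sup>\<plusminus>\<^sup>1, v\<^sup>\<plusminus>\<^sup>1\<close> a function on \<^typ>\<open>int \<times> int\<close>. Addition is pointwise.
\<close>

definition ser_mult :: "('e::ab_group_add \<Rightarrow> 'a::semiring_0 fps) \<Rightarrow> ('e \<Rightarrow> 'a fps) \<Rightarrow> 'e \<Rightarrow> 'a fps"
    (infixl \<open>\<star>\<close> 75) where
  "(f \<star> g) e = hsum (\<lambda>i. f i * g (e - i))"

definition ser_one :: "'e::zero \<Rightarrow> 'a::ring_1 fps" where
  "ser_one e = (if e = 0 then 1 else 0)"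

text \<open>Inverse of a series congruent to \<open>1\<close> modulo \<open>\<hbar>\<close>, as a geometric series.\<close>

definition ser_inv :: "('e::ab_group_add \<Rightarrow> 'a::ring_1 fps) \<Rightarrow> 'e \<Rightarrow> 'a fps" where
  "ser_inv f e = hsum (\<lambda>k. (((\<star>) (ser_one - f)) ^^ k) ser_one e)"

text \<open>The binomial coefficient for an integer upper argument; the division is exact.\<close>

definition ibinom :: "int \<Rightarrow> nat \<Rightarrow> int" where
  "ibinom k d = (\<Prod>i<d. k - int i) div fact d"

text \<open>\<open>(u + s)\<^sup>k\<close> for \<open>s\<close> divisible by \<open>\<hbar>\<close> and \<open>k \<in> \<int>\<close>, expanded in nonnegative powers of \<open>s\<close>.\<close>

definition pw :: "'a::ring_1 fps \<Rightarrow> int \<Rightarrow> int \<Rightarrow> 'a fps" where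
  "pw s k m = (if m \<le> k then of_int (ibinom k (nat (k - m))) * s ^ nat (k - m) else 0)"

text \<open>\<open>f(u + s)\<close>\<close>

definition ser_shift :: "'a::ring_1 fps \<Rightarrow> (int \<Rightarrow> 'a fps) \<Rightarrow> int \<Rightarrow> 'a fps" where
  "ser_shift s f b = hsum (\<lambda>m. f m * pw s m b)"

definition in_u :: "(int \<Rightarrow> 'a::zero) \<Rightarrow> int \<times> int \<Rightarrow> 'a" where
  "in_u f = (\<lambda>(a, b). if b = 0 then f a else 0)"

definition in_v :: "(int \<Rightarrow> 'a::zero) \<Rightarrow> int \<times> int \<Rightarrow> 'a" where
  "in_v f = (\<lambda>(a, b). if a = 0 then f b else 0)"

text \<open>\<open>(u + x) - (v + y) + z\<close>\<close>

definition lin :: "'a::ring_1 fps \<Rightarrow> 'a fps \<Rightarrow> 'a fps \<Rightarrow> int \<times> int \<Rightarrow> 'a fps" where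
  "lin x y z e = (if e = (1, 0) then 1 else if e = (0, 1) then -1 else if e = (0, 0) then x - y + z else 0)"

text \<open>
  \<open>1 / (u + s - v)\<close> for \<open>s\<close> divisible by \<open>\<hbar>\<close>, expanded in powers of \<open>u\<^sup>-\<^sup>1\<close>, as
  \<open>\<Sum>\<^sub>k\<^sub>\<ge>\<^sub>0 u\<^sup>-\<^sup>k\<^sup>-\<^sup>1 (v - s)\<^sup>k\<close>, respectively in nonnegative powers of \<open>u\<close>, as
  \<open>- \<Sum>\<^sub>k\<^sub>\<ge>\<^sub>0 u\<^sup>k (v - s)\<^sup>-\<^sup>k\<^sup>-\<^sup>1\<close>.
\<close>

definition recip_uinf :: "'a::ring_1 fps \<Rightarrow> int \<times> int \<Rightarrow> 'a fps" where
  "recip_uinf s = (\<lambda>(a, b). if a \<le> -1 then pw (- s) (- a - 1) b else 0)"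

definition recip_u0 :: "'a::ring_1 fps \<Rightarrow> int \<times> int \<Rightarrow> 'a fps" where
  "recip_u0 s = (\<lambda>(a, b). if 0 \<le> a then - pw (- s) (- a - 1) b else 0)"

text \<open>\<open>\<delta>((u + x) - (v + y)) = \<Sum>\<^sub>k (u + x)\<^sup>-\<^sup>k\<^sup>-\<^sup>1 (v + y)\<^sup>k\<close>\<close>

definition delta :: "'a::ring_1 fps \<Rightarrow> 'a fps \<Rightarrow> int \<times> int \<Rightarrow> 'a fps" where
  "delta x y = (\<lambda>(a, b). hsum (\<lambda>k. pw x (- k - 1) a * pw y k b))"


section \<open>The root lattice of type \<open>D\<^sub>n\<close>\<close>

text \<open>A vector \<open>\<Sum>\<^sub>l b\<^sub>l \<epsilon>\<^sub>l\<close> is represented by \<open>l \<mapsto> b\<^sub>l\<close>.\<close>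

type_synonym lat = "nat \<Rightarrow>\<^sub>0 int"

definition ip :: "lat \<Rightarrow> lat \<Rightarrow> int" where
  "ip \<beta> \<gamma> = (\<Sum>l\<in>Poly_Mapping.keys \<beta>. Poly_Mapping.lookup \<beta> l * Poly_Mapping.lookup \<gamma> l)"

definition eps :: "nat \<Rightarrow> lat" where
  "eps l = Poly_Mapping.single l 1"

definition alpha :: "nat \<Rightarrow> nat \<Rightarrow> lat" where
  "alpha n j = (if j = n then eps (n - 1) + eps n else eps j - eps (j + 1))"

definition root_lattice :: "nat \<Rightarrow> lat set" where
  "root_lattice n = {\<beta>. \<exists>c :: nat \<Rightarrow> int. \<forall>l.
     Poly_Mapping.lookup \<beta> l = (\<Sum>i\<in>{1..n}. c i * Poly_Mapping.lookup (alpha n i) l)}"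

definition cartan :: "nat \<Rightarrow> nat \<Rightarrow> nat \<Rightarrow> int" where
  "cartan n i j = 2 * ip (alpha n i) (alpha n j) div ip (alpha n i) (alpha n i)"

definition Bform :: "nat \<Rightarrow> nat \<Rightarrow> nat \<Rightarrow> complex" where
  "Bform n i j = of_int (ip (alpha n i) (alpha n j)) / 2"


section \<open>The double Yangian\<close>

datatype gen = HH nat int | XP nat int | XM nat int | CC

datatype word = Word (letters: "gen list")

instantiation word :: monoid_add
begin
definition zero_word :: word where "0 = Word []"
definition plus_word :: "word \<Rightarrow> word \<Rightarrow> word" where "v + w = Word (letters v @ letters w)"
instance by standard (auto simp: zero_word_def plus_word_def)
end

text \<open>
  Completed free algebra \<open>\<complex>\<langle>gen\<rangle>[[\<hbar>]]\<close>. The metric topology of \<^typ>\<open>'a fps\<close> is the \<open>\<hbar>\<close>-adic one.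
\<close>

type_synonym falg = "(word \<Rightarrow>\<^sub>0 complex) fps"

definition gens :: "nat \<Rightarrow> gen set" where
  "gens n = insert CC {g. \<exists>i\<in>{1..n}. \<exists>r. g = HH i r \<or> g = XP i r \<or> g = XM i r}"

definition gen_el :: "gen \<Rightarrow> falg" where
  "gen_el g = fps_const (Poly_Mapping.single (Word [g]) 1)"

definition free_alg :: "nat \<Rightarrow> falg ring" where
  "free_alg n = \<lparr>carrier = {x. \<forall>p. \<forall>w\<in>Poly_Mapping.keys (x $ p). set (letters w) \<subseteq> gens n},
     mult = (*), one = 1, zero = 0, add = (+)\<rparr>"

text \<open>\<open>H\<^sub>i\<^sup>\<plusminus>(u)\<close> with sign \<open>s = \<plusminus>1\<close>, \<open>E\<^sub>i(u)\<close>, \<open>F\<^sub>i(u)\<close>, and \<open>\<hbar>c/4\<close>, so that \<open>u\<^sub>\<plusminus> = u \<plusminus> hc4\<close>.\<close>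

definition Hser :: "int \<Rightarrow> nat \<Rightarrow> int \<Rightarrow> falg" where
  "Hser s i m =
    (if s = 1 then ser_one m + (if m \<le> -1 then fps_X * gen_el (HH i (- m - 1)) else 0)
     else ser_one m - (if 0 \<le> m then fps_X * gen_el (HH i (- m - 1)) else 0))"

definition Eser :: "nat \<Rightarrow> int \<Rightarrow> falg" where
  "Eser i m = gen_el (XP i (- m - 1))"

definition Fser :: "nat \<Rightarrow> int \<Rightarrow> falg" where
  "Fser i m = gen_el (XM i (- m - 1))"

definition hc4 :: falg where
  "hc4 = scl (hb (1/4)) * gen_el CC"

definition Bh :: "nat \<Rightarrow> nat \<Rightarrow> nat \<Rightarrow> falg" where
  "Bh n i j = scl (hb (Bform n i j))"

definition commutator :: "falg \<Rightarrow> falg \<Rightarrow> falg" where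
  "commutator x y = x * y - y * x"

text \<open>
  Nested commutator \<open>[X\<^sub>i(u\<^sub>\<sigma>\<^sub>(\<^sub>1\<^sub>)), \<dots>, [X\<^sub>i(u\<^sub>\<sigma>\<^sub>(\<^sub>m\<^sub>)), X\<^sub>j(v)]\<dots>]\<close>, summed over \<open>\<sigma>\<close>; coefficient of
  \<open>u\<^sub>1\<^sup>r\<^sup>1 \<dots> u\<^sub>m\<^sup>r\<^sup>m v\<^sup>t\<close>.
\<close>

definition serre :: "(nat \<Rightarrow> int \<Rightarrow> falg) \<Rightarrow> nat \<Rightarrow> nat \<Rightarrow> nat \<Rightarrow> (nat \<Rightarrow> int) \<Rightarrow> int \<Rightarrow> falg" where
  "serre X m i j r t =
    (\<Sum>\<sigma> | \<sigma> permutes {1..m}. foldr (\<lambda>k y. commutator (X i (r (\<sigma> k))) y) [1..<Suc m] (X j t))"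

text \<open>
  The coefficients of (left side - right side) of the defining relations; \<open>s = \<plusminus>1\<close> is the upper,
  respectively lower sign. In the last rule \<^term>\<open>fps_shift 1\<close> is the division by \<open>\<hbar>\<close>, which is
  exact since the argument vanishes at \<open>\<hbar> = 0\<close>.
\<close>

inductive_set relators :: "nat \<Rightarrow> falg set" for n :: nat where
  central:
    "g \<in> gens n \<Longrightarrow> commutator (gen_el CC) (gen_el g) \<in> relators n"
| HH_same:
    "\<lbrakk>i \<in> {1..n}; j \<in> {1..n}; s \<in> {1, -1}\<rbrakk> \<Longrightarrow>
     (in_u (Hser s i) \<star> in_v (Hser s j) - in_v (Hser s j) \<star> in_u (Hser s i)) e \<in> relators n"
| HH_mixed:
    "\<lbrakk>i \<in> {1..n}; j \<in> {1..n}; s \<in> {1, -1}; q = of_int s * hc4; b = Bh n i j\<rbrakk> \<Longrightarrow>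
     (lin q (- q) (- b) \<star> lin (- q) q b \<star> in_u (Hser s i) \<star> in_v (Hser (- s) j)
      - lin q (- q) b \<star> lin (- q) q (- b) \<star> in_v (Hser (- s) j) \<star> in_u (Hser s i)) e \<in> relators n"
| HE:
    "\<lbrakk>i \<in> {1..n}; j \<in> {1..n}; s \<in> {1, -1}; q = of_int s * hc4; b = Bh n i j;
      recip = (if s = 1 then recip_uinf else recip_u0)\<rbrakk> \<Longrightarrow>
     (in_u (ser_inv (Hser s i)) \<star> in_v (Eser j) \<star> in_u (Hser s i)
      - lin (- q) 0 b \<star> recip (- q - b) \<star> in_v (Eser j)) e \<in> relators n"
| HF:
    "\<lbrakk>i \<in> {1..n}; j \<in> {1..n}; s \<in> {1, -1}; q = of_int s * hc4; b = Bh n i j;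
      recip = (if s = 1 then recip_uinf else recip_u0)\<rbrakk> \<Longrightarrow>
     (in_u (Hser s i) \<star> in_v (Fser j) \<star> in_u (ser_inv (Hser s i))
      - lin q 0 b \<star> recip (q - b) \<star> in_v (Fser j)) e \<in> relators n"
| EE:
    "\<lbrakk>i \<in> {1..n}; j \<in> {1..n}; b = Bh n i j\<rbrakk> \<Longrightarrow>
     (lin 0 0 b \<star> in_u (Eser i) \<star> in_v (Eser j)
      - lin 0 0 (- b) \<star> in_v (Eser j) \<star> in_u (Eser i)) e \<in> relators n"
| FF:
    "\<lbrakk>i \<in> {1..n}; j \<in> {1..n}; b = Bh n i j\<rbrakk> \<Longrightarrow>
     (lin 0 0 (- b) \<star> in_u (Fser i) \<star> in_v (Fser j)
      - lin 0 0 b \<star> in_v (Fser j) \<star> in_u (Fser i)) e \<in> relators n"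
| serre_E:
    "\<lbrakk>i \<in> {1..n}; j \<in> {1..n}; i \<noteq> j\<rbrakk> \<Longrightarrow>
     serre Eser (nat (1 - cartan n i j)) i j r t \<in> relators n"
| serre_F:
    "\<lbrakk>i \<in> {1..n}; j \<in> {1..n}; i \<noteq> j\<rbrakk> \<Longrightarrow>
     serre Fser (nat (1 - cartan n i j)) i j r t \<in> relators n"
| EF:
    "\<lbrakk>i \<in> {1..n}; j \<in> {1..n}\<rbrakk> \<Longrightarrow>
     (in_u (Eser i) \<star> in_v (Fser j) - in_v (Fser j) \<star> in_u (Eser i)) e
      - (if i = j
         then fps_shift 1 ((delta (- hc4) hc4 \<star> in_v (ser_shift hc4 (Hser (-1) i))
                            - delta hc4 (- hc4) \<star> in_u (ser_shift hc4 (Hser 1 i))) e)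
         else 0) \<in> relators n"

text \<open>The closed two-sided ideal generated by the relators.\<close>

definition DY_ideal :: "nat \<Rightarrow> falg set" where
  "DY_ideal n = \<Inter>{I. ideal I (free_alg n) \<and> closed I \<and> relators n \<subseteq> I}"

definition DY :: "nat \<Rightarrow> falg set ring" where
  "DY n = free_alg n Quot DY_ideal n"

definition cls :: "nat \<Rightarrow> falg \<Rightarrow> falg set" where
  "cls n x = DY_ideal n +>\<^bsub>free_alg n\<^esub> x"


section \<open>The Fock space\<close>

text \<open>
  Basis vectors: the pair of \<open>\<mu>\<close> and \<open>\<beta>\<close> stands for \<open>\<Prod>\<^sub>j\<^sub>,\<^sub>k a\<^sub>j\<^sub>,\<^sub>-\<^sub>k ^ \<mu>(j,k) \<otimes> e\<^sup>\<beta>\<close>.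
\<close>

type_synonym key = "(nat \<times> nat \<Rightarrow>\<^sub>0 nat) \<times> lat"

type_synonym fock = "(key \<Rightarrow>\<^sub>0 complex) fps"

definition Fock :: "nat \<Rightarrow> fock set" where
  "Fock n = {x. \<forall>p. \<forall>(\<mu>, \<beta>)\<in>Poly_Mapping.keys (x $ p).
     Poly_Mapping.keys \<mu> \<subseteq> {1..n} \<times> {1..} \<and> \<beta> \<in> root_lattice n}"

text \<open>
  \<open>[a\<^sub>j\<^sub>,\<^sub>k, f]\<close> for \<open>k > 0\<close>: since \<open>[a\<^sub>j\<^sub>,\<^sub>k, a\<^sub>i\<^sub>,\<^sub>-\<^sub>l] = k \<delta>\<^sub>i\<^sub>j \<delta>\<^sub>k\<^sub>l\<close>, this is \<open>k\<close> times the partial derivative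
  with respect to \<open>a\<^sub>j\<^sub>,\<^sub>-\<^sub>k\<close>.
\<close>

definition annih :: "nat \<Rightarrow> nat \<Rightarrow> fock \<Rightarrow> fock" where
  "annih j k x = Abs_fps (\<lambda>p. \<Sum>(\<mu>, \<beta>)\<in>Poly_Mapping.keys (x $ p).
     Poly_Mapping.single (\<mu> - Poly_Mapping.single (j, k) 1, \<beta>)
       (of_nat k * of_nat (Poly_Mapping.lookup \<mu> (j, k)) * Poly_Mapping.lookup (x $ p) (\<mu>, \<beta>)))"

definition boson :: "nat \<Rightarrow> int \<Rightarrow> fock \<Rightarrow> fock" where
  "boson j k x =
    (if j = 0 then 0
     else if k < 0
     then fps_const (Poly_Mapping.single (Poly_Mapping.single (j, nat (- k)) 1, 0) 1) * x
     else annih j (nat k) x)"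

definition elat :: "lat \<Rightarrow> fock \<Rightarrow> fock" where
  "elat \<gamma> x = fps_const (Poly_Mapping.single (0, \<gamma>) 1) * x"

text \<open>The \<open>\<A>\<close>-linear operator acting on \<open>f \<otimes> e\<^sup>\<beta>\<close> as the scalar \<open>g \<beta>\<close>.\<close>

definition wt_op :: "(lat \<Rightarrow> complex fps) \<Rightarrow> fock \<Rightarrow> fock" where
  "wt_op g x = Abs_fps (\<lambda>p. \<Sum>q\<le>p. \<Sum>b\<in>Poly_Mapping.keys (x $ q).
     Poly_Mapping.single b (g (snd b) $ (p - q) * Poly_Mapping.lookup (x $ q) b))"

text \<open>Operator-valued formal series in \<open>u\<close>; products are composed pointwise on vectors.\<close>

type_synonym opser = "int \<Rightarrow> fock \<Rightarrow> fock"

definition op_mult :: "opser \<Rightarrow> opser \<Rightarrow> opser" (infixr \<open>\<diamondop>\<close> 75) where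
  "(X \<diamondop> Y) m x = hsum (\<lambda>i. X i (Y (m - i) x))"

definition op_const :: "(fock \<Rightarrow> fock) \<Rightarrow> opser" where
  "op_const T m x = (if m = 0 then T x else 0)"

definition op_exp :: "opser \<Rightarrow> opser" where
  "op_exp X m x = hsum (\<lambda>k. scl (fps_const (1 / fact k)) * (((\<diamondop>) X ^^ k) (op_const id)) m x)"

text \<open>
  \<open>cre j c = \<Sum>\<^sub>k\<^sub>>\<^sub>0 (a\<^sub>j\<^sub>,\<^sub>-\<^sub>k / k) (u + c\<hbar>)\<^sup>k\<close> and \<open>ann j c = \<Sum>\<^sub>k\<^sub>>\<^sub>0 (a\<^sub>j\<^sub>,\<^sub>k / k) (u + c\<hbar>)\<^sup>-\<^sup>k\<close>
\<close>

definition cre :: "nat \<Rightarrow> complex \<Rightarrow> opser" where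
  "cre j c m x = hsum (\<lambda>k::nat. if k = 0 then 0
     else scl (fps_const (1 / of_nat k) * pw (hb c) (int k) m) * boson j (- int k) x)"

definition ann :: "nat \<Rightarrow> complex \<Rightarrow> opser" where
  "ann j c m x = hsum (\<lambda>k::nat. if k = 0 then 0
     else scl (fps_const (1 / of_nat k) * pw (hb c) (- int k) m) * boson j (int k) x)"

text \<open>\<open>[(-1)\<^sup>s (u + c\<hbar>)]\<close> raised to the power \<open>\<partial>\<gamma>\<close>\<close>

definition zpow :: "nat \<Rightarrow> complex \<Rightarrow> lat \<Rightarrow> opser" where
  "zpow s c \<gamma> m =
    wt_op (\<lambda>\<beta>. fps_const (((-1) ^ s) powi ip \<gamma> \<beta>) * pw (hb c) (ip \<gamma> \<beta>) m)"

text \<open>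
  The indices \<open>i\<close> of the \<open>a\<^sub>i\<^sub>,\<^sub>-\<^sub>k\<close> accompanying \<open>a\<^sub>j\<^sub>,\<^sub>-\<^sub>k\<close>; index \<open>0\<close> may occur and contributes \<open>0\<close>,
  as \<open>a\<^sub>0\<^sub>,\<^sub>k = 0\<close>.
\<close>

definition nbrs :: "nat \<Rightarrow> nat \<Rightarrow> nat set" where
  "nbrs n j = (if j \<le> n - 3 then {j + 1, j - 1}
               else if j = n - 2 then {n - 1, n - 3, n}
               else {n - 2})"

definition sgn_exp :: "nat \<Rightarrow> nat \<Rightarrow> nat" where
  "sgn_exp n j = (if j \<le> n - 3 then j - 1
                  else if j = n - 2 then n - 3
                  else if j = n - 1 then n - 2
                  else n)"

definition E_op :: "nat \<Rightarrow> nat \<Rightarrow> opser" where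
  "E_op n j =
    op_exp (cre j (-1/4) + cre j (3/4) - (\<Sum>i\<in>nbrs n j. cre i (1/4)))
    \<diamondop> op_exp (- ann j (-1/4))
    \<diamondop> op_const (elat (alpha n j))
    \<diamondop> zpow (sgn_exp n j) (-1/4) (alpha n j)"

definition F_op :: "nat \<Rightarrow> nat \<Rightarrow> opser" where
  "F_op n j =
    op_exp (- (cre j (1/4) + cre j (-3/4)) + (\<Sum>i\<in>nbrs n j. cre i (-1/4)))
    \<diamondop> op_exp (ann j (1/4))
    \<diamondop> op_const (elat (- alpha n j))
    \<diamondop> zpow (sgn_exp n j) (1/4) (- alpha n j)"

definition Hm_op :: "nat \<Rightarrow> nat \<Rightarrow> opser" where
  "Hm_op n j =
    op_exp (- (cre j (-1) - cre j 1) + (\<Sum>i\<in>nbrs n j. cre i (-1/2) - cre i (1/2)))"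

definition Hp_op :: "nat \<Rightarrow> nat \<Rightarrow> opser" where
  "Hp_op n j =
    op_exp (- (ann j (-1/2) - ann j (1/2)))
    \<diamondop> (\<lambda>m. wt_op (\<lambda>\<beta>. (pw (hb (1/2)) (- ip (alpha n j) \<beta>)
                           \<star> pw (hb (-1/2)) (ip (alpha n j) \<beta>)) m))"


section \<open>Module structures on the Fock space\<close>

definition End_Fock :: "nat \<Rightarrow> (fock \<Rightarrow> fock) ring" where
  "End_Fock n =
    \<lparr>carrier = {T \<in> Fock n \<rightarrow>\<^sub>E Fock n.
       (\<forall>x\<in>Fock n. \<forall>y\<in>Fock n. T (x + y) = T x + T y) \<and>
       (\<forall>f. \<forall>x\<in>Fock n. T (scl f * x) = scl f * T x)},
     mult = compose (Fock n), one = (\<lambda>x\<in>Fock n. x),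
     zero = (\<lambda>x\<in>Fock n. 0), add = (\<lambda>S T. \<lambda>x\<in>Fock n. S x + T x)\<rparr>"

text \<open>
  An \<open>\<A>\<close>-algebra homomorphism to \<open>End\<^sub>\<A>(\<F>)\<close>. It is automatically \<open>\<hbar>\<close>-adically continuous, being
  \<open>\<A>\<close>-linear.
\<close>

definition DY_module :: "nat \<Rightarrow> (falg set \<Rightarrow> fock \<Rightarrow> fock) \<Rightarrow> bool" where
  "DY_module n \<rho> \<longleftrightarrow>
    \<rho> \<in> ring_hom (DY n) (End_Fock n) \<and>
    (\<forall>f. \<rho> (cls n (scl f)) = (\<lambda>x\<in>Fock n. scl f * x))"

end

theory Submission
  imports Defs
begin

text \<open>
  Every operator of the statement is a field \<open>x \<mapsto> s(x) \<cdot> M(u)\<close>: the annihilation exponential together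
  with the power of \<open>\<partial>\<gamma>\<close> is a ring homomorphism \<open>s\<close> from the Fock space to Laurent series in \<open>u\<close> over it
  (a shift of the generators \<open>a\<^sub>j\<^sub>,\<^sub>-\<^sub>k\<close>), and the creation exponential is multiplication by \<open>M(u)\<close>.
  A product of two fields is therefore the normally ordered product times a factor \<open>s(N(v))/N(v)\<close>,
  which is a product of powers of linear factors \<open>u - v + c\<hbar>\<close>. Comparing the two orders of
  multiplication yields all quadratic relations with denominators cleared. Dividing by linear factors is
  legitimate because multiplication by \<open>u - v + c\<hbar>\<close> is injective on series which modulo each power of
  \<open>\<hbar>\<close> are bounded below in one variable; this also gives the Serre relations and, together with the
  residues along \<open>u\<^sup>-\<^sup>1\<close> and \<open>v\<^sup>-\<^sup>1\<close>, the delta function relation. The representation of the free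
  algebra so obtained kills the closed ideal generated by the relators. It is the only one,
  because a representation is determined modulo every power of \<open>\<hbar>\<close> by its values on the generators, which
  in turn are determined by the given series, \<open>\<hbar>\<close> being cancellable.
\<close>

section \<open>\<open>\<hbar>\<close>-adically continuous linear maps\<close>

text \<open>The lattice enters through its plain group algebra, without a cocycle, so the operators
  e^(alpha_i) commute. The sign that a linear factor acquires when u and v are interchanged must
  come from elsewhere: the signs (-1)^(s_j) supply it, and for this they 2-colour the Dynkin
  diagram. The bosons are orthonormal, so the Cartan matrix is carried by the neighbour terms of the
  creation parts alone.

  The obstacle is that the two orders of a product are expansions of one rational function in
  opposite regions. Two-sided series form no ring, and u - v kills the delta function, in whose
  multiples the E-F relation lives. Every cancellation is therefore paid for by a bound in one
  variable or by knowledge of a single row or column. In the Serre relations the auxiliary series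
  from which E_i E_j E_i is computed start without the required bound; it is extracted from the
  relations themselves.

  Generators h_(ir) exist as operators because H^+ and H^- are the identity modulo hbar. In the E-F
  relation the division by hbar is undone by the two poles, whose linear factors differ by exactly
  hbar.\<close>

text \<open>The locality condition makes such maps commute with \<open>\<hbar>\<close>-adically convergent sums.\<close>

definition local_add :: "('a::ab_group_add fps \<Rightarrow> 'b::ab_group_add fps) \<Rightarrow> bool" where
  "local_add T \<longleftrightarrow> (\<forall>x y. T (x + y) = T x + T y) \<and> (\<forall>p x. (\<forall>q\<le>p. x $ q = 0) \<longrightarrow> T x $ p = 0)"

definition hsummable :: "('i \<Rightarrow> 'a::comm_monoid_add fps) \<Rightarrow> bool" where
  "hsummable f \<longleftrightarrow> (\<forall>p. finite {i. f i $ p \<noteq> 0})"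

lemma local_add_add: "local_add T \<Longrightarrow> T (x + y) = T x + T y"
  by (simp add: local_add_def)

lemma local_add_0: assumes "local_add T" shows "T 0 = 0"
  using local_add_add[OF assms, of 0 0] by simp

lemma local_add_minus: assumes "local_add T" shows "T (- x) = - T x"
  using local_add_add[OF assms, of x "- x"] local_add_0[OF assms]
  by (metis add.inverse_unique add.right_inverse)

lemma local_add_diff: assumes "local_add T" shows "T (x - y) = T x - T y"
  using local_add_add[OF assms, of x "- y"] local_add_minus[OF assms] by simp

lemma local_add_sum: assumes "local_add T" shows "T (sum f A) = (\<Sum>i\<in>A. T (f i))"
  by (induction A rule: infinite_finite_induct) (auto simp: local_add_0[OF assms] local_add_add[OF assms])

lemma local_add_local:
  assumes "local_add T" "\<And>q. q \<le> p \<Longrightarrow> x $ q = y $ q" shows "T x $ p = T y $ p"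
proof -
  have "T (x - y) $ p = 0" using assms by (auto simp: local_add_def)
  then show ?thesis by (simp add: local_add_diff[OF assms(1)])
qed

lemma local_add_mult_left: "local_add (\<lambda>x. c * x)" for c :: "'a::ring fps"
  by (auto simp: local_add_def distrib_left fps_mult_nth)

lemma local_add_mult_right: "local_add (\<lambda>x. x * c)" for c :: "'a::ring fps"
  by (auto simp: local_add_def distrib_right fps_mult_nth)

lemma hsummableI: "(\<And>p. finite {i. f i $ p \<noteq> 0}) \<Longrightarrow> hsummable f"
  by (simp add: hsummable_def)

lemma hsummable_finite: "finite {i. f i \<noteq> 0} \<Longrightarrow> hsummable f"
  unfolding hsummable_def by (auto elim!: rev_finite_subset)

lemma hsummable_bounded:
  assumes "\<And>p. \<exists>A. finite A \<and> (\<forall>i. i \<notin> A \<longrightarrow> f i $ p = 0)" shows "hsummable f"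
proof (rule hsummableI)
  fix p
  from assms[of p] obtain A where "finite A" "\<forall>i. i \<notin> A \<longrightarrow> f i $ p = 0" by blast
  then show "finite {i. f i $ p \<noteq> 0}" by (auto elim: rev_finite_subset)
qed

lemma hsum_nth: "hsum f $ p = Sum_any (\<lambda>i. f i $ p)"
  by (simp add: hsum_def)

lemma hsum_nth_finite:
  assumes "finite A" "\<And>i. i \<notin> A \<Longrightarrow> f i $ p = 0" shows "hsum f $ p = (\<Sum>i\<in>A. f i $ p)"
  unfolding hsum_nth using assms by (intro Sum_any.expand_superset) auto

lemma hsum_finite:
  assumes "finite A" "\<And>i. i \<notin> A \<Longrightarrow> f i = 0" shows "hsum f = sum f A"
  by (rule fps_ext) (simp add: hsum_nth_finite[OF assms(1)] assms(2) fps_sum_nth)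

lemma hsum_single: "(\<And>i. i \<noteq> j \<Longrightarrow> f i = 0) \<Longrightarrow> hsum f = f j"
  using hsum_finite[of "{j}" f] by simp

lemma hsum_0 [simp]: "hsum (\<lambda>i. 0) = 0"
  by (rule fps_ext) (simp add: hsum_nth)

lemma hsum_add: "hsummable f \<Longrightarrow> hsummable g \<Longrightarrow> hsum (\<lambda>i. f i + g i) = hsum f + hsum g"
  by (rule fps_ext) (simp add: hsum_nth hsummable_def Sum_any.distrib)

lemma hsummable_add: "hsummable f \<Longrightarrow> hsummable g \<Longrightarrow> hsummable (\<lambda>i. f i + g i)"
  unfolding hsummable_def
proof (intro allI)
  fix p assume *: "\<forall>p. finite {i. f i $ p \<noteq> 0}" "\<forall>p. finite {i. g i $ p \<noteq> 0}"
  have "{i. (f i + g i) $ p \<noteq> 0} \<subseteq> {i. f i $ p \<noteq> 0} \<union> {i. g i $ p \<noteq> 0}" by auto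
  then show "finite {i. (f i + g i) $ p \<noteq> 0}" using * by (meson finite_Un finite_subset)
qed

lemma hsummable_local_add:
  assumes "local_add T" "hsummable f" shows "hsummable (\<lambda>i. T (f i))"
proof (rule hsummable_bounded, intro exI conjI allI impI)
  fix p
  \<comment> \<open>All orders q \<le> p are collected, not just p: locality allows \<open>T\<close>
    to move a coefficient to a higher power of hbar, never to a lower one.\<close>
  let ?A = "\<Union>q\<le>p. {i. f i $ q \<noteq> 0}"
  show "finite ?A" using assms by (simp add: hsummable_def)
  fix i assume "i \<notin> ?A"
  then show "T (f i) $ p = 0" using assms(1) by (auto simp: local_add_def)
qed

text \<open>Up to order p only the finitely many summands in \<open>?A\<close> are visible, and
  locality lets \<open>T\<close> be applied to their finite sum instead of the whole series.\<close>

lemma hsum_local_add: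
  assumes "local_add T" "hsummable f" shows "T (hsum f) = hsum (\<lambda>i. T (f i))"
proof (rule fps_ext)
  fix p
  let ?A = "\<Union>q\<le>p. {i. f i $ q \<noteq> 0}"
  have fin: "finite ?A" using assms by (simp add: hsummable_def)
  have "T (hsum f) $ p = T (sum f ?A) $ p"
    by (rule local_add_local[OF assms(1)]) (subst hsum_nth_finite[OF fin], auto simp: fps_sum_nth)
  also have "\<dots> = (\<Sum>i\<in>?A. T (f i) $ p)" by (simp add: local_add_sum[OF assms(1)] fps_sum_nth)
  also have "\<dots> = hsum (\<lambda>i. T (f i)) $ p"
    by (rule hsum_nth_finite[symmetric, OF fin]) (use assms(1) in \<open>auto simp: local_add_def\<close>)
  finally show "T (hsum f) $ p = hsum (\<lambda>i. T (f i)) $ p" .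
qed

lemma hsum_reindex:
  assumes "bij_betw h UNIV UNIV" shows "hsum (\<lambda>i. f (h i)) = hsum f"
proof (rule fps_ext)
  fix p show "hsum (\<lambda>i. f (h i)) $ p = hsum f $ p"
    unfolding hsum_nth by (rule Sum_any.reindex_cong[OF assms, symmetric]) (simp add: fun_eq_iff)
qed

lemma hsum_uminus: "hsum (\<lambda>i. - f i) = - hsum f" for f :: "'i \<Rightarrow> 'a::ab_group_add fps"
proof (rule fps_ext)
  fix p show "hsum (\<lambda>i. - f i) $ p = (- hsum f) $ p"
    by (auto simp: hsum_nth Sum_any.expand_set sum_negf)
qed

lemma hsummable_uminus: "hsummable f \<Longrightarrow> hsummable (\<lambda>i. - f i)" for f :: "'i \<Rightarrow> 'a::ab_group_add fps"
  by (simp add: hsummable_def)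

lemma hsum_diff: "hsummable f \<Longrightarrow> hsummable g \<Longrightarrow> hsum (\<lambda>i. f i - g i) = hsum f - hsum g"
  for f :: "'i \<Rightarrow> 'a::ab_group_add fps"
  using hsum_add[of f "\<lambda>i. - g i"] by (simp add: hsum_uminus hsummable_uminus)

section \<open>Scalars from C[[hbar]] in a completed monoid algebra\<close>

lemma lookup_scale [simp]: "Poly_Mapping.lookup (Poly_Mapping.single 0 c * x) k = c * Poly_Mapping.lookup x k"
  for c :: complex and x :: "'k::monoid_add \<Rightarrow>\<^sub>0 complex"
  by (simp flip: mult_map_scale_conv_mult add: map.rep_eq when_def)

text \<open>Monomials may be words, which do not commute, so right multiplication by a constant is
  computed separately; together with the left version it makes scalars central
  (\<open>scl_comm\<close>).\<close>

lemma lookup_scale' [simp]: "Poly_Mapping.lookup (x * Poly_Mapping.single 0 c) k = c * Poly_Mapping.lookup x k"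
  for c :: complex and x :: "'k::monoid_add \<Rightarrow>\<^sub>0 complex"
proof -
  have "(\<Sum>q. Poly_Mapping.lookup (Poly_Mapping.single 0 c) q when l + q = k) = (c when l = k)"
    if "True" for l :: 'k
  proof -
    have *: "(\<lambda>q. Poly_Mapping.lookup (Poly_Mapping.single 0 c) q when l + q = k)
      = (\<lambda>q. if q = 0 then (c when l = k) else 0)"
      by (auto simp: fun_eq_iff lookup_single when_def)
    show ?thesis unfolding * by simp
  qed
  then have "(\<Sum>q. Poly_Mapping.lookup (Poly_Mapping.single 0 c) q when k = l + q) = (c when l = k)" for l
    by (simp add: eq_commute[of k])
  then show ?thesis by (simp add: lookup_mult mult_when when_mult mult.commute)
qed

lemma scale_comm: "Poly_Mapping.single 0 c * x = x * Poly_Mapping.single 0 c"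
  for c :: complex and x :: "'k::monoid_add \<Rightarrow>\<^sub>0 complex"
  by (rule poly_mapping_eqI) simp

lemma scl_nth [simp]: "scl f $ p = Poly_Mapping.single 0 (f $ p)"
  by (simp add: scl_def)

lemma scl_add: "scl (f + g) = scl f + scl g"
  by (rule fps_ext) (simp add: single_add)

lemma scl_minus: "scl (- f) = - scl f"
  by (rule fps_ext) (simp add: single_uminus)

lemma scl_diff: "scl (f - g) = scl f - scl g"
  by (rule fps_ext) (simp add: single_diff)

lemma scl_0 [simp]: "scl 0 = 0"
  by (rule fps_ext) simp

lemma scl_1 [simp]: "scl 1 = (1 :: ('k::monoid_add \<Rightarrow>\<^sub>0 complex) fps)"
  by (rule fps_ext) (simp add: fps_one_nth)

lemma single0_sum: "Poly_Mapping.single 0 (sum f A) = (\<Sum>i\<in>A. Poly_Mapping.single 0 (f i))"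
  by (induction A rule: infinite_finite_induct) (auto simp: single_add)

lemma scl_mult: "scl (f * g) = scl f * (scl g :: ('k::monoid_add \<Rightarrow>\<^sub>0 complex) fps)"
  by (rule fps_ext) (simp add: fps_mult_nth single0_sum mult_single)

lemma scl_power: "scl (f ^ k) = (scl f :: ('k::monoid_add \<Rightarrow>\<^sub>0 complex) fps) ^ k"
  by (induction k) (auto simp: scl_mult)

lemma scl_of_int: "scl (of_int k) = (of_int k :: ('k::monoid_add \<Rightarrow>\<^sub>0 complex) fps)"
  by (rule fps_ext) (auto simp: fps_of_int[symmetric])

lemma scl_of_nat: "scl (of_nat k) = (of_nat k :: ('k::monoid_add \<Rightarrow>\<^sub>0 complex) fps)"
  using scl_of_int[of "int k"] by simp

lemma scl_comm: "scl f * x = x * scl f" for x :: "('k::monoid_add \<Rightarrow>\<^sub>0 complex) fps"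
proof (rule fps_ext)
  fix p
  have "(\<Sum>i=0..p. Poly_Mapping.single 0 (f $ i) * x $ (p - i)) = (\<Sum>i=0..p. x $ i * Poly_Mapping.single 0 (f $ (p - i)))"
    by (rule sum.reindex_bij_witness[of _ "\<lambda>i. p - i" "\<lambda>i. p - i"]) (auto simp: scale_comm)
  then show "(scl f * x) $ p = (x * scl f) $ p" by (simp add: fps_mult_nth)
qed

lemma scl_X: "scl fps_X = (fps_X :: ('k::monoid_add \<Rightarrow>\<^sub>0 complex) fps)"
  by (rule fps_ext) (simp add: fps_X_def)

lemma scl_left_comm: "x * (scl f * y) = scl f * (x * y)" for x :: "('k::monoid_add \<Rightarrow>\<^sub>0 complex) fps"
  by (metis mult.assoc scl_comm)

section \<open>Linear maps over C[[hbar]] between completed free modules\<close>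

definition A_linear :: "(('k::monoid_add \<Rightarrow>\<^sub>0 complex) fps \<Rightarrow> ('l::monoid_add \<Rightarrow>\<^sub>0 complex) fps) \<Rightarrow> bool" where
  "A_linear T \<longleftrightarrow> (\<forall>x y. T (x + y) = T x + T y) \<and> (\<forall>f x. T (scl f * x) = scl f * T x)"

definition basis :: "'k \<Rightarrow> ('k \<Rightarrow>\<^sub>0 complex) fps" where
  "basis k = fps_const (Poly_Mapping.single k 1)"

lemma basis_mult: "basis k * basis l = basis (k + l)"
  by (simp add: basis_def mult_single)

lemma basis_0: "basis 0 = 1"
  by (simp add: basis_def)

lemma A_linear_scl: "A_linear T \<Longrightarrow> T (scl f * x) = scl f * T x"
  by (simp add: A_linear_def)

text \<open>A series that vanishes up to order p is hbar^(p+1) times another one, and linearity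
  carries this power out of \<open>T\<close>. Continuity is thus a consequence of linearity over
  power series in hbar.\<close>

lemma A_linear_local_add: assumes "A_linear T" shows "local_add T"
  unfolding local_add_def
proof (intro conjI allI impI)
  fix x y show "T (x + y) = T x + T y" using assms by (simp add: A_linear_def)
next
  fix p and x :: "('a \<Rightarrow>\<^sub>0 complex) fps" assume "\<forall>q\<le>p. x $ q = 0"
  then have "x = fps_X ^ Suc p * fps_shift (Suc p) x"
    by (intro fps_ext) (auto simp: fps_X_power_mult_nth simp del: power_Suc)
  then have "x = scl (fps_X ^ Suc p) * fps_shift (Suc p) x" by (simp only: scl_power scl_X)
  then have "T x = fps_X ^ Suc p * T (fps_shift (Suc p) x)"
    using assms by (metis A_linear_def scl_power scl_X)
  then show "T x $ p = 0" by (simp only: fps_X_power_mult_nth) simp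
qed

lemmas A_linear_add = local_add_add[OF A_linear_local_add]
lemmas A_linear_0 = local_add_0[OF A_linear_local_add]
lemmas A_linear_minus = local_add_minus[OF A_linear_local_add]
lemmas A_linear_diff = local_add_diff[OF A_linear_local_add]
lemmas A_linear_sum = local_add_sum[OF A_linear_local_add]
lemmas A_linear_local = local_add_local[OF A_linear_local_add]
lemmas A_linear_hsum = hsum_local_add[OF A_linear_local_add]
lemma A_linearI: "(\<And>x y. T (x + y) = T x + T y) \<Longrightarrow> (\<And>f x. T (scl f * x) = scl f * T x) \<Longrightarrow> A_linear T"
  by (simp add: A_linear_def)

lemma A_linear_comp: "A_linear S \<Longrightarrow> A_linear T \<Longrightarrow> A_linear (\<lambda>x. S (T x))"
  by (auto simp: A_linear_def)

lemma A_linear_plus: "A_linear S \<Longrightarrow> A_linear T \<Longrightarrow> A_linear (\<lambda>x. S x + T x)"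
  by (auto simp: A_linear_def distrib_left)

lemma A_linear_uminus: "A_linear S \<Longrightarrow> A_linear (\<lambda>x. - S x)"
  by (auto simp: A_linear_def)

lemma A_linear_minus2: "A_linear S \<Longrightarrow> A_linear T \<Longrightarrow> A_linear (\<lambda>x. S x - T x)"
  by (auto simp: A_linear_def right_diff_distrib)

lemma A_linear_id: "A_linear (\<lambda>x. x)"
  by (auto simp: A_linear_def)

lemma A_linear_zero: "A_linear (\<lambda>x. 0)"
  by (auto simp: A_linear_def)

lemma A_linear_mult_left: "A_linear S \<Longrightarrow> A_linear (\<lambda>x. c * S x)"
  by (auto simp: A_linear_def distrib_left scl_left_comm)

lemma A_linear_mult_right: "A_linear S \<Longrightarrow> A_linear (\<lambda>x. S x * c)"
  by (auto simp: A_linear_def distrib_right mult.assoc)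

lemma A_linear_hsum_fun:
  assumes "\<And>i. A_linear (S i)" "\<And>x. hsummable (\<lambda>i. S i x)" shows "A_linear (\<lambda>x. hsum (\<lambda>i. S i x))"
proof (rule A_linearI)
  fix x y show "hsum (\<lambda>i. S i (x + y)) = hsum (\<lambda>i. S i x) + hsum (\<lambda>i. S i y)"
    using assms by (simp add: A_linear_add hsum_add)
next
  fix f x show "hsum (\<lambda>i. S i (scl f * x)) = scl f * hsum (\<lambda>i. S i x)"
    using assms hsum_local_add[OF local_add_mult_left[of "scl f"] assms(2)[of x]] by (simp add: A_linear_scl)
qed

definition lin_ext_fin :: "('k \<Rightarrow> ('l::monoid_add \<Rightarrow>\<^sub>0 complex) fps) \<Rightarrow> ('k \<Rightarrow>\<^sub>0 complex) \<Rightarrow> ('l \<Rightarrow>\<^sub>0 complex) fps" where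
  "lin_ext_fin \<phi> v = (\<Sum>k\<in>Poly_Mapping.keys v. scl (fps_const (Poly_Mapping.lookup v k)) * \<phi> k)"

lemma lin_ext_fin_superset:
  assumes "finite K" "Poly_Mapping.keys v \<subseteq> K"
  shows "lin_ext_fin \<phi> v = (\<Sum>k\<in>K. scl (fps_const (Poly_Mapping.lookup v k)) * \<phi> k)"
  unfolding lin_ext_fin_def using assms by (intro sum.mono_neutral_left) (auto simp: in_keys_iff)

lemma lin_ext_fin_add: "lin_ext_fin \<phi> (v + w) = lin_ext_fin \<phi> v + lin_ext_fin \<phi> w"
proof -
  let ?K = "Poly_Mapping.keys v \<union> Poly_Mapping.keys w"
  have "lin_ext_fin \<phi> (v + w) = (\<Sum>k\<in>?K. scl (fps_const (Poly_Mapping.lookup (v + w) k)) * \<phi> k)"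
    by (rule lin_ext_fin_superset) (auto simp: Poly_Mapping.keys_add)
  moreover have "lin_ext_fin \<phi> v = (\<Sum>k\<in>?K. scl (fps_const (Poly_Mapping.lookup v k)) * \<phi> k)"
    by (rule lin_ext_fin_superset) auto
  moreover have "lin_ext_fin \<phi> w = (\<Sum>k\<in>?K. scl (fps_const (Poly_Mapping.lookup w k)) * \<phi> k)"
    by (rule lin_ext_fin_superset) auto
  ultimately show ?thesis
    by (simp add: lookup_add sum.distrib[symmetric] scl_add distrib_right flip: fps_const_add)
qed

lemma lin_ext_fin_0 [simp]: "lin_ext_fin \<phi> 0 = 0"
  by (simp add: lin_ext_fin_def)

lemma lin_ext_fin_scale: "lin_ext_fin \<phi> (Poly_Mapping.single 0 c * v) = scl (fps_const c) * lin_ext_fin \<phi> v" for v :: "'k::monoid_add \<Rightarrow>\<^sub>0 complex"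
proof -
  have "lin_ext_fin \<phi> (Poly_Mapping.single 0 c * v) = (\<Sum>k\<in>Poly_Mapping.keys v. scl (fps_const (Poly_Mapping.lookup (Poly_Mapping.single 0 c * v) k)) * \<phi> k)"
    by (rule lin_ext_fin_superset) (auto simp: in_keys_iff)
  then show ?thesis by (simp add: lin_ext_fin_def sum_distrib_left scl_mult mult.assoc flip: fps_const_mult)
qed

lemma lin_ext_fin_single: "lin_ext_fin \<phi> (Poly_Mapping.single k c) = scl (fps_const c) * \<phi> k"
  by (cases "c = 0") (auto simp: lin_ext_fin_def)

lemma lin_ext_fin_sum: "lin_ext_fin \<phi> (sum f A) = (\<Sum>i\<in>A. lin_ext_fin \<phi> (f i))"
  by (induction A rule: infinite_finite_induct) (auto simp: lin_ext_fin_add)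

text \<open>Universal property of the completed free module: every map on basis vectors extends,
  whatever its growth, because order p of the result uses only the orders q \<le> p of
  \<open>x\<close>, each of them a finite combination.\<close>

definition lin_ext :: "('k \<Rightarrow> ('l::monoid_add \<Rightarrow>\<^sub>0 complex) fps) \<Rightarrow> ('k \<Rightarrow>\<^sub>0 complex) fps \<Rightarrow> ('l \<Rightarrow>\<^sub>0 complex) fps" where
  "lin_ext \<phi> x = Abs_fps (\<lambda>p. \<Sum>q=0..p. lin_ext_fin \<phi> (x $ q) $ (p - q))"

lemma lin_ext_basis [simp]: "lin_ext \<phi> (basis k) = \<phi> k"
proof (rule fps_ext)
  fix p
  have "(\<Sum>q=0..p. lin_ext_fin \<phi> (basis k $ q) $ (p - q)) = (\<Sum>q=0..p. if q = 0 then \<phi> k $ p else 0)"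
    by (rule sum.cong) (auto simp: basis_def lin_ext_fin_single)
  then show "lin_ext \<phi> (basis k) $ p = \<phi> k $ p" by (simp add: lin_ext_def)
qed

lemma fps_scl_const_mult_nth: "(scl (fps_const c) * x) $ p = Poly_Mapping.single 0 c * x $ p"
  for x :: "('k::monoid_add \<Rightarrow>\<^sub>0 complex) fps"
proof -
  have "scl (fps_const c) = fps_const (Poly_Mapping.single (0::'k) c)" by (rule fps_ext) auto
  then show ?thesis by simp
qed

lemma A_linear_lin_ext: "A_linear (lin_ext (\<phi> :: 'k::monoid_add \<Rightarrow> _))"
proof (rule A_linearI)
  fix x y show "lin_ext \<phi> (x + y) = lin_ext \<phi> x + lin_ext \<phi> y"
    by (rule fps_ext) (simp add: lin_ext_def lin_ext_fin_add sum.distrib)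
next
  fix f and x :: "('k \<Rightarrow>\<^sub>0 complex) fps"
  show "lin_ext \<phi> (scl f * x) = scl f * lin_ext \<phi> x"
  proof (rule fps_ext)
    fix p
    define F where "F i j k = Poly_Mapping.single 0 (f $ i) * lin_ext_fin \<phi> (x $ j) $ k" for i j k
    have "lin_ext \<phi> (scl f * x) $ p = (\<Sum>q=0..p. \<Sum>i=0..q. F i (q - i) (p - q))"
      by (simp add: lin_ext_def fps_mult_nth[of "scl f"] lin_ext_fin_sum lin_ext_fin_scale fps_sum_nth fps_scl_const_mult_nth F_def)
    also have "\<dots> = (\<Sum>i=0..p. \<Sum>q=0..p - i. F i q (p - i - q))"
      by (rule fps_mult_assoc_lemma)
    also have "\<dots> = (scl f * lin_ext \<phi> x) $ p"
      by (simp add: fps_mult_nth lin_ext_def sum_distrib_left F_def)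
    finally show "lin_ext \<phi> (scl f * x) $ p = (scl f * lin_ext \<phi> x) $ p" .
  qed
qed

text \<open>The part of \<open>x\<close> up to order p, written as a finite combination of basis
  vectors over \<open>complex fps\<close>, so that an A-linear map can be evaluated on it
  termwise.\<close>

definition trunc :: "nat \<Rightarrow> ('k::monoid_add \<Rightarrow>\<^sub>0 complex) fps \<Rightarrow> ('k \<Rightarrow>\<^sub>0 complex) fps" where
  "trunc p x = (\<Sum>q\<le>p. \<Sum>k\<in>Poly_Mapping.keys (x $ q). scl (fps_const (Poly_Mapping.lookup (x $ q) k) * fps_X ^ q) * basis k)"

lemma scl_mon_basis_nth: "(scl (fps_const c * fps_X ^ q) * basis k) $ p = (if p = q then Poly_Mapping.single k c else 0)"
  for k :: "'k::monoid_add"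
proof -
  have "scl (fps_const c * fps_X ^ q) * basis k = fps_X ^ q * (scl (fps_const c) * basis k)"
    by (simp add: scl_mult scl_power scl_X fps_mult_fps_X_power_commute mult.assoc)
  then show ?thesis
    by (auto simp: fps_X_power_mult_nth fps_scl_const_mult_nth basis_def mult_single)
qed

lemma pm_sum_single: "(\<Sum>k\<in>Poly_Mapping.keys v. Poly_Mapping.single k (Poly_Mapping.lookup v k)) = v"
  for v :: "'k \<Rightarrow>\<^sub>0 'b::comm_monoid_add"
proof (rule poly_mapping_eqI)
  fix l
  have "(\<Sum>k\<in>Poly_Mapping.keys v. Poly_Mapping.lookup (Poly_Mapping.single k (Poly_Mapping.lookup v k)) l)
    = (\<Sum>k\<in>Poly_Mapping.keys v. if k = l then Poly_Mapping.lookup v l else 0)"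
    by (rule sum.cong) (auto simp: lookup_single when_def)
  then show "Poly_Mapping.lookup (\<Sum>k\<in>Poly_Mapping.keys v. Poly_Mapping.single k (Poly_Mapping.lookup v k)) l = Poly_Mapping.lookup v l"
    by (simp add: lookup_sum in_keys_iff)
qed

lemma trunc_nth: "trunc p x $ r = (if r \<le> p then x $ r else 0)"
proof -
  have "trunc p x $ r = (\<Sum>q\<le>p. if r = q then \<Sum>k\<in>Poly_Mapping.keys (x $ q). Poly_Mapping.single k (Poly_Mapping.lookup (x $ q) k) else 0)"
    unfolding trunc_def fps_sum_nth scl_mon_basis_nth by (rule sum.cong) auto
  then show ?thesis by (simp add: pm_sum_single)
qed

lemma A_linear_trunc: assumes "A_linear T" shows "T x $ p = T (trunc p x) $ p"
  by (rule A_linear_local[OF assms]) (simp add: trunc_nth)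

lemma A_linear_trunc_expand: assumes "A_linear T"
  shows "T (trunc p x) = (\<Sum>q\<le>p. \<Sum>k\<in>Poly_Mapping.keys (x $ q). scl (fps_const (Poly_Mapping.lookup (x $ q) k) * fps_X ^ q) * T (basis k))"
  by (simp add: trunc_def A_linear_sum[OF assms] A_linear_scl[OF assms])

text \<open>Modulo hbar^(p+1) every \<open>x\<close> is a finite combination of basis vectors. Most
  later operator identities are reduced to monomials in this way.\<close>

lemma A_linear_eqI:
  assumes "A_linear S" "A_linear T" "\<And>k. S (basis k) = T (basis k)" shows "S x = T x"
  by (rule fps_ext) (simp only: A_linear_trunc[OF assms(1)] A_linear_trunc[OF assms(2)] A_linear_trunc_expand[OF assms(1)] A_linear_trunc_expand[OF assms(2)] assms(3))

text \<open>Convergence can be tested on basis vectors: only finitely many of them occur in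
  \<open>x\<close> up to order p, so only finitely many indices contribute to that order.\<close>

lemma A_linear_hfinI:
  assumes "\<And>i. A_linear (S i)" "\<And>k. finite {i. S i (basis k) \<noteq> 0}" shows "hsummable (\<lambda>i. S i x)"
proof (rule hsummable_bounded)
  fix p
  let ?A = "\<Union>q\<le>p. \<Union>k\<in>Poly_Mapping.keys (x $ q). {i. S i (basis k) \<noteq> 0}"
  have "finite ?A" using assms(2) by auto
  moreover have "S i x $ p = 0" if "i \<notin> ?A" for i
  proof -
    have "S i (trunc p x) = 0" unfolding A_linear_trunc_expand[OF assms(1)]
      using that by (intro sum.neutral ballI) auto
    then show ?thesis by (subst A_linear_trunc[OF assms(1)]) simp
  qed
  ultimately show "\<exists>A. finite A \<and> (\<forall>i. i \<notin> A \<longrightarrow> S i x $ p = 0)" by blast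
qed

section \<open>Submodules spanned by a set of basis vectors\<close>

definition supp_in :: "'k set \<Rightarrow> ('k \<Rightarrow>\<^sub>0 complex) fps \<Rightarrow> bool" where
  "supp_in S x \<longleftrightarrow> (\<forall>p. Poly_Mapping.keys (x $ p) \<subseteq> S)"

lemma supp_in_0 [simp]: "supp_in S 0"
  by (simp add: supp_in_def)

lemma supp_in_add: "supp_in S x \<Longrightarrow> supp_in S y \<Longrightarrow> supp_in S (x + y)"
  unfolding supp_in_def using Poly_Mapping.keys_add by (metis (no_types, lifting) Un_subset_iff fps_add_nth sup.orderE subset_trans)

lemma supp_in_uminus: "supp_in S x \<Longrightarrow> supp_in S (- x)"
  by (simp add: supp_in_def in_keys_iff subset_iff)

lemma supp_in_diff: "supp_in S x \<Longrightarrow> supp_in S y \<Longrightarrow> supp_in S (x - y)"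
  using supp_in_add[of S x "- y"] supp_in_uminus by fastforce

lemma supp_in_sum: "(\<And>i. i \<in> A \<Longrightarrow> supp_in S (f i)) \<Longrightarrow> supp_in S (sum f A)"
  by (induction A rule: infinite_finite_induct) (auto intro: supp_in_add)

lemma pm_keys_sum:
  assumes "\<And>i. i \<in> A \<Longrightarrow> Poly_Mapping.keys (f i) \<subseteq> S" shows "Poly_Mapping.keys (sum f A) \<subseteq> S"
  using assms
proof (induction A rule: infinite_finite_induct)
  case (insert a A)
  have "Poly_Mapping.keys (f a + sum f A) \<subseteq> Poly_Mapping.keys (f a) \<union> Poly_Mapping.keys (sum f A)"
    by (rule Poly_Mapping.keys_add)
  then show ?case using insert by (simp add: subset_iff) blast
qed auto

lemma supp_in_hsum: assumes "\<And>i. supp_in S (f i)" shows "supp_in S (hsum f)"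
  unfolding supp_in_def
proof
  fix p
  have "Poly_Mapping.keys (sum (\<lambda>i. f i $ p) A) \<subseteq> S" for A
    by (rule pm_keys_sum) (use assms in \<open>auto simp: supp_in_def\<close>)
  then show "Poly_Mapping.keys (hsum f $ p) \<subseteq> S" by (simp add: hsum_nth Sum_any.expand_set)
qed

lemma supp_in_basis: "supp_in S (basis k) \<longleftrightarrow> k \<in> S"
proof
  assume "supp_in S (basis k)"
  then have "Poly_Mapping.keys ((basis k :: ('a \<Rightarrow>\<^sub>0 complex) fps) $ 0) \<subseteq> S" unfolding supp_in_def by blast
  then show "k \<in> S" by (simp add: basis_def)
qed (auto simp: supp_in_def basis_def)

lemma supp_in_mult:
  assumes "supp_in S x" "supp_in T y" "\<And>k l. k \<in> S \<Longrightarrow> l \<in> T \<Longrightarrow> k + l \<in> U" shows "supp_in U (x * y)"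
  unfolding supp_in_def
proof
  fix p
  have "Poly_Mapping.keys (x $ i * y $ j) \<subseteq> U" for i j
  proof
    fix a assume "a \<in> Poly_Mapping.keys (x $ i * y $ j)"
    then obtain k l where "a = k + l" "k \<in> Poly_Mapping.keys (x $ i)" "l \<in> Poly_Mapping.keys (y $ j)"
      using keys_mult[of "x $ i" "y $ j"] by blast
    then show "a \<in> U" using assms unfolding supp_in_def by blast
  qed
  then have "Poly_Mapping.keys (sum (\<lambda>i. x $ i * y $ (p - i)) A) \<subseteq> U" for A
    by (intro pm_keys_sum)
  then show "Poly_Mapping.keys ((x * y) $ p) \<subseteq> U" by (simp add: fps_mult_nth)
qed

lemma supp_in_scl: "supp_in S x \<Longrightarrow> supp_in S (scl f * x)" for x :: "('k::monoid_add \<Rightarrow>\<^sub>0 complex) fps"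
  by (rule supp_in_mult[of "{0}"]) (auto simp: supp_in_def split: if_splits)

lemma supp_in_A_linear:
  assumes "A_linear T" "\<And>k. k \<in> S \<Longrightarrow> supp_in U (T (basis k))" "supp_in S x" shows "supp_in U (T x)"
  unfolding supp_in_def
proof
  fix p
  have "supp_in U (T (trunc p x))"
    unfolding A_linear_trunc_expand[OF assms(1)]
    by (intro supp_in_sum supp_in_scl assms(2)) (use assms(3) in \<open>auto simp: supp_in_def\<close>)
  then show "Poly_Mapping.keys (T x $ p) \<subseteq> U" by (subst A_linear_trunc[OF assms(1)]) (simp add: supp_in_def)
qed

lemma lin_ext_mult:
  assumes "\<And>k l. \<phi> (k + l) = \<phi> k * \<phi> l" shows "lin_ext \<phi> (x * y) = lin_ext \<phi> x * lin_ext \<phi> y"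
proof -
  have *: "lin_ext \<phi> (basis k * y) = \<phi> k * lin_ext \<phi> y" for k
    by (rule A_linear_eqI[of "\<lambda>y. lin_ext \<phi> (basis k * y)"])
      (auto intro!: A_linear_comp[OF A_linear_lin_ext] A_linear_mult_left A_linear_lin_ext A_linear_id simp: basis_mult assms)
  show ?thesis
    by (rule A_linear_eqI[of "\<lambda>x. lin_ext \<phi> (x * y)"])
      (auto intro!: A_linear_comp[OF A_linear_lin_ext] A_linear_mult_right A_linear_lin_ext A_linear_id simp: *)
qed

section \<open>Laurent polynomials acting on formal series\<close>

text \<open>
  A Laurent series acts on arbitrary functions of the exponents, since a basis element merely shifts them; no
  convergence condition arises.
\<close>

definition ser_act :: "(('k::comm_monoid_add \<times> 'e::ab_group_add) \<Rightarrow>\<^sub>0 complex) fps \<Rightarrow> ('e \<Rightarrow> ('k \<Rightarrow>\<^sub>0 complex) fps) \<Rightarrow> 'e \<Rightarrow> ('k \<Rightarrow>\<^sub>0 complex) fps" where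
  "ser_act r f e = lin_ext (\<lambda>(k, i). basis k * f (e - i)) r"

lemma ser_act_basis: "ser_act (basis (k, i)) f e = basis k * f (e - i)"
  by (simp add: ser_act_def)

lemma A_linear_ser_act: "A_linear (\<lambda>r. ser_act r f e)"
  unfolding ser_act_def by (rule A_linear_lin_ext)

lemmas ser_act_add = A_linear_add[OF A_linear_ser_act]
lemmas ser_act_diff = A_linear_diff[OF A_linear_ser_act]
lemmas ser_act_scl = A_linear_scl[OF A_linear_ser_act]
lemma ser_act_add2: "ser_act r (\<lambda>e. f e + g e) e = ser_act r f e + ser_act r g e"
  by (rule A_linear_eqI[of "\<lambda>r. ser_act r (\<lambda>e. f e + g e) e"]) (auto intro!: A_linear_ser_act A_linear_plus simp: ser_act_basis distrib_left)

lemma ser_act_mult2: "ser_act r (\<lambda>e. c * f e) e = c * ser_act r f e"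
  by (rule A_linear_eqI[of "\<lambda>r. ser_act r (\<lambda>e. c * f e) e"]) (auto intro!: A_linear_ser_act A_linear_mult_left simp: ser_act_basis)

lemma ser_act_mult: "ser_act (r * s) f e = ser_act r (ser_act s f) e"
proof -
  have *: "ser_act (basis k * s) f e = ser_act (basis k) (ser_act s f) e" for k
  proof (rule A_linear_eqI[of "\<lambda>s. ser_act (basis k * s) f e"])
    show "A_linear (\<lambda>s. ser_act (basis k * s) f e)" by (intro A_linear_comp[OF A_linear_ser_act] A_linear_mult_left A_linear_id)
    obtain k1 i1 where k: "k = (k1, i1)" by force
    show "A_linear (\<lambda>s. ser_act (basis k) (ser_act s f) e)" unfolding k ser_act_basis
      by (intro A_linear_mult_left A_linear_ser_act)
    fix l :: "'a \<times> 'b"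
    obtain k2 i2 where l: "l = (k2, i2)" by force
    show "ser_act (basis k * basis l) f e = ser_act (basis k) (ser_act (basis l) f) e"
      unfolding k l basis_mult plus_prod_def fst_conv snd_conv ser_act_basis
      by (simp add: basis_mult[symmetric] algebra_simps)
  qed
  show ?thesis
    by (rule A_linear_eqI[of "\<lambda>r. ser_act (r * s) f e"]) (auto intro!: A_linear_comp[OF A_linear_ser_act] A_linear_mult_right A_linear_id A_linear_ser_act simp: *)
qed

lemma ser_act_1: "ser_act 1 f e = f e"
  using ser_act_basis[of 0 0 f e] by (simp add: basis_0 flip: zero_prod_def)

lemma ser_act_commute: "ser_act r (ser_act s f) = ser_act s (ser_act r f)"
  by (rule ext) (metis ser_act_mult mult.commute)

definition ser_coeff :: "(('k::comm_monoid_add \<times> 'e::ab_group_add) \<Rightarrow>\<^sub>0 complex) fps \<Rightarrow> 'e \<Rightarrow> ('k \<Rightarrow>\<^sub>0 complex) fps" where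
  "ser_coeff r = ser_act r (\<lambda>e. if e = 0 then 1 else 0)"

lemma A_linear_ser_coeff: "A_linear (\<lambda>r. ser_coeff r e)"
  unfolding ser_coeff_def by (rule A_linear_ser_act)

lemma ser_coeff_basis: "ser_coeff (basis (k, i)) m = (if m = i then basis k else 0)"
  by (simp add: ser_coeff_def ser_act_basis)

text \<open>A basis element has a single nonzero coefficient, so the sum then has one term;
  linearity gives convergence and the formula for every \<open>r\<close>.\<close>

lemma
  fixes r :: "(('k::comm_monoid_add \<times> 'e::ab_group_add) \<Rightarrow>\<^sub>0 complex) fps"
  shows hsummable_ser_coeff: "hsummable (\<lambda>i. M i * ser_coeff r (m - i))"
  and hsum_ser_coeff: "hsum (\<lambda>i. M i * ser_coeff r (m - i)) = ser_act r M m"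
proof -
  have fin: "finite {i. M i * ser_coeff (basis k) (m - i) \<noteq> 0}" for k :: "'k \<times> 'e"
  proof (rule finite_subset)
    obtain a j where k: "k = (a, j)" by force
    show "{i. M i * ser_coeff (basis k) (m - i) \<noteq> 0} \<subseteq> {m - snd k}"
      unfolding k by (auto simp: ser_coeff_basis split: if_splits)
  qed simp
  have *: "hsummable (\<lambda>i. M i * ser_coeff r (m - i))" for r :: "(('k::comm_monoid_add \<times> 'e::ab_group_add) \<Rightarrow>\<^sub>0 complex) fps"
    by (rule A_linear_hfinI[OF A_linear_mult_left[OF A_linear_ser_coeff] fin])
  then show "hsummable (\<lambda>i. M i * ser_coeff r (m - i))" .
  show "hsum (\<lambda>i. M i * ser_coeff r (m - i)) = ser_act r M m"
  proof (rule A_linear_eqI[of "\<lambda>r. hsum (\<lambda>i. M i * ser_coeff r (m - i))"])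
    show "A_linear (\<lambda>r. hsum (\<lambda>i. M i * ser_coeff r (m - i)))"
      by (rule A_linear_hsum_fun[OF A_linear_mult_left[OF A_linear_ser_coeff] *])
    fix k :: "'k \<times> 'e" obtain a j where k: "k = (a, j)" by force
    have "hsum (\<lambda>i. M i * ser_coeff (basis k) (m - i)) = M (m - j) * ser_coeff (basis k) (m - (m - j))"
      by (rule hsum_single) (auto simp: k ser_coeff_basis)
    then show "hsum (\<lambda>i. M i * ser_coeff (basis k) (m - i)) = ser_act (basis k) M m"
      by (simp add: k ser_coeff_basis ser_act_basis mult.commute)
  qed (rule A_linear_ser_act)
qed

text \<open>The extension of \<open>S\<close> that is linear over monomials in u. It expresses the
  composition of operator series when both factors depend on the same variable
  (\<open>hsum_ser_coeff_comp\<close>).\<close>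

definition ext_ser :: "(('k::comm_monoid_add \<Rightarrow>\<^sub>0 complex) fps \<Rightarrow> (('k \<times> 'e::ab_group_add) \<Rightarrow>\<^sub>0 complex) fps) \<Rightarrow> (('k \<times> 'e) \<Rightarrow>\<^sub>0 complex) fps \<Rightarrow> (('k \<times> 'e) \<Rightarrow>\<^sub>0 complex) fps" where
  "ext_ser S = lin_ext (\<lambda>(k, j). S (basis k) * basis (0, j))"

lemma ser_coeff_shift: "ser_coeff (s * basis (0, j)) m = ser_coeff s (m - j)"
  by (subst mult.commute) (simp add: ser_coeff_def ser_act_mult ser_act_basis basis_0)

lemma hsum_ser_coeff_comp:
  fixes r :: "(('k::comm_monoid_add \<times> 'e::ab_group_add) \<Rightarrow>\<^sub>0 complex) fps"
  assumes S: "A_linear S"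
  shows "hsum (\<lambda>i. ser_coeff (S (ser_coeff r (m - i))) i) = ser_coeff (ext_ser S r) m"
proof -
  have al: "A_linear (\<lambda>r. ser_coeff (S (ser_coeff r (m - i))) i)" for i
    by (rule A_linear_comp[OF A_linear_ser_coeff A_linear_comp[OF S A_linear_ser_coeff]])
  have fin: "finite {i. ser_coeff (S (ser_coeff (basis k) (m - i))) i \<noteq> 0}" for k :: "'k \<times> 'e"
  proof (rule finite_subset)
    obtain a j where k: "k = (a, j)" by force
    show "{i. ser_coeff (S (ser_coeff (basis k) (m - i))) i \<noteq> 0} \<subseteq> {m - snd k}"
      unfolding k by (auto simp: ser_coeff_basis A_linear_0[OF S] A_linear_0[OF A_linear_ser_coeff] split: if_splits)
  qed simp
  show ?thesis
  proof (rule A_linear_eqI[of "\<lambda>r. hsum (\<lambda>i. ser_coeff (S (ser_coeff r (m - i))) i)"])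
    show "A_linear (\<lambda>r. hsum (\<lambda>i. ser_coeff (S (ser_coeff r (m - i))) i))"
      by (rule A_linear_hsum_fun[OF al A_linear_hfinI[OF al fin]])
    show "A_linear (\<lambda>r. ser_coeff (ext_ser S r) m)" unfolding ext_ser_def by (rule A_linear_comp[OF A_linear_ser_coeff A_linear_lin_ext])
    fix k :: "'k \<times> 'e" obtain a j where k: "k = (a, j)" by force
    have "hsum (\<lambda>i. ser_coeff (S (ser_coeff (basis k) (m - i))) i) = ser_coeff (S (ser_coeff (basis k) (m - (m - j)))) (m - j)"
      by (rule hsum_single) (auto simp: k ser_coeff_basis A_linear_0[OF S] A_linear_0[OF A_linear_ser_coeff])
    then show "hsum (\<lambda>i. ser_coeff (S (ser_coeff (basis k) (m - i))) i) = ser_coeff (ext_ser S (basis k)) m"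
      by (simp add: k ser_coeff_basis ext_ser_def ser_coeff_shift)
  qed
qed

section \<open>Changes of variables\<close>

definition relabel :: "('k \<Rightarrow> 'l) \<Rightarrow> ('k \<Rightarrow>\<^sub>0 complex) fps \<Rightarrow> ('l::monoid_add \<Rightarrow>\<^sub>0 complex) fps" where
  "relabel h = lin_ext (\<lambda>k. basis (h k))"

lemma A_linear_relabel: fixes h :: "'k::monoid_add \<Rightarrow> 'l::monoid_add" shows "A_linear (relabel h)"
  unfolding relabel_def by (rule A_linear_lin_ext)

lemma relabel_basis [simp]: "relabel h (basis k) = basis (h k)"
  by (simp add: relabel_def)

lemma relabel_mult: fixes h :: "'k::monoid_add \<Rightarrow> 'l::monoid_add" assumes "\<And>k l. h (k + l) = h k + h l" shows "relabel h (x * y) = relabel h x * relabel h y"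
  unfolding relabel_def by (rule lin_ext_mult) (simp add: assms basis_mult)

lemma relabel_scl_mult: fixes h :: "'k::monoid_add \<Rightarrow> 'l::monoid_add" shows "relabel h (scl f * x) = scl f * relabel h x"
  by (rule A_linear_scl[OF A_linear_relabel])

lemma relabel_1: fixes h :: "'k::monoid_add \<Rightarrow> 'l::monoid_add" shows "h 0 = 0 \<Longrightarrow> relabel h 1 = 1"
  by (simp add: basis_0[symmetric])

lemma relabel_scl: fixes h :: "'k::monoid_add \<Rightarrow> 'l::monoid_add" shows "h 0 = 0 \<Longrightarrow> relabel h (scl f) = scl f"
  using relabel_scl_mult[of h f 1] by (simp add: relabel_1)

definition emb :: "('k \<Rightarrow>\<^sub>0 complex) fps \<Rightarrow> (('k::comm_monoid_add \<times> 'e::ab_group_add) \<Rightarrow>\<^sub>0 complex) fps" where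
  "emb = relabel (\<lambda>k. (k, 0))"
definition emb_u :: "(('k::comm_monoid_add \<times> int) \<Rightarrow>\<^sub>0 complex) fps \<Rightarrow> (('k \<times> (int \<times> int)) \<Rightarrow>\<^sub>0 complex) fps" where
  "emb_u = relabel (\<lambda>(k, i). (k, (i, 0)))"
definition emb_v :: "(('k::comm_monoid_add \<times> int) \<Rightarrow>\<^sub>0 complex) fps \<Rightarrow> (('k \<times> (int \<times> int)) \<Rightarrow>\<^sub>0 complex) fps" where
  "emb_v = relabel (\<lambda>(k, i). (k, (0, i)))"

lemma A_linear_emb: "A_linear emb" and A_linear_emb_u: "A_linear emb_u" and A_linear_emb_v: "A_linear emb_v"
  by (simp_all add: emb_def emb_u_def emb_v_def A_linear_relabel)

lemma emb_mult: "emb (x * y) = emb x * emb y"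
  unfolding emb_def by (rule relabel_mult) auto
lemma emb_u_mult: "emb_u (x * y) = emb_u x * emb_u y"
  unfolding emb_u_def by (rule relabel_mult) auto
lemma emb_v_mult: "emb_v (x * y) = emb_v x * emb_v y"
  unfolding emb_v_def by (rule relabel_mult) auto
lemma emb_basis [simp]: "emb (basis k) = basis (k, 0)" by (simp add: emb_def)
lemma emb_u_basis [simp]: "emb_u (basis (k, i)) = basis (k, (i, 0))" by (simp add: emb_u_def)
lemma emb_v_basis [simp]: "emb_v (basis (k, i)) = basis (k, (0, i))" by (simp add: emb_v_def)
lemma emb_1 [simp]: "emb 1 = 1" by (simp add: emb_def relabel_1 zero_prod_def)
lemma emb_u_1 [simp]: "emb_u 1 = 1" by (simp add: emb_u_def relabel_1 zero_prod_def)
lemma emb_v_1 [simp]: "emb_v 1 = 1" by (simp add: emb_v_def relabel_1 zero_prod_def)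
lemma emb_scl [simp]: "emb (scl f) = scl f" by (simp add: emb_def relabel_scl zero_prod_def)
lemma emb_u_scl [simp]: "emb_u (scl f) = scl f" by (simp add: emb_u_def relabel_scl zero_prod_def)
lemma emb_v_scl [simp]: "emb_v (scl f) = scl f" by (simp add: emb_v_def relabel_scl zero_prod_def)

lemma ser_act_emb: "ser_act (emb x) f e = x * f e"
  by (rule A_linear_eqI[of "\<lambda>x. ser_act (emb x) f e"]) (auto intro!: A_linear_comp[OF A_linear_ser_act A_linear_emb] A_linear_mult_right A_linear_id simp: ser_act_basis)

lemma ser_act_emb_u: "ser_act (emb_u r) f (a, b) = ser_act r (\<lambda>a. f (a, b)) a"
proof (rule A_linear_eqI[of "\<lambda>r. ser_act (emb_u r) f (a, b)"])
  fix k :: "'a \<times> int" show "ser_act (emb_u (basis k)) f (a, b) = ser_act (basis k) (\<lambda>a. f (a, b)) a"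
    by (cases k) (simp add: ser_act_basis)
qed (auto intro!: A_linear_comp[OF A_linear_ser_act A_linear_emb_u] A_linear_ser_act)

lemma ser_act_emb_v: "ser_act (emb_v r) f (a, b) = ser_act r (\<lambda>b. f (a, b)) b"
proof (rule A_linear_eqI[of "\<lambda>r. ser_act (emb_v r) f (a, b)"])
  fix k :: "'a \<times> int" show "ser_act (emb_v (basis k)) f (a, b) = ser_act (basis k) (\<lambda>b. f (a, b)) b"
    by (cases k) (simp add: ser_act_basis)
qed (auto intro!: A_linear_comp[OF A_linear_ser_act A_linear_emb_v] A_linear_ser_act)

section \<open>Integer binomials and powers of a linear factor\<close>

lemma ibinom_prod_Suc:
  "(\<Prod>i<Suc d. (k + 1) - int i) = (\<Prod>i<Suc d. k - int i) + int (Suc d) * (\<Prod>i<d. k - int i)"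
proof -
  have "(\<Prod>i<Suc d. (k + 1) - int i) = (k + 1) * (\<Prod>i<d. k - int i)"
    by (subst prod.lessThan_Suc_shift) (simp add: algebra_simps)
  moreover have "(\<Prod>i<Suc d. k - int i) = (\<Prod>i<d. k - int i) * (k - int d)" by simp
  ultimately show ?thesis by (simp add: algebra_simps)
qed

text \<open>The products at k + 1 and k differ by \<open>Suc d\<close> times a product of length d,
  so divisibility spreads upwards and downwards from k = 0, where the product contains the factor
  0.\<close>

lemma fact_dvd_ibinom_prod: "fact d dvd (\<Prod>i<d. k - int i)"
proof (induction d arbitrary: k)
  case (Suc d)
  have step: "(fact (Suc d) dvd (\<Prod>i<Suc d. (k + 1) - int i)) \<longleftrightarrow> fact (Suc d) dvd (\<Prod>i<Suc d. k - int i)" for k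
  proof -
    have "(fact (Suc d) :: int) dvd int (Suc d) * (\<Prod>i<d. k - int i)"
      using Suc[of k] by (simp add: mult_dvd_mono)
    then show ?thesis unfolding ibinom_prod_Suc by (rule dvd_add_left_iff)
  qed
  show ?case
  proof (induction k rule: int_induct[of _ 0])
    case base then show ?case by (subst prod.lessThan_Suc_shift) simp
  next
    case (step1 i) then show ?case using step[of i] by blast
  next
    case (step2 i) then show ?case using step[of "i - 1"] by simp
  qed
qed simp

lemma ibinom_0 [simp]: "ibinom k 0 = 1"
  by (simp add: ibinom_def)

lemma ibinom_zero: "ibinom 0 (Suc d) = 0"
  unfolding ibinom_def by (subst prod.lessThan_Suc_shift) simp

lemma ibinom_Pascal: "ibinom (k + 1) (Suc d) = ibinom k (Suc d) + ibinom k d"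
proof -
  have "(\<Prod>i<Suc d. (k + 1) - int i) div fact (Suc d) = (\<Prod>i<Suc d. k - int i) div fact (Suc d) + (int (Suc d) * (\<Prod>i<d. k - int i)) div fact (Suc d)"
    unfolding ibinom_prod_Suc by (rule div_plus_div_distrib_dvd_left) (rule fact_dvd_ibinom_prod)
  also have "(int (Suc d) * (\<Prod>i<d. k - int i)) div fact (Suc d) = (\<Prod>i<d. k - int i) div fact d"
    unfolding fact_Suc of_nat_id by (subst div_mult_mult1) auto
  finally show ?thesis by (simp only: ibinom_def)
qed

lemma pw_0: "pw s 0 m = (if m = 0 then 1 else 0)"
proof (cases "m < 0")
  case True
  then have "nat (0 - m) = Suc (nat (- m - 1))" by simp
  then show ?thesis using True by (simp add: pw_def ibinom_zero)
qed (auto simp: pw_def)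

text \<open>Coefficientwise form of multiplying (u + s)^k by u + s. It is kept for noncommutative
  coefficients, since s will be \<open>hc4\<close> in the free algebra.\<close>

lemma pw_Pascal: "pw s (k + 1) m = pw s k (m - 1) + s * pw s k m"
proof (cases "m \<le> k")
  case True
  then have *: "nat (k + 1 - m) = Suc (nat (k - m))" "nat (k - (m - 1)) = Suc (nat (k - m))" by auto
  have "s * (of_int z * x) = of_int z * (s * x)" for z :: int and x
    by (metis mult.assoc Ints_of_int mult_of_int_commute)
  with True show ?thesis unfolding pw_def * by (simp add: ibinom_Pascal distrib_right)
next
  case False
  then show ?thesis by (cases "m = k + 1") (auto simp: pw_def)
qed

lemma pw_nonneg_eq_0: "0 \<le> k \<Longrightarrow> m < 0 \<Longrightarrow> pw s k m = 0"
proof (induction "nat k" arbitrary: k m)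
  case (Suc n)
  then have "pw s (k - 1) (m - 1) = 0" "pw s (k - 1) m = 0" by auto
  then show ?case using pw_Pascal[of s "k - 1" m] by simp
qed (simp add: pw_0)

lemma hb_power_nth: "(hb c ^ d) $ p = (if p = d then c ^ d else 0)"
  by (simp add: hb_def power_mult_distrib fps_const_power)

lemma of_int_fps_mult: "of_int z * x = fps_const (of_int z) * x" for x :: "complex fps"
  by (simp add: fps_of_int)

lemma pw_hb_nth: "pw (hb c) k m $ p = (if m = k - int p then of_int (ibinom k p) * c ^ p else 0)"
proof (cases "m \<le> k")
  case True
  then have "(p = nat (k - m)) = (m = k - int p)" by auto
  then show ?thesis using True by (auto simp: pw_def of_int_fps_mult hb_power_nth)
qed (auto simp: pw_def)

text \<open>The power (u + c hbar)^k as one element of the completed Laurent ring. For negative k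
  too, each power of hbar carries a single monomial, so Laurent polynomials completed in hbar are
  large enough.\<close>

definition lin_pow :: "complex \<Rightarrow> int \<Rightarrow> (('k::comm_monoid_add \<times> int) \<Rightarrow>\<^sub>0 complex) fps" where
  "lin_pow c k = Abs_fps (\<lambda>p. Poly_Mapping.single (0, k - int p) (of_int (ibinom k p) * c ^ p))"

lemma lin_pow_0: "lin_pow c 0 = 1"
proof (rule fps_ext)
  fix p show "lin_pow c 0 $ p = 1 $ p"
    by (cases p) (auto simp: lin_pow_def ibinom_zero single_one[symmetric] zero_prod_def simp del: single_one)
qed

lemma lin_pow_Suc: "lin_pow c (k + 1) = (basis (0, 1) + scl (hb c)) * (lin_pow c k :: (('k::comm_monoid_add \<times> int) \<Rightarrow>\<^sub>0 complex) fps)"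
proof (rule fps_ext)
  fix p
  have s: "scl (hb c) = fps_const (Poly_Mapping.single 0 c) * fps_X"
    unfolding hb_def scl_mult scl_X by (simp add: fps_eq_iff)
  have *: "complex_of_int (ibinom (k + 1) (Suc n)) * c ^ Suc n = of_int (ibinom k (Suc n)) * c ^ Suc n + c * (of_int (ibinom k n) * c ^ n)" for n
    unfolding ibinom_Pascal by (simp add: algebra_simps)
  have 1: "(basis (0, 1) * (lin_pow c k :: (('k \<times> int) \<Rightarrow>\<^sub>0 complex) fps)) $ p = Poly_Mapping.single (0, k + 1 - int p) (of_int (ibinom k p) * c ^ p)"
    by (simp add: basis_def lin_pow_def mult_single algebra_simps)
  have 2: "(scl (hb c) * (lin_pow c k :: (('k \<times> int) \<Rightarrow>\<^sub>0 complex) fps)) $ p = (case p of 0 \<Rightarrow> 0 | Suc n \<Rightarrow> Poly_Mapping.single (0, k - int n) (c * (of_int (ibinom k n) * c ^ n)))"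
    by (cases p) (simp_all add: s mult.assoc lin_pow_def mult_single)
  have "((basis (0, 1) + scl (hb c)) * (lin_pow c k :: (('k \<times> int) \<Rightarrow>\<^sub>0 complex) fps)) $ p = (case p of 0 \<Rightarrow> Poly_Mapping.single (0, k + 1) 1 | Suc n \<Rightarrow> 
     Poly_Mapping.single (0, k - int n) (of_int (ibinom k (Suc n)) * c ^ Suc n + c * (of_int (ibinom k n) * c ^ n)))"
    unfolding distrib_right fps_add_nth 1 2 by (cases p) (simp_all add: single_add)
  moreover have "(lin_pow c (k + 1) :: (('k \<times> int) \<Rightarrow>\<^sub>0 complex) fps) $ p = (case p of 0 \<Rightarrow> Poly_Mapping.single (0, k + 1) 1 | Suc n \<Rightarrow> 
     Poly_Mapping.single (0, k - int n) (of_int (ibinom k (Suc n)) * c ^ Suc n + c * (of_int (ibinom k n) * c ^ n)))"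
    by (cases p) (simp_all add: lin_pow_def * del: power_Suc)
  ultimately show "lin_pow c (k + 1) $ p = ((basis (0, 1) + scl (hb c)) * (lin_pow c k :: (('k \<times> int) \<Rightarrow>\<^sub>0 complex) fps)) $ p" by (simp only:)
qed

lemma lin_pow_1: "lin_pow c 1 = basis (0, 1) + scl (hb c)"
  using lin_pow_Suc[of c 0] by (simp add: lin_pow_0)

lemma lin_pow_add: "lin_pow c (k + l) = (lin_pow c k * lin_pow c l :: (('k::comm_monoid_add \<times> int) \<Rightarrow>\<^sub>0 complex) fps)"
proof -
  define X :: "int \<Rightarrow> (('k \<times> int) \<Rightarrow>\<^sub>0 complex) fps" where "X = lin_pow c"
  have X: "X (k + 1) = X 1 * X k" for k unfolding X_def lin_pow_1 by (rule lin_pow_Suc)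
  have X0: "X 0 = 1" by (simp add: X_def lin_pow_0)
  have nat: "X (k + int n) = X (int n) * X k" for k n
  proof (induction n)
    case (Suc n)
    have e: "k + int (Suc n) = (k + int n) + 1" "int (Suc n) = int n + 1" by auto
    show ?case unfolding e(1) X Suc unfolding e(2) X by (simp only: mult.assoc)
  qed (simp add: X0)
  have "X (k + l) = X k * X l"
  proof (cases "0 \<le> l")
    case True then show ?thesis using nat[of k "nat l"] by (simp add: mult.commute)
  next
    case False
    then have 1: "X (int (nat (- l))) * X l = 1" using nat[of l "nat (- l)"] by (simp add: X0)
    have "X k = X (int (nat (- l))) * X (k + l)" using False nat[of "k + l" "nat (- l)"] by simp
    then have "X k * X l = X (k + l) * (X (int (nat (- l))) * X l)"
      by (simp only: mult_ac)
    then show ?thesis using 1 by simp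
  qed
  then show ?thesis by (simp add: X_def)
qed

lemma lin_pow_power: "lin_pow c k ^ n = lin_pow c (k * int n)"
  by (induction n) (auto simp: lin_pow_0 lin_pow_add[symmetric] algebra_simps)

lemma lin_pow_inv: "lin_pow c k * lin_pow c (- k) = 1" "lin_pow c (- k) * lin_pow c k = 1"
  by (simp_all add: lin_pow_add[symmetric] lin_pow_0)

lemma lin_ext_fin_lookup: "lin_ext_fin \<phi> v $ p = (\<Sum>k\<in>Poly_Mapping.keys v. Poly_Mapping.single 0 (Poly_Mapping.lookup v k) * \<phi> k $ p)"
  by (simp add: lin_ext_fin_def fps_sum_nth fps_scl_const_mult_nth)

lemma ser_coeff_nth: "Poly_Mapping.lookup (ser_coeff r m $ p) k = Poly_Mapping.lookup (r $ p) (k, m)"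
proof -
  have *: "(case a of (k, i) \<Rightarrow> basis k * (if m - i = 0 then 1 else 0)) $ q =
     (if q = 0 \<and> snd a = m then Poly_Mapping.single (fst a) 1 else 0)" for a q
    by (auto simp: basis_def split: prod.splits)
  have "ser_coeff r m $ p = (\<Sum>q=0..p. if q = p then lin_ext_fin (\<lambda>(k, i). basis k * (if m - i = 0 then 1 else 0)) (r $ p) $ 0 else 0)"
    unfolding ser_coeff_def ser_act_def lin_ext_def fps_nth_Abs_fps lin_ext_fin_lookup * by (intro sum.cong) (auto simp: sum.neutral)
  also have "\<dots> = (\<Sum>a\<in>Poly_Mapping.keys (r $ p). if snd a = m then Poly_Mapping.single (fst a) (Poly_Mapping.lookup (r $ p) a) else 0)"
    by (auto intro!: sum.cong simp: lin_ext_fin_lookup * mult_single basis_def)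
  also have "Poly_Mapping.lookup \<dots> k = (\<Sum>a\<in>Poly_Mapping.keys (r $ p). if a = (k, m) then Poly_Mapping.lookup (r $ p) (k, m) else 0)"
    unfolding lookup_sum by (rule sum.cong) (auto simp: lookup_single when_def)
  finally show ?thesis by (simp add: in_keys_iff)
qed

lemma ser_coeff_lin_pow: "ser_coeff (lin_pow c k) m = scl (pw (hb c) k m)"
proof (rule fps_ext, rule poly_mapping_eqI)
  fix p l show "Poly_Mapping.lookup (ser_coeff (lin_pow c k) m $ p) l = Poly_Mapping.lookup (scl (pw (hb c) k m) $ p) l"
    by (auto simp: ser_coeff_nth lin_pow_def pw_hb_nth lookup_single when_def)
qed

section \<open>The Fock space as a commutative algebra with generators\<close>

definition a_elt :: "nat \<times> nat \<Rightarrow> fock" where "a_elt jk = basis (Poly_Mapping.single jk 1, 0)"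
definition e_elt :: "lat \<Rightarrow> fock" where "e_elt \<beta> = basis (0, \<beta>)"

definition mon_prod :: "(nat \<times> nat \<Rightarrow> 'a::comm_monoid_mult) \<Rightarrow> (nat \<times> nat \<Rightarrow>\<^sub>0 nat) \<Rightarrow> 'a" where
  "mon_prod a \<mu> = (\<Prod>jk\<in>Poly_Mapping.keys \<mu>. a jk ^ Poly_Mapping.lookup \<mu> jk)"

lemma mon_prod_superset:
  assumes "finite K" "Poly_Mapping.keys \<mu> \<subseteq> K" shows "mon_prod a \<mu> = (\<Prod>jk\<in>K. a jk ^ Poly_Mapping.lookup \<mu> jk)"
  unfolding mon_prod_def using assms by (intro prod.mono_neutral_left) (auto simp: in_keys_iff)

lemma mon_prod_add: "mon_prod a (\<mu> + \<nu>) = mon_prod a \<mu> * mon_prod a \<nu>"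
proof -
  let ?K = "Poly_Mapping.keys \<mu> \<union> Poly_Mapping.keys \<nu>"
  have "mon_prod a (\<mu> + \<nu>) = (\<Prod>jk\<in>?K. a jk ^ Poly_Mapping.lookup (\<mu> + \<nu>) jk)"
    by (rule mon_prod_superset) (auto dest: Poly_Mapping.keys_add[THEN subsetD])
  moreover have "mon_prod a \<mu> = (\<Prod>jk\<in>?K. a jk ^ Poly_Mapping.lookup \<mu> jk)" "mon_prod a \<nu> = (\<Prod>jk\<in>?K. a jk ^ Poly_Mapping.lookup \<nu> jk)"
    by (auto intro!: mon_prod_superset)
  ultimately show ?thesis by (simp add: lookup_add power_add prod.distrib)
qed

lemma mon_prod_0 [simp]: "mon_prod a 0 = 1"
  by (simp add: mon_prod_def)

lemma mon_prod_single: "mon_prod a (Poly_Mapping.single jk 1) = a jk"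
  by (simp add: mon_prod_def)

text \<open>Induction on the total degree: splitting one generator off a nontrivial monomial lowers
  the sum of its exponents by one.\<close>

lemma pm_nat_induct:
  fixes \<mu> :: "'a \<Rightarrow>\<^sub>0 nat"
  assumes "P 0" "\<And>\<mu> j. P \<mu> \<Longrightarrow> P (Poly_Mapping.single j 1 + \<mu>)" shows "P \<mu>"
proof -
  have "P \<mu>" if "(\<Sum>k\<in>Poly_Mapping.keys \<mu>. Poly_Mapping.lookup \<mu> k) = n" for n \<mu>
    using that
  proof (induction n arbitrary: \<mu>)
    case 0
    then have "\<mu> = 0" by (intro poly_mapping_eqI) (auto simp: in_keys_iff)
    then show ?case using assms by simp
  next
    case (Suc n)
    then obtain j where j: "j \<in> Poly_Mapping.keys \<mu>" by (metis nat.simps(3) sum.empty ex_in_conv)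
    let ?\<nu> = "\<mu> - Poly_Mapping.single j 1"
    have eq: "\<mu> = Poly_Mapping.single j 1 + ?\<nu>"
      using j by (intro poly_mapping_eqI) (auto simp: lookup_add lookup_minus lookup_single when_def in_keys_iff)
    have "(\<Sum>k\<in>Poly_Mapping.keys \<mu>. Poly_Mapping.lookup \<mu> k) = (\<Sum>k\<in>Poly_Mapping.keys \<mu>. Poly_Mapping.lookup ?\<nu> k + (if k = j then 1 else 0))"
      by (subst eq) (auto intro!: sum.cong simp: lookup_add lookup_single when_def)
    also have "\<dots> = (\<Sum>k\<in>Poly_Mapping.keys \<mu>. Poly_Mapping.lookup ?\<nu> k) + 1"
      using j by (simp add: sum.distrib)
    also have "(\<Sum>k\<in>Poly_Mapping.keys \<mu>. Poly_Mapping.lookup ?\<nu> k) = (\<Sum>k\<in>Poly_Mapping.keys ?\<nu>. Poly_Mapping.lookup ?\<nu> k)"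
      by (rule sum.mono_neutral_right) (auto simp: in_keys_iff lookup_minus)
    finally have "(\<Sum>k\<in>Poly_Mapping.keys ?\<nu>. Poly_Mapping.lookup ?\<nu> k) = n" using Suc.prems by simp
    then have "P ?\<nu>" by (rule Suc.IH)
    then show ?case by (subst eq) (rule assms(2))
  qed
  then show ?thesis by blast
qed

text \<open>Products of the a_(j,-k) and the e^beta exhaust the basis vectors, and A-linearity takes
  care of the completion.\<close>

lemma fock_hom_eqI:
  fixes H :: "fock \<Rightarrow> ('l::monoid_add \<Rightarrow>\<^sub>0 complex) fps"
  assumes "A_linear H" "\<And>x y. H (x * y) = H x * H y" "H 1 = 1"
    and "A_linear G" "\<And>x y. G (x * y) = G x * G y" "G 1 = 1"
    and "\<And>jk. H (a_elt jk) = G (a_elt jk)" "\<And>\<beta>. H (e_elt \<beta>) = G (e_elt \<beta>)"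
  shows "H x = G x"
proof (rule A_linear_eqI[OF assms(1,4)])
  fix k :: key obtain \<mu> \<beta> where k: "k = (\<mu>, \<beta>)" by force
  have "H (basis (\<mu>, 0)) = G (basis (\<mu>, 0))"
  proof (induction \<mu> rule: pm_nat_induct)
    case 1 then show ?case using assms(3,6) by (simp add: basis_0 flip: zero_prod_def)
  next
    case (2 \<mu> j)
    have "basis (Poly_Mapping.single j 1 + \<mu>, 0) = a_elt j * basis (\<mu>, 0)"
      by (simp add: a_elt_def basis_mult)
    then show ?case using 2 assms by simp
  qed
  moreover have "basis k = basis (\<mu>, 0) * e_elt \<beta>" by (simp add: k e_elt_def basis_mult)
  ultimately show "H (basis k) = G (basis k)" using assms by simp
qed

text \<open>
  The homomorphism with \<open>a\<^sub>j\<^sub>,\<^sub>-\<^sub>k \<mapsto> a\<^sub>j\<^sub>,\<^sub>-\<^sub>k +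
  S(j,k)\<close> and \<open>e\<^sup>\<beta> \<mapsto> g(\<beta>) e\<^sup>\<beta>\<close>, i.e. conjugation by
  the exponential of a combination of annihilation operators.
\<close>

definition shift_hom :: "(nat \<times> nat \<Rightarrow> ((key \<times> 'e::ab_group_add) \<Rightarrow>\<^sub>0 complex) fps) \<Rightarrow> (lat \<Rightarrow> ((key \<times> 'e) \<Rightarrow>\<^sub>0 complex) fps) \<Rightarrow> fock \<Rightarrow> ((key \<times> 'e) \<Rightarrow>\<^sub>0 complex) fps" where
  "shift_hom S g = lin_ext (\<lambda>(\<mu>, \<beta>). mon_prod (\<lambda>jk. emb (a_elt jk) + S jk) \<mu> * (emb (e_elt \<beta>) * g \<beta>))"

lemma A_linear_shift_hom: "A_linear (shift_hom S g)"
  unfolding shift_hom_def by (rule A_linear_lin_ext)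

definition mult_hom :: "(lat \<Rightarrow> 'a::monoid_mult) \<Rightarrow> bool" where
  "mult_hom g \<longleftrightarrow> g 0 = 1 \<and> (\<forall>\<beta> \<gamma>. g (\<beta> + \<gamma>) = g \<beta> * g \<gamma>)"

lemma e_elt_add: "e_elt (\<beta> + \<gamma>) = e_elt \<beta> * e_elt \<gamma>"
  by (simp add: e_elt_def basis_mult)

lemma e_elt_0 [simp]: "e_elt 0 = 1"
  by (simp add: e_elt_def basis_0 flip: zero_prod_def)

lemma shift_hom_mult: assumes "mult_hom g" shows "shift_hom S g (x * y) = shift_hom S g x * shift_hom S g y"
  unfolding shift_hom_def using assms
  by (intro lin_ext_mult) (auto simp: mon_prod_add mult_hom_def e_elt_add emb_mult mult_ac)

lemma shift_hom_1: assumes "mult_hom g" shows "shift_hom S g 1 = 1"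
proof -
  have "shift_hom S g (basis 0) = 1" unfolding shift_hom_def lin_ext_basis using assms by (simp add: zero_prod_def mult_hom_def)
  then show ?thesis by (simp add: basis_0)
qed

lemma shift_hom_a_elt: assumes "mult_hom g" shows "shift_hom S g (a_elt jk) = emb (a_elt jk) + S jk"
  proof -
  have "shift_hom S g (basis (Poly_Mapping.single jk 1, 0)) = emb (a_elt jk) + S jk"
    unfolding shift_hom_def lin_ext_basis using assms by (simp add: mon_prod_single[unfolded One_nat_def] mult_hom_def)
  then show ?thesis by (simp only: a_elt_def)
qed

lemma shift_hom_e_elt: "shift_hom S g (e_elt \<beta>) = emb (e_elt \<beta>) * g \<beta>"
proof -
  have "shift_hom S g (basis (0, \<beta>)) = emb (e_elt \<beta>) * g \<beta>" unfolding shift_hom_def lin_ext_basis by simp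
  then show ?thesis by (simp only: e_elt_def)
qed

lemma mult_hom_mult: "mult_hom g \<Longrightarrow> mult_hom h \<Longrightarrow> mult_hom (\<lambda>\<beta>. g \<beta> * h \<beta>)" for g :: "lat \<Rightarrow> 'a::comm_monoid_mult"
  by (auto simp: mult_hom_def mult_ac)

lemma mult_hom_1: "mult_hom (\<lambda>\<beta>. 1)"
  by (auto simp: mult_hom_def)

section \<open>Exponentials and substitution of power series\<close>

text \<open>
  Here the outer power series variable is \<open>v\<close>, the inner one is \<open>\<hbar>\<close>, and both
  have degree one; all exponentials below converge in this grading.
\<close>

definition in_filt :: "nat \<Rightarrow> 'a::zero fps fps \<Rightarrow> bool" where
  "in_filt N F \<longleftrightarrow> (\<forall>m p. m + p < N \<longrightarrow> F $ m $ p = 0)"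

lemma in_filt_0 [simp]: "in_filt N 0" by (simp add: in_filt_def)
lemma in_filt_le0 [simp]: "in_filt 0 F" by (simp add: in_filt_def)
lemma in_filt_add: "in_filt N F \<Longrightarrow> in_filt N G \<Longrightarrow> in_filt N (F + G)" for F :: "'a::ab_group_add fps fps" by (simp add: in_filt_def)
lemma in_filt_diff: "in_filt N F \<Longrightarrow> in_filt N G \<Longrightarrow> in_filt N (F - G)" for F :: "'a::ab_group_add fps fps" by (simp add: in_filt_def)
lemma in_filt_minus: "in_filt N F \<Longrightarrow> in_filt N (- F)" for F :: "'a::ab_group_add fps fps" by (simp add: in_filt_def)
lemma in_filt_sum: "(\<And>i. i \<in> A \<Longrightarrow> in_filt N (f i)) \<Longrightarrow> in_filt N (sum f A)" for f :: "'b \<Rightarrow> 'a::ab_group_add fps fps"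
  by (induction A rule: infinite_finite_induct) (auto intro: in_filt_add)
lemma in_filt_mono: "in_filt N F \<Longrightarrow> M \<le> N \<Longrightarrow> in_filt M F" by (simp add: in_filt_def)

lemma in_filt_mult: fixes F :: "'a::comm_ring_1 fps fps" assumes "in_filt M F" "in_filt N G" shows "in_filt (M + N) (F * G)"
  unfolding in_filt_def
proof (intro allI impI)
  fix m p assume mp: "m + p < M + N"
  have "F $ i $ q * G $ (m - i) $ (p - q) = 0" if "i \<le> m" "q \<le> p" for i q
  proof (cases "i + q < M")
    case True then show ?thesis using assms by (simp add: in_filt_def)
  next
    case False
    then have "(m - i) + (p - q) < N" using mp that by linarith
    then show ?thesis using assms by (simp add: in_filt_def)
  qed
  then show "(F * G) $ m $ p = 0" by (simp add: fps_mult_nth fps_sum_nth)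
qed

lemma in_filt_mult_left: fixes F :: "'a::comm_ring_1 fps fps" assumes "in_filt N G" shows "in_filt N (F * G)"
  using in_filt_mult[OF in_filt_le0[of F] assms] by simp

lemma in_filt_mult_right: fixes F :: "'a::comm_ring_1 fps fps" assumes "in_filt N F" shows "in_filt N (F * G)"
  using in_filt_mult_left[OF assms, of G] by (simp add: mult.commute)

lemma in_filt_power: fixes F :: "'a::comm_ring_1 fps fps" assumes "in_filt 1 F" shows "in_filt k (F ^ k)"
proof (induction k)
  case (Suc k) then show ?case using in_filt_mult[OF assms, of k "F ^ k"] by simp
qed simp

lemma in_filt_eqI: fixes F :: "'a::ab_group_add fps fps" assumes "\<And>N. in_filt N (F - G)" shows "F = G"
proof (intro fps_ext)
  fix m p show "F $ m $ p = G $ m $ p" using assms[of "Suc (m + p)"] by (simp add: in_filt_def)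
qed

lemma in_filt_trans: "in_filt N (F - G) \<Longrightarrow> in_filt N (G - H) \<Longrightarrow> in_filt N (F - H)" for F :: "'a::ab_group_add fps fps"
  using in_filt_add[of N "F - G" "G - H"] by simp
lemma in_filt_sym: "in_filt N (F - G) \<Longrightarrow> in_filt N (G - F)" for F :: "'a::ab_group_add fps fps"
  using in_filt_minus[of N "F - G"] by simp

lemma in_filt_const_scl_hb: "in_filt 1 (fps_const (scl (hb c)))"
  by (auto simp: in_filt_def hb_def)

lemma in_filt_X: "in_filt 1 (fps_X :: 'a::comm_ring_1 fps fps)"
  by (auto simp: in_filt_def)

text \<open>The Euler operator v d/dv + hbar d/dhbar. It is a derivation that multiplies degree d by
  d, so identities between exponentials become uniqueness statements for a first-order
  equation.\<close>

definition euler :: "('k::comm_monoid_add \<Rightarrow>\<^sub>0 complex) fps fps \<Rightarrow> ('k \<Rightarrow>\<^sub>0 complex) fps fps" where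
  "euler F = Abs_fps (\<lambda>m. Abs_fps (\<lambda>p. of_nat (m + p) * F $ m $ p))"

lemma euler_nth: "euler F $ m $ p = of_nat (m + p) * F $ m $ p" by (simp add: euler_def)

lemma euler_add: "euler (F + G) = euler F + euler G" by (intro fps_ext) (simp add: euler_nth distrib_left)
lemma euler_minus: "euler (- F) = - euler F" by (intro fps_ext) (simp add: euler_nth)
lemma euler_diff: "euler (F - G) = euler F - euler G" by (intro fps_ext) (simp add: euler_nth right_diff_distrib)
lemma euler_0 [simp]: "euler 0 = 0" by (intro fps_ext) (simp add: euler_nth)
lemma euler_1 [simp]: "euler 1 = 0"
proof (intro fps_ext)
  fix m p show "euler 1 $ m $ p = 0 $ m $ p" by (cases "m = 0"; cases "p = 0") (auto simp: euler_nth)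
qed
lemma euler_sum: "euler (sum f A) = (\<Sum>i\<in>A. euler (f i))"
  by (induction A rule: infinite_finite_induct) (auto simp: euler_add)

lemma euler_mult: "euler (F * G) = euler F * G + F * euler G"
proof (intro fps_ext)
  fix m p
  have "euler (F * G) $ m $ p = (\<Sum>i=0..m. \<Sum>q=0..p. of_nat (m + p) * (F $ i $ q * G $ (m - i) $ (p - q)))"
    by (simp add: euler_nth fps_mult_nth fps_sum_nth sum_distrib_left)
  also have "\<dots> = (\<Sum>i=0..m. \<Sum>q=0..p. of_nat (i + q) * F $ i $ q * G $ (m - i) $ (p - q)
     + F $ i $ q * (of_nat ((m - i) + (p - q)) * G $ (m - i) $ (p - q)))"
  proof (intro sum.cong refl)
    fix i q assume "i \<in> {0..m}" "q \<in> {0..p}"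
    then have "m + p = (i + q) + ((m - i) + (p - q))" by auto
    then have e: "(of_nat (m + p) :: 'a \<Rightarrow>\<^sub>0 complex) = of_nat (i + q) + of_nat ((m - i) + (p - q))" by (metis of_nat_add)
    show "of_nat (m + p) * (F $ i $ q * G $ (m - i) $ (p - q)) = of_nat (i + q) * F $ i $ q * G $ (m - i) $ (p - q)
     + F $ i $ q * (of_nat ((m - i) + (p - q)) * G $ (m - i) $ (p - q))"
      unfolding e by (simp only: distrib_right distrib_left mult_ac)
  qed
  also have "\<dots> = (euler F * G + F * euler G) $ m $ p"
    by (simp add: euler_nth fps_mult_nth fps_sum_nth sum.distrib mult.assoc del: of_nat_add)
  finally show "euler (F * G) $ m $ p = (euler F * G + F * euler G) $ m $ p" .
qed

definition cconst :: "complex \<Rightarrow> ('k::comm_monoid_add \<Rightarrow>\<^sub>0 complex) fps fps" where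
  "cconst c = fps_const (scl (fps_const c))"

lemma cconst_mult: "cconst (a * b) = cconst a * cconst b"
  by (simp add: cconst_def scl_mult flip: fps_const_mult)
lemma cconst_1 [simp]: "cconst 1 = 1" by (simp add: cconst_def)
lemma cconst_of_nat: "cconst (of_nat n) = of_nat n"
  unfolding cconst_def by (simp add: fps_of_nat scl_of_nat)
lemma cconst_fact: "cconst (1 / fact (Suc k)) * of_nat (Suc k) = cconst (1 / fact k)"
  unfolding cconst_of_nat[symmetric] cconst_mult[symmetric] by (simp del: of_nat_Suc)
lemma euler_cconst [simp]: "euler (cconst c) = 0"
  by (intro fps_ext) (auto simp: euler_nth cconst_def)

lemma euler_power: "euler (F ^ k) = of_nat k * F ^ (k - 1) * euler F"
proof (induction k)
  case (Suc k)
  then show ?case by (cases k) (auto simp: euler_mult algebra_simps)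
qed simp

lemma in_filt_euler: "in_filt N F \<Longrightarrow> in_filt N (euler F)" by (simp add: in_filt_def euler_nth)

definition EXP :: "('k::comm_monoid_add \<Rightarrow>\<^sub>0 complex) fps fps \<Rightarrow> ('k \<Rightarrow>\<^sub>0 complex) fps fps" where
  "EXP C = Abs_fps (\<lambda>m. hsum (\<lambda>k. scl (fps_const (1 / fact k)) * (C ^ k) $ m))"

definition EXP_trunc :: "nat \<Rightarrow> ('k::comm_monoid_add \<Rightarrow>\<^sub>0 complex) fps fps \<Rightarrow> ('k \<Rightarrow>\<^sub>0 complex) fps fps" where
  "EXP_trunc N C = (\<Sum>k<N. cconst (1 / fact k) * C ^ k)"

text \<open>As \<open>C\<close> starts in degree one, \<open>C ^ k\<close> starts in degree k; below
  degree \<open>N\<close> the truncation after \<open>N\<close> terms is therefore exact.\<close>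

lemma
  assumes "in_filt 1 C"
  shows hsummable_EXP: "hsummable (\<lambda>k. scl (fps_const (1 / fact k)) * (C ^ k) $ m)"
    and in_filt_EXP: "in_filt N (EXP C - EXP_trunc N C)"
proof -
  have z: "(scl (fps_const (1 / fact k)) * (C ^ k) $ m) $ p = 0" if "k \<notin> {..<N}" "m + p < N" for k m p N
  proof -
    have "(C ^ k) $ m $ p = 0" using in_filt_power[OF assms, of k] that by (auto simp: in_filt_def)
    then show ?thesis by (simp add: fps_scl_const_mult_nth)
  qed
  show "hsummable (\<lambda>k. scl (fps_const (1 / fact k)) * (C ^ k) $ m)"
  proof (rule hsummable_bounded)
    fix p show "\<exists>A. finite A \<and> (\<forall>i. i \<notin> A \<longrightarrow> (scl (fps_const (1 / fact i)) * (C ^ i) $ m) $ p = 0)"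
      using z[of _ "Suc (m + p)" m p] by (intro exI[of _ "{..<Suc (m + p)}"]) auto
  qed
  show "in_filt N (EXP C - EXP_trunc N C)"
    unfolding in_filt_def
  proof (intro allI impI)
    fix m p assume mp: "m + p < N"
    have "EXP C $ m $ p = (\<Sum>k\<in>{..<N}. (scl (fps_const (1 / fact k)) * (C ^ k) $ m) $ p)"
      unfolding EXP_def fps_nth_Abs_fps by (rule hsum_nth_finite) (use z mp in auto)
    also have "\<dots> = EXP_trunc N C $ m $ p" by (simp add: EXP_trunc_def fps_sum_nth cconst_def)
    finally show "(EXP C - EXP_trunc N C) $ m $ p = 0" by simp
  qed
qed

text \<open>Differentiation lowers the index of each term by one, so the truncation loses its last
  term; hence \<open>Suc N\<close> on one side and \<open>N\<close> on the other.\<close>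

lemma euler_EXP_trunc: "euler (EXP_trunc (Suc N) C) = euler C * EXP_trunc N C"
proof -
  have "euler (EXP_trunc (Suc N) C) = (\<Sum>k<Suc N. cconst (1 / fact k) * (of_nat k * C ^ (k - 1) * euler C))"
    by (simp only: EXP_trunc_def euler_sum euler_mult euler_power euler_cconst) simp
  also have "\<dots> = (\<Sum>k<N. cconst (1 / fact (Suc k)) * (of_nat (Suc k) * C ^ k * euler C))"
    by (subst sum.lessThan_Suc_shift) simp
  also have "\<dots> = (\<Sum>k<N. cconst (1 / fact k) * C ^ k * euler C)"
  proof (intro sum.cong refl)
    fix k
    show "cconst (1 / fact (Suc k)) * (of_nat (Suc k) * C ^ k * euler C) = cconst (1 / fact k) * C ^ k * euler C"
      by (simp only: mult.assoc[symmetric] cconst_fact)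
  qed
  finally show ?thesis by (simp only: EXP_trunc_def[of N] sum_distrib_left mult_ac)
qed

lemma euler_EXP: assumes "in_filt 1 C" shows "euler (EXP C) = euler C * EXP C"
proof (rule in_filt_eqI)
  fix N
  have "euler (EXP C) - euler C * EXP C = euler (EXP C - EXP_trunc (Suc N) C) - euler C * (EXP C - EXP_trunc N C)"
    by (simp add: euler_diff euler_EXP_trunc algebra_simps)
  moreover have "in_filt N (euler (EXP C - EXP_trunc (Suc N) C))"
    by (intro in_filt_euler in_filt_mono[OF in_filt_EXP[OF assms, of "Suc N"]]) simp
  moreover have "in_filt N (euler C * (EXP C - EXP_trunc N C))" by (intro in_filt_mult_left in_filt_EXP assms)
  ultimately show "in_filt N (euler (EXP C) - euler C * EXP C)" by (simp add: in_filt_diff)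
qed

text \<open>In degree d the Euler operator multiplies by d, whereas \<open>c\<close>, of positive
  degree, brings in only lower degrees. The difference of two solutions hence vanishes degree by
  degree once its constant term does.\<close>

lemma euler_unique:
  assumes "in_filt 1 c" "euler X = c * X" "euler Y = c * Y" "X $ 0 $ 0 = Y $ 0 $ 0" shows "X = Y"
proof (rule in_filt_eqI)
  fix N
  have D: "euler (X - Y) = c * (X - Y)" using assms by (simp add: euler_diff algebra_simps)
  show "in_filt N (X - Y)"
  proof (induction N)
    case (Suc N)
    have "in_filt (Suc N) (euler (X - Y))" unfolding D using in_filt_mult[OF assms(1) Suc] by simp
    then have *: "of_nat (m + p) * (X - Y) $ m $ p = 0" if "m + p < Suc N" for m p
      using that unfolding in_filt_def euler_nth by blast
    show ?case unfolding in_filt_def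
    proof (intro allI impI)
      fix m p assume mp: "m + p < Suc N"
      show "(X - Y) $ m $ p = 0"
      proof (cases "m + p = 0")
        case True then show ?thesis using assms(4) by simp
      next
        case False
        have "of_nat (m + p) * (X - Y) $ m $ p = Poly_Mapping.single 0 (of_nat (m + p)) * (X - Y) $ m $ p" by (simp del: of_nat_add)
        then have "of_nat (m + p) * Poly_Mapping.lookup ((X - Y) $ m $ p) l = 0" for l
          using *[OF mp] by (metis lookup_scale lookup_zero)
        then have "Poly_Mapping.lookup ((X - Y) $ m $ p) l = 0" for l
          using False by (metis mult_eq_0_iff of_nat_eq_0_iff)
        then show ?thesis by (intro poly_mapping_eqI) simp
      qed
    qed
  qed simp
qed

lemma EXP_00: assumes "in_filt 1 C" shows "EXP C $ 0 $ 0 = 1"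
  using in_filt_EXP[OF assms, of 1] by (simp add: in_filt_def EXP_trunc_def)

text \<open>Both sides solve the same Euler equation and have the same constant term; no double
  series has to be rearranged.\<close>

lemma EXP_add: assumes "in_filt 1 C" "in_filt 1 D" shows "EXP (C + D) = EXP C * EXP D"
proof (rule euler_unique)
  show "in_filt 1 (euler C + euler D)" using assms by (intro in_filt_add in_filt_euler)
  show "euler (EXP (C + D)) = (euler C + euler D) * EXP (C + D)"
    using euler_EXP[OF in_filt_add[OF assms]] by (simp add: euler_add)
  show "euler (EXP C * EXP D) = (euler C + euler D) * (EXP C * EXP D)"
    using assms by (simp add: euler_mult euler_EXP algebra_simps)
  show "EXP (C + D) $ 0 $ 0 = (EXP C * EXP D) $ 0 $ 0"
    using assms by (simp add: EXP_00 in_filt_add)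
qed

lemma EXP_0 [simp]: "EXP 0 = 1"
  by (rule euler_unique[of 0]) (simp_all add: euler_EXP EXP_00)

lemma EXP_minus: assumes "in_filt 1 C" shows "EXP (- C) * EXP C = 1" "EXP C * EXP (- C) = 1"
  using EXP_add[OF in_filt_minus[OF assms] assms] by (simp_all add: mult.commute)

lemma EXP_diff: assumes "in_filt 1 C" "in_filt 1 D" shows "EXP (C - D) = EXP C * EXP (- D)"
  using EXP_add[OF assms(1) in_filt_minus[OF assms(2)]] by simp

section \<open>Substitution of a series of positive degree for v\<close>

definition subst_v :: "('k::comm_monoid_add \<Rightarrow>\<^sub>0 complex) fps fps \<Rightarrow> ('k \<Rightarrow>\<^sub>0 complex) fps fps \<Rightarrow> ('k \<Rightarrow>\<^sub>0 complex) fps fps" where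
  "subst_v y F = Abs_fps (\<lambda>m. hsum (\<lambda>k. F $ k * (y ^ k) $ m))"

text \<open>Maps that are linear over series in hbar and never lower the degree. They are determined
  by the powers of v (\<open>filt_linear_eqI\<close>), which reduces every law of substitution to a
  law of powers.\<close>

definition filt_linear :: "(('k::comm_monoid_add \<Rightarrow>\<^sub>0 complex) fps fps \<Rightarrow> ('k \<Rightarrow>\<^sub>0 complex) fps fps) \<Rightarrow> bool" where
  "filt_linear T \<longleftrightarrow> (\<forall>F G. T (F + G) = T F + T G) \<and> (\<forall>c F. T (fps_const c * F) = fps_const c * T F) \<and> (\<forall>N F. in_filt N F \<longrightarrow> in_filt N (T F))"

lemma fps_decomp: "F = (\<Sum>k<N. fps_const (F $ k) * fps_X ^ k) + fps_X ^ N * fps_shift N F" for F :: "'a::comm_ring_1 fps"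
proof (rule fps_ext)
  fix m
  have "(\<Sum>k<N. (fps_const (F $ k) * fps_X ^ k) $ m) = (\<Sum>k<N. if k = m then F $ m else 0)"
    by (intro sum.cong) auto
  then show "F $ m = ((\<Sum>k<N. fps_const (F $ k) * fps_X ^ k) + fps_X ^ N * fps_shift N F) $ m"
    by (auto simp: fps_sum_nth fps_X_power_mult_nth)
qed

lemma in_filt_decomp: "in_filt N (F - (\<Sum>k<N. fps_const (F $ k) * fps_X ^ k))" for F :: "'a::comm_ring_1 fps fps"
proof -
  have "F - (\<Sum>k<N. fps_const (F $ k) * fps_X ^ k) = fps_shift N F * fps_X ^ N"
    by (subst (1) fps_decomp[of F N]) (simp add: mult.commute)
  then show ?thesis by (simp add: in_filt_mult_left in_filt_power[OF in_filt_X])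
qed

lemma filt_linear_sum: "filt_linear T \<Longrightarrow> T (sum f A) = (\<Sum>i\<in>A. T (f i))"
proof (induction A rule: infinite_finite_induct)
  case (infinite A)
  then have "T (0 + 0) = T 0 + T 0" unfolding filt_linear_def by blast
  then show ?case using infinite by simp
next
  case empty
  then have "T (0 + 0) = T 0 + T 0" unfolding filt_linear_def by blast
  then show ?case by simp
qed (auto simp: filt_linear_def)

lemma filt_linear_diff: assumes "filt_linear T" shows "T (F - G) = T F - T G"
proof -
  have "T ((F - G) + G) = T (F - G) + T G" using assms unfolding filt_linear_def by blast
  then show ?thesis by simp
qed

lemma filt_linear_eqI:
  assumes "filt_linear S" "filt_linear T" "\<And>k. S (fps_X ^ k) = T (fps_X ^ k)" shows "S F = T F"
proof (rule in_filt_eqI)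
  fix N
  let ?P = "\<Sum>k<N. fps_const (F $ k) * fps_X ^ k"
  have lin: "U ?P = (\<Sum>k<N. fps_const (F $ k) * U (fps_X ^ k))" if "filt_linear U" for U :: "('a \<Rightarrow>\<^sub>0 complex) fps fps \<Rightarrow> _"
    unfolding filt_linear_sum[OF that] using that by (simp add: filt_linear_def)
  have eq: "S ?P = T ?P" unfolding lin[OF assms(1)] lin[OF assms(2)] assms(3) ..
  have in_filt: "in_filt N (U F - U ?P)" if "filt_linear U" for U :: "('a \<Rightarrow>\<^sub>0 complex) fps fps \<Rightarrow> _"
    unfolding filt_linear_diff[OF that, symmetric] using that in_filt_decomp[of N F] by (simp add: filt_linear_def)
  show "in_filt N (S F - T F)"
    using in_filt_trans[OF in_filt[OF assms(1)], of "T F"] in_filt_sym[OF in_filt[OF assms(2)]] eq by simp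
qed

context
  fixes y :: "('k::comm_monoid_add \<Rightarrow>\<^sub>0 complex) fps fps"
  assumes y: "in_filt 1 y"
begin

lemma subst_v_z: assumes "in_filt N F" "m + p < k \<or> m + p < N" shows "(F $ k * (y ^ k) $ m) $ p = 0"
  unfolding fps_mult_nth[of "F $ k"]
proof (intro sum.neutral ballI)
  fix q assume q: "q \<in> {0..p}"
  show "F $ k $ q * (y ^ k) $ m $ (p - q) = 0"
  proof (cases "k + q < N")
    case True then show ?thesis using assms by (simp add: in_filt_def)
  next
    case False
    then have "m + (p - q) < k" using q assms(2) by auto
    then show ?thesis using in_filt_power[OF y, of k] by (simp add: in_filt_def)
  qed
qed

lemma hsummable_subst_v: "hsummable (\<lambda>k. F $ k * (y ^ k) $ m)"
proof (rule hsummable_bounded)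
  fix p show "\<exists>A. finite A \<and> (\<forall>k. k \<notin> A \<longrightarrow> (F $ k * (y ^ k) $ m) $ p = 0)"
    using subst_v_z[OF in_filt_le0, of m p] by (intro exI[of _ "{..m + p}"]) auto
qed

lemma in_filt_subst_v: assumes "in_filt N F" shows "in_filt N (subst_v y F)"
  unfolding in_filt_def subst_v_def fps_nth_Abs_fps
proof (intro allI impI)
  fix m p assume "m + p < N"
  then show "hsum (\<lambda>k. F $ k * (y ^ k) $ m) $ p = 0"
    using subst_v_z[OF assms, of m p] by (subst hsum_nth_finite[of "{}"]) auto
qed

lemma subst_v_add: "subst_v y (F + G) = subst_v y F + subst_v y G"
  by (rule fps_ext) (simp add: subst_v_def distrib_right hsum_add hsummable_subst_v)

lemma subst_v_const_mult: "subst_v y (fps_const c * F) = fps_const c * subst_v y F"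
proof (rule fps_ext)
  fix m
  show "subst_v y (fps_const c * F) $ m = (fps_const c * subst_v y F) $ m"
    using hsum_local_add[OF local_add_mult_left[of c] hsummable_subst_v[of F m]] by (simp add: subst_v_def mult.assoc)
qed

lemma filt_linear_subst_v: "filt_linear (subst_v y)"
  by (simp add: filt_linear_def subst_v_add subst_v_const_mult in_filt_subst_v)

lemma subst_v_X_power: "subst_v y (fps_X ^ n) = y ^ n"
proof (rule fps_ext)
  fix m
  have "hsum (\<lambda>k. (fps_X ^ n) $ k * (y ^ k) $ m) = (fps_X ^ n) $ n * (y ^ n) $ m"
    by (rule hsum_single) auto
  then show "subst_v y (fps_X ^ n) $ m = (y ^ n) $ m" by (simp add: subst_v_def)
qed

lemma subst_v_X: "subst_v y fps_X = y" using subst_v_X_power[of 1] by simp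
lemma subst_v_1: "subst_v y 1 = 1" using subst_v_X_power[of 0] by simp
lemma subst_v_const: "subst_v y (fps_const c) = fps_const c" using subst_v_const_mult[of c 1] by (simp add: subst_v_1)
lemma subst_v_diff: "subst_v y (F - G) = subst_v y F - subst_v y G" by (rule filt_linear_diff[OF filt_linear_subst_v])
lemma subst_v_0: "subst_v y 0 = 0" using subst_v_diff[of 0 0] by simp
lemma subst_v_minus: "subst_v y (- G) = - subst_v y G" using subst_v_diff[of 0 G] by (simp add: subst_v_0)
lemma subst_v_sum: "subst_v y (sum f A) = (\<Sum>i\<in>A. subst_v y (f i))" by (rule filt_linear_sum[OF filt_linear_subst_v])

lemma subst_v_Xn_mult: "subst_v y (fps_X ^ n * G) = y ^ n * subst_v y G"
proof (rule filt_linear_eqI[of "\<lambda>G. subst_v y (fps_X ^ n * G)"])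
  show "filt_linear (\<lambda>G. subst_v y (fps_X ^ n * G))"
    unfolding filt_linear_def by (auto simp: distrib_left subst_v_add in_filt_subst_v in_filt_mult_left mult.left_commute[of _ "fps_const _"] subst_v_const_mult)
  show "filt_linear (\<lambda>G. y ^ n * subst_v y G)"
    unfolding filt_linear_def by (auto simp: distrib_left subst_v_add in_filt_subst_v in_filt_mult_left mult.left_commute[of _ "fps_const _"] subst_v_const_mult)
qed (simp add: subst_v_X_power power_add[symmetric])

lemma subst_v_mult: "subst_v y (F * G) = subst_v y F * subst_v y G"
proof (rule filt_linear_eqI[of "\<lambda>F. subst_v y (F * G)"])
  show "filt_linear (\<lambda>F. subst_v y (F * G))"
    unfolding filt_linear_def by (auto simp: distrib_right subst_v_add mult.assoc subst_v_const_mult intro!: in_filt_subst_v in_filt_mult_right)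
  show "filt_linear (\<lambda>F. subst_v y F * subst_v y G)"
    unfolding filt_linear_def by (auto simp: distrib_right subst_v_add mult.assoc subst_v_const_mult intro!: in_filt_subst_v in_filt_mult_right)
qed (simp add: subst_v_X_power subst_v_Xn_mult)

lemma subst_v_power: "subst_v y (F ^ n) = subst_v y F ^ n"
  by (induction n) (auto simp: subst_v_1 subst_v_mult)

lemma subst_v_EXP: assumes "in_filt 1 C" shows "subst_v y (EXP C) = EXP (subst_v y C)"
proof (rule in_filt_eqI)
  fix N
  have "subst_v y (EXP_trunc N C) = EXP_trunc N (subst_v y C)"
    by (simp add: EXP_trunc_def cconst_def subst_v_sum subst_v_const_mult subst_v_power)
  then have "in_filt N (subst_v y (EXP C) - EXP_trunc N (subst_v y C))"
    using in_filt_subst_v[OF in_filt_EXP[OF assms, of N]] by (simp add: subst_v_diff)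
  then show "in_filt N (subst_v y (EXP C) - EXP (subst_v y C))"
    using in_filt_sym[OF in_filt_EXP[OF in_filt_subst_v[OF assms]]] in_filt_trans by blast
qed

lemma subst_v_subst_v: assumes "in_filt 1 z" shows "subst_v y (subst_v z F) = subst_v (subst_v y z) F"
proof (rule filt_linear_eqI[of "\<lambda>F. subst_v y (subst_v z F)"])
  have z: "filt_linear (subst_v z)"
    using Submission.filt_linear_subst_v[OF assms] .
  show "filt_linear (\<lambda>F. subst_v y (subst_v z F))" using filt_linear_subst_v z by (simp add: filt_linear_def)
  show "filt_linear (subst_v (subst_v y z))" by (rule Submission.filt_linear_subst_v[OF in_filt_subst_v[OF assms]])
qed (simp add: Submission.subst_v_X_power[OF assms] subst_v_power Submission.subst_v_X_power[OF in_filt_subst_v[OF assms]])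

end

definition v_plus :: "complex \<Rightarrow> ('k::comm_monoid_add \<Rightarrow>\<^sub>0 complex) fps fps" where
  "v_plus c = fps_X + fps_const (scl (hb c))"

lemma hb_add: "hb (c + d) = hb c + hb d"
  by (simp add: hb_def distrib_right flip: fps_const_add)
lemma hb_minus: "hb (- c) = - hb c"
  by (simp add: hb_def flip: fps_const_neg)
lemma hb_diff: "hb (c - d) = hb c - hb d"
  using hb_add[of c "- d"] by (simp add: hb_minus)
lemma hb_0 [simp]: "hb 0 = 0" by (simp add: hb_def)

lemma in_filt_v_plus: "in_filt 1 (v_plus c)" unfolding v_plus_def by (intro in_filt_add in_filt_X in_filt_const_scl_hb)

lemma subst_v_v_plus: "subst_v (v_plus d) (v_plus c) = v_plus (c + d)"
  unfolding v_plus_def[of c] subst_v_add[OF in_filt_v_plus] subst_v_X[OF in_filt_v_plus] subst_v_const[OF in_filt_v_plus]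
  by (simp add: v_plus_def hb_add scl_add algebra_simps flip: fps_const_add)

lemma v_plus_power: "(v_plus c ^ k) $ m = scl (pw (hb c) (int k) (int m))"
proof (induction k arbitrary: m)
  case 0 then show ?case by (simp add: pw_0)
next
  case (Suc k)
  have e: "pw (hb c) (int (Suc k)) (int m) = pw (hb c) (int k) (int m - 1) + hb c * pw (hb c) (int k) (int m)"
    using pw_Pascal[of "hb c" "int k" "int m"] by (simp add: add.commute)
  show ?case
  proof (cases m)
    case 0
    then show ?thesis unfolding power_Suc v_plus_def[of c] distrib_right unfolding v_plus_def[symmetric] e
      using Suc[of 0] by (simp add: scl_mult pw_nonneg_eq_0)
  next
    case (Suc m')
    then show ?thesis unfolding power_Suc v_plus_def[of c] distrib_right unfolding v_plus_def[symmetric] e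
      using Suc.IH by (simp add: scl_mult scl_add)
  qed
qed

text \<open>The series -log (1 - v). Its constant term is absent because \<open>1 / of_nat 0\<close>
  is 0.\<close>

definition log_ser :: "('k::comm_monoid_add \<Rightarrow>\<^sub>0 complex) fps fps" where
  "log_ser = Abs_fps (\<lambda>k. scl (fps_const (1 / of_nat k)))"

lemma in_filt_log_ser: "in_filt 1 log_ser" by (auto simp: in_filt_def log_ser_def)

text \<open>The Euler operator sends \<open>log_ser\<close> to v + v^2 + ... = v/(1 - v), so 1 - v
  satisfies the equation that characterizes the exponential.\<close>

lemma EXP_log_ser: "EXP (- log_ser) = (1 - fps_X :: ('k::comm_monoid_add \<Rightarrow>\<^sub>0 complex) fps fps)"
proof -
  let ?L = "log_ser :: ('k::comm_monoid_add \<Rightarrow>\<^sub>0 complex) fps fps" and ?X = "fps_X :: ('k::comm_monoid_add \<Rightarrow>\<^sub>0 complex) fps fps"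
  show ?thesis
  proof (rule euler_unique)
  show "in_filt 1 (- euler ?L)" by (intro in_filt_minus in_filt_euler in_filt_log_ser)
  show "euler (EXP (- ?L)) = - euler ?L * EXP (- ?L)"
    unfolding euler_EXP[OF in_filt_minus[OF in_filt_log_ser]] by (simp only: euler_minus)
  have 1: "euler ?L $ m = (if m = 0 then 0 else 1)" for m
    by (rule fps_ext) (auto simp: euler_nth log_ser_def mult_single simp flip: single_of_nat single_one)
  have 2: "euler ?X = fps_X"
  proof (intro fps_ext)
    fix m p show "euler ?X $ m $ p = fps_X $ m $ p" by (cases "m = 1"; cases "p = 0") (auto simp: euler_nth)
  qed
  have "euler ?L * (1 - fps_X) = (fps_X :: ('k::comm_monoid_add \<Rightarrow>\<^sub>0 complex) fps fps)"
    by (rule fps_ext) (auto simp: right_diff_distrib 1 fps_X_nth)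
  then show "euler (1 - ?X) = - euler ?L * (1 - fps_X)" by (simp add: euler_diff 2)
  show "EXP (- ?L) $ 0 $ 0 = (1 - ?X) $ 0 $ 0" using EXP_00[OF in_filt_minus[OF in_filt_log_ser]] by simp
  qed
qed

lemma EXP_subst_v_log_ser: assumes "in_filt 1 y" shows "EXP (- subst_v y log_ser) = 1 - y"
  using subst_v_EXP[OF assms in_filt_minus[OF in_filt_log_ser]] by (simp add: EXP_log_ser subst_v_minus[OF assms] subst_v_diff[OF assms] subst_v_1[OF assms] subst_v_X[OF assms])

section \<open>Ring homomorphisms applied to coefficients\<close>

definition fps_map :: "('a \<Rightarrow> 'b) \<Rightarrow> 'a fps \<Rightarrow> 'b fps" where "fps_map s F = Abs_fps (\<lambda>n. s (F $ n))"

lemma fps_map_nth [simp]: "fps_map s F $ n = s (F $ n)" by (simp add: fps_map_def)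

context
  fixes s :: "('k::comm_monoid_add \<Rightarrow>\<^sub>0 complex) fps \<Rightarrow> ('l::comm_monoid_add \<Rightarrow>\<^sub>0 complex) fps"
  assumes al: "A_linear s" and mu: "\<And>x y. s (x * y) = s x * s y" and s1: "s 1 = 1"
begin

lemma hom_scl: "s (scl f) = scl f" using A_linear_scl[OF al, of f 1] by (simp add: s1)

lemma fps_map_add: "fps_map s (F + G) = fps_map s F + fps_map s G" by (rule fps_ext) (simp add: A_linear_add[OF al])
lemma fps_map_diff: "fps_map s (F - G) = fps_map s F - fps_map s G" by (rule fps_ext) (simp add: A_linear_diff[OF al])
lemma fps_map_minus: "fps_map s (- F) = - fps_map s F" by (rule fps_ext) (simp add: A_linear_minus[OF al])
lemma fps_map_sum: "fps_map s (sum f A) = (\<Sum>i\<in>A. fps_map s (f i))"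
  by (rule fps_ext) (simp add: fps_sum_nth A_linear_sum[OF al])
lemma fps_map_mult: "fps_map s (F * G) = fps_map s F * fps_map s G"
  by (rule fps_ext) (simp add: fps_mult_nth A_linear_sum[OF al] mu)
lemma fps_map_1: "fps_map s 1 = 1" by (rule fps_ext) (simp add: s1 A_linear_0[OF al])
lemma fps_map_power: "fps_map s (F ^ n) = fps_map s F ^ n" by (induction n) (auto simp: fps_map_1 fps_map_mult)
lemma fps_map_const: "fps_map s (fps_const c) = fps_const (s c)" by (rule fps_ext) (simp add: A_linear_0[OF al])
lemma fps_map_v_plus: "fps_map s (v_plus c) = v_plus c" 
  unfolding v_plus_def fps_map_add fps_map_const hom_scl by (simp add: fps_eq_iff fps_X_def s1 A_linear_0[OF al])

lemma in_filt_fps_map: "in_filt N F \<Longrightarrow> in_filt N (fps_map s F)"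
  unfolding in_filt_def
proof (intro allI impI)
  fix m p assume "\<forall>m p. m + p < N \<longrightarrow> F $ m $ p = 0" "m + p < N"
  then have "F $ m $ q = 0 $ q" if "q \<le> p" for q using that by simp
  then have "s (F $ m) $ p = s 0 $ p" by (rule A_linear_local[OF al])
  then show "fps_map s F $ m $ p = 0" by (simp add: A_linear_0[OF al])
qed

lemma fps_map_EXP: assumes "in_filt 1 C" shows "fps_map s (EXP C) = EXP (fps_map s C)"
proof (rule fps_ext)
  fix m
  show "fps_map s (EXP C) $ m = EXP (fps_map s C) $ m"
    unfolding EXP_def fps_nth_Abs_fps fps_map_nth A_linear_hsum[OF al hsummable_EXP[OF assms]]
    by (simp add: A_linear_scl[OF al] flip: fps_map_power)
qed

lemma fps_map_subst_v: assumes "in_filt 1 y" shows "fps_map s (subst_v y F) = subst_v (fps_map s y) (fps_map s F)"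
proof (rule fps_ext)
  fix m
  show "fps_map s (subst_v y F) $ m = subst_v (fps_map s y) (fps_map s F) $ m"
    unfolding subst_v_def fps_nth_Abs_fps fps_map_nth A_linear_hsum[OF al hsummable_subst_v[OF assms]]
    by (simp add: mu flip: fps_map_power)
qed

end

section \<open>Linear factors and their logarithms\<close>

type_synonym laurent = "((key \<times> int) \<Rightarrow>\<^sub>0 complex) fps"

text \<open>The factor u - v + e hbar, with v as the outer variable and u inside the coefficients.
  This asymmetry fixes the region: \<open>lin_fac_inv\<close> is the expansion for |u| >
  |v|.\<close>

definition lin_fac :: "complex \<Rightarrow> laurent fps" where "lin_fac e = fps_const (lin_pow e 1) - fps_X"
definition lin_fac_inv :: "complex \<Rightarrow> laurent fps" where "lin_fac_inv e = Abs_fps (\<lambda>k. lin_pow e (- int k - 1))"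

lemma lin_fac_inv: "lin_fac e * lin_fac_inv e = 1"
proof (rule fps_ext)
  fix k
  have 1: "lin_pow e 1 * lin_pow e (- int k - 1) = (lin_pow e (- int k) :: laurent)" by (simp add: lin_pow_add[symmetric])
  have 2: "lin_pow e (- int n - 1) = (lin_pow e (- int (Suc n)) :: laurent)" for n by (rule arg_cong[of _ _ "lin_pow e"]) simp
  show "(lin_fac e * lin_fac_inv e) $ k = 1 $ k"
    using 1 by (cases k) (simp_all only: lin_fac_def lin_fac_inv_def left_diff_distrib 2 fps_sub_nth fps_mult_fps_X_commute fps_mult_left_const_nth fps_nth_Abs_fps,
      simp_all add: lin_pow_0)
qed

lemma lin_pow_minus_v_plus: "fps_const (lin_pow c 1) - v_plus d = lin_fac (c - d)"
proof -
  have e: "scl (hb (c - d)) = (scl (hb c) - scl (hb d) :: laurent)" by (simp add: hb_diff scl_diff)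
  show ?thesis unfolding lin_fac_def v_plus_def lin_pow_1 e by (simp add: algebra_simps flip: fps_const_add fps_const_sub)
qed

text \<open>The logarithm \<open>- log (1 - (v + d\<hbar>)/(u + c\<hbar>))\<close>.\<close>

definition log_fac :: "complex \<Rightarrow> complex \<Rightarrow> laurent fps" where
  "log_fac c d = subst_v (fps_const (lin_pow c (-1)) * v_plus d) log_ser"

lemma in_filt_log_fac: "in_filt 1 (log_fac c d)"
  unfolding log_fac_def by (intro in_filt_subst_v in_filt_mult_left in_filt_v_plus in_filt_log_ser)

lemma EXP_log_fac_minus: "EXP (- log_fac c d) = fps_const (lin_pow c (-1)) * lin_fac (c - d)"
proof -
  have "EXP (- log_fac c d) = 1 - fps_const (lin_pow c (-1)) * v_plus d"
    unfolding log_fac_def by (intro EXP_subst_v_log_ser in_filt_mult_left in_filt_v_plus)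
  also have "\<dots> = fps_const (lin_pow c (-1)) * (fps_const (lin_pow c 1) - v_plus d)"
    using lin_pow_inv(2)[of c 1] by (simp add: right_diff_distrib)
  finally show ?thesis by (simp add: lin_pow_minus_v_plus)
qed

lemma EXP_log_fac: "EXP (log_fac c d) = fps_const (lin_pow c 1) * lin_fac_inv (c - d)"
proof -
  have 1: "(fps_const (lin_pow c (-1)) * lin_fac (c - d)) * (fps_const (lin_pow c 1) * lin_fac_inv (c - d)) = 1"
    using lin_fac_inv[of "c - d"] lin_pow_inv(2)[of c 1] by (metis (no_types, lifting) fps_const_1_eq_1 fps_const_mult mult.assoc mult.left_commute mult.right_neutral)
  have "EXP (log_fac c d) = EXP (log_fac c d) * (EXP (- log_fac c d) * (fps_const (lin_pow c 1) * lin_fac_inv (c - d)))"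
    unfolding EXP_log_fac_minus 1 by simp
  also have "\<dots> = fps_const (lin_pow c 1) * lin_fac_inv (c - d)"
    unfolding mult.assoc[symmetric] EXP_minus(2)[OF in_filt_log_fac] by simp
  finally show ?thesis .
qed

section \<open>Vertex operators as fields\<close>

lemma A_linear_eqI_supp:
  assumes "A_linear S" "A_linear T" "\<And>k. k \<in> A \<Longrightarrow> S (basis k) = T (basis k)" "supp_in A x" shows "S x = T x"
proof (rule fps_ext)
  fix p
  have "S (trunc p x) = T (trunc p x)"
    unfolding A_linear_trunc_expand[OF assms(1)] A_linear_trunc_expand[OF assms(2)]
    by (intro sum.cong refl arg_cong2[of _ _ _ _ "(*)"] assms(3)) (use assms(4) in \<open>auto simp: supp_in_def\<close>)
  then show "S x $ p = T x $ p" by (simp only: A_linear_trunc[OF assms(1), of x] A_linear_trunc[OF assms(2), of x])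
qed

text \<open>The term of index 0 vanishes by \<open>1 / of_nat 0 = 0\<close>, and the case
  \<open>j = 0\<close> agrees with \<open>boson 0 = 0\<close>. Arguments u + c hbar are obtained
  afterwards by substitution.\<close>

definition cre_gen :: "nat \<Rightarrow> fock fps" where
  "cre_gen j = Abs_fps (\<lambda>k. if j = 0 then 0 else scl (fps_const (1 / of_nat k)) * a_elt (j, k))"
definition cre_ser :: "nat \<Rightarrow> complex \<Rightarrow> fock fps" where "cre_ser j c = subst_v (v_plus c) (cre_gen j)"
definition to_ser :: "'a::zero fps \<Rightarrow> int \<Rightarrow> 'a" where "to_ser F m = (if 0 \<le> m then F $ nat m else 0)"

lemma in_filt_cre_gen: "in_filt 1 (cre_gen j)"
  by (auto simp: in_filt_def cre_gen_def)
lemma in_filt_cre_ser: "in_filt 1 (cre_ser j c)"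
  unfolding cre_ser_def by (intro in_filt_subst_v in_filt_v_plus in_filt_cre_gen)

definition mult_op :: "fock fps \<Rightarrow> opser" where "mult_op F m x = to_ser F m * x"

lemma mult_op_add: "mult_op F + mult_op G = mult_op (F + G)"
  by (intro ext) (auto simp: mult_op_def to_ser_def distrib_right)
lemma mult_op_minus: "- mult_op F = mult_op (- F)"
  by (intro ext) (auto simp: mult_op_def to_ser_def)
lemma mult_op_diff: "mult_op F - mult_op G = mult_op (F - G)"
  by (intro ext) (auto simp: mult_op_def to_ser_def left_diff_distrib)
lemma mult_op_0: "0 = mult_op 0"
  by (intro ext) (auto simp: mult_op_def to_ser_def)
lemma mult_op_sum: "(\<Sum>i\<in>A. mult_op (f i)) = mult_op (sum f A)"
  by (induction A rule: infinite_finite_induct) (auto simp: mult_op_add mult_op_0[symmetric])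

lemma boson_neg: "0 < k \<Longrightarrow> boson j (- int k) x = (if j = 0 then 0 else a_elt (j, k) * x)"
  by (simp add: boson_def a_elt_def basis_def)

text \<open>Creation operators are multiplications, and positive powers of u + c hbar contain no
  negative powers of u, so the operator series is multiplication by an ordinary power
  series.\<close>

lemma cre_eq: "cre j c = mult_op (cre_ser j c)"
proof (intro ext)
  fix m x
  have "cre j c m x = hsum (\<lambda>k. (cre_gen j $ k * scl (pw (hb c) (int k) m)) * x)"
    unfolding cre_def
    by (rule arg_cong[of _ _ hsum]) (auto simp: fun_eq_iff cre_gen_def boson_neg scl_mult mult_ac)
  also have "\<dots> = mult_op (cre_ser j c) m x"
  proof (cases "0 \<le> m")
    case True
    then have "hsum (\<lambda>k. (cre_gen j $ k * scl (pw (hb c) (int k) m)) * x) = hsum (\<lambda>k. cre_gen j $ k * (v_plus c ^ k) $ nat m) * x"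
      by (subst hsum_local_add[OF local_add_mult_right hsummable_subst_v[OF in_filt_v_plus]]) (simp add: v_plus_power)
    then show ?thesis using True by (simp add: mult_op_def cre_ser_def subst_v_def to_ser_def)
  next
    case False then show ?thesis by (simp add: pw_nonneg_eq_0 mult_op_def to_ser_def)
  qed
  finally show "cre j c m x = mult_op (cre_ser j c) m x" .
qed

lemma mult_op_op_mult: "mult_op F \<diamondop> mult_op G = mult_op (F * G)"
proof (intro ext)
  fix m x
  show "(mult_op F \<diamondop> mult_op G) m x = mult_op (F * G) m x"
  proof (cases "0 \<le> m")
    case True
    have "(mult_op F \<diamondop> mult_op G) m x = (\<Sum>i\<in>{0..m}. mult_op F i (mult_op G (m - i) x))"
      unfolding op_mult_def by (rule hsum_finite) (auto simp: mult_op_def to_ser_def)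
    also have "\<dots> = (\<Sum>i=0..nat m. F $ i * G $ (nat m - i)) * x"
      unfolding sum_distrib_right
      by (rule sum.reindex_bij_witness[of _ int nat]) (use True in \<open>auto simp: mult_op_def to_ser_def mult.assoc nat_diff_distrib\<close>)
    finally show ?thesis using True by (simp add: mult_op_def to_ser_def fps_mult_nth)
  next
    case False
    then have "(mult_op F \<diamondop> mult_op G) m x = 0"
      unfolding op_mult_def by (subst hsum_finite[of "{}"]) (auto simp: mult_op_def to_ser_def)
    then show ?thesis using False by (simp add: mult_op_def to_ser_def)
  qed
qed

lemma mult_op_1: "op_const id = mult_op 1"
  by (intro ext) (auto simp: op_const_def mult_op_def to_ser_def)

lemma mult_op_op_power: "(((\<diamondop>) (mult_op C)) ^^ k) (op_const id) = mult_op (C ^ k)"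
proof (induction k)
  case 0 show ?case unfolding funpow.simps power_0 mult_op_1[symmetric] by (rule id_apply)
qed (simp only: funpow.simps o_apply power_Suc mult_op_op_mult)

lemma op_exp_mult_op: assumes "in_filt 1 C" shows "op_exp (mult_op C) = mult_op (EXP C)"
proof (intro ext)
  fix m x
  show "op_exp (mult_op C) m x = mult_op (EXP C) m x"
    unfolding op_exp_def mult_op_op_power
  proof (cases "0 \<le> m")
    case True
    have "mult_op (EXP C) m x = hsum (\<lambda>k. scl (fps_const (1 / fact k)) * (C ^ k) $ nat m * x)"
      using True hsum_local_add[OF local_add_mult_right[of x] hsummable_EXP[OF assms, of "nat m"]] by (simp add: mult_op_def to_ser_def EXP_def)
    then show "hsum (\<lambda>k. scl (fps_const (1 / fact k)) * mult_op (C ^ k) m x) = mult_op (EXP C) m x"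
      using True by (simp add: mult_op_def to_ser_def mult.assoc)
  qed (simp add: mult_op_def to_ser_def)
qed

section \<open>Annihilation operators as derivations and their exponentials as shifts\<close>

definition deriv_by :: "(nat \<times> nat \<Rightarrow> laurent) \<Rightarrow> fock \<Rightarrow> laurent" where
  "deriv_by S = lin_ext (\<lambda>(\<mu>, \<beta>). \<Sum>jk\<in>Poly_Mapping.keys \<mu>. scl (fps_const (of_nat (Poly_Mapping.lookup \<mu> jk))) * (S jk * basis ((\<mu> - Poly_Mapping.single jk 1, \<beta>), 0)))"

lemma A_linear_deriv_by: "A_linear (deriv_by S)" unfolding deriv_by_def by (rule A_linear_lin_ext)

lemma deriv_by_basis: "finite K \<Longrightarrow> Poly_Mapping.keys \<mu> \<subseteq> K \<Longrightarrow> deriv_by S (basis (\<mu>, \<beta>)) = (\<Sum>jk\<in>K. scl (fps_const (of_nat (Poly_Mapping.lookup \<mu> jk))) * (S jk * basis ((\<mu> - Poly_Mapping.single jk 1, \<beta>), 0)))"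
  unfolding deriv_by_def by (simp, intro sum.mono_neutral_left) (auto simp: in_keys_iff)

lemma deriv_by_diff: "deriv_by (\<lambda>jk. S jk - T jk) x = deriv_by S x - deriv_by T x"
proof (rule A_linear_eqI[of "deriv_by (\<lambda>jk. S jk - T jk)"])
  fix k :: key show "deriv_by (\<lambda>jk. S jk - T jk) (basis k) = deriv_by S (basis k) - deriv_by T (basis k)"
    by (cases k) (simp add: deriv_by_basis[OF _ order_refl] sum_subtractf algebra_simps)
qed (auto intro!: A_linear_deriv_by A_linear_minus2)

lemma deriv_by_uminus: "deriv_by (\<lambda>jk. - S jk) x = - deriv_by S x"
proof (rule A_linear_eqI[of "deriv_by (\<lambda>jk. - S jk)"])
  fix k :: key show "deriv_by (\<lambda>jk. - S jk) (basis k) = - deriv_by S (basis k)"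
    by (cases k) (simp add: deriv_by_basis[OF _ order_refl] sum_negf)
qed (auto intro!: A_linear_deriv_by A_linear_uminus)

definition scalar_ser :: "laurent \<Rightarrow> bool" where "scalar_ser s \<longleftrightarrow> supp_in ({0} \<times> UNIV) s"

lemma scalar_ser_lin_pow: "scalar_ser (lin_pow c k)" by (simp add: scalar_ser_def supp_in_def lin_pow_def)
lemma scalar_ser_0: "scalar_ser 0" by (simp add: scalar_ser_def)
lemma scalar_ser_uminus: "scalar_ser s \<Longrightarrow> scalar_ser (- s)" by (simp add: scalar_ser_def supp_in_uminus)
lemma scalar_ser_diff: "scalar_ser s \<Longrightarrow> scalar_ser t \<Longrightarrow> scalar_ser (s - t)" by (simp add: scalar_ser_def supp_in_diff)
lemma scalar_ser_mult: "scalar_ser s \<Longrightarrow> scalar_ser t \<Longrightarrow> scalar_ser (s * t)" 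
  unfolding scalar_ser_def by (rule supp_in_mult) auto
lemma scalar_ser_scl: "scalar_ser s \<Longrightarrow> scalar_ser (scl f * s)" by (simp add: scalar_ser_def supp_in_scl)

lemma A_linear_ext_ser: "A_linear (ext_ser S)" unfolding ext_ser_def by (rule A_linear_lin_ext)

lemma ext_ser_basis_mult: "ext_ser S (basis (0, i) * r) = basis (0, i) * ext_ser S r"
proof (rule A_linear_eqI[of "\<lambda>r. ext_ser S (basis (0, i) * r)"])
  fix k :: "'a \<times> 'b" show "ext_ser S (basis (0, i) * basis k) = basis (0, i) * ext_ser S (basis k)"
    by (cases k) (simp add: basis_mult ext_ser_def, simp add: basis_mult[of "(0, _)" "(0, _)", simplified, symmetric] mult_ac)
qed (auto intro!: A_linear_comp[OF A_linear_ext_ser] A_linear_mult_left A_linear_id A_linear_ext_ser)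

lemma ext_ser_scalar_ser: assumes "scalar_ser s" shows "ext_ser S (s * r) = s * ext_ser S r"
proof (rule A_linear_eqI_supp[of "\<lambda>s. ext_ser S (s * r)"])
  show "supp_in ({0} \<times> UNIV) s" using assms by (simp add: scalar_ser_def)
qed (auto intro!: A_linear_comp[OF A_linear_ext_ser] A_linear_mult_right A_linear_id simp: ext_ser_basis_mult)

lemma ext_ser_emb: assumes "A_linear S" shows "ext_ser S (emb x) = S x"
proof (rule A_linear_eqI[of "\<lambda>x. ext_ser S (emb x)"])
  fix k show "ext_ser S (emb (basis k)) = S (basis k)" by (simp add: ext_ser_def basis_0 flip: zero_prod_def)
qed (intro A_linear_comp[OF A_linear_ext_ser] A_linear_emb assms)+

text \<open>Leibniz rule for one generator: \<open>deriv_by S\<close> is the derivation that sends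
  a_(j,-k) to \<open>S (j, k)\<close> and every e^beta to 0.\<close>

lemma ext_ser_deriv_by_a_elt: "ext_ser (deriv_by S) (emb (a_elt a) * r) = emb (a_elt a) * ext_ser (deriv_by S) r + S a * r"
proof (rule A_linear_eqI[of "\<lambda>r. ext_ser (deriv_by S) (emb (a_elt a) * r)"])
  fix k :: "key \<times> int" obtain \<mu> \<beta> i where k: "k = ((\<mu>, \<beta>), i)" by (metis prod.exhaust)
  let ?d = "Poly_Mapping.single a (1::nat)"
  let ?K = "insert a (Poly_Mapping.keys \<mu>)"
  have "deriv_by S (basis (?d + \<mu>, \<beta>)) = (\<Sum>jk\<in>?K. scl (fps_const (of_nat (Poly_Mapping.lookup (?d + \<mu>) jk))) * (S jk * basis ((?d + \<mu> - Poly_Mapping.single jk 1, \<beta>), 0)))"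
    by (rule deriv_by_basis) (auto simp: in_keys_iff lookup_add lookup_single when_def split: if_splits)
  also have "\<dots> = (\<Sum>jk\<in>?K. emb (a_elt a) * (scl (fps_const (of_nat (Poly_Mapping.lookup \<mu> jk))) * (S jk * basis ((\<mu> - Poly_Mapping.single jk 1, \<beta>), 0)))
      + (if jk = a then S a * basis ((\<mu>, \<beta>), 0) else 0))"
  proof (intro sum.cong refl)
    fix jk
    have 1: "scl (fps_const (of_nat (Poly_Mapping.lookup \<mu> jk))) * (S jk * basis ((?d + \<mu> - Poly_Mapping.single jk 1, \<beta>), 0))
      = emb (a_elt a) * (scl (fps_const (of_nat (Poly_Mapping.lookup \<mu> jk))) * (S jk * basis ((\<mu> - Poly_Mapping.single jk 1, \<beta>), 0)))"
    \<comment> \<open>Subtraction of exponents is truncated, so for exponent 0 the two monomials may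
      differ; the coefficient is 0 in that case.\<close>
    proof (cases "Poly_Mapping.lookup \<mu> jk = 0")
      case False
      then have "?d + \<mu> - Poly_Mapping.single jk 1 = ?d + (\<mu> - Poly_Mapping.single jk 1)"
        by (intro poly_mapping_eqI) (auto simp: lookup_add lookup_minus lookup_single when_def)
      then have "(basis ((?d + \<mu> - Poly_Mapping.single jk 1, \<beta>), 0) :: laurent) = emb (a_elt a) * basis ((\<mu> - Poly_Mapping.single jk 1, \<beta>), 0)"
        by (simp add: a_elt_def basis_mult)
      then show ?thesis by (simp only: mult_ac)
    qed simp
    have 2: "?d + \<mu> - Poly_Mapping.single a 1 = \<mu>" by simp
    show "scl (fps_const (of_nat (Poly_Mapping.lookup (?d + \<mu>) jk))) * (S jk * basis ((?d + \<mu> - Poly_Mapping.single jk 1, \<beta>), 0)) =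
      emb (a_elt a) * (scl (fps_const (of_nat (Poly_Mapping.lookup \<mu> jk))) * (S jk * basis ((\<mu> - Poly_Mapping.single jk 1, \<beta>), 0)))
      + (if jk = a then S a * basis ((\<mu>, \<beta>), 0) else 0)"
    proof (cases "jk = a")
      case True
      have "(of_nat (Poly_Mapping.lookup (?d + \<mu>) jk) :: complex) = of_nat (Poly_Mapping.lookup \<mu> jk) + 1"
        using True by (simp add: lookup_add)
      then have "scl (fps_const (of_nat (Poly_Mapping.lookup (?d + \<mu>) jk))) = (scl (fps_const (of_nat (Poly_Mapping.lookup \<mu> jk))) + 1 :: laurent)"
        by (simp only: fps_const_add[symmetric] scl_add) simp
      then show ?thesis using 1 2 True by (simp only: distrib_right) simp
    next
      case False
      then have "Poly_Mapping.lookup (?d + \<mu>) jk = Poly_Mapping.lookup \<mu> jk" by (simp add: lookup_add lookup_single)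
      then show ?thesis using 1 False by simp
    qed
  qed
  also have "\<dots> = emb (a_elt a) * deriv_by S (basis (\<mu>, \<beta>)) + S a * basis ((\<mu>, \<beta>), 0)"
    unfolding deriv_by_basis[of ?K \<mu> S, OF finite.insertI[OF finite_keys] subset_insertI] sum.distrib sum_distrib_left[symmetric] by simp
  finally have *: "deriv_by S (basis (?d + \<mu>, \<beta>)) = emb (a_elt a) * deriv_by S (basis (\<mu>, \<beta>)) + S a * basis ((\<mu>, \<beta>), 0)" .
  have 3: "basis ((\<mu>, \<beta>), 0) * basis (0, i) = (basis k :: laurent)" by (simp add: k basis_mult)
  have 4: "emb (a_elt a) * basis k = (basis ((?d + \<mu>, \<beta>), i) :: laurent)" by (simp add: k a_elt_def basis_mult)
  show "ext_ser (deriv_by S) (emb (a_elt a) * basis k) = emb (a_elt a) * ext_ser (deriv_by S) (basis k) + S a * basis k"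
    unfolding 4 unfolding k ext_ser_def lin_ext_basis prod.case * unfolding distrib_right mult.assoc 3[unfolded k] ..
qed (auto intro!: A_linear_comp[OF A_linear_ext_ser] A_linear_mult_left A_linear_id A_linear_ext_ser A_linear_plus)

definition div_pow :: "(nat \<times> nat \<Rightarrow> laurent) \<Rightarrow> nat \<Rightarrow> laurent \<Rightarrow> laurent" where
  "div_pow S k r = scl (fps_const (1 / fact k)) * (ext_ser (deriv_by S) ^^ k) r"

lemma A_linear_funpow: fixes T :: "('k::monoid_add \<Rightarrow>\<^sub>0 complex) fps \<Rightarrow> ('k \<Rightarrow>\<^sub>0 complex) fps" shows "A_linear T \<Longrightarrow> A_linear (\<lambda>x. (T ^^ k) x)"
proof (induction k)
  case (Suc k) then show ?case using A_linear_comp[of T "\<lambda>x. (T ^^ k) x"] by simp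
qed (simp add: A_linear_id id_def)

lemma A_linear_div_pow: "A_linear (div_pow S k)"
  unfolding div_pow_def by (intro A_linear_mult_left A_linear_funpow A_linear_ext_ser)

text \<open>The derivation maps the generator to a scalar, which it does not differentiate further.
  Of the Leibniz expansion only two terms survive, and the division by the factorial absorbs the
  multiplicity.\<close>

lemma div_pow_a_elt_Suc: assumes "\<And>a. scalar_ser (S a)" shows "div_pow S (Suc k) (emb (a_elt a) * r) = emb (a_elt a) * div_pow S (Suc k) r + S a * div_pow S k r"
proof -
  let ?T = "ext_ser (deriv_by S)"
  have *: "(?T ^^ Suc k) (emb (a_elt a) * r) = emb (a_elt a) * (?T ^^ Suc k) r + of_nat (Suc k) * (S a * (?T ^^ k) r)" for k
  proof (induction k)
    case 0 then show ?case by (simp add: ext_ser_deriv_by_a_elt)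
  next
    case (Suc k)
    have "(?T ^^ Suc (Suc k)) (emb (a_elt a) * r) = ?T ((?T ^^ Suc k) (emb (a_elt a) * r))" by simp
    also have "\<dots> = ?T (emb (a_elt a) * (?T ^^ Suc k) r + scl (of_nat (Suc k)) * (S a * (?T ^^ k) r))"
      by (simp only: Suc scl_of_nat)
    also have "\<dots> = emb (a_elt a) * (?T ^^ Suc (Suc k)) r + S a * (?T ^^ Suc k) r + of_nat (Suc k) * (S a * (?T ^^ Suc k) r)"
      by (simp only: A_linear_add[OF A_linear_ext_ser] A_linear_scl[OF A_linear_ext_ser] ext_ser_deriv_by_a_elt ext_ser_scalar_ser[OF assms] funpow.simps o_apply) (simp only: scl_of_nat)
    also have "\<dots> = emb (a_elt a) * (?T ^^ Suc (Suc k)) r + of_nat (Suc (Suc k)) * (S a * (?T ^^ Suc k) r)"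
      by (simp only: of_nat_Suc[of "Suc k"] distrib_right mult_1 add_ac)
    finally show ?case .
  qed
  have f: "scl (fps_const (1 / fact (Suc k))) * of_nat (Suc k) = (scl (fps_const (1 / fact k)) :: laurent)"
    unfolding scl_of_nat[symmetric] scl_mult[symmetric] by (simp add: fps_of_nat[symmetric] del: of_nat_Suc)
  show ?thesis unfolding div_pow_def * distrib_left f[symmetric] by (simp only: mult_ac)
qed

lemma div_pow_a_elt_0: "div_pow S 0 (emb (a_elt a) * r) = emb (a_elt a) * div_pow S 0 r"
  by (simp add: div_pow_def)

text \<open>A derivation with scalar values on generators is nilpotent on each monomial, so its
  exponential is a finite sum there; \<open>div_pow_a_elt_Suc\<close> shows that this sum is
  multiplicative in one generator at a time.\<close>

lemma div_pow_sum_basis: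
  assumes "\<And>a. scalar_ser (S a)"
  shows "\<exists>K. (\<forall>k\<ge>K. div_pow S k (basis ((\<mu>, \<beta>), 0)) = 0) \<and> (\<Sum>k<K. div_pow S k (basis ((\<mu>, \<beta>), 0))) = shift_hom S (\<lambda>_. 1) (basis (\<mu>, \<beta>))"
proof (induction \<mu> rule: pm_nat_induct)
  case 1
  have 0: "ext_ser (deriv_by S) (basis ((0, \<beta>), 0)) = 0"
    by (simp add: ext_ser_def deriv_by_basis[of "{}"])
  have "div_pow S k (basis ((0, \<beta>), 0)) = 0" if "1 \<le> k" for k
  proof -
    obtain l where k: "k = Suc l" using \<open>1 \<le> k\<close> by (cases k) auto
    show ?thesis unfolding k div_pow_def funpow_Suc_right o_apply 0 A_linear_0[OF A_linear_funpow[OF A_linear_ext_ser]] by simp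
  qed
  moreover have "div_pow S 0 (basis ((0, \<beta>), 0)) = shift_hom S (\<lambda>_. 1) (basis (0, \<beta>))"
    using shift_hom_e_elt[of S "\<lambda>_. 1" \<beta>] by (simp add: div_pow_def e_elt_def)
  ultimately show ?case by (intro exI[of _ 1]) simp
next
  case (2 \<mu> a)
  let ?r = "basis ((\<mu>, \<beta>), 0) :: laurent"
  obtain K where K: "\<forall>k\<ge>K. div_pow S k ?r = 0" "(\<Sum>k<K. div_pow S k ?r) = shift_hom S (\<lambda>_. 1) (basis (\<mu>, \<beta>))" using 2 by blast
  have e: "basis ((Poly_Mapping.single a 1 + \<mu>, \<beta>), 0) = emb (a_elt a) * ?r" by (simp add: a_elt_def basis_mult)
  have e': "basis (Poly_Mapping.single a 1 + \<mu>, \<beta>) = a_elt a * basis (\<mu>, \<beta>)" by (simp add: a_elt_def basis_mult)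
  have "div_pow S k (emb (a_elt a) * ?r) = 0" if "Suc K \<le> k" for k
    using that K(1) by (cases k) (simp_all add: div_pow_a_elt_Suc[OF assms])
  moreover have "(\<Sum>k<Suc K. div_pow S k (emb (a_elt a) * ?r)) = emb (a_elt a) * (\<Sum>k<Suc K. div_pow S k ?r) + S a * (\<Sum>k<K. div_pow S k ?r)"
    unfolding sum.lessThan_Suc_shift div_pow_a_elt_0 div_pow_a_elt_Suc[OF assms] by (simp add: sum.distrib distrib_left sum_distrib_left)
  moreover have "(\<Sum>k<Suc K. div_pow S k ?r) = (\<Sum>k<K. div_pow S k ?r)" using K(1) by simp
  ultimately show ?case unfolding e e' shift_hom_mult[OF mult_hom_1] shift_hom_a_elt[OF mult_hom_1] K(2)[symmetric]
    by (intro exI[of _ "Suc K"]) (simp add: distrib_right)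
qed

text \<open>Powers of the operator series in one variable are iterates of
  \<open>ext_ser (deriv_by S)\<close>, which turns the operator exponential into the sum of divided
  powers.\<close>

lemma op_exp_deriv_by:
  assumes "\<And>a. scalar_ser (S a)" and X: "\<And>m x. X m x = ser_coeff (deriv_by S x) m"
  shows "op_exp X m x = ser_coeff (shift_hom S (\<lambda>_. 1) x) m"
proof -
  have *: "(((\<diamondop>) X) ^^ k) (op_const id) m x = ser_coeff ((ext_ser (deriv_by S) ^^ k) (emb x)) m" for k m x
  proof (induction k arbitrary: m)
    case 0 show ?case
    proof -
      have "ser_coeff (emb x) m = ser_act (emb x) (\<lambda>e. if e = 0 then 1 else 0) m" by (simp add: ser_coeff_def)
      then show ?thesis by (simp add: ser_act_emb op_const_def)
    qed
  next
    case (Suc k)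
    have "(((\<diamondop>) X) ^^ Suc k) (op_const id) m x = hsum (\<lambda>i. ser_coeff (deriv_by S (ser_coeff ((ext_ser (deriv_by S) ^^ k) (emb x)) (m - i))) i)"
      unfolding funpow.simps o_apply op_mult_def X Suc ..
    then show ?case unfolding hsum_ser_coeff_comp[OF A_linear_deriv_by] by (simp only: funpow.simps o_apply)
  qed
  have "op_exp X m x = hsum (\<lambda>k. ser_coeff (div_pow S k (emb x)) m)"
    unfolding op_exp_def * div_pow_def by (simp add: A_linear_scl[OF A_linear_ser_coeff])
  also have "\<dots> = ser_coeff (shift_hom S (\<lambda>_. 1) x) m"
  proof (rule A_linear_eqI[of "\<lambda>x. hsum (\<lambda>k. ser_coeff (div_pow S k (emb x)) m)"])
    have al: "A_linear (\<lambda>x. ser_coeff (div_pow S k (emb x)) m)" for k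
      by (rule A_linear_comp[OF A_linear_ser_coeff A_linear_comp[OF A_linear_div_pow A_linear_emb]])
    have sm: "\<exists>K. (\<forall>k\<ge>K. div_pow S k (emb (basis b)) = 0) \<and> (\<Sum>k<K. div_pow S k (emb (basis b))) = shift_hom S (\<lambda>_. 1) (basis b)" for b
      using div_pow_sum_basis[OF assms(1), where \<mu> = "fst b" and \<beta> = "snd b"] by simp
    have "finite {k. ser_coeff (div_pow S k (emb (basis b))) m \<noteq> 0}" for b
    proof -
      obtain K where "\<forall>k\<ge>K. div_pow S k (emb (basis b)) = 0" using sm[of b] by blast
      then have "{k. ser_coeff (div_pow S k (emb (basis b))) m \<noteq> 0} \<subseteq> {..<K}"
        by (auto simp: A_linear_0[OF A_linear_ser_coeff]) (metis A_linear_0[OF A_linear_ser_coeff] not_le)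
      then show ?thesis by (rule finite_subset) simp
    qed
    then show "A_linear (\<lambda>x. hsum (\<lambda>k. ser_coeff (div_pow S k (emb x)) m))"
      by (intro A_linear_hsum_fun al A_linear_hfinI[OF al])
    show "A_linear (\<lambda>x. ser_coeff (shift_hom S (\<lambda>_. 1) x) m)" by (rule A_linear_comp[OF A_linear_ser_coeff A_linear_shift_hom])
    fix b
    obtain K where K: "\<forall>k\<ge>K. div_pow S k (emb (basis b)) = 0" "(\<Sum>k<K. div_pow S k (emb (basis b))) = shift_hom S (\<lambda>_. 1) (basis b)"
      using sm[of b] by blast
    have "hsum (\<lambda>k. ser_coeff (div_pow S k (emb (basis b))) m) = (\<Sum>k<K. ser_coeff (div_pow S k (emb (basis b))) m)"
      by (rule hsum_finite) (use K(1) in \<open>auto simp: A_linear_0[OF A_linear_ser_coeff]\<close>)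
    also have "\<dots> = ser_coeff (shift_hom S (\<lambda>_. 1) (basis b)) m" unfolding K(2)[symmetric] by (simp add: A_linear_sum[OF A_linear_ser_coeff])
    finally show "hsum (\<lambda>k. ser_coeff (div_pow S k (emb (basis b))) m) = ser_coeff (shift_hom S (\<lambda>_. 1) (basis b)) m" .
  qed
  finally show ?thesis .
qed

text \<open>
  \<open>[\<Sum>\<^sub>k (a\<^sub>i\<^sub>,\<^sub>k/k) (u + c\<hbar>)\<^sup>-\<^sup>k,
  a\<^sub>j\<^sub>,\<^sub>-\<^sub>l]\<close>
\<close>

definition ann_shift :: "nat \<Rightarrow> complex \<Rightarrow> nat \<times> nat \<Rightarrow> laurent" where
  "ann_shift i c jk = (if fst jk = i \<and> 0 < snd jk then lin_pow c (- int (snd jk)) else 0)"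

lemma scalar_ser_ann_shift: "scalar_ser (ann_shift i c a)" by (simp add: ann_shift_def scalar_ser_lin_pow scalar_ser_0)

lemma lin_ext_const_nth:
  "lin_ext (\<lambda>k. fps_const (\<psi> k)) x $ p = (\<Sum>k\<in>Poly_Mapping.keys (x $ p). Poly_Mapping.single 0 (Poly_Mapping.lookup (x $ p) k) * \<psi> k)"
proof -
  have "lin_ext (\<lambda>k. fps_const (\<psi> k)) x $ p = (\<Sum>q=0..p. if q = p then (\<Sum>k\<in>Poly_Mapping.keys (x $ p). Poly_Mapping.single 0 (Poly_Mapping.lookup (x $ p) k) * \<psi> k) else 0)"
    unfolding lin_ext_def fps_nth_Abs_fps lin_ext_fin_lookup by (rule sum.cong) auto
  then show ?thesis by simp
qed

lemma annih_lin_ext: "annih j k = lin_ext (\<lambda>(\<mu>, \<beta>). fps_const (Poly_Mapping.single (\<mu> - Poly_Mapping.single (j, k) 1, \<beta>) (of_nat k * of_nat (Poly_Mapping.lookup \<mu> (j, k)))))"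
proof (intro ext fps_ext)
  fix x p
  show "annih j k x $ p = lin_ext (\<lambda>(\<mu>, \<beta>). fps_const (Poly_Mapping.single (\<mu> - Poly_Mapping.single (j, k) 1, \<beta>) (of_nat k * of_nat (Poly_Mapping.lookup \<mu> (j, k))))) x $ p"
    unfolding case_prod_beta lin_ext_const_nth unfolding annih_def by (auto intro!: sum.cong simp: mult_single mult_ac)
qed

text \<open>The factor k of the commutator cancels the 1/k of the series, so a_(j,-k) is sent to (u
  + c hbar)^(-k) exactly.\<close>

lemma ann_eq: assumes "j \<noteq> 0" shows "ann j c m x = ser_coeff (deriv_by (ann_shift j c) x) m"
proof -
  have bos: "boson j (int k) = annih j k" for k
    by (intro ext) (use assms in \<open>simp add: boson_def\<close>)
  let ?f = "\<lambda>x k::nat. if k = 0 then 0 else scl (fps_const (1 / of_nat k) * pw (hb c) (- int k) m) * annih j k x"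
  have al: "A_linear (\<lambda>x. ?f x k)" for k
  proof (cases "k = 0")
    case False then show ?thesis by (simp add: annih_lin_ext A_linear_mult_left[OF A_linear_lin_ext])
  qed (simp add: A_linear_zero)
  have b: "?f (basis (\<mu>, \<beta>)) k = (if k = 0 then 0 else scl (fps_const (of_nat (Poly_Mapping.lookup \<mu> (j, k)))) * (scl (pw (hb c) (- int k) m) * basis (\<mu> - Poly_Mapping.single (j, k) 1, \<beta>)))" for \<mu> \<beta> k
  proof (cases "k = 0")
    case False
    have 1: "annih j k (basis (\<mu>, \<beta>)) = scl (fps_const (of_nat k * of_nat (Poly_Mapping.lookup \<mu> (j, k)))) * basis (\<mu> - Poly_Mapping.single (j, k) 1, \<beta>)"
      unfolding annih_lin_ext lin_ext_basis prod.case by (rule fps_ext) (auto simp: fps_scl_const_mult_nth basis_def mult_single)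
    have "fps_const (1 / of_nat k) * fps_const (of_nat k * of_nat (Poly_Mapping.lookup \<mu> (j, k))) = fps_const (of_nat (Poly_Mapping.lookup \<mu> (j, k)) :: complex)"
      using False by simp
    then have 2: "(scl (fps_const (1 / of_nat k)) * scl (fps_const (of_nat k * of_nat (Poly_Mapping.lookup \<mu> (j, k)))) :: fock) = scl (fps_const (of_nat (Poly_Mapping.lookup \<mu> (j, k))))"
      by (simp only: scl_mult[symmetric])
    have alg: "x * w * (y * z) = (x * y) * (w * z)" for x y z w :: fock by (simp only: mult_ac)
    have "scl (fps_const (1 / of_nat k) * pw (hb c) (- int k) m) * annih j k (basis (\<mu>, \<beta>)) = scl (fps_const (of_nat (Poly_Mapping.lookup \<mu> (j, k)))) * (scl (pw (hb c) (- int k) m) * basis (\<mu> - Poly_Mapping.single (j, k) 1, \<beta>))"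
      unfolding 1 scl_mult[of "fps_const (1 / of_nat k)" "pw (hb c) (- int k) m"] alg[of "scl (fps_const (1 / of_nat k))" "scl (pw (hb c) (- int k) m)"] 2 ..
    then show ?thesis using False by simp
  qed simp
  let ?K = "\<lambda>\<mu>. {k. (j, k) \<in> Poly_Mapping.keys (\<mu> :: nat \<times> nat \<Rightarrow>\<^sub>0 nat)}"
  have finK: "finite (?K \<mu>)" for \<mu>
  proof -
    have "?K \<mu> \<subseteq> snd ` Poly_Mapping.keys \<mu>" by force
    then show ?thesis by (rule finite_subset) simp
  qed
  have "hsum (?f x) = ser_coeff (deriv_by (ann_shift j c) x) m"
  proof (rule A_linear_eqI[of "\<lambda>x. hsum (?f x)"])
    have "finite {k. ?f (basis b) k \<noteq> 0}" for b
    proof -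
      obtain \<mu> \<beta> where "b = (\<mu>, \<beta>)" by force
      moreover have "?f (basis (\<mu>, \<beta>)) k = 0" if "k \<notin> ?K \<mu>" for k
        unfolding b using that by (simp add: in_keys_iff)
      ultimately have "{k. ?f (basis b) k \<noteq> 0} \<subseteq> ?K \<mu>" by blast
      then show ?thesis using finK finite_subset by blast
    qed
    then show "A_linear (\<lambda>x. hsum (?f x))" by (intro A_linear_hsum_fun al A_linear_hfinI[OF al])
    show "A_linear (\<lambda>x. ser_coeff (deriv_by (ann_shift j c) x) m)" by (rule A_linear_comp[OF A_linear_ser_coeff A_linear_deriv_by])
    fix bb :: key obtain \<mu> \<beta> where bb: "bb = (\<mu>, \<beta>)" by force
    have "hsum (?f (basis bb)) = (\<Sum>k\<in>?K \<mu>. ?f (basis bb) k)"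
      by (rule hsum_finite[OF finK]) (simp only: bb b, auto simp: in_keys_iff)
    also have "\<dots> = (\<Sum>k\<in>?K \<mu>. ser_coeff (scl (fps_const (of_nat (Poly_Mapping.lookup \<mu> (j, k)))) * (ann_shift j c (j, k) * basis ((\<mu> - Poly_Mapping.single (j, k) 1, \<beta>), 0))) m)"
    proof (intro sum.cong refl)
      fix k
      have "ser_coeff (lin_pow c (- int k) * basis ((\<mu> - Poly_Mapping.single (j, k) 1, \<beta>), 0)) m = scl (pw (hb c) (- int k) m) * basis (\<mu> - Poly_Mapping.single (j, k) 1, \<beta>)"
        unfolding mult.commute[of "lin_pow c _"] ser_coeff_def ser_act_mult ser_act_basis unfolding ser_coeff_def[symmetric] ser_coeff_lin_pow by (simp add: mult.commute)
      then show "?f (basis bb) k = ser_coeff (scl (fps_const (of_nat (Poly_Mapping.lookup \<mu> (j, k)))) * (ann_shift j c (j, k) * basis ((\<mu> - Poly_Mapping.single (j, k) 1, \<beta>), 0))) m"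
        unfolding bb b A_linear_scl[OF A_linear_ser_coeff] by (auto simp: ann_shift_def A_linear_0[OF A_linear_ser_coeff])
    qed
    also have "\<dots> = (\<Sum>jk\<in>Poly_Mapping.keys \<mu>. ser_coeff (scl (fps_const (of_nat (Poly_Mapping.lookup \<mu> jk))) * (ann_shift j c jk * basis ((\<mu> - Poly_Mapping.single jk 1, \<beta>), 0))) m)"
    proof -
      have "(\<Sum>jk\<in>Poly_Mapping.keys \<mu>. ser_coeff (scl (fps_const (of_nat (Poly_Mapping.lookup \<mu> jk))) * (ann_shift j c jk * basis ((\<mu> - Poly_Mapping.single jk 1, \<beta>), 0))) m)
        = (\<Sum>jk\<in>Pair j ` ?K \<mu>. ser_coeff (scl (fps_const (of_nat (Poly_Mapping.lookup \<mu> jk))) * (ann_shift j c jk * basis ((\<mu> - Poly_Mapping.single jk 1, \<beta>), 0))) m)"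
        by (rule sum.mono_neutral_right) (auto simp: ann_shift_def A_linear_0[OF A_linear_ser_coeff])
      then show ?thesis by (simp add: sum.reindex inj_on_def)
    qed
    also have "\<dots> = ser_coeff (deriv_by (ann_shift j c) (basis bb)) m"
      unfolding bb deriv_by_basis[OF finite_keys order_refl] A_linear_sum[OF A_linear_ser_coeff] ..
    finally show "hsum (?f (basis bb)) = ser_coeff (deriv_by (ann_shift j c) (basis bb)) m" .
  qed
  then show ?thesis by (simp add: ann_def bos cong: if_cong)
qed

section \<open>Zero modes and complete vertex operators\<close>

definition wt_mult :: "(lat \<Rightarrow> laurent) \<Rightarrow> fock \<Rightarrow> laurent" where
  "wt_mult g = lin_ext (\<lambda>k. emb (basis k) * g (snd k))"

lemma A_linear_wt_mult: "A_linear (wt_mult g)" unfolding wt_mult_def by (rule A_linear_lin_ext)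

lemma scl_basis_nth: "(scl f * basis b) $ p = Poly_Mapping.single b (f $ p)" for b :: "'k::monoid_add"
  by (simp add: basis_def mult_single)

lemma wt_op_lin_ext: "wt_op G x = lin_ext (\<lambda>k. scl (G (snd k)) * basis k) x"
  by (rule fps_ext) (simp add: wt_op_def lin_ext_def lin_ext_fin_lookup scl_basis_nth mult_single atLeast0AtMost mult.commute[of "Poly_Mapping.lookup _ _"])

lemma ser_coeff_emb_mult: "ser_coeff (emb y * s) m = y * ser_coeff s m"
  by (simp add: ser_coeff_def ser_act_mult ser_act_emb)

lemma wt_op_eq: assumes "\<And>\<beta>. ser_coeff (g \<beta>) m = scl (G \<beta>)" shows "wt_op G x = ser_coeff (wt_mult g x) m"
  unfolding wt_op_lin_ext
  by (rule A_linear_eqI[OF A_linear_lin_ext A_linear_comp[OF A_linear_ser_coeff A_linear_wt_mult]]) (simp only: wt_mult_def lin_ext_basis ser_coeff_emb_mult assms mult.commute)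

definition field_ser :: "(fock \<Rightarrow> laurent) \<Rightarrow> fock fps \<Rightarrow> opser" where
  "field_ser s M m x = ser_act (s x) (to_ser M) m"

text \<open>The zero mode acts before e^gamma and so sees the original weight. Its values are
  scalars, which the annihilation exponential leaves alone; both therefore merge into the single
  homomorphism \<open>shift_hom S g\<close>.\<close>

lemma ext_ser_shift_hom_wt_mult:
  assumes "\<And>\<beta>. scalar_ser (g \<beta>)"
  shows "ext_ser (shift_hom S (\<lambda>_. 1)) (emb (e_elt \<gamma>) * wt_mult g x) = emb (e_elt \<gamma>) * shift_hom S g x"
proof (rule A_linear_eqI[of "\<lambda>x. ext_ser (shift_hom S (\<lambda>_. 1)) (emb (e_elt \<gamma>) * wt_mult g x)"])
  fix k :: key obtain \<mu> \<beta> where k: "k = (\<mu>, \<beta>)" by force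
  have e: "emb (e_elt \<gamma>) * wt_mult g (basis k) = g \<beta> * emb (e_elt \<gamma> * basis k)"
    unfolding wt_mult_def lin_ext_basis by (simp add: k emb_mult mult_ac del: emb_basis)
  show "ext_ser (shift_hom S (\<lambda>_. 1)) (emb (e_elt \<gamma>) * wt_mult g (basis k)) = emb (e_elt \<gamma>) * shift_hom S g (basis k)"
    unfolding e ext_ser_scalar_ser[OF assms] ext_ser_emb[OF A_linear_shift_hom] shift_hom_mult[OF mult_hom_1] shift_hom_e_elt
    unfolding shift_hom_def k lin_ext_basis by (simp add: mult_ac)
qed (intro A_linear_comp[OF A_linear_ext_ser] A_linear_mult_left A_linear_wt_mult A_linear_shift_hom)+

lemma vertex_op_eq:
  assumes C: "in_filt 1 C" and S: "\<And>a. scalar_ser (S a)" and X: "\<And>m x. X m x = ser_coeff (deriv_by S x) m"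
    and g: "\<And>\<beta>. scalar_ser (g \<beta>)" and Z: "\<And>m x. Z m x = ser_coeff (wt_mult g x) m"
  shows "op_exp (mult_op C) \<diamondop> op_exp X \<diamondop> op_const (elat \<gamma>) \<diamondop> Z = field_ser (shift_hom S g) (fps_const (e_elt \<gamma>) * EXP C)"
proof (intro ext)
  fix m x
  have 1: "(op_const (elat \<gamma>) \<diamondop> Z) m x = ser_coeff (emb (e_elt \<gamma>) * wt_mult g x) m" for m
  proof -
    have "(op_const (elat \<gamma>) \<diamondop> Z) m x = op_const (elat \<gamma>) 0 (Z (m - 0) x)"
      unfolding op_mult_def by (rule hsum_single) (simp add: op_const_def)
    then show ?thesis by (simp add: op_const_def Z ser_coeff_emb_mult elat_def e_elt_def basis_def)
  qed
  have 2: "(op_exp X \<diamondop> op_const (elat \<gamma>) \<diamondop> Z) m x = ser_coeff (emb (e_elt \<gamma>) * shift_hom S g x) m" for m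
    unfolding op_mult_def[of "op_exp X"] 1 op_exp_deriv_by[OF S X] hsum_ser_coeff_comp[OF A_linear_shift_hom] ext_ser_shift_hom_wt_mult[OF g] ..
  have "(op_exp (mult_op C) \<diamondop> op_exp X \<diamondop> op_const (elat \<gamma>) \<diamondop> Z) m x = hsum (\<lambda>i. to_ser (EXP C) i * ser_coeff (emb (e_elt \<gamma>) * shift_hom S g x) (m - i))"
    unfolding op_mult_def[of "op_exp (mult_op C)"] 2 unfolding op_exp_mult_op[OF C] mult_op_def ..
  also have "\<dots> = ser_act (emb (e_elt \<gamma>) * shift_hom S g x) (to_ser (EXP C)) m" by (rule hsum_ser_coeff)
  also have "\<dots> = field_ser (shift_hom S g) (fps_const (e_elt \<gamma>) * EXP C) m x"
  proof -
    have t: "ser_act (emb (e_elt \<gamma>)) (to_ser (EXP C)) = to_ser (fps_const (e_elt \<gamma>) * EXP C)"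
      by (rule ext) (simp add: ser_act_emb to_ser_def)
    show ?thesis unfolding field_ser_def mult.commute[of "emb _"] ser_act_mult t ..
  qed
  finally show "(op_exp (mult_op C) \<diamondop> op_exp X \<diamondop> op_const (elat \<gamma>) \<diamondop> Z) m x = field_ser (shift_hom S g) (fps_const (e_elt \<gamma>) * EXP C) m x" .
qed

definition zpow_val :: "nat \<Rightarrow> complex \<Rightarrow> lat \<Rightarrow> lat \<Rightarrow> laurent" where
  "zpow_val s c \<gamma> \<beta> = scl (fps_const (((-1) ^ s) powi ip \<gamma> \<beta>)) * lin_pow c (ip \<gamma> \<beta>)"

lemma scalar_ser_zpow_val: "scalar_ser (zpow_val s c \<gamma> \<beta>)"
  unfolding zpow_val_def by (intro scalar_ser_scl scalar_ser_lin_pow)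

lemma ip_add: "ip \<gamma> (\<alpha> + \<beta>) = ip \<gamma> \<alpha> + ip \<gamma> \<beta>"
  by (simp add: ip_def lookup_add distrib_left sum.distrib)
lemma ip_0 [simp]: "ip \<gamma> 0 = 0" by (simp add: ip_def)
lemma ip_minus: "ip (- \<gamma>) \<beta> = - ip \<gamma> \<beta>"
  by (simp add: ip_def sum_negf)
lemma ip_minus2: "ip \<gamma> (- \<beta>) = - ip \<gamma> \<beta>"
  by (simp add: ip_def sum_negf)

lemma mult_hom_zpow_val: "mult_hom (zpow_val s c \<gamma>)"
  unfolding mult_hom_def
proof (intro conjI allI)
  show "zpow_val s c \<gamma> 0 = 1" by (simp add: zpow_val_def lin_pow_0)
  fix \<alpha> \<beta> show "zpow_val s c \<gamma> (\<alpha> + \<beta>) = zpow_val s c \<gamma> \<alpha> * zpow_val s c \<gamma> \<beta>"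
    by (simp add: zpow_val_def ip_add lin_pow_add power_int_add scl_mult mult_ac flip: fps_const_mult)
qed

lemma zpow_eq: "zpow s c \<gamma> m x = ser_coeff (wt_mult (zpow_val s c \<gamma>) x) m"
  unfolding zpow_def by (rule wt_op_eq) (simp add: zpow_val_def A_linear_scl[OF A_linear_ser_coeff] ser_coeff_lin_pow scl_mult)

lemma local_add_scl: "local_add scl"
  by (auto simp: local_add_def scl_add)

lemma ser_coeff_lin_pow_mult: "ser_coeff (lin_pow a k * lin_pow b l) m = scl ((pw (hb a) k \<star> pw (hb b) l) m)"
proof -
  let ?f = "\<lambda>i. pw (hb a) k i * pw (hb b) l (m - i)"
  have "{i. ?f i \<noteq> 0} \<subseteq> {m - l..k}" by (auto simp: pw_def split: if_splits)
  then have fin: "hsummable ?f" by (intro hsummable_finite) (rule finite_subset, auto)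
  have "ser_coeff (lin_pow a k * lin_pow b l) m = ser_act (lin_pow b l) (ser_coeff (lin_pow a k)) m"
    by (simp add: ser_coeff_def mult.commute[of "lin_pow a k"] ser_act_mult)
  also have "\<dots> = hsum (\<lambda>i. scl (?f i))" by (simp add: hsum_ser_coeff[symmetric] ser_coeff_lin_pow scl_mult)
  finally show ?thesis by (simp add: ser_mult_def hsum_local_add[OF local_add_scl fin])
qed

definition H_weight :: "nat \<Rightarrow> nat \<Rightarrow> lat \<Rightarrow> laurent" where
  "H_weight n j \<beta> = lin_pow (1/2) (- ip (alpha n j) \<beta>) * lin_pow (-1/2) (ip (alpha n j) \<beta>)"

lemma mult_hom_H_weight: "mult_hom (H_weight n j)"
  unfolding mult_hom_def
proof (intro conjI allI)
  show "H_weight n j 0 = 1" by (simp add: H_weight_def lin_pow_0)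
  fix \<beta> \<gamma>
  have "- ip (alpha n j) (\<beta> + \<gamma>) = - ip (alpha n j) \<beta> + - ip (alpha n j) \<gamma>" by (simp add: ip_add)
  then show "H_weight n j (\<beta> + \<gamma>) = H_weight n j \<beta> * H_weight n j \<gamma>"
    unfolding H_weight_def by (simp only: ip_add lin_pow_add mult_ac)
qed

definition hom_E :: "nat \<Rightarrow> nat \<Rightarrow> fock \<Rightarrow> laurent" where
  "hom_E n j = shift_hom (\<lambda>jk. - ann_shift j (-1/4) jk) (zpow_val (sgn_exp n j) (-1/4) (alpha n j))"
definition hom_F :: "nat \<Rightarrow> nat \<Rightarrow> fock \<Rightarrow> laurent" where
  "hom_F n j = shift_hom (ann_shift j (1/4)) (zpow_val (sgn_exp n j) (1/4) (- alpha n j))"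
definition hom_H :: "nat \<Rightarrow> nat \<Rightarrow> fock \<Rightarrow> laurent" where
  "hom_H n j = shift_hom (\<lambda>jk. - (ann_shift j (-1/2) jk - ann_shift j (1/2) jk)) (H_weight n j)"

definition log_cre_E :: "nat \<Rightarrow> nat \<Rightarrow> fock fps" where
  "log_cre_E n j = cre_ser j (-1/4) + cre_ser j (3/4) - (\<Sum>i\<in>nbrs n j. cre_ser i (1/4))"
definition log_cre_F :: "nat \<Rightarrow> nat \<Rightarrow> fock fps" where
  "log_cre_F n j = - (cre_ser j (1/4) + cre_ser j (-3/4)) + (\<Sum>i\<in>nbrs n j. cre_ser i (-1/4))"
definition log_cre_H :: "nat \<Rightarrow> nat \<Rightarrow> fock fps" where
  "log_cre_H n j = - (cre_ser j (-1) - cre_ser j 1) + (\<Sum>i\<in>nbrs n j. cre_ser i (-1/2) - cre_ser i (1/2))"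

lemma in_filt_log_cre_E: "in_filt 1 (log_cre_E n j)" and in_filt_log_cre_F: "in_filt 1 (log_cre_F n j)" and in_filt_log_cre_H: "in_filt 1 (log_cre_H n j)"
  unfolding log_cre_E_def log_cre_F_def log_cre_H_def by (intro in_filt_add in_filt_diff in_filt_minus in_filt_sum in_filt_cre_ser)+

definition cre_E :: "nat \<Rightarrow> nat \<Rightarrow> fock fps" where "cre_E n j = fps_const (e_elt (alpha n j)) * EXP (log_cre_E n j)"
definition cre_F :: "nat \<Rightarrow> nat \<Rightarrow> fock fps" where "cre_F n j = fps_const (e_elt (- alpha n j)) * EXP (log_cre_F n j)"
definition cre_H :: "nat \<Rightarrow> nat \<Rightarrow> fock fps" where "cre_H n j = EXP (log_cre_H n j)"

lemma E_op_eq: assumes "j \<noteq> 0" shows "E_op n j = field_ser (hom_E n j) (cre_E n j)"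
  unfolding E_op_def cre_eq mult_op_add mult_op_sum mult_op_diff hom_E_def cre_E_def log_cre_E_def[symmetric]
  by (rule vertex_op_eq) (auto simp: in_filt_log_cre_E[unfolded One_nat_def] scalar_ser_uminus scalar_ser_ann_shift scalar_ser_zpow_val zpow_eq ann_eq[OF assms] deriv_by_uminus A_linear_minus[OF A_linear_ser_coeff])

lemma F_op_eq: assumes "j \<noteq> 0" shows "F_op n j = field_ser (hom_F n j) (cre_F n j)"
  unfolding F_op_def cre_eq mult_op_add mult_op_minus mult_op_sum hom_F_def cre_F_def log_cre_F_def[symmetric]
  by (rule vertex_op_eq) (auto simp: in_filt_log_cre_F[unfolded One_nat_def] scalar_ser_ann_shift scalar_ser_zpow_val zpow_eq ann_eq[OF assms])

lemma Hm_op_eq: "Hm_op n j = field_ser emb (cre_H n j)"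
  unfolding Hm_op_def cre_eq mult_op_diff mult_op_add mult_op_minus mult_op_sum cre_H_def log_cre_H_def[symmetric] op_exp_mult_op[OF in_filt_log_cre_H]
  by (intro ext) (simp add: field_ser_def ser_act_emb mult_op_def mult.commute)

lemma to_ser_1: "to_ser 1 = (\<lambda>e. if e = 0 then 1 else 0)"
  by (auto simp: to_ser_def fun_eq_iff)

lemma scalar_ser_H_weight: "scalar_ser (H_weight n j \<beta>)" unfolding H_weight_def by (intro scalar_ser_mult scalar_ser_lin_pow)

lemma Hp_op_eq: assumes "j \<noteq> 0" shows "Hp_op n j = field_ser (hom_H n j) 1"
proof (intro ext)
  fix m x
  let ?S = "\<lambda>jk. - (ann_shift j (-1/2) jk - ann_shift j (1/2) jk)"
  have S: "scalar_ser (?S a)" for a by (intro scalar_ser_uminus scalar_ser_diff scalar_ser_ann_shift)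
  have X: "(- (ann j (-1/2) - ann j (1/2))) m x = ser_coeff (deriv_by ?S x) m" for m x
    by (simp add: ann_eq[OF assms] deriv_by_uminus deriv_by_diff A_linear_minus[OF A_linear_ser_coeff] A_linear_diff[OF A_linear_ser_coeff] del: minus_diff_eq)
  have W: "wt_op (\<lambda>\<beta>. (pw (hb (1/2)) (- ip (alpha n j) \<beta>) \<star> pw (hb (-1/2)) (ip (alpha n j) \<beta>)) m) x = ser_coeff (wt_mult (H_weight n j) x) m" for m x
    by (rule wt_op_eq) (simp add: H_weight_def ser_coeff_lin_pow_mult)
  have "Hp_op n j m x = ser_coeff (ext_ser (shift_hom ?S (\<lambda>_. 1)) (wt_mult (H_weight n j) x)) m"
    unfolding Hp_op_def op_mult_def W op_exp_deriv_by[OF S X] by (rule hsum_ser_coeff_comp[OF A_linear_shift_hom])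
  also have "ext_ser (shift_hom ?S (\<lambda>_. 1)) (wt_mult (H_weight n j) x) = hom_H n j x"
    using ext_ser_shift_hom_wt_mult[OF scalar_ser_H_weight, where \<gamma> = 0 and x = x and S = ?S] by (simp add: hom_H_def)
  finally show "Hp_op n j m x = field_ser (hom_H n j) 1 m x" by (simp add: field_ser_def ser_coeff_def to_ser_1)
qed

section \<open>Exchange relations\<close>

declare One_nat_def [simp del]

text \<open>
  Multiplication by \<open>u - v + c\<hbar>\<close>, for the variables \<open>u\<close> and \<open>v\<close>
  with exponent vectors \<open>d1\<close> and \<open>d2\<close>.
\<close>

definition diff_op :: "'e \<Rightarrow> 'e \<Rightarrow> complex \<Rightarrow> ('e::ab_group_add \<Rightarrow> ('k::monoid_add \<Rightarrow>\<^sub>0 complex) fps) \<Rightarrow> 'e \<Rightarrow> ('k \<Rightarrow>\<^sub>0 complex) fps" where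
  "diff_op d1 d2 c f e = f (e - d1) - f (e - d2) + scl (hb c) * f e"

lemma diff_op_ser_act: "diff_op d1 d2 c f = ser_act (basis (0, d1) - basis (0, d2) + scl (hb c)) f"
  using ser_act_scl[of "hb c" 1 f]
  by (intro ext) (simp add: diff_op_def ser_act_add ser_act_diff ser_act_basis basis_0 ser_act_1)

lemma diff_op_commute: "diff_op d1 d2 c (diff_op d3 d4 c' f) = diff_op d3 d4 c' (diff_op d1 d2 c f)"
  for f :: "'e::ab_group_add \<Rightarrow> ('k::comm_monoid_add \<Rightarrow>\<^sub>0 complex) fps"
  unfolding diff_op_ser_act by (rule ser_act_commute)

lemma diff_op_ser_act_commute: "diff_op d1 d2 c (ser_act r f) = ser_act r (diff_op d1 d2 c f)"
  unfolding diff_op_ser_act by (rule ser_act_commute)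

lemma diff_op_scl: "diff_op d1 d2 c (\<lambda>e. scl g * f e) = (\<lambda>e. scl g * diff_op d1 d2 c f e)"
  by (rule ext) (simp add: diff_op_def right_diff_distrib distrib_left scl_left_comm[of "scl (hb c)" g])

abbreviation diff_uv :: "complex \<Rightarrow> (int \<times> int \<Rightarrow> fock) \<Rightarrow> int \<times> int \<Rightarrow> fock" where "diff_uv \<equiv> diff_op (1, 0) (0, 1)"

definition diff_uvs :: "complex list \<Rightarrow> (int \<times> int \<Rightarrow> fock) \<Rightarrow> int \<times> int \<Rightarrow> fock" where "diff_uvs es = foldr diff_uv es"

lemma diff_uvs_simps [simp]: "diff_uvs [] f = f" "diff_uvs (e # es) f = diff_uv e (diff_uvs es f)"
  by (simp_all add: diff_uvs_def)

lemma diff_uvs_ser_act_commute: "diff_uvs es (ser_act r f) = ser_act r (diff_uvs es f)"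
  by (induction es) (auto simp: diff_op_ser_act_commute)

lemma A_linear_field_ser: "A_linear s \<Longrightarrow> A_linear (field_ser s M m)"
  unfolding field_ser_def by (rule A_linear_comp[OF A_linear_ser_act])

lemma field_ser_mult: "(\<And>x y. s (x * y) = s x * s y) \<Longrightarrow> field_ser s M m (g * x) = ser_act (s g) (\<lambda>m. field_ser s M m x) m"
  unfolding field_ser_def[abs_def] by (simp add: ser_act_mult)

lemma basis_00: "basis (0, (0, 0)) = (1 :: (('k::comm_monoid_add \<times> (int \<times> int)) \<Rightarrow>\<^sub>0 complex) fps)"
  by (simp add: basis_0 flip: zero_prod_def)

lemma ser_act_scl1: "ser_act (scl c) f e = scl c * f e"
  using ser_act_scl[of c 1 f e] by (simp add: ser_act_1)

section \<open>Products of two fields\<close>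

definition lift_u :: "(fock \<Rightarrow> laurent) \<Rightarrow> laurent \<Rightarrow> ((key \<times> (int \<times> int)) \<Rightarrow>\<^sub>0 complex) fps" where
  "lift_u s = lin_ext (\<lambda>(k, j). emb_u (s (basis k)) * basis (0, (0, j)))"
definition lift_v :: "(fock \<Rightarrow> laurent) \<Rightarrow> laurent \<Rightarrow> ((key \<times> (int \<times> int)) \<Rightarrow>\<^sub>0 complex) fps" where
  "lift_v s = lin_ext (\<lambda>(k, j). emb_v (s (basis k)) * basis (0, (j, 0)))"

lemma A_linear_lift_u: "A_linear (lift_u s)" and A_linear_lift_v: "A_linear (lift_v s)" unfolding lift_u_def lift_v_def by (rule A_linear_lin_ext)+

definition fock_hom :: "(fock \<Rightarrow> ('l::monoid_add \<Rightarrow>\<^sub>0 complex) fps) \<Rightarrow> bool" where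
  "fock_hom s \<longleftrightarrow> A_linear s \<and> (\<forall>x y. s (x * y) = s x * s y) \<and> s 1 = 1"

lemma fock_homD: assumes "fock_hom s" shows "A_linear s" "s (x * y) = s x * s y" "s 1 = 1"
  using assms by (auto simp: fock_hom_def)

lemma fock_hom_shift_hom: "mult_hom g \<Longrightarrow> fock_hom (shift_hom S g)"
  by (simp add: fock_hom_def A_linear_shift_hom shift_hom_mult shift_hom_1)

text \<open>The homomorphism of the left field acts on both factors of t(x) N(v). On t(x) it
  produces an element that is the same for both orders (\<open>lift_u_shift_hom\<close>,
  \<open>lift_v_shift_hom\<close>), on N(v) the contraction.\<close>

lemma field_ser_field_ser_u:
  assumes "fock_hom s"
  shows "field_ser s M a (field_ser t N b x) = ser_act (lift_u s (t x)) (\<lambda>(a, b). field_ser s M a (to_ser N b)) (a, b)"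
proof -
  have "field_ser s M a (ser_act r (to_ser N) b) = ser_act (lift_u s r) (\<lambda>(a, b). field_ser s M a (to_ser N b)) (a, b)" for r
  proof (rule A_linear_eqI[of "\<lambda>r. field_ser s M a (ser_act r (to_ser N) b)"])
    fix k :: "key \<times> int" obtain l j where k: "k = (l, j)" by (cases k)
    show "field_ser s M a (ser_act (basis k) (to_ser N) b) = ser_act (lift_u s (basis k)) (\<lambda>(a, b). field_ser s M a (to_ser N b)) (a, b)"
      by (simp add: k ser_act_basis field_ser_mult[OF fock_homD(2)[OF assms]] lift_u_def ser_act_mult ser_act_emb_u basis_0)
  qed (intro A_linear_comp[OF A_linear_field_ser] A_linear_comp[OF A_linear_ser_act] A_linear_ser_act A_linear_lift_u fock_homD(1)[OF assms])+
  then show ?thesis by (simp add: field_ser_def[of t])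
qed

lemma field_ser_field_ser_v:
  assumes "fock_hom t"
  shows "field_ser t N b (field_ser s M a x) = ser_act (lift_v t (s x)) (\<lambda>(a, b). field_ser t N b (to_ser M a)) (a, b)"
proof -
  have "field_ser t N b (ser_act r (to_ser M) a) = ser_act (lift_v t r) (\<lambda>(a, b). field_ser t N b (to_ser M a)) (a, b)" for r
  proof (rule A_linear_eqI[of "\<lambda>r. field_ser t N b (ser_act r (to_ser M) a)"])
    fix k :: "key \<times> int" obtain l j where k: "k = (l, j)" by (cases k)
    show "field_ser t N b (ser_act (basis k) (to_ser M) a) = ser_act (lift_v t (basis k)) (\<lambda>(a, b). field_ser t N b (to_ser M a)) (a, b)"
      by (simp add: k ser_act_basis field_ser_mult[OF fock_homD(2)[OF assms]] lift_v_def ser_act_mult ser_act_emb_v basis_0)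
  qed (intro A_linear_comp[OF A_linear_field_ser] A_linear_comp[OF A_linear_ser_act] A_linear_ser_act A_linear_lift_v fock_homD(1)[OF assms])+
  then show ?thesis by (simp add: field_ser_def[of s])
qed

lemma lift_u_mult: assumes "fock_hom s" shows "lift_u s (x * y) = lift_u s x * lift_u s y"
  unfolding lift_u_def
proof (rule lin_ext_mult)
  fix k l :: "key \<times> int"
  have "(basis (0, (0, snd k + snd l)) :: ((key \<times> (int \<times> int)) \<Rightarrow>\<^sub>0 complex) fps) = basis (0, (0, snd k)) * basis (0, (0, snd l))" by (simp add: basis_mult)
  then show "(case k + l of (k, j) \<Rightarrow> emb_u (s (basis k)) * basis (0, 0, j)) = (case k of (k, j) \<Rightarrow> emb_u (s (basis k)) * basis (0, 0, j)) * (case l of (k, j) \<Rightarrow> emb_u (s (basis k)) * basis (0, 0, j))"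
    using fock_homD(2)[OF assms] by (simp add: case_prod_beta emb_u_mult basis_mult[symmetric, where 'a=key] mult_ac)
qed

lemma lift_v_mult: assumes "fock_hom s" shows "lift_v s (x * y) = lift_v s x * lift_v s y"
  unfolding lift_v_def
proof (rule lin_ext_mult)
  fix k l :: "key \<times> int"
  have "(basis (0, (snd k + snd l, 0)) :: ((key \<times> (int \<times> int)) \<Rightarrow>\<^sub>0 complex) fps) = basis (0, (snd k, 0)) * basis (0, (snd l, 0))" by (simp add: basis_mult)
  then show "(case k + l of (k, j) \<Rightarrow> emb_v (s (basis k)) * basis (0, j, 0)) = (case k of (k, j) \<Rightarrow> emb_v (s (basis k)) * basis (0, j, 0)) * (case l of (k, j) \<Rightarrow> emb_v (s (basis k)) * basis (0, j, 0))"
    using fock_homD(2)[OF assms] by (simp add: case_prod_beta emb_v_mult basis_mult[symmetric, where 'a=key] mult_ac)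
qed

lemma lift_u_emb: assumes "fock_hom s" shows "lift_u s (emb x) = emb_u (s x)"
  by (rule A_linear_eqI[OF A_linear_comp[OF A_linear_lift_u A_linear_emb] A_linear_comp[OF A_linear_emb_u fock_homD(1)[OF assms]]]) (simp add: lift_u_def basis_00)
lemma lift_v_emb: assumes "fock_hom s" shows "lift_v s (emb x) = emb_v (s x)"
  by (rule A_linear_eqI[OF A_linear_comp[OF A_linear_lift_v A_linear_emb] A_linear_comp[OF A_linear_emb_v fock_homD(1)[OF assms]]]) (simp add: lift_v_def basis_00)
lemma lift_u_scalar_ser: assumes "fock_hom s" "scalar_ser r" shows "lift_u s r = emb_v r"
proof (rule A_linear_eqI_supp[OF A_linear_lift_u A_linear_emb_v])
  show "supp_in ({0} \<times> UNIV) r" using assms by (simp add: scalar_ser_def)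
qed (auto simp: lift_u_def basis_0 fock_homD[OF assms(1)])
lemma lift_v_scalar_ser: assumes "fock_hom s" "scalar_ser r" shows "lift_v s r = emb_u r"
proof (rule A_linear_eqI_supp[OF A_linear_lift_v A_linear_emb_u])
  show "supp_in ({0} \<times> UNIV) r" using assms by (simp add: scalar_ser_def)
qed (auto simp: lift_v_def basis_0 fock_homD[OF assms(1)])

lemma emb_u_emb: "emb_u (emb x) = emb x"
  by (rule A_linear_eqI[OF A_linear_comp[OF A_linear_emb_u A_linear_emb] A_linear_emb]) (simp add: zero_prod_def)
lemma emb_v_emb: "emb_v (emb x) = emb x"
  by (rule A_linear_eqI[OF A_linear_comp[OF A_linear_emb_v A_linear_emb] A_linear_emb]) (simp add: zero_prod_def)

definition good_shift :: "(nat \<times> nat \<Rightarrow> laurent) \<Rightarrow> (lat \<Rightarrow> laurent) \<Rightarrow> bool" where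
  "good_shift S g \<longleftrightarrow> (\<forall>a. scalar_ser (S a)) \<and> (\<forall>\<beta>. scalar_ser (g \<beta>)) \<and> mult_hom g"

definition shift_hom2 where
  "shift_hom2 S g T h = shift_hom (\<lambda>a. emb_u (S a) + emb_v (T a)) (\<lambda>\<beta>. emb_u (g \<beta>) * emb_v (h \<beta>))"

lemma good_shiftD: assumes "good_shift S g" shows "scalar_ser (S a)" "scalar_ser (g \<beta>)" "mult_hom g"
  using assms unfolding good_shift_def by blast+

lemma mult_hom_emb_u: "mult_hom g \<Longrightarrow> mult_hom (\<lambda>\<beta>. emb_u (g \<beta>))" by (simp add: mult_hom_def emb_u_mult)
lemma mult_hom_emb_v: "mult_hom g \<Longrightarrow> mult_hom (\<lambda>\<beta>. emb_v (g \<beta>))" by (simp add: mult_hom_def emb_v_mult)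

text \<open>The second homomorphism fixes the scalars introduced by the first, so the two shifts
  add. As the opposite order adds the same shifts, the two orders of a product differ in their
  contractions alone.\<close>

lemma lift_u_shift_hom: assumes "good_shift S g" "good_shift T h" shows "lift_u (shift_hom S g) (shift_hom T h x) = shift_hom2 S g T h x"
proof (rule fock_hom_eqI[of "\<lambda>x. lift_u (shift_hom S g) (shift_hom T h x)"])
  have g: "mult_hom g" "mult_hom h" using assms by (auto simp: good_shift_def)
  note v = fock_hom_shift_hom[OF g(1)]
  have gg: "mult_hom (\<lambda>\<beta>. emb_u (g \<beta>) * emb_v (h \<beta>))" using g by (intro mult_hom_mult mult_hom_emb_u mult_hom_emb_v)
  show "A_linear (\<lambda>x. lift_u (shift_hom S g) (shift_hom T h x))" by (rule A_linear_comp[OF A_linear_lift_u A_linear_shift_hom])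
  show "lift_u (shift_hom S g) (shift_hom T h (x * y)) = lift_u (shift_hom S g) (shift_hom T h x) * lift_u (shift_hom S g) (shift_hom T h y)" for x y
    by (simp add: shift_hom_mult[OF g(2)] lift_u_mult[OF v])
  show "lift_u (shift_hom S g) (shift_hom T h 1) = 1" using lift_u_emb[OF v, where x = 1] by (simp add: shift_hom_1[OF g(2)] shift_hom_1[OF g(1)])
  show "A_linear (shift_hom2 S g T h)" unfolding shift_hom2_def by (rule A_linear_shift_hom)
  show "shift_hom2 S g T h (x * y) = shift_hom2 S g T h x * shift_hom2 S g T h y" for x y unfolding shift_hom2_def by (rule shift_hom_mult[OF gg])
  show "shift_hom2 S g T h 1 = 1" unfolding shift_hom2_def by (rule shift_hom_1[OF gg])
  show "lift_u (shift_hom S g) (shift_hom T h (a_elt jk)) = shift_hom2 S g T h (a_elt jk)" for jk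
    by (simp add: shift_hom2_def shift_hom_a_elt g gg A_linear_add[OF A_linear_lift_u] lift_u_emb[OF v] lift_u_scalar_ser[OF v good_shiftD(1)[OF assms(2)]] A_linear_add[OF A_linear_emb_u] emb_u_emb add.assoc)
  show "lift_u (shift_hom S g) (shift_hom T h (e_elt \<beta>)) = shift_hom2 S g T h (e_elt \<beta>)" for \<beta>
    using assms by (simp add: shift_hom2_def shift_hom_e_elt lift_u_mult[OF v] lift_u_emb[OF v] lift_u_scalar_ser[OF v] good_shift_def emb_u_mult emb_u_emb mult.assoc)
qed

lemma lift_v_shift_hom: assumes "good_shift S g" "good_shift T h" shows "lift_v (shift_hom T h) (shift_hom S g x) = shift_hom2 S g T h x"
proof (rule fock_hom_eqI[of "\<lambda>x. lift_v (shift_hom T h) (shift_hom S g x)"])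
  have g: "mult_hom g" "mult_hom h" using assms by (auto simp: good_shift_def)
  note v = fock_hom_shift_hom[OF g(2)]
  have gg: "mult_hom (\<lambda>\<beta>. emb_u (g \<beta>) * emb_v (h \<beta>))" using g by (intro mult_hom_mult mult_hom_emb_u mult_hom_emb_v)
  show "A_linear (\<lambda>x. lift_v (shift_hom T h) (shift_hom S g x))" by (rule A_linear_comp[OF A_linear_lift_v A_linear_shift_hom])
  show "lift_v (shift_hom T h) (shift_hom S g (x * y)) = lift_v (shift_hom T h) (shift_hom S g x) * lift_v (shift_hom T h) (shift_hom S g y)" for x y
    by (simp add: shift_hom_mult[OF g(1)] lift_v_mult[OF v])
  show "lift_v (shift_hom T h) (shift_hom S g 1) = 1" using lift_v_emb[OF v, where x = 1] by (simp add: shift_hom_1[OF g(2)] shift_hom_1[OF g(1)])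
  show "A_linear (shift_hom2 S g T h)" unfolding shift_hom2_def by (rule A_linear_shift_hom)
  show "shift_hom2 S g T h (x * y) = shift_hom2 S g T h x * shift_hom2 S g T h y" for x y unfolding shift_hom2_def by (rule shift_hom_mult[OF gg])
  show "shift_hom2 S g T h 1 = 1" unfolding shift_hom2_def by (rule shift_hom_1[OF gg])
  show "lift_v (shift_hom T h) (shift_hom S g (a_elt jk)) = shift_hom2 S g T h (a_elt jk)" for jk
    by (simp add: shift_hom2_def shift_hom_a_elt g gg A_linear_add[OF A_linear_lift_v] lift_v_emb[OF v] lift_v_scalar_ser[OF v good_shiftD(1)[OF assms(1)]] A_linear_add[OF A_linear_emb_v] emb_v_emb add_ac)
  show "lift_v (shift_hom T h) (shift_hom S g (e_elt \<beta>)) = shift_hom2 S g T h (e_elt \<beta>)" for \<beta>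
    using assms by (simp add: shift_hom2_def shift_hom_e_elt lift_v_mult[OF v] lift_v_emb[OF v] lift_v_scalar_ser[OF v] good_shift_def emb_v_mult emb_v_emb mult_ac)
qed

lemma emb_eq_shift_hom: "(emb :: fock \<Rightarrow> laurent) = shift_hom (\<lambda>_. 0) (\<lambda>_. 1)"
proof
  fix x :: fock
  show "(emb x :: laurent) = shift_hom (\<lambda>_. 0) (\<lambda>_. 1) x"
    by (rule fock_hom_eqI[of emb]) (simp_all add: A_linear_emb emb_mult A_linear_shift_hom shift_hom_mult shift_hom_1 mult_hom_1 shift_hom_a_elt shift_hom_e_elt)
qed

lemma scalar_ser_1: "scalar_ser 1" using scalar_ser_lin_pow[of 0 0] by (simp add: lin_pow_0)

lemma fock_hom_emb: "fock_hom (emb :: fock \<Rightarrow> laurent)" unfolding emb_eq_shift_hom by (rule fock_hom_shift_hom[OF mult_hom_1])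

definition lin_facs :: "complex list \<Rightarrow> laurent fps" where "lin_facs es = prod_list (map lin_fac es)"

lemma lin_facs_simps [simp]: "lin_facs [] = 1" "lin_facs (e # es) = lin_fac e * lin_facs es" "lin_facs (es @ fs) = lin_facs es * lin_facs fs"
  by (simp_all add: lin_facs_def)

text \<open>
  \<open>\<Prod>\<^sub>p (u - v + p\<hbar>) \<cdot> s(N(v)) = c \<Prod>\<^sub>q (u - v + q\<hbar>) \<cdot>
  N(v)\<close>
\<close>

definition exch :: "(fock \<Rightarrow> laurent) \<Rightarrow> fock fps \<Rightarrow> complex list \<Rightarrow> complex list \<Rightarrow> complex \<Rightarrow> bool" where
  "exch s N ps qs c \<longleftrightarrow> lin_facs ps * fps_map s N = cconst c * (lin_facs qs * fps_map emb N)"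

text \<open>Power series in v with Laurent coefficients in u contain the inverse of
  \<open>lin_fac e\<close>, so a common factor can be cancelled at once. For two-sided series the
  corresponding step is \<open>diff_op_inj\<close>.\<close>

lemma exch_cancel: "exch s N (e # ps) (e # qs) c \<Longrightarrow> exch s N ps qs c"
proof -
  assume "exch s N (e # ps) (e # qs) c"
  then have "lin_fac_inv e * (lin_fac e * (lin_facs ps * fps_map s N)) = lin_fac_inv e * (lin_fac e * (cconst c * (lin_facs qs * fps_map emb N)))"
    by (simp add: exch_def mult_ac)
  moreover have "lin_fac_inv e * (lin_fac e * X) = X" for X
    using lin_fac_inv[of e] unfolding mult.assoc[symmetric] mult.commute[of "lin_fac_inv e" "lin_fac e"] by simp
  ultimately show ?thesis by (simp add: exch_def)
qed

definition join_u :: "fock fps \<Rightarrow> laurent fps \<Rightarrow> int \<times> int \<Rightarrow> fock" where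
  "join_u M Y = (\<lambda>(a, b). if 0 \<le> b then ser_act (Y $ nat b) (to_ser M) a else 0)"
definition join_v :: "fock fps \<Rightarrow> laurent fps \<Rightarrow> int \<times> int \<Rightarrow> fock" where
  "join_v M Y = (\<lambda>(a, b). if 0 \<le> a then ser_act (Y $ nat a) (to_ser M) b else 0)"

lemma join_u_lin_fac: "join_u M (lin_fac e * Y) = diff_uv e (join_u M Y)"
proof (intro ext, clarify)
  fix a b :: int
  show "join_u M (lin_fac e * Y) (a, b) = diff_uv e (join_u M Y) (a, b)"
  proof (cases "0 < b")
    case True
    then have b: "nat (b - 1) = nat b - 1" by auto
    show ?thesis using True
      by (simp add: join_u_def diff_op_def lin_fac_def left_diff_distrib lin_pow_1 distrib_right ser_act_add ser_act_diff ser_act_scl ser_act_scl1 ser_act_mult ser_act_basis basis_0 b)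
  qed (auto simp: join_u_def diff_op_def lin_fac_def left_diff_distrib lin_pow_1 distrib_right ser_act_add ser_act_diff ser_act_scl ser_act_scl1 ser_act_mult ser_act_basis basis_0)
qed

text \<open>In \<open>join_v\<close> the outer variable is u, so \<open>lin_fac e\<close> stands for
  v - u + e hbar = -(u - v - e hbar).\<close>

lemma join_v_lin_fac: "join_v M (lin_fac e * Y) = (\<lambda>x. - diff_uv (- e) (join_v M Y) x)"
proof (intro ext, clarify)
  fix a b :: int
  show "join_v M (lin_fac e * Y) (a, b) = - diff_uv (- e) (join_v M Y) (a, b)"
  proof (cases "0 < a")
    case True
    then have b: "nat (a - 1) = nat a - 1" by auto
    show ?thesis using True
      by (simp add: join_v_def diff_op_def lin_fac_def left_diff_distrib lin_pow_1 distrib_right ser_act_add ser_act_diff ser_act_scl ser_act_scl1 ser_act_mult ser_act_basis basis_0 b hb_minus scl_minus)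
  qed (auto simp: join_v_def diff_op_def lin_fac_def left_diff_distrib lin_pow_1 distrib_right ser_act_add ser_act_diff ser_act_scl ser_act_scl1 ser_act_mult ser_act_basis basis_0 hb_minus scl_minus)
qed

lemma join_u_cconst: "join_u M (cconst c * Y) = (\<lambda>x. scl (fps_const c) * join_u M Y x)"
  by (auto simp: join_u_def cconst_def ser_act_scl fun_eq_iff)
lemma join_v_cconst: "join_v M (cconst c * Y) = (\<lambda>x. scl (fps_const c) * join_v M Y x)"
  by (auto simp: join_v_def cconst_def ser_act_scl fun_eq_iff)

lemma join_u_lin_facs: "join_u M (lin_facs es * Y) = diff_uvs es (join_u M Y)"
  by (induction es) (simp_all add: mult.assoc join_u_lin_fac)

lemma join_v_lin_facs: "join_v M (lin_facs es * Y) = (\<lambda>x. scl (fps_const ((-1) ^ length es)) * diff_uvs (map uminus es) (join_v M Y) x)"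
proof (induction es)
  case (Cons e es)
  show ?case by (simp add: mult.assoc join_v_lin_fac Cons diff_op_scl scl_minus flip: fps_const_neg)
qed simp

definition normal_prod :: "(nat \<times> nat \<Rightarrow> laurent) \<Rightarrow> (lat \<Rightarrow> laurent) \<Rightarrow> fock fps \<Rightarrow> (nat \<times> nat \<Rightarrow> laurent) \<Rightarrow> (lat \<Rightarrow> laurent) \<Rightarrow> fock fps \<Rightarrow> fock \<Rightarrow> int \<times> int \<Rightarrow> fock" where
  "normal_prod S g M T h N x = ser_act (shift_hom2 S g T h x) (\<lambda>(a, b). to_ser M a * to_ser N b)"

lemma field_ser_0: "A_linear s \<Longrightarrow> field_ser s M m 0 = 0" by (rule A_linear_0[OF A_linear_field_ser])

lemma exchange_u:
  assumes "good_shift S g" "good_shift T h" "exch (shift_hom S g) N ps qs c"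
  shows "diff_uvs ps (\<lambda>(a, b). field_ser (shift_hom S g) M a (field_ser (shift_hom T h) N b x)) = (\<lambda>e. scl (fps_const c) * diff_uvs qs (normal_prod S g M T h N x) e)"
proof -
  have g: "mult_hom g" using assms by (simp add: good_shift_def)
  have 1: "(\<lambda>(a, b). field_ser (shift_hom S g) M a (field_ser (shift_hom T h) N b x)) = ser_act (shift_hom2 S g T h x) (join_u M (fps_map (shift_hom S g) N))"
  proof -
    have "(\<lambda>(a, b). field_ser (shift_hom S g) M a (to_ser N b)) = join_u M (fps_map (shift_hom S g) N)"
      by (auto simp: join_u_def fun_eq_iff to_ser_def field_ser_0[OF A_linear_shift_hom]) (simp add: field_ser_def to_ser_def[abs_def])
    then show ?thesis by (auto simp: fun_eq_iff field_ser_field_ser_u[OF fock_hom_shift_hom[OF g]] lift_u_shift_hom[OF assms(1,2)])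
  qed
  have 2: "join_u M (fps_map emb N) = (\<lambda>(a, b). to_ser M a * to_ser N b)"
    by (auto simp: join_u_def fun_eq_iff ser_act_emb to_ser_def)
  have 3: "diff_uvs ps (join_u M (fps_map (shift_hom S g) N)) = (\<lambda>e. scl (fps_const c) * diff_uvs qs (join_u M (fps_map emb N)) e)"
    unfolding join_u_lin_facs[symmetric] join_u_cconst[symmetric] assms(3)[unfolded exch_def] ..
  show ?thesis
    unfolding 1 normal_prod_def diff_uvs_ser_act_commute 3 2 by (rule ext) (rule ser_act_mult2)
qed

text \<open>Every linear factor of either list changes its sign when u and v trade places
  (\<open>join_v_lin_facs\<close>). The sign belonging to \<open>ps\<close> is its own inverse and
  moves to the other side.\<close>

lemma exchange_v:
  assumes "good_shift S g" "good_shift T h" "exch (shift_hom T h) M ps qs c"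
  shows "diff_uvs (map uminus ps) (\<lambda>(a, b). field_ser (shift_hom T h) N b (field_ser (shift_hom S g) M a x)) = (\<lambda>e. scl (fps_const (c * (-1) ^ (length ps + length qs))) * diff_uvs (map uminus qs) (normal_prod S g M T h N x) e)"
proof -
  have g: "mult_hom h" using assms by (simp add: good_shift_def)
  have 1: "(\<lambda>(a, b). field_ser (shift_hom T h) N b (field_ser (shift_hom S g) M a x)) = ser_act (shift_hom2 S g T h x) (join_v N (fps_map (shift_hom T h) M))"
  proof -
    have "(\<lambda>(a, b). field_ser (shift_hom T h) N b (to_ser M a)) = join_v N (fps_map (shift_hom T h) M)"
      by (auto simp: join_v_def fun_eq_iff to_ser_def field_ser_0[OF A_linear_shift_hom]) (simp add: field_ser_def to_ser_def[abs_def])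
    then show ?thesis by (auto simp: fun_eq_iff field_ser_field_ser_v[OF fock_hom_shift_hom[OF g]] lift_v_shift_hom[OF assms(1,2)])
  qed
  have 2: "join_v N (fps_map emb M) = (\<lambda>(a, b). to_ser M a * to_ser N b)"
    by (auto simp: join_v_def fun_eq_iff ser_act_emb to_ser_def)
  have 3: "(\<lambda>x. scl (fps_const ((-1) ^ length ps)) * diff_uvs (map uminus ps) (join_v N (fps_map (shift_hom T h) M)) x)
     = (\<lambda>e. scl (fps_const c) * (scl (fps_const ((-1) ^ length qs)) * diff_uvs (map uminus qs) (join_v N (fps_map emb M)) e))"
    using arg_cong[OF assms(3)[unfolded exch_def], of "join_v N"] unfolding join_v_cconst join_v_lin_facs .
  have 4: "diff_uvs (map uminus ps) (join_v N (fps_map (shift_hom T h) M)) = (\<lambda>e. scl (fps_const (c * (-1) ^ (length ps + length qs))) * diff_uvs (map uminus qs) (join_v N (fps_map emb M)) e)"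
  proof
    fix e
    let ?A = "scl (fps_const ((-1) ^ length ps)) :: fock" and ?B = "scl (fps_const ((-1) ^ length qs)) :: fock" and ?C = "scl (fps_const c) :: fock"
    have "(-1) ^ length ps * (-1) ^ length ps = (1 :: complex)" by (simp flip: power_mult_distrib)
    then have AA: "?A * ?A = 1" by (simp flip: scl_mult)
    have ACB: "?A * ?C * ?B = scl (fps_const (c * (-1) ^ (length ps + length qs)))"
      by (simp only: scl_mult[symmetric] fps_const_mult power_add mult_ac)
    have "diff_uvs (map uminus ps) (join_v N (fps_map (shift_hom T h) M)) e = ?A * (?A * diff_uvs (map uminus ps) (join_v N (fps_map (shift_hom T h) M)) e)"
      unfolding mult.assoc[symmetric] AA by simp
    also have "\<dots> = ?A * (?C * (?B * diff_uvs (map uminus qs) (join_v N (fps_map emb M)) e))"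
      using fun_cong[OF 3, of e] by simp
    finally show "diff_uvs (map uminus ps) (join_v N (fps_map (shift_hom T h) M)) e = scl (fps_const (c * (-1) ^ (length ps + length qs))) * diff_uvs (map uminus qs) (join_v N (fps_map emb M)) e"
      unfolding mult.assoc[symmetric] ACB .
  qed
  show ?thesis
    unfolding 1 normal_prod_def diff_uvs_ser_act_commute 4 2 by (rule ext) (rule ser_act_mult2)
qed

section \<open>Inner products, neighbours and signs for the D_n diagram\<close>

lemma ip_add_left: "ip (\<alpha> + \<beta>) \<gamma> = ip \<alpha> \<gamma> + ip \<beta> \<gamma>"
proof -
  have sup: "ip \<delta> \<gamma> = (\<Sum>l\<in>K. Poly_Mapping.lookup \<delta> l * Poly_Mapping.lookup \<gamma> l)" if "finite K" "Poly_Mapping.keys \<delta> \<subseteq> K" for \<delta> K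
    unfolding ip_def using that by (intro sum.mono_neutral_left) (auto simp: in_keys_iff)
  let ?K = "Poly_Mapping.keys \<alpha> \<union> Poly_Mapping.keys \<beta>"
  have "ip (\<alpha> + \<beta>) \<gamma> = (\<Sum>l\<in>?K. Poly_Mapping.lookup (\<alpha> + \<beta>) l * Poly_Mapping.lookup \<gamma> l)"
    by (rule sup) (auto dest: Poly_Mapping.keys_add[THEN subsetD])
  then show ?thesis using sup[of ?K \<alpha>] sup[of ?K \<beta>] by (simp add: lookup_add distrib_right sum.distrib)
qed

lemma ip_eps: "ip (eps l) \<gamma> = Poly_Mapping.lookup \<gamma> l"
  by (simp add: ip_def eps_def)

lemma ip_alpha: "ip (alpha n i) \<gamma> = (if i = n then Poly_Mapping.lookup \<gamma> (n - 1) + Poly_Mapping.lookup \<gamma> n else Poly_Mapping.lookup \<gamma> i - Poly_Mapping.lookup \<gamma> (i + 1))"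
  using ip_add_left[of "eps i" "- eps (i + 1)" \<gamma>]
  by (simp add: alpha_def ip_add_left ip_eps ip_minus)

lemma lookup_eps: "Poly_Mapping.lookup (eps l) m = (if l = m then 1 else 0)"
  by (simp add: eps_def lookup_single when_def)

lemma nbrs_iff:
  assumes "3 \<le> n" "i \<in> {1..n}" "j \<in> {1..n}"
  shows "i \<in> nbrs n j \<longleftrightarrow> (if j = n then i = n - 2 else (i + 1 = j \<or> i = j + 1 \<and> i < n \<or> j = n - 2 \<and> i = n))"
proof -
  \<comment> \<open>Substituting n = m + 3 turns the truncated differences n - 2 and n - 3 into sums
    before arithmetic decides the cases.\<close>
  obtain m where m: "n = m + 3" using assms(1) by (metis add.commute le_Suc_ex)
  show ?thesis using assms unfolding m nbrs_def by simp presburger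
qed

lemma ip_alpha_alpha:
  assumes "3 \<le> n" "i \<in> {1..n}" "j \<in> {1..n}"
  shows "ip (alpha n i) (alpha n j) = (if i = j then 2 else if i \<in> nbrs n j then -1 else 0)"
proof -
  obtain m where m: "n = m + 3" using assms(1) by (metis add.commute le_Suc_ex)
  have lk: "Poly_Mapping.lookup (alpha n j) l = (if j = n then (if l = n - 1 then 1 else 0) + (if l = n then 1 else 0)
      else (if l = j then 1 else 0) - (if l = j + 1 then 1 else 0))" for l
    by (auto simp: alpha_def lookup_add lookup_minus lookup_eps)
  consider "i = n" "j = n" | "i = n" "j \<noteq> n" | "i \<noteq> n" "j = n" | "i \<noteq> n" "j \<noteq> n" by blast
  then show ?thesis unfolding ip_alpha lk nbrs_iff[OF assms] using assms unfolding m by cases ((simp; presburger)+)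
qed

lemma nbrs_sym:
  assumes "3 \<le> n" "i \<in> {1..n}" "j \<in> {1..n}" "i \<in> nbrs n j" shows "j \<in> nbrs n i"
  using assms unfolding nbrs_def by (auto split: if_splits)

lemma nbrs_irrefl: assumes "3 \<le> n" "j \<in> {1..n}" shows "j \<notin> nbrs n j"
  using assms unfolding nbrs_def by (auto split: if_splits)

lemma nbrs_subset: assumes "3 \<le> n" "j \<in> {1..n}" shows "nbrs n j \<subseteq> {0..n}"
  using assms unfolding nbrs_def by (auto split: if_splits)

lemma finite_nbrs [simp]: "finite (nbrs n j)"
  by (simp add: nbrs_def)

text \<open>The exponents 2-colour the diagram: their parity is that of j - 1 up to vertex n - 1,
  and vertex n gets the parity of n so that both ends of the fork differ from vertex n - 2.\<close>

lemma sgn_adj: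
  assumes "3 \<le> n" "i \<in> {1..n}" "j \<in> {1..n}" "i \<in> nbrs n j"
  shows "(-1 :: complex) ^ sgn_exp n i = - ((-1) ^ sgn_exp n j)"
proof -
  have "even (sgn_exp n i) \<longleftrightarrow> odd (sgn_exp n j)"
  proof -
    have p: "even (sgn_exp n k) \<longleftrightarrow> (if k = n then even n else odd k)" if "k \<in> {1..n}" for k
    proof -
      obtain m where m: "n = m + 3" using assms(1) by (metis add.commute le_Suc_ex)
      show ?thesis using that unfolding sgn_exp_def m by simp presburger
    qed
    show ?thesis using assms unfolding p[OF assms(2)] p[OF assms(3)] nbrs_iff[OF assms(1-3)]
      by (auto split: if_splits)
  qed
  then show ?thesis by (cases "even (sgn_exp n i)") (auto simp: minus_one_power_iff)
qed

text \<open>The shift adds (u + c hbar)^(-k) to a_(i,-k); summed with the weights (v + d hbar)^k / k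
  this is the logarithm \<open>log_fac c d\<close>. The list \<open>cs\<close> lets one lemma serve
  E, F and the difference in H^+.\<close>

lemma fps_map_shift_hom_cre_ser:
  assumes g: "mult_hom g" and S: "\<And>j k. S (j, k) = (if j = i then \<Sum>(e, c)\<leftarrow>cs. e * ann_shift i c (j, k) else 0)" "i \<noteq> 0"
  shows "fps_map (shift_hom S g) (cre_ser j d) = fps_map emb (cre_ser j d) + (if j = i then \<Sum>(e, c)\<leftarrow>cs. fps_const e * log_fac c d else 0)"
proof -
  note v = fock_homD[OF fock_hom_shift_hom[OF g]]
  let ?r = "\<lambda>c. fps_const (lin_pow c (-1)) * fps_X :: laurent fps"
  have FIr: "in_filt 1 (?r c)" for c by (rule in_filt_mult_left[OF in_filt_X])
  have rn: "subst_v (?r c) log_ser $ k = scl (fps_const (1 / of_nat k)) * lin_pow c (- int k)" for c k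
  proof -
    have "hsum (\<lambda>l. log_ser $ l * (?r c ^ l) $ k) = log_ser $ k * (?r c ^ k) $ k"
      by (rule hsum_single) (simp add: power_mult_distrib fps_const_power)
    then show ?thesis by (simp add: subst_v_def log_ser_def power_mult_distrib fps_const_power lin_pow_power)
  qed
  have L: "fps_map (shift_hom S g) (cre_gen j) = fps_map emb (cre_gen j) + (if j = i then \<Sum>(e, c)\<leftarrow>cs. fps_const e * subst_v (?r c) log_ser else 0)"
  proof (rule fps_ext)
    fix k
    have nthl: "(\<Sum>(e, c)\<leftarrow>cs'. fps_const e * subst_v (?r c) log_ser) $ k = scl (fps_const (1 / of_nat k)) * (\<Sum>(e, c)\<leftarrow>cs'. e * lin_pow c (- int k))" for cs' k
      by (induction cs') (auto simp: rn distrib_left mult.left_commute)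
    show "fps_map (shift_hom S g) (cre_gen j) $ k = (fps_map emb (cre_gen j) + (if j = i then \<Sum>(e, c)\<leftarrow>cs. fps_const e * subst_v (?r c) log_ser else 0)) $ k"
    proof (cases "j = i \<and> k \<noteq> 0")
      case True
      then have "S (j, k) = (\<Sum>(e, c)\<leftarrow>cs. e * lin_pow c (- int k))" using S by (simp add: ann_shift_def cong: map_cong)
      then show ?thesis using True S(2)
        by (simp add: cre_gen_def A_linear_scl[OF v(1)] A_linear_scl[OF A_linear_emb] shift_hom_a_elt[OF g] distrib_left nthl)
    next
      case False
      then show ?thesis using S(2)
        by (auto simp: cre_gen_def A_linear_scl[OF v(1)] A_linear_scl[OF A_linear_emb] A_linear_0[OF v(1)] A_linear_0[OF A_linear_emb] shift_hom_a_elt[OF g] S(1) nthl)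
    qed
  qed
  have Lgr: "subst_v (v_plus d) (subst_v (?r c) log_ser) = log_fac c d" for c
    unfolding log_fac_def subst_v_subst_v[OF in_filt_v_plus FIr] subst_v_const_mult[OF in_filt_v_plus] subst_v_X[OF in_filt_v_plus] ..
  have sbl: "subst_v (v_plus d) (\<Sum>(e, c)\<leftarrow>cs'. fps_const e * subst_v (?r c) log_ser) = (\<Sum>(e, c)\<leftarrow>cs'. fps_const e * log_fac c d)" for cs'
    by (induction cs') (auto simp: subst_v_0[OF in_filt_v_plus] subst_v_add[OF in_filt_v_plus] subst_v_const_mult[OF in_filt_v_plus] Lgr)
  note vi = fock_homD[OF fock_hom_emb]
  have "fps_map (shift_hom S g) (cre_ser j d) = subst_v (v_plus d) (fps_map (shift_hom S g) (cre_gen j))"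
    unfolding cre_ser_def fps_map_subst_v[OF v in_filt_v_plus] fps_map_v_plus[OF v] ..
  also have "\<dots> = subst_v (v_plus d) (fps_map emb (cre_gen j)) + (if j = i then \<Sum>(e, c)\<leftarrow>cs. fps_const e * log_fac c d else 0)"
    unfolding L by (simp add: subst_v_add[OF in_filt_v_plus] sbl subst_v_0[OF in_filt_v_plus])
  also have "subst_v (v_plus d) (fps_map emb (cre_gen j)) = (fps_map emb (cre_ser j d) :: laurent fps)"
    unfolding cre_ser_def fps_map_subst_v[OF vi in_filt_v_plus] fps_map_v_plus[OF vi] ..
  finally show ?thesis .
qed

text \<open>
  The homomorphism \<open>s\<close> adds \<open>K\<close> to the creation series with index \<open>i\<close> and
  fixes the others; \<open>exp (K d)\<close> is, up to the unit \<open>z\<close>, the quotient of the linear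
  factors listed in \<open>Nm d\<close> and \<open>Dn d\<close>.
\<close>

locale vertex_hom =
  fixes n i :: nat and s :: "fock \<Rightarrow> laurent" and K :: "complex \<Rightarrow> laurent fps" and z z' :: laurent and \<epsilon> :: complex
    and Nm Dn :: "complex \<Rightarrow> complex list" and g :: "lat \<Rightarrow> laurent"
  assumes n: "3 \<le> n" and i: "i \<in> {1..n}" and s: "fock_hom s" and FK: "\<And>d. in_filt 1 (K d)"
    and sC: "\<And>j d. fps_map s (cre_ser j d) = fps_map emb (cre_ser j d) + (if j = i then K d else 0)"
    and zz: "z * z' = 1"
    and K1: "\<And>d. lin_facs (Dn d) * EXP (K d) = fps_const z * lin_facs (Nm d)"
    and K2: "\<And>d. lin_facs (Nm d) * EXP (- K d) = fps_const z' * lin_facs (Dn d)"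
    and sev: "\<And>\<gamma>. s (e_elt \<gamma>) = emb (e_elt \<gamma>) * g \<gamma>"
    and g: "\<And>\<gamma>. ip (alpha n i) \<gamma> = 0 \<Longrightarrow> g \<gamma> = 1"
      "\<And>\<gamma>. ip (alpha n i) \<gamma> = 1 \<Longrightarrow> g \<gamma> = scl (fps_const \<epsilon>) * z'"
      "\<And>\<gamma>. ip (alpha n i) \<gamma> = -1 \<Longrightarrow> g \<gamma> = scl (fps_const \<epsilon>) * z"
      "\<And>\<gamma>. ip (alpha n i) \<gamma> = 2 \<Longrightarrow> g \<gamma> = z' * z'"
      "\<And>\<gamma>. ip (alpha n i) \<gamma> = -2 \<Longrightarrow> g \<gamma> = z * z"
begin

lemmas sv = fock_homD[OF s]
lemmas vi = fock_homD[OF fock_hom_emb]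

lemma fps_map_vertex:
  assumes "in_filt 1 C" "fps_map s C = fps_map emb C + X" "in_filt 1 X"
  shows "fps_map s (fps_const (e_elt \<gamma>) * EXP C) = fps_map emb (fps_const (e_elt \<gamma>) * EXP C) * (fps_const (g \<gamma>) * EXP X)"
proof -
  have "fps_map s (fps_const (e_elt \<gamma>) * EXP C) = fps_const (emb (e_elt \<gamma>)) * fps_const (g \<gamma>) * (EXP (fps_map emb C) * EXP X)"
    by (simp add: fps_map_mult[OF sv] fps_map_const[OF sv] fps_map_EXP[OF sv assms(1)] assms(2) EXP_add[OF in_filt_fps_map[OF vi assms(1)] assms(3)] sev del: fps_const_mult) (simp add: mult_ac)
  also have "\<dots> = fps_map emb (fps_const (e_elt \<gamma>) * EXP C) * (fps_const (g \<gamma>) * EXP X)"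
    by (simp add: fps_map_mult[OF vi] fps_map_const[OF vi] fps_map_EXP[OF vi assms(1)] mult_ac del: fps_const_mult)
  finally show ?thesis .
qed

lemma sum_nbrs: "(\<Sum>l\<in>nbrs n j. fps_map s (cre_ser l d)) = (\<Sum>l\<in>nbrs n j. fps_map emb (cre_ser l d)) + (if i \<in> nbrs n j then K d else 0)"
  by (simp add: sC sum.distrib)

lemma sCE: "fps_map s (log_cre_E n j) = fps_map emb (log_cre_E n j) + ((if j = i then K (-1/4) + K (3/4) else 0) - (if i \<in> nbrs n j then K (1/4) else 0))"
  unfolding log_cre_E_def fps_map_add[OF sv] fps_map_diff[OF sv] fps_map_sum[OF sv] fps_map_add[OF vi] fps_map_diff[OF vi] fps_map_sum[OF vi] sum_nbrs
  unfolding sC by simp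
lemma sCF: "fps_map s (log_cre_F n j) = fps_map emb (log_cre_F n j) + ((if i \<in> nbrs n j then K (-1/4) else 0) - (if j = i then K (1/4) + K (-3/4) else 0))"
  unfolding log_cre_F_def fps_map_add[OF sv] fps_map_minus[OF sv] fps_map_sum[OF sv] fps_map_add[OF vi] fps_map_minus[OF vi] fps_map_sum[OF vi] sum_nbrs
  unfolding sC by simp
lemma sCH: "fps_map s (log_cre_H n j) = fps_map emb (log_cre_H n j) + ((if i \<in> nbrs n j then K (-1/2) - K (1/2) else 0) - (if j = i then K (-1) - K 1 else 0))"
  unfolding log_cre_H_def fps_map_add[OF sv] fps_map_minus[OF sv] fps_map_sum[OF sv] fps_map_diff[OF sv] fps_map_add[OF vi] fps_map_diff[OF vi] fps_map_minus[OF vi] fps_map_sum[OF vi] sum_subtractf sum_nbrs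
  unfolding sC by simp

lemma zz_fps: "fps_const z * fps_const z' = 1" using zz by simp

lemma exch_one: "exch s 1 [] [] 1" by (simp add: exch_def fps_map_1[OF sv] fps_map_1[OF vi])

context fixes j assumes j: "j \<in> {1..n}" begin

lemma ipj: "ip (alpha n i) (alpha n j) = (if i = j then 2 else if i \<in> nbrs n j then -1 else 0)"
  by (rule ip_alpha_alpha[OF n i j])

lemma exch_cre_E_far: assumes "i \<noteq> j" "i \<notin> nbrs n j" shows "exch s (cre_E n j) [] [] 1"
  using assms fps_map_vertex[OF in_filt_log_cre_E sCE, of j "alpha n j"] ipj g(1)[of "alpha n j"] by (simp add: exch_def cre_E_def)

lemma exch_cre_F_far: assumes "i \<noteq> j" "i \<notin> nbrs n j" shows "exch s (cre_F n j) [] [] 1"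
  using assms fps_map_vertex[OF in_filt_log_cre_F sCF, of j "- alpha n j"] ipj g(1)[of "- alpha n j"] by (simp add: exch_def cre_F_def ip_minus2)

lemma exch_cre_H_far: assumes "i \<noteq> j" "i \<notin> nbrs n j" shows "exch s (cre_H n j) [] [] 1"
  using assms fps_map_vertex[OF in_filt_log_cre_H sCH, of j 0] g(1)[of 0] by (simp add: exch_def cre_H_def)

text \<open>For adjacent vertices the pairing is -1: the zero mode contributes the sign and
  \<open>z\<close>, the creation part contributes \<open>z'\<close> through exp(-K). The two units
  cancel; this is the purpose of the powers of u in the vertex operators.\<close>

lemma exch_cre_E_adj: assumes "i \<noteq> j" "i \<in> nbrs n j" shows "exch s (cre_E n j) (Nm (1/4)) (Dn (1/4)) \<epsilon>"
proof -
  have "fps_map s (cre_E n j) = fps_map emb (cre_E n j) * (fps_const (scl (fps_const \<epsilon>) * z) * EXP (- K (1/4)))"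
    using assms fps_map_vertex[OF in_filt_log_cre_E sCE, of j "alpha n j"] ipj g(3)[of "alpha n j"] by (simp add: cre_E_def in_filt_minus FK)
  then have "lin_facs (Nm (1/4)) * fps_map s (cre_E n j) = fps_map emb (cre_E n j) * cconst \<epsilon> * fps_const z * (lin_facs (Nm (1/4)) * EXP (- K (1/4)))"
    by (simp add: cconst_def mult_ac flip: fps_const_mult)
  also have "\<dots> = fps_map emb (cre_E n j) * cconst \<epsilon> * (fps_const z * fps_const z') * lin_facs (Dn (1/4))" unfolding K2 by (simp only: mult_ac)
  finally show ?thesis unfolding zz_fps exch_def by (simp add: mult_ac)
qed

lemma exch_cre_F_adj: assumes "i \<noteq> j" "i \<in> nbrs n j" shows "exch s (cre_F n j) (Dn (-1/4)) (Nm (-1/4)) \<epsilon>"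
proof -
  have "fps_map s (cre_F n j) = fps_map emb (cre_F n j) * (fps_const (scl (fps_const \<epsilon>) * z') * EXP (K (-1/4)))"
    using assms fps_map_vertex[OF in_filt_log_cre_F sCF, of j "- alpha n j"] ipj g(2)[of "- alpha n j"] by (simp add: cre_F_def FK ip_minus2)
  then have "lin_facs (Dn (-1/4)) * fps_map s (cre_F n j) = fps_map emb (cre_F n j) * cconst \<epsilon> * fps_const z' * (lin_facs (Dn (-1/4)) * EXP (K (-1/4)))"
    by (simp add: cconst_def mult_ac flip: fps_const_mult)
  also have "\<dots> = fps_map emb (cre_F n j) * cconst \<epsilon> * (fps_const z * fps_const z') * lin_facs (Nm (-1/4))" unfolding K1 by (simp only: mult_ac)
  finally show ?thesis unfolding zz_fps exch_def by (simp add: mult_ac)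
qed

lemma exch_cre_H_adj: assumes "i \<noteq> j" "i \<in> nbrs n j" shows "exch s (cre_H n j) (Dn (-1/2) @ Nm (1/2)) (Nm (-1/2) @ Dn (1/2)) 1"
proof -
  have "fps_map s (cre_H n j) = fps_map emb (cre_H n j) * (EXP (K (-1/2)) * EXP (- K (1/2)))"
    using assms fps_map_vertex[OF in_filt_log_cre_H sCH, of j 0] g(1)[of 0] by (simp add: cre_H_def in_filt_diff FK EXP_diff)
  then have "lin_facs (Dn (-1/2) @ Nm (1/2)) * fps_map s (cre_H n j) = fps_map emb (cre_H n j) * (lin_facs (Dn (-1/2)) * EXP (K (-1/2))) * (lin_facs (Nm (1/2)) * EXP (- K (1/2)))"
    by (simp add: mult_ac)
  also have "\<dots> = fps_map emb (cre_H n j) * (fps_const z * fps_const z') * (lin_facs (Nm (-1/2)) * lin_facs (Dn (1/2)))" unfolding K1 K2 by (simp only: mult_ac)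
  finally show ?thesis unfolding zz_fps exch_def by (simp add: mult_ac)
qed

lemma exch_cre_E_same: assumes "i = j" shows "exch s (cre_E n j) (Dn (-1/4) @ Dn (3/4)) (Nm (-1/4) @ Nm (3/4)) 1"
proof -
  have "fps_map s (cre_E n j) = fps_map emb (cre_E n j) * (fps_const (z' * z') * (EXP (K (-1/4)) * EXP (K (3/4))))"
    using assms fps_map_vertex[OF in_filt_log_cre_E sCE, of j "alpha n j"] ipj g(4)[of "alpha n j"] nbrs_irrefl[OF n j] by (simp add: cre_E_def in_filt_add FK EXP_add)
  then have "lin_facs (Dn (-1/4) @ Dn (3/4)) * fps_map s (cre_E n j) = fps_map emb (cre_E n j) * fps_const z' * fps_const z' * (lin_facs (Dn (-1/4)) * EXP (K (-1/4))) * (lin_facs (Dn (3/4)) * EXP (K (3/4)))"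
    by (simp add: mult_ac flip: fps_const_mult)
  also have "\<dots> = fps_map emb (cre_E n j) * (fps_const z * fps_const z') * (fps_const z * fps_const z') * (lin_facs (Nm (-1/4)) * lin_facs (Nm (3/4)))" unfolding K1 by (simp only: mult_ac)
  finally show ?thesis unfolding zz_fps exch_def by (simp add: mult_ac)
qed

lemma exch_cre_F_same: assumes "i = j" shows "exch s (cre_F n j) (Nm (1/4) @ Nm (-3/4)) (Dn (1/4) @ Dn (-3/4)) 1"
proof -
  have "fps_map s (cre_F n j) = fps_map emb (cre_F n j) * (fps_const (z * z) * (EXP (- K (1/4)) * EXP (- K (-3/4))))"
    using assms fps_map_vertex[OF in_filt_log_cre_F sCF, of j "- alpha n j"] ipj g(5)[of "- alpha n j"] nbrs_irrefl[OF n j] EXP_add[OF in_filt_minus[OF FK[of "1/4"]] in_filt_minus[OF FK[of "-3/4"]]]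
    by (simp add: cre_F_def in_filt_add in_filt_diff in_filt_minus FK ip_minus2)
  then have "lin_facs (Nm (1/4) @ Nm (-3/4)) * fps_map s (cre_F n j) = fps_map emb (cre_F n j) * fps_const z * fps_const z * (lin_facs (Nm (1/4)) * EXP (- K (1/4))) * (lin_facs (Nm (-3/4)) * EXP (- K (-3/4)))"
    by (simp add: mult_ac flip: fps_const_mult)
  also have "\<dots> = fps_map emb (cre_F n j) * (fps_const z * fps_const z') * (fps_const z * fps_const z') * (lin_facs (Dn (1/4)) * lin_facs (Dn (-3/4)))" unfolding K2 by (simp only: mult_ac)
  finally show ?thesis unfolding zz_fps exch_def by (simp add: mult_ac)
qed

lemma exch_cre_H_same: assumes "i = j" shows "exch s (cre_H n j) (Nm (-1) @ Dn 1) (Dn (-1) @ Nm 1) 1"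
proof -
  have "fps_map s (cre_H n j) = fps_map emb (cre_H n j) * (EXP (K 1) * EXP (- K (-1)))"
    using assms fps_map_vertex[OF in_filt_log_cre_H sCH, of j 0] g(1)[of 0] nbrs_irrefl[OF n j] by (simp add: cre_H_def in_filt_diff in_filt_minus FK EXP_diff)
  then have "lin_facs (Nm (-1) @ Dn 1) * fps_map s (cre_H n j) = fps_map emb (cre_H n j) * (lin_facs (Dn 1) * EXP (K 1)) * (lin_facs (Nm (-1)) * EXP (- K (-1)))"
    by (simp add: mult_ac)
  also have "\<dots> = fps_map emb (cre_H n j) * (fps_const z * fps_const z') * (lin_facs (Nm 1) * lin_facs (Dn (-1)))" unfolding K1 K2 by (simp only: mult_ac)
  finally show ?thesis unfolding zz_fps exch_def by (simp add: mult_ac)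
qed

end

end

lemma lin_fac_EXP_log_fac: "lin_fac (c - d) * EXP (log_fac c d) = fps_const (lin_pow c 1)"
  unfolding EXP_log_fac using lin_fac_inv[of "c - d"] by (simp add: mult.left_commute)

lemma zpow_val_vals:
  "ip \<gamma> \<beta> = 0 \<Longrightarrow> zpow_val t c \<gamma> \<beta> = 1"
  "ip \<gamma> \<beta> = 1 \<Longrightarrow> zpow_val t c \<gamma> \<beta> = scl (fps_const ((-1) ^ t)) * lin_pow c 1"
  "ip \<gamma> \<beta> = -1 \<Longrightarrow> zpow_val t c \<gamma> \<beta> = scl (fps_const ((-1) ^ t)) * lin_pow c (-1)"
  "ip \<gamma> \<beta> = 2 \<Longrightarrow> zpow_val t c \<gamma> \<beta> = lin_pow c 1 * lin_pow c 1"
  "ip \<gamma> \<beta> = -2 \<Longrightarrow> zpow_val t c \<gamma> \<beta> = lin_pow c (-1) * lin_pow c (-1)"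
proof -
  have 1: "inverse ((-1 :: complex) ^ t) = (-1) ^ t" by (simp flip: power_inverse)
  have 2: "((-1 :: complex) ^ t) ^ 2 = 1" by (simp flip: power_mult)
  have 3: "(x :: complex) powi 2 = x ^ 2" "x powi (-2) = inverse x ^ 2" for x by (simp_all add: power_int_def)
  show "ip \<gamma> \<beta> = 0 \<Longrightarrow> zpow_val t c \<gamma> \<beta> = 1" "ip \<gamma> \<beta> = 1 \<Longrightarrow> zpow_val t c \<gamma> \<beta> = scl (fps_const ((-1) ^ t)) * lin_pow c 1"
    "ip \<gamma> \<beta> = -1 \<Longrightarrow> zpow_val t c \<gamma> \<beta> = scl (fps_const ((-1) ^ t)) * lin_pow c (-1)"
    by (simp_all add: zpow_val_def lin_pow_0 1)
  show "ip \<gamma> \<beta> = 2 \<Longrightarrow> zpow_val t c \<gamma> \<beta> = lin_pow c 1 * lin_pow c 1"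
    "ip \<gamma> \<beta> = -2 \<Longrightarrow> zpow_val t c \<gamma> \<beta> = lin_pow c (-1) * lin_pow c (-1)"
    by (simp_all add: zpow_val_def 1 2 3 lin_pow_add[symmetric])
qed

text \<open>The exponential in E contributes 1 - (v + d hbar)/(u - hbar/4), that is, one factor in
  the numerator and the unit (u - hbar/4)^(-1). F contributes such a factor in the denominator, H^+
  a quotient of two.\<close>

lemma vertex_hom_E:
  assumes "3 \<le> n" "i \<in> {1..n}"
  shows "vertex_hom n i (hom_E n i) (\<lambda>d. - log_fac (-1/4) d) (lin_pow (-1/4) (-1)) (lin_pow (-1/4) 1) ((-1) ^ sgn_exp n i)
    (\<lambda>d. [-1/4 - d]) (\<lambda>d. []) (zpow_val (sgn_exp n i) (-1/4) (alpha n i))"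
proof
  show "fps_map (hom_E n i) (cre_ser j d) = fps_map emb (cre_ser j d) + (if j = i then - log_fac (-1/4) d else 0)" for j d
    unfolding hom_E_def using fps_map_shift_hom_cre_ser[OF mult_hom_zpow_val, of "\<lambda>jk. - ann_shift i (-1/4) jk" i "[(-1, -1/4)]"] assms by (simp add: ann_shift_def flip: fps_const_neg)
  show "lin_facs [-1/4 - d] * EXP (- (- log_fac (-1/4) d)) = fps_const (lin_pow (-1/4) 1) * lin_facs []" for d
    using lin_fac_EXP_log_fac[of "-1/4" d] by simp
qed (use assms in \<open>simp_all add: hom_E_def fock_hom_shift_hom mult_hom_zpow_val in_filt_log_fac in_filt_minus EXP_log_fac_minus lin_pow_inv shift_hom_e_elt zpow_val_vals\<close>)

lemma vertex_hom_F:
  assumes "3 \<le> n" "i \<in> {1..n}"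
  shows "vertex_hom n i (hom_F n i) (\<lambda>d. log_fac (1/4) d) (lin_pow (1/4) 1) (lin_pow (1/4) (-1)) ((-1) ^ sgn_exp n i)
    (\<lambda>d. []) (\<lambda>d. [1/4 - d]) (zpow_val (sgn_exp n i) (1/4) (- alpha n i))"
proof
  show "fps_map (hom_F n i) (cre_ser j d) = fps_map emb (cre_ser j d) + (if j = i then log_fac (1/4) d else 0)" for j d
    unfolding hom_F_def using fps_map_shift_hom_cre_ser[OF mult_hom_zpow_val, of "ann_shift i (1/4)" i "[(1, 1/4)]"] assms by (simp add: ann_shift_def)
qed (use assms in \<open>simp_all add: hom_F_def fock_hom_shift_hom mult_hom_zpow_val in_filt_log_fac EXP_log_fac_minus lin_pow_inv shift_hom_e_elt zpow_val_vals ip_minus lin_fac_EXP_log_fac\<close>)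

lemma vertex_hom_H:
  assumes "3 \<le> n" "i \<in> {1..n}"
  shows "vertex_hom n i (hom_H n i) (\<lambda>d. log_fac (1/2) d - log_fac (-1/2) d) (lin_pow (-1/2) (-1) * lin_pow (1/2) 1) (lin_pow (-1/2) 1 * lin_pow (1/2) (-1)) 1
    (\<lambda>d. [-1/2 - d]) (\<lambda>d. [1/2 - d]) (H_weight n i)"
proof
  show "fps_map (hom_H n i) (cre_ser j d) = fps_map emb (cre_ser j d) + (if j = i then log_fac (1/2) d - log_fac (-1/2) d else 0)" for j d
    unfolding hom_H_def using fps_map_shift_hom_cre_ser[OF mult_hom_H_weight, of "\<lambda>jk. - (ann_shift i (-1/2) jk - ann_shift i (1/2) jk)" i "[(1, 1/2), (-1, -1/2)]"] assms by (simp add: ann_shift_def flip: fps_const_neg)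
  fix d :: complex
  have 1: "lin_fac (1/2 - d) * EXP (log_fac (1/2) d) = fps_const (lin_pow (1/2) 1)" by (rule lin_fac_EXP_log_fac)
  have 2: "EXP (- log_fac (-1/2) d) = fps_const (lin_pow (-1/2) (-1)) * lin_fac (-1/2 - d)" by (rule EXP_log_fac_minus)
  have 3: "lin_fac (-1/2 - d) * EXP (log_fac (-1/2) d) = fps_const (lin_pow (-1/2) 1)" by (rule lin_fac_EXP_log_fac)
  have 4: "EXP (- log_fac (1/2) d) = fps_const (lin_pow (1/2) (-1)) * lin_fac (1/2 - d)" by (rule EXP_log_fac_minus)
  have "lin_facs [1/2 - d] * EXP (log_fac (1/2) d - log_fac (-1/2) d) = (lin_fac (1/2 - d) * EXP (log_fac (1/2) d)) * EXP (- log_fac (-1/2) d)"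
    by (simp add: EXP_diff in_filt_log_fac mult_ac)
  also have "\<dots> = fps_const (lin_pow (-1/2) (-1) * lin_pow (1/2) 1) * lin_facs [-1/2 - d]"
    unfolding 1 2 by (simp add: mult_ac flip: fps_const_mult)
  finally show "lin_facs [1/2 - d] * EXP (log_fac (1/2) d - log_fac (-1/2) d) = fps_const (lin_pow (-1/2) (-1) * lin_pow (1/2) 1) * lin_facs [-1/2 - d]" .
  have "lin_facs [-1/2 - d] * EXP (- (log_fac (1/2) d - log_fac (-1/2) d)) = (lin_fac (-1/2 - d) * EXP (log_fac (-1/2) d)) * EXP (- log_fac (1/2) d)"
    unfolding minus_diff_eq by (simp add: EXP_diff in_filt_log_fac mult_ac)
  also have "\<dots> = fps_const (lin_pow (-1/2) 1 * lin_pow (1/2) (-1)) * lin_facs [1/2 - d]"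
    unfolding 3 4 by (simp add: mult_ac flip: fps_const_mult)
  finally show "lin_facs [-1/2 - d] * EXP (- (log_fac (1/2) d - log_fac (-1/2) d)) = fps_const (lin_pow (-1/2) 1 * lin_pow (1/2) (-1)) * lin_facs [1/2 - d]" .
next
  have "(lin_pow (-1/2) (-1) * lin_pow (1/2) 1) * (lin_pow (-1/2) 1 * lin_pow (1/2) (-1)) = (lin_pow (-1/2) (-1) * lin_pow (-1/2) 1) * (lin_pow (1/2) 1 * lin_pow (1/2) (-1) :: laurent)"
    by (simp only: mult_ac)
  then show "(lin_pow (-1/2) (-1) * lin_pow (1/2) 1) * (lin_pow (-1/2) 1 * lin_pow (1/2) (-1)) = (1 :: laurent)"
    by (simp add: lin_pow_inv)
  have 2: "lin_pow e 2 = (lin_pow e 1 * lin_pow e 1 :: laurent)" "lin_pow e (-2) = (lin_pow e (-1) * lin_pow e (-1) :: laurent)" for e by (simp_all add: lin_pow_add[symmetric])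
  show "ip (alpha n i) \<gamma> = 0 \<Longrightarrow> H_weight n i \<gamma> = 1"
    "ip (alpha n i) \<gamma> = 1 \<Longrightarrow> H_weight n i \<gamma> = scl (fps_const 1) * (lin_pow (-1/2) 1 * lin_pow (1/2) (-1))"
    "ip (alpha n i) \<gamma> = -1 \<Longrightarrow> H_weight n i \<gamma> = scl (fps_const 1) * (lin_pow (-1/2) (-1) * lin_pow (1/2) 1)"
    "ip (alpha n i) \<gamma> = 2 \<Longrightarrow> H_weight n i \<gamma> = lin_pow (-1/2) 1 * lin_pow (1/2) (-1) * (lin_pow (-1/2) 1 * lin_pow (1/2) (-1))"
    "ip (alpha n i) \<gamma> = -2 \<Longrightarrow> H_weight n i \<gamma> = lin_pow (-1/2) (-1) * lin_pow (1/2) 1 * (lin_pow (-1/2) (-1) * lin_pow (1/2) 1)" for \<gamma>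
    by (simp_all add: H_weight_def lin_pow_0 2 mult_ac)
qed (use assms in \<open>simp_all add: hom_H_def fock_hom_shift_hom mult_hom_H_weight in_filt_log_fac in_filt_diff shift_hom_e_elt\<close>)

section \<open>Exchange relations of the individual fields\<close>

type_synonym vfield = "(nat \<times> nat \<Rightarrow> laurent) \<times> (lat \<Rightarrow> laurent) \<times> fock fps"

definition field_hom :: "vfield \<Rightarrow> fock \<Rightarrow> laurent" where "field_hom A = shift_hom (fst A) (fst (snd A))"
definition field_cre :: "vfield \<Rightarrow> fock fps" where "field_cre A = snd (snd A)"
definition field_op :: "vfield \<Rightarrow> opser" where "field_op A = field_ser (field_hom A) (field_cre A)"
definition field_good :: "vfield \<Rightarrow> bool" where "field_good A \<longleftrightarrow> good_shift (fst A) (fst (snd A))"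
definition normal_ord :: "vfield \<Rightarrow> vfield \<Rightarrow> fock \<Rightarrow> int \<times> int \<Rightarrow> fock" where
  "normal_ord A B x = normal_prod (fst A) (fst (snd A)) (field_cre A) (fst B) (fst (snd B)) (field_cre B) x"

text \<open>The series \<open>X(u) Y(v) x\<close> and \<open>Y(v) X(u) x\<close>.\<close>

definition comp_uv :: "opser \<Rightarrow> opser \<Rightarrow> fock \<Rightarrow> int \<times> int \<Rightarrow> fock" where "comp_uv X Y x = (\<lambda>(a, b). X a (Y b x))"
definition comp_vu :: "opser \<Rightarrow> opser \<Rightarrow> fock \<Rightarrow> int \<times> int \<Rightarrow> fock" where "comp_vu X Y x = (\<lambda>(a, b). Y b (X a x))"

lemma field_exchange_u: "field_good A \<Longrightarrow> field_good B \<Longrightarrow> exch (field_hom A) (field_cre B) ps qs c \<Longrightarrow>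
  diff_uvs ps (comp_uv (field_op A) (field_op B) x) = (\<lambda>e. scl (fps_const c) * diff_uvs qs (normal_ord A B x) e)"
  unfolding comp_uv_def field_op_def field_hom_def normal_ord_def by (rule exchange_u) (simp_all add: field_good_def)

lemma field_exchange_v: "field_good A \<Longrightarrow> field_good B \<Longrightarrow> exch (field_hom B) (field_cre A) ps qs c \<Longrightarrow>
  diff_uvs (map uminus ps) (comp_vu (field_op A) (field_op B) x) = (\<lambda>e. scl (fps_const (c * (-1) ^ (length ps + length qs))) * diff_uvs (map uminus qs) (normal_ord A B x) e)"
  unfolding comp_vu_def field_op_def field_hom_def normal_ord_def by (rule exchange_v) (simp_all add: field_good_def)

definition field_E :: "nat \<Rightarrow> nat \<Rightarrow> vfield" where "field_E n j = (\<lambda>jk. - ann_shift j (-1/4) jk, zpow_val (sgn_exp n j) (-1/4) (alpha n j), cre_E n j)"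
definition field_F :: "nat \<Rightarrow> nat \<Rightarrow> vfield" where "field_F n j = (ann_shift j (1/4), zpow_val (sgn_exp n j) (1/4) (- alpha n j), cre_F n j)"
definition field_Hp :: "nat \<Rightarrow> nat \<Rightarrow> vfield" where "field_Hp n j = (\<lambda>jk. - (ann_shift j (-1/2) jk - ann_shift j (1/2) jk), H_weight n j, 1)"
definition field_Hm :: "nat \<Rightarrow> nat \<Rightarrow> vfield" where "field_Hm n j = (\<lambda>_. 0, \<lambda>_. 1, cre_H n j)"

lemma field_hom_eqs: "field_hom (field_E n j) = hom_E n j" "field_hom (field_F n j) = hom_F n j" "field_hom (field_Hp n j) = hom_H n j" "field_hom (field_Hm n j) = emb"
  and field_cre_eqs: "field_cre (field_E n j) = cre_E n j" "field_cre (field_F n j) = cre_F n j" "field_cre (field_Hp n j) = 1" "field_cre (field_Hm n j) = cre_H n j"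
  by (simp_all add: field_hom_def field_cre_def field_E_def field_F_def field_Hp_def field_Hm_def hom_E_def hom_F_def hom_H_def emb_eq_shift_hom)

lemma field_good_eqs: "field_good (field_E n j)" "field_good (field_F n j)" "field_good (field_Hp n j)" "field_good (field_Hm n j)"
  unfolding field_good_def field_E_def field_F_def field_Hp_def field_Hm_def fst_conv snd_conv
  by (auto simp: good_shift_def scalar_ser_uminus scalar_ser_diff scalar_ser_ann_shift scalar_ser_zpow_val mult_hom_zpow_val scalar_ser_H_weight mult_hom_H_weight scalar_ser_0 scalar_ser_1 mult_hom_1 simp del: minus_diff_eq)

lemma op_eqs: "j \<noteq> 0 \<Longrightarrow> E_op n j = field_op (field_E n j)" "j \<noteq> 0 \<Longrightarrow> F_op n j = field_op (field_F n j)"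
  "j \<noteq> 0 \<Longrightarrow> Hp_op n j = field_op (field_Hp n j)" "Hm_op n j = field_op (field_Hm n j)"
  by (simp_all add: field_op_def field_hom_eqs field_cre_eqs E_op_eq F_op_eq Hp_op_eq Hm_op_eq)

lemma exch_same_mult: "exch s N [] [] c \<Longrightarrow> exch s N es es c"
  by (simp add: exch_def mult.left_commute)

lemma exch_swap: "exch s N [a, b] [c, d] e \<Longrightarrow> exch s N [b, a] [c, d] e"
  by (simp add: exch_def mult_ac)

lemma exch_emb: "exch emb N [] [] 1" by (simp add: exch_def)

context
  fixes n i j :: nat assumes n: "3 \<le> n" and i: "i \<in> {1..n}" and j: "j \<in> {1..n}"
begin

interpretation VE: vertex_hom n i "hom_E n i" "\<lambda>d. - log_fac (-1/4) d" "lin_pow (-1/4) (-1)" "lin_pow (-1/4) 1" "(-1) ^ sgn_exp n i"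
  "\<lambda>d. [-1/4 - d]" "\<lambda>d. []" "zpow_val (sgn_exp n i) (-1/4) (alpha n i)" by (rule vertex_hom_E[OF n i])
interpretation VF: vertex_hom n i "hom_F n i" "\<lambda>d. log_fac (1/4) d" "lin_pow (1/4) 1" "lin_pow (1/4) (-1)" "(-1) ^ sgn_exp n i"
  "\<lambda>d. []" "\<lambda>d. [1/4 - d]" "zpow_val (sgn_exp n i) (1/4) (- alpha n i)" by (rule vertex_hom_F[OF n i])
interpretation VH: vertex_hom n i "hom_H n i" "\<lambda>d. log_fac (1/2) d - log_fac (-1/2) d" "lin_pow (-1/2) (-1) * lin_pow (1/2) 1" "lin_pow (-1/2) 1 * lin_pow (1/2) (-1)" 1
  "\<lambda>d. [-1/2 - d]" "\<lambda>d. [1/2 - d]" "H_weight n i" by (rule vertex_hom_H[OF n i])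

lemma Bform_cases:
  obtains (same) "i = j" "Bform n i j = 1" | (adj) "i \<noteq> j" "i \<in> nbrs n j" "Bform n i j = -1/2"
  | (far) "i \<noteq> j" "i \<notin> nbrs n j" "Bform n i j = 0"
  using ip_alpha_alpha[OF n i j] that by (auto simp: Bform_def split: if_splits)

text \<open>The entries are -1/4 - d for the shifts d in the creation part of E: -1/4 and 3/4 on the
  diagonal, 1/4 for a neighbour.\<close>

lemma qEE: "i = j \<Longrightarrow> exch (hom_E n i) (cre_E n j) [] [0, -1] 1"
  "i \<noteq> j \<Longrightarrow> i \<in> nbrs n j \<Longrightarrow> exch (hom_E n i) (cre_E n j) [-1/2] [] ((-1) ^ sgn_exp n i)"
  "i \<noteq> j \<Longrightarrow> i \<notin> nbrs n j \<Longrightarrow> exch (hom_E n i) (cre_E n j) [] [] 1"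
  using VE.exch_cre_E_same[OF j] VE.exch_cre_E_adj[OF j] VE.exch_cre_E_far[OF j] by simp_all

lemma qFF: "i = j \<Longrightarrow> exch (hom_F n i) (cre_F n j) [] [0, 1] 1"
  "i \<noteq> j \<Longrightarrow> i \<in> nbrs n j \<Longrightarrow> exch (hom_F n i) (cre_F n j) [1/2] [] ((-1) ^ sgn_exp n i)"
  "i \<noteq> j \<Longrightarrow> i \<notin> nbrs n j \<Longrightarrow> exch (hom_F n i) (cre_F n j) [] [] 1"
  using VF.exch_cre_F_same[OF j] VF.exch_cre_F_adj[OF j] VF.exch_cre_F_far[OF j] by simp_all

lemma qEF: "i = j \<Longrightarrow> exch (hom_E n i) (cre_F n j) [-1/2, 1/2] [] 1"
  "i \<noteq> j \<Longrightarrow> i \<in> nbrs n j \<Longrightarrow> exch (hom_E n i) (cre_F n j) [] [0] ((-1) ^ sgn_exp n i)"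
  "i \<noteq> j \<Longrightarrow> i \<notin> nbrs n j \<Longrightarrow> exch (hom_E n i) (cre_F n j) [] [] 1"
  using VE.exch_cre_F_same[OF j] VE.exch_cre_F_adj[OF j] VE.exch_cre_F_far[OF j] by simp_all

lemma qFE: "i = j \<Longrightarrow> exch (hom_F n i) (cre_E n j) [1/2, -1/2] [] 1"
  "i \<noteq> j \<Longrightarrow> i \<in> nbrs n j \<Longrightarrow> exch (hom_F n i) (cre_E n j) [] [0] ((-1) ^ sgn_exp n i)"
  "i \<noteq> j \<Longrightarrow> i \<notin> nbrs n j \<Longrightarrow> exch (hom_F n i) (cre_E n j) [] [] 1"
  using VF.exch_cre_E_same[OF j] VF.exch_cre_E_adj[OF j] VF.exch_cre_E_far[OF j] by simp_all

text \<open>On the diagonal two of the four factors coincide and cancel, after which the three cases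
  share one formula in terms of \<open>Bform\<close>.\<close>

lemma qPE: "exch (hom_H n i) (cre_E n j) [-1/4 + Bform n i j] [-1/4 - Bform n i j] 1"
proof (cases rule: Bform_cases)
  case same
  have "exch (hom_H n i) (cre_E n j) [3/4, -1/4] [-1/4, -5/4] 1" using VH.exch_cre_E_same[OF j same(1)] by simp
  then show ?thesis using exch_cancel[OF exch_swap] same by fastforce
next
  case adj then show ?thesis using VH.exch_cre_E_adj[OF j] by simp
next
  case far then show ?thesis using exch_same_mult[OF VH.exch_cre_E_far[OF j]] by simp
qed

lemma qPF: "exch (hom_H n i) (cre_F n j) [1/4 - Bform n i j] [1/4 + Bform n i j] 1"
proof (cases rule: Bform_cases)
  case same
  have "exch (hom_H n i) (cre_F n j) [-3/4, 1/4] [1/4, 5/4] 1" using VH.exch_cre_F_same[OF j same(1)] by simp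
  then show ?thesis using exch_cancel[OF exch_swap] same by fastforce
next
  case adj then show ?thesis using VH.exch_cre_F_adj[OF j] by simp
next
  case far then show ?thesis using exch_same_mult[OF VH.exch_cre_F_far[OF j]] by simp
qed

lemma qEM: "exch (hom_E n i) (cre_H n j) [-1/4 + Bform n i j] [-1/4 - Bform n i j] 1"
proof (cases rule: Bform_cases)
  case same then show ?thesis using VE.exch_cre_H_same[OF j] by simp
next
  case adj then show ?thesis using VE.exch_cre_H_adj[OF j] by simp
next
  case far then show ?thesis using exch_same_mult[OF VE.exch_cre_H_far[OF j]] by simp
qed

lemma qFM: "exch (hom_F n i) (cre_H n j) [1/4 - Bform n i j] [1/4 + Bform n i j] 1"
proof (cases rule: Bform_cases)
  case same then show ?thesis using VF.exch_cre_H_same[OF j] by simp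
next
  case adj then show ?thesis using VF.exch_cre_H_adj[OF j] by simp
next
  case far then show ?thesis using exch_same_mult[OF VF.exch_cre_H_far[OF j]] by simp
qed

lemma qPM: "exch (hom_H n i) (cre_H n j) [1/2 - Bform n i j, -1/2 + Bform n i j] [1/2 + Bform n i j, -1/2 - Bform n i j] 1"
proof (cases rule: Bform_cases)
  case same
  have "exch (hom_H n i) (cre_H n j) [1/2, -1/2] [3/2, -3/2] 1" using VH.exch_cre_H_same[OF j same(1)] by simp
  then show ?thesis using exch_swap same by fastforce
next
  case adj then show ?thesis using VH.exch_cre_H_adj[OF j] by simp
next
  case far then show ?thesis using exch_same_mult[OF VH.exch_cre_H_far[OF j]] by simp
qed

lemma qE1: "exch (hom_E n i) 1 [] [] 1" and qF1: "exch (hom_F n i) 1 [] [] 1" and qP1: "exch (hom_H n i) 1 [] [] 1"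
  by (rule VE.exch_one VF.exch_one VH.exch_one)+

lemma Bform_sym: "Bform n i j = Bform n j i"
  using ip_alpha_alpha[OF n i j] ip_alpha_alpha[OF n j i] nbrs_sym[OF n i j] nbrs_sym[OF n j i] by (auto simp: Bform_def)

end

context
  fixes n i j :: nat assumes n: "3 \<le> n" and i: "i \<in> {1..n}" and j: "j \<in> {1..n}"
begin

lemmas fgd = field_good_eqs
private lemma ij0: "i \<noteq> 0" "j \<noteq> 0" using i j by auto
private lemmas ops = op_eqs(1)[OF ij0(1)] op_eqs(1)[OF ij0(2)] op_eqs(2)[OF ij0(1)] op_eqs(2)[OF ij0(2)] op_eqs(3)[OF ij0(1)] op_eqs(3)[OF ij0(2)] op_eqs(4)
private lemmas eqs = field_hom_eqs field_cre_eqs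

lemma EE_same:
  assumes "i = j"
  shows "comp_uv (E_op n i) (E_op n j) x = diff_uv 0 (diff_uv (-1) (normal_ord (field_E n i) (field_E n j) x))" "comp_vu (E_op n i) (E_op n j) x = diff_uv 0 (diff_uv 1 (normal_ord (field_E n i) (field_E n j) x))"
  using field_exchange_u[OF fgd(1)[of n i] fgd(1)[of n j], unfolded eqs, OF qEE(1)[OF n i j assms], of x] field_exchange_v[OF fgd(1)[of n i] fgd(1)[of n j], unfolded eqs, OF qEE(1)[OF n j i assms[symmetric]], of x] by (simp_all add: ops)

text \<open>The reversed order carries the sign of j and a further -1 from its single linear factor.
  By \<open>sgn_adj\<close> this is the sign of i, so both sides are the same multiple of the
  normally ordered product.\<close>

lemma EE_adj:
  assumes "i \<noteq> j" "i \<in> nbrs n j"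
  shows "diff_uv (-1/2) (comp_uv (E_op n i) (E_op n j) x) = diff_uv (1/2) (comp_vu (E_op n i) (E_op n j) x)"
  using field_exchange_u[OF fgd(1)[of n i] fgd(1)[of n j], unfolded eqs, OF qEE(2)[OF n i j assms], of x] field_exchange_v[OF fgd(1)[of n i] fgd(1)[of n j], unfolded eqs, OF qEE(2)[OF n j i assms(1)[symmetric] nbrs_sym[OF n i j assms(2)]], of x]
    sgn_adj[OF n i j assms(2)] by (simp add: ops)

lemma EE_far:
  assumes "i \<noteq> j" "i \<notin> nbrs n j"
  shows "comp_uv (E_op n i) (E_op n j) x = comp_vu (E_op n i) (E_op n j) x"
proof -
  have "j \<notin> nbrs n i" using nbrs_sym[OF n j i] assms by auto
  then show ?thesis
    using field_exchange_u[OF fgd(1)[of n i] fgd(1)[of n j], unfolded eqs, OF qEE(3)[OF n i j assms], of x] field_exchange_v[OF fgd(1)[of n i] fgd(1)[of n j], unfolded eqs, OF qEE(3)[OF n j i assms(1)[symmetric]], of x] by (simp add: ops)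
qed

lemma FF_same:
  assumes "i = j"
  shows "comp_uv (F_op n i) (F_op n j) x = diff_uv 0 (diff_uv 1 (normal_ord (field_F n i) (field_F n j) x))" "comp_vu (F_op n i) (F_op n j) x = diff_uv 0 (diff_uv (-1) (normal_ord (field_F n i) (field_F n j) x))"
  using field_exchange_u[OF fgd(2)[of n i] fgd(2)[of n j], unfolded eqs, OF qFF(1)[OF n i j assms], of x] field_exchange_v[OF fgd(2)[of n i] fgd(2)[of n j], unfolded eqs, OF qFF(1)[OF n j i assms[symmetric]], of x] by (simp_all add: ops)

lemma FF_adj:
  assumes "i \<noteq> j" "i \<in> nbrs n j"
  shows "diff_uv (1/2) (comp_uv (F_op n i) (F_op n j) x) = diff_uv (-1/2) (comp_vu (F_op n i) (F_op n j) x)"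
  using field_exchange_u[OF fgd(2)[of n i] fgd(2)[of n j], unfolded eqs, OF qFF(2)[OF n i j assms], of x] field_exchange_v[OF fgd(2)[of n i] fgd(2)[of n j], unfolded eqs, OF qFF(2)[OF n j i assms(1)[symmetric] nbrs_sym[OF n i j assms(2)]], of x]
    sgn_adj[OF n i j assms(2)] by (simp add: ops)

lemma FF_far:
  assumes "i \<noteq> j" "i \<notin> nbrs n j"
  shows "comp_uv (F_op n i) (F_op n j) x = comp_vu (F_op n i) (F_op n j) x"
proof -
  have "j \<notin> nbrs n i" using nbrs_sym[OF n j i] assms by auto
  then show ?thesis
    using field_exchange_u[OF fgd(2)[of n i] fgd(2)[of n j], unfolded eqs, OF qFF(3)[OF n i j assms], of x] field_exchange_v[OF fgd(2)[of n i] fgd(2)[of n j], unfolded eqs, OF qFF(3)[OF n j i assms(1)[symmetric]], of x] by (simp add: ops)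
qed

lemma EE_relabel: "diff_uv (Bform n i j) (comp_uv (E_op n i) (E_op n j) x) = diff_uv (- Bform n i j) (comp_vu (E_op n i) (E_op n j) x)"
proof (cases rule: Bform_cases[OF n i j])
  case 1 then show ?thesis unfolding EE_same[OF 1(1)] by (metis diff_op_commute)
next
  case 2 then show ?thesis using EE_adj[OF 2(1,2)] by simp
next
  case 3 then show ?thesis using EE_far[OF 3(1,2)] by simp
qed

lemma FF_relabel: "diff_uv (- Bform n i j) (comp_uv (F_op n i) (F_op n j) x) = diff_uv (Bform n i j) (comp_vu (F_op n i) (F_op n j) x)"
proof (cases rule: Bform_cases[OF n i j])
  case 1 then show ?thesis unfolding FF_same[OF 1(1)] by (metis diff_op_commute)
next
  case 2 then show ?thesis using FF_adj[OF 2(1,2)] by simp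
next
  case 3 then show ?thesis using FF_far[OF 3(1,2)] by simp
qed

text \<open>H^+ has no creation part and H^- no annihilation part. Hence E(v) H^+(u) and H^-(u) E(v)
  are already normally ordered and only the opposite order contributes factors; likewise with F in
  place of E.\<close>

lemma Hp_E_relabel: "diff_uv (-1/4 - Bform n i j) (comp_vu (Hp_op n i) (E_op n j) x) = diff_uv (-1/4 + Bform n i j) (comp_uv (Hp_op n i) (E_op n j) x)"
  using field_exchange_u[OF fgd(3)[of n i] fgd(1)[of n j], unfolded eqs, OF qPE[OF n i j], of x] field_exchange_v[OF fgd(3)[of n i] fgd(1)[of n j], unfolded eqs, OF qE1[OF n j j], of x] by (simp add: ops)

lemma Hm_E_relabel: "diff_uv (1/4 - Bform n i j) (comp_vu (Hm_op n i) (E_op n j) x) = diff_uv (1/4 + Bform n i j) (comp_uv (Hm_op n i) (E_op n j) x)"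
  using field_exchange_u[OF fgd(4)[of n i] fgd(1)[of n j], unfolded eqs, OF exch_emb, of x] field_exchange_v[OF fgd(4)[of n i] fgd(1)[of n j], unfolded eqs, OF qEM[OF n j i], of x] by (simp add: ops Bform_sym[OF n j i] add.commute minus_diff_commute)

lemma Hp_F_relabel: "diff_uv (1/4 - Bform n i j) (comp_uv (Hp_op n i) (F_op n j) x) = diff_uv (1/4 + Bform n i j) (comp_vu (Hp_op n i) (F_op n j) x)"
  using field_exchange_u[OF fgd(3)[of n i] fgd(2)[of n j], unfolded eqs, OF qPF[OF n i j], of x] field_exchange_v[OF fgd(3)[of n i] fgd(2)[of n j], unfolded eqs, OF qF1[OF n j j], of x] by (simp add: ops)

lemma Hm_F_relabel: "diff_uv (-1/4 - Bform n i j) (comp_uv (Hm_op n i) (F_op n j) x) = diff_uv (-1/4 + Bform n i j) (comp_vu (Hm_op n i) (F_op n j) x)"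
  using field_exchange_u[OF fgd(4)[of n i] fgd(2)[of n j], unfolded eqs, OF exch_emb, of x] field_exchange_v[OF fgd(4)[of n i] fgd(2)[of n j], unfolded eqs, OF qFM[OF n j i], of x] by (simp add: ops Bform_sym[OF n j i] add.commute minus_diff_commute)

lemma Hp_Hp_relabel: "comp_uv (Hp_op n i) (Hp_op n j) x = comp_vu (Hp_op n i) (Hp_op n j) x"
  using field_exchange_u[OF fgd(3)[of n i] fgd(3)[of n j], unfolded eqs, OF qP1[OF n i i], of x] field_exchange_v[OF fgd(3)[of n i] fgd(3)[of n j], unfolded eqs, OF qP1[OF n j j], of x] by (simp add: ops)

lemma Hm_Hm_relabel: "comp_uv (Hm_op n i) (Hm_op n j) x = comp_vu (Hm_op n i) (Hm_op n j) x"
  using field_exchange_u[OF fgd(4)[of n i] fgd(4)[of n j], unfolded eqs, OF exch_emb, of x] field_exchange_v[OF fgd(4)[of n i] fgd(4)[of n j], unfolded eqs, OF exch_emb, of x] by (simp add: ops)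

lemma Hp_Hm_relabel: "diff_uv (1/2 - Bform n i j) (diff_uv (-1/2 + Bform n i j) (comp_uv (Hp_op n i) (Hm_op n j) x)) = diff_uv (1/2 + Bform n i j) (diff_uv (-1/2 - Bform n i j) (comp_vu (Hp_op n i) (Hm_op n j) x))"
  using field_exchange_u[OF fgd(3)[of n i] fgd(4)[of n j], unfolded eqs, OF qPM[OF n i j], of x] field_exchange_v[OF fgd(3)[of n i] fgd(4)[of n j], unfolded eqs, OF exch_emb, of x] by (simp add: ops)

lemma Hm_Hp_relabel: "diff_uv (-1/2 - Bform n i j) (diff_uv (1/2 + Bform n i j) (comp_uv (Hm_op n i) (Hp_op n j) x)) = diff_uv (-1/2 + Bform n i j) (diff_uv (1/2 - Bform n i j) (comp_vu (Hm_op n i) (Hp_op n j) x))"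
  using field_exchange_u[OF fgd(4)[of n i] fgd(3)[of n j], unfolded eqs, OF exch_emb, of x] field_exchange_v[OF fgd(4)[of n i] fgd(3)[of n j], unfolded eqs, OF qPM[OF n j i], of x] diff_op_commute[of "(1,0)" "(0,1)"] by (simp add: ops Bform_sym[OF n j i] add.commute minus_diff_commute)

text \<open>Both orders are expansions, in opposite regions, of the normal product divided by (u - v
  - hbar/2)(u - v + hbar/2); the commutator is supported at these two poles.\<close>

lemma EF_same:
  assumes "i = j"
  shows "diff_uv (-1/2) (diff_uv (1/2) (comp_uv (E_op n i) (F_op n j) x)) = normal_ord (field_E n i) (field_F n j) x" "diff_uv (-1/2) (diff_uv (1/2) (comp_vu (E_op n i) (F_op n j) x)) = normal_ord (field_E n i) (field_F n j) x"
  using field_exchange_u[OF fgd(1)[of n i] fgd(2)[of n j], unfolded eqs, OF qEF(1)[OF n i j assms], of x] field_exchange_v[OF fgd(1)[of n i] fgd(2)[of n j], unfolded eqs, OF qFE(1)[OF n j i assms[symmetric]], of x] by (simp_all add: ops)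

text \<open>For different indices the contraction has no denominator, so both orders are the same
  multiple of the normal product; \<open>sgn_adj\<close> matches their signs for neighbours.\<close>

lemma EF_diff: assumes "i \<noteq> j" shows "comp_uv (E_op n i) (F_op n j) x = comp_vu (E_op n i) (F_op n j) x"
proof (cases "i \<in> nbrs n j")
  case True
  show ?thesis
    using field_exchange_u[OF fgd(1)[of n i] fgd(2)[of n j], unfolded eqs, OF qEF(2)[OF n i j assms True], of x] field_exchange_v[OF fgd(1)[of n i] fgd(2)[of n j], unfolded eqs, OF qFE(2)[OF n j i assms[symmetric] nbrs_sym[OF n i j True]], of x]
      sgn_adj[OF n i j True] by (simp add: ops)
next
  case False
  then have "j \<notin> nbrs n i" using nbrs_sym[OF n j i] by auto
  then show ?thesis
    using field_exchange_u[OF fgd(1)[of n i] fgd(2)[of n j], unfolded eqs, OF qEF(3)[OF n i j assms False], of x] field_exchange_v[OF fgd(1)[of n i] fgd(2)[of n j], unfolded eqs, OF qFE(3)[OF n j i assms[symmetric]], of x] by (simp add: ops)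
qed

end

section \<open>Boundedness and cancellation of linear factors\<close>

definition additive_deg :: "('e::ab_group_add \<Rightarrow> int) \<Rightarrow> bool" where "additive_deg \<kappa> \<longleftrightarrow> (\<forall>a b. \<kappa> (a - b) = \<kappa> a - \<kappa> b)"

text \<open>The bound may depend on p: a power (u + c hbar)^k with negative k reaches p steps
  further down at order p, so a bound uniform in hbar would exclude the fields themselves.\<close>

definition bounded_deg :: "('e \<Rightarrow> int) \<Rightarrow> ('e \<Rightarrow> 'a::zero fps) \<Rightarrow> bool" where
  "bounded_deg \<kappa> f \<longleftrightarrow> (\<forall>p. \<exists>K. \<forall>e. \<kappa> e < K \<longrightarrow> (\<forall>q\<le>p. f e $ q = 0))"

lemma bounded_degE: assumes "bounded_deg \<kappa> f" obtains K where "\<And>e q. \<kappa> e < K \<Longrightarrow> q \<le> p \<Longrightarrow> f e $ q = 0"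
  using assms unfolding bounded_deg_def by blast

lemma bounded_degI: assumes "\<And>p. \<exists>K. \<forall>e q. \<kappa> e < K \<longrightarrow> q \<le> p \<longrightarrow> f e $ q = 0" shows "bounded_deg \<kappa> f"
  using assms unfolding bounded_deg_def by blast

lemma bounded_deg_A_linear:
  assumes "bounded_deg \<kappa> f" "\<And>e. A_linear (T e)" shows "bounded_deg \<kappa> (\<lambda>e. T e (f e))"
proof (rule bounded_degI)
  fix p obtain K where K: "\<And>e q. \<kappa> e < K \<Longrightarrow> q \<le> p \<Longrightarrow> f e $ q = 0" using bounded_degE[OF assms(1)] by blast
  have "T e (f e) $ q = 0" if "\<kappa> e < K" "q \<le> p" for e q
    using A_linear_local[OF assms(2), of q "f e" 0 e] K[OF that(1)] that(2) by (simp add: A_linear_0[OF assms(2)])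
  then show "\<exists>K. \<forall>e q. \<kappa> e < K \<longrightarrow> q \<le> p \<longrightarrow> T e (f e) $ q = 0" by blast
qed

lemma bounded_deg_add: fixes f :: "_ \<Rightarrow> 'a::ab_group_add fps" assumes "bounded_deg \<kappa> f" "bounded_deg \<kappa> g" shows "bounded_deg \<kappa> (\<lambda>e. f e + g e)"
proof (rule bounded_degI)
  fix p
  obtain K where K: "\<And>e q. \<kappa> e < K \<Longrightarrow> q \<le> p \<Longrightarrow> f e $ q = 0" using bounded_degE[OF assms(1)] by blast
  obtain K' where K': "\<And>e q. \<kappa> e < K' \<Longrightarrow> q \<le> p \<Longrightarrow> g e $ q = 0" using bounded_degE[OF assms(2)] by blast
  show "\<exists>K. \<forall>e q. \<kappa> e < K \<longrightarrow> q \<le> p \<longrightarrow> (f e + g e) $ q = 0"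
    by (rule exI[of _ "min K K'"]) (simp add: K K')
qed

lemma bounded_deg_uminus: "bounded_deg \<kappa> f \<Longrightarrow> bounded_deg \<kappa> (\<lambda>e. - f e)" for f :: "_ \<Rightarrow> 'a::ab_group_add fps"
  by (simp add: bounded_deg_def)

lemma bounded_deg_diff: "bounded_deg \<kappa> f \<Longrightarrow> bounded_deg \<kappa> g \<Longrightarrow> bounded_deg \<kappa> (\<lambda>e. f e - g e)" for f :: "_ \<Rightarrow> 'a::ab_group_add fps"
  using bounded_deg_add[of \<kappa> f "\<lambda>e. - g e"] by (simp add: bounded_deg_uminus)

lemma bounded_deg_shift: assumes "additive_deg \<kappa>" "bounded_deg \<kappa> f" shows "bounded_deg \<kappa> (\<lambda>e. f (e - d))"
proof (rule bounded_degI)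
  fix p obtain K where K: "\<And>e q. \<kappa> e < K \<Longrightarrow> q \<le> p \<Longrightarrow> f e $ q = 0" using bounded_degE[OF assms(2)] by blast
  show "\<exists>K. \<forall>e q. \<kappa> e < K \<longrightarrow> q \<le> p \<longrightarrow> f (e - d) $ q = 0"
    by (rule exI[of _ "K + \<kappa> d"]) (use assms(1) in \<open>auto simp: additive_deg_def intro!: K\<close>)
qed

lemma bounded_deg_diff_op: assumes "additive_deg \<kappa>" "bounded_deg \<kappa> f" shows "bounded_deg \<kappa> (diff_op d1 d2 c f)"
  unfolding diff_op_def[abs_def]
  by (intro bounded_deg_add bounded_deg_diff bounded_deg_shift assms bounded_deg_A_linear[OF assms(2), of "\<lambda>e x. scl (hb c) * x"] A_linear_mult_left A_linear_id)

lemma bounded_deg_ser_act: assumes "additive_deg \<kappa>" "bounded_deg \<kappa> f" shows "bounded_deg \<kappa> (ser_act r f)"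
proof (rule bounded_degI)
  fix p
  obtain K where K: "\<And>e q. \<kappa> e < K \<Longrightarrow> q \<le> p \<Longrightarrow> f e $ q = 0" using bounded_degE[OF assms(2)] by blast
  define I where "I = (\<Union>q\<le>p. snd ` Poly_Mapping.keys (r $ q))"
  have fin: "finite I" unfolding I_def by auto
  \<comment> \<open>Inserting 0 keeps the set nonempty, so that \<open>Min\<close> is meaningful
    when no monomial occurs.\<close>
  define K' where "K' = Min (insert 0 (\<kappa> ` I)) + K"
  have "ser_act r f e $ q = 0" if e: "\<kappa> e < K'" and q: "q \<le> p" for e q
  proof -
    have "ser_act (basis k) f e $ q' = 0" if "k \<in> Poly_Mapping.keys (r $ s)" "s \<le> q" "q' \<le> q" for k s q'
    proof -
      obtain l i where k: "k = (l, i)" by (cases k)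
      have "i \<in> I" using that q unfolding I_def k by force
      then have "Min (insert 0 (\<kappa> ` I)) \<le> \<kappa> i" using fin by simp
      then have "\<kappa> (e - i) < K" using e assms(1) by (simp add: K'_def additive_deg_def)
      then show ?thesis using that(3) q unfolding k ser_act_basis fps_mult_nth by (intro sum.neutral ballI) (simp add: K)
    qed
    then have "(scl g * ser_act (basis k) f e) $ q = 0" if "k \<in> Poly_Mapping.keys (r $ s)" "s \<le> q" for k s g
      unfolding fps_mult_nth using that by (intro sum.neutral ballI) simp
    then have "ser_act (trunc q r) f e $ q = 0"
      unfolding A_linear_trunc_expand[OF A_linear_ser_act] fps_sum_nth by (intro sum.neutral ballI) auto
    then show ?thesis by (simp only: A_linear_trunc[OF A_linear_ser_act, of r f e q])
  qed
  then show "\<exists>K. \<forall>e q. \<kappa> e < K \<longrightarrow> q \<le> p \<longrightarrow> ser_act r f e $ q = 0" by blast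
qed

lemma bounded_deg_to_ser: "bounded_deg (\<lambda>m. m) (to_ser M)"
  by (rule bounded_degI) (auto intro!: exI[of _ 0] simp: to_ser_def)

lemma additive_deg_id: "additive_deg (\<lambda>m. m)" by (simp add: additive_deg_def)
lemma additive_deg_fst: "additive_deg fst" by (simp add: additive_deg_def)
lemma additive_deg_snd: "additive_deg snd" by (simp add: additive_deg_def)

lemma bounded_deg_field_op: "bounded_deg (\<lambda>m. m) (\<lambda>m. field_op A m x)"
  unfolding field_op_def field_ser_def by (rule bounded_deg_ser_act[OF additive_deg_id bounded_deg_to_ser])

lemma A_linear_field_op: "A_linear (field_op A m)"
  unfolding field_op_def field_hom_def by (rule A_linear_field_ser[OF A_linear_shift_hom])

lemma bounded_deg_comp: assumes "bounded_deg (\<lambda>m. m) f" shows "bounded_deg \<kappa> (\<lambda>e. f (\<kappa> e))"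
  using assms unfolding bounded_deg_def by blast

lemma bounded_deg_normal_ord: "bounded_deg fst (normal_ord A B x)" "bounded_deg snd (normal_ord A B x)"
proof -
  have "bounded_deg fst (\<lambda>(a, b). to_ser (field_cre A) a * to_ser (field_cre B) b)" "bounded_deg snd (\<lambda>(a, b). to_ser (field_cre A) a * to_ser (field_cre B) b)"
    by (auto intro!: bounded_degI exI[of _ 0] simp: to_ser_def)
  then show "bounded_deg fst (normal_ord A B x)" "bounded_deg snd (normal_ord A B x)"
    unfolding normal_ord_def normal_prod_def by (auto intro: bounded_deg_ser_act additive_deg_fst additive_deg_snd)
qed

lemma A_linear_normal_ord: "A_linear (\<lambda>x. normal_ord A B x e)"
  unfolding normal_ord_def normal_prod_def shift_hom2_def by (rule A_linear_comp[OF A_linear_ser_act A_linear_shift_hom])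

text \<open>Induction on the order in hbar. The hbar term involves only lower orders, so at order p
  the series is invariant under translation by d1 - d2; this lowers the degree by one until the
  bound applies. The set \<open>U\<close> restricts the argument to a region stable under these
  translations.\<close>

lemma diff_op_uniq:
  fixes f :: "'e::ab_group_add \<Rightarrow> ('k::comm_monoid_add \<Rightarrow>\<^sub>0 complex) fps"
  assumes k: "additive_deg \<kappa>" "\<kappa> d1 = 0" "\<kappa> d2 = 1"
    and U: "\<And>e. e \<in> U \<Longrightarrow> e + d1 \<in> U" "\<And>e. e \<in> U \<Longrightarrow> e - d2 \<in> U"
    and L: "\<And>e q. e \<in> U \<Longrightarrow> q \<le> P \<Longrightarrow> diff_op d1 d2 c f (e + d1) $ q = 0"
    and b: "\<And>p. p \<le> P \<Longrightarrow> \<exists>K. \<forall>e\<in>U. \<kappa> e < K \<longrightarrow> f e $ p = 0"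
  shows "e \<in> U \<Longrightarrow> p \<le> P \<Longrightarrow> f e $ p = 0"
proof (induction p arbitrary: e rule: less_induct)
  case (less p)
  obtain K where K: "\<And>e. e \<in> U \<Longrightarrow> \<kappa> e < K \<Longrightarrow> f e $ p = 0" using b[OF less.prems(2)] by blast
  have "(scl (hb c) * f e) $ p = 0" if eU: "e \<in> U" for e
    unfolding fps_mult_nth
  proof (intro sum.neutral ballI)
    fix i assume "i \<in> {0..p}"
    then show "scl (hb c) $ i * f e $ (p - i) = 0" using less.IH[of "p - i" e] eU less.prems(2)
      by (cases "i = 0") (auto simp: hb_def)
  qed
  then have step: "f e $ p = f (e + d1 - d2) $ p" if "e \<in> U" for e
    using L[OF that less.prems(2)] U(1)[OF that] by (simp add: diff_op_def)
  have "f e $ p = 0" if "e \<in> U" "\<kappa> e < K + int N" for N e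
    using that
  proof (induction N arbitrary: e)
    case 0 then show ?case using K by simp
  next
    case (Suc N)
    have "\<kappa> (e + d1 - d2) = \<kappa> e - 1"
    proof -
      have "\<kappa> (e + d1 - d2) = \<kappa> (e - (0 - d1)) - \<kappa> d2" using k(1) by (simp add: additive_deg_def)
      also have "\<kappa> (e - (0 - d1)) = \<kappa> e - (\<kappa> (d1 - d1) - \<kappa> d1)" using k(1) unfolding additive_deg_def by (metis diff_self)
      also have "\<kappa> (d1 - d1) = 0" using k(1) unfolding additive_deg_def by (metis diff_self)
      finally show ?thesis using k by simp
    qed
    then show ?case using Suc step[OF Suc.prems(1)] U by auto
  qed
  from this[of e "nat (\<kappa> e - K) + 1"] show ?case using less.prems by (cases "\<kappa> e < K") (auto intro: K)
qed

lemma diff_op_swap: "diff_op d2 d1 (- c) f = (\<lambda>e. - diff_op d1 d2 c f e)"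
  by (rule ext) (simp add: diff_op_def hb_minus scl_minus)

text \<open>The bound is what excludes delta functions, which linear factors annihilate. It may
  concern either variable, since exchanging them only changes the sign of the operator.\<close>

lemma diff_op_inj:
  fixes f :: "'e::ab_group_add \<Rightarrow> ('k::comm_monoid_add \<Rightarrow>\<^sub>0 complex) fps"
  assumes "additive_deg \<kappa>" "\<kappa> d1 = 0 \<and> \<kappa> d2 = 1 \<or> \<kappa> d1 = 1 \<and> \<kappa> d2 = 0" "bounded_deg \<kappa> f" "bounded_deg \<kappa> g" "diff_op d1 d2 c f = diff_op d1 d2 c g"
  shows "f = g"
proof -
  let ?h = "\<lambda>e. f e - g e"
  have 0: "diff_op d1 d2 c ?h = (\<lambda>e. 0)" using assms(5) by (auto simp: diff_op_def fun_eq_iff algebra_simps)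
  then have Z': "diff_op d2 d1 (- c) ?h = (\<lambda>e. 0)" unfolding diff_op_swap by simp
  have b: "\<exists>K. \<forall>e\<in>UNIV. \<kappa> e < K \<longrightarrow> ?h e $ p = 0" for p
    using bounded_degE[OF bounded_deg_diff[OF assms(3,4)], of p] by (metis order_refl)
  have "?h e $ p = 0" for e p
    using assms(2)
  proof
    assume "\<kappa> d1 = 0 \<and> \<kappa> d2 = 1"
    then show ?thesis by (intro diff_op_uniq[of \<kappa> d1 d2 UNIV p c ?h, OF assms(1)]) (use 0 b in auto)
  next
    assume "\<kappa> d1 = 1 \<and> \<kappa> d2 = 0"
    then show ?thesis by (intro diff_op_uniq[of \<kappa> d2 d1 UNIV p "- c" ?h, OF assms(1)]) (use Z' b in auto)
  qed
  then show ?thesis by (intro ext fps_ext) (metis diff_eq_diff_eq fps_sub_nth eq_iff_diff_eq_0)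
qed

section \<open>The Serre relations\<close>

lemma A_linear_two: "A_linear T \<Longrightarrow> T (2 * x) = 2 * T x"
  by (simp only: mult_2 A_linear_add)

lemma diff_op_lin: "diff_op d1 d3 c f e - diff_op d2 d3 c' f e = diff_op d1 d2 (c - c') f e"
  by (simp add: diff_op_def hb_diff scl_diff algebra_simps)

lemma diff_op_diff: "diff_op d1 d2 c (\<lambda>e. f e - g e) e = diff_op d1 d2 c f e - diff_op d1 d2 c g e"
  by (simp add: diff_op_def algebra_simps)

lemma diff_op_add: "diff_op d1 d2 c (\<lambda>e. f e + g e) e = diff_op d1 d2 c f e + diff_op d1 d2 c g e"
  by (simp add: diff_op_def algebra_simps)

lemma bounded_deg_shift_pair: fixes f :: "int \<times> int \<Rightarrow> fock" assumes "bounded_deg snd f" shows "bounded_deg snd (\<lambda>(a, b). f (a - c, b - d))"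
  using bounded_deg_shift[OF additive_deg_snd assms, of "(c, d)"] by (simp add: case_prod_beta' minus_prod_def)

text \<open>A bound in u_2 for each exponent of v separately. The series \<open>M (B b x)\<close> of
  \<open>serre_exchange\<close> is of this kind, as the bound on \<open>M\<close> varies with its
  argument.\<close>

definition slice_bdd :: "(int \<times> int \<times> int \<Rightarrow> fock) \<Rightarrow> bool" where
  "slice_bdd f \<longleftrightarrow> (\<forall>b. bounded_deg snd (\<lambda>(a1, a2). f (a1, a2, b)))"

lemma slice_bdd_diff_op: assumes "slice_bdd f" shows "slice_bdd (diff_op (i1, i2, i3) (j1, j2, j3) c f)"
  unfolding slice_bdd_def
proof
  fix b
  have 1: "bounded_deg snd (\<lambda>(a1, a2). f (a1 - k1, a2 - k2, b - k3))" for k1 k2 k3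
  proof -
    have "bounded_deg snd (\<lambda>(a1, a2). f (a1, a2, b - k3))" using assms by (simp add: slice_bdd_def)
    from bounded_deg_shift_pair[OF this, of k1 k2] show ?thesis by (simp add: case_prod_beta)
  qed
  have 2: "bounded_deg snd (\<lambda>e. scl (hb c) * (\<lambda>(a1, a2). f (a1 - 0, a2 - 0, b - 0)) e)"
    by (rule bounded_deg_A_linear[OF 1, of "\<lambda>e x. scl (hb c) * x"]) (intro A_linear_mult_left A_linear_id)
  have "(\<lambda>(a1, a2). diff_op (i1, i2, i3) (j1, j2, j3) c f (a1, a2, b)) = (\<lambda>e. ((\<lambda>(a1, a2). f (a1 - i1, a2 - i2, b - i3)) e
     - (\<lambda>(a1, a2). f (a1 - j1, a2 - j2, b - j3)) e) + scl (hb c) * (\<lambda>(a1, a2). f (a1 - 0, a2 - 0, b - 0)) e)"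
    by (auto simp: diff_op_def fun_eq_iff)
  moreover have "bounded_deg snd \<dots>" by (intro bounded_deg_add bounded_deg_diff 1 2)
  ultimately show "bounded_deg snd (\<lambda>(a1, a2). diff_op (i1, i2, i3) (j1, j2, j3) c f (a1, a2, b))" by simp
qed

lemma slice_bdd_inj: assumes "slice_bdd f" "slice_bdd g" "diff_op (1,0,0) (0,1,0) c f = diff_op (1,0,0) (0,1,0) c g" shows "f = g"
proof -
  have "(\<lambda>(a1, a2). f (a1, a2, b)) = (\<lambda>(a1, a2). g (a1, a2, b))" for b
  proof (rule diff_op_inj[OF additive_deg_snd, of "(1,0)" "(0,1)"])
    have "diff_uv c (\<lambda>(a1, a2). f (a1, a2, b)) (a1, a2) = diff_op (1,0,0) (0,1,0) c f (a1, a2, b)" for f :: "int \<times> int \<times> int \<Rightarrow> fock" and a1 a2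
      by (simp add: diff_op_def)
    then show "diff_uv c (\<lambda>(a1, a2). f (a1, a2, b)) = diff_uv c (\<lambda>(a1, a2). g (a1, a2, b))" using assms(3) by (auto simp: fun_eq_iff)
  qed (use assms in \<open>auto simp: slice_bdd_def\<close>)
  then show ?thesis by (auto simp: fun_eq_iff)
qed

text \<open>
  With \<open>E\<^sub>i(u\<^sub>1)E\<^sub>i(u\<^sub>2) = t(t - h)M\<close> and \<open>t = u\<^sub>1 -
  u\<^sub>2\<close>, the products \<open>E\<^sub>iE\<^sub>jE\<^sub>i\<close> are found by cancelling factors
  \<open>u\<^sub>k - v \<plusminus> h/2\<close>; all six terms are then combinations of the same few series.
\<close>

lemma serre_exchange:
  fixes A B :: opser and M :: "fock \<Rightarrow> int \<times> int \<Rightarrow> fock" and h :: complex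
  assumes alA: "\<And>m. A_linear (A m)" and alB: "\<And>m. A_linear (B m)" and alM: "\<And>e. A_linear (\<lambda>x. M x e)"
    and bA: "\<And>x. bounded_deg (\<lambda>m. m) (\<lambda>m. A m x)" and bB: "\<And>x. bounded_deg (\<lambda>m. m) (\<lambda>m. B m x)"
    and bM: "\<And>x. bounded_deg fst (M x)" "\<And>x. bounded_deg snd (M x)"
    and H1: "\<And>x. comp_uv A A x = diff_uv 0 (diff_uv (- h) (M x))" "\<And>x. comp_vu A A x = diff_uv 0 (diff_uv h (M x))"
    and H2: "\<And>x. diff_uv (- (h / 2)) (comp_uv A B x) = diff_uv (h / 2) (comp_vu A B x)"
  shows "A a1 (A a2 (B b x)) + A a2 (A a1 (B b x)) - 2 * A a1 (B b (A a2 x)) - 2 * A a2 (B b (A a1 x))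
    + B b (A a1 (A a2 x)) + B b (A a2 (A a1 x)) = 0"
proof -
  define T where "T = (\<lambda>c. diff_op (1,0,0) (0,1,0) c :: (int \<times> int \<times> int \<Rightarrow> fock) \<Rightarrow> _)"
  define W1 where "W1 = (\<lambda>c. diff_op (1,0,0) (0,0,1) c :: (int \<times> int \<times> int \<Rightarrow> fock) \<Rightarrow> _)"
  define W2 where "W2 = (\<lambda>c. diff_op (0,1,0) (0,0,1) c :: (int \<times> int \<times> int \<Rightarrow> fock) \<Rightarrow> _)"
  note defs = T_def W1_def W2_def
  define P where "P = (\<lambda>(a1, a2, b). M (B b x) (a1, a2))"
  define Q where "Q = (\<lambda>(a1, a2, b). B b (M x (a1, a2)))"
  define G1 where "G1 = (\<lambda>(a1, a2, b). A a1 (B b (A a2 x)))"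
  define G2 where "G2 = (\<lambda>(a1, a2, b). A a2 (B b (A a1 x)))"
  define C1 where "C1 = (\<lambda>(a1, a2, b). A a1 (A a2 (B b x)))"
  define C2 where "C2 = (\<lambda>(a1, a2, b). A a2 (A a1 (B b x)))"
  define R1 where "R1 = (\<lambda>(a1, a2, b). B b (A a1 (A a2 x)))"
  define R2 where "R2 = (\<lambda>(a1, a2, b). B b (A a2 (A a1 x)))"
  note linB = A_linear_add[OF alB] A_linear_diff[OF alB] A_linear_scl[OF alB]
  note linA = A_linear_add[OF alA] A_linear_diff[OF alA] A_linear_scl[OF alA]
  have C1: "C1 = T 0 (T (- h) P)"
  proof (intro ext, clarify)
    fix a1 a2 b show "C1 (a1, a2, b) = T 0 (T (- h) P) (a1, a2, b)"
      using fun_cong[OF H1(1)[of "B b x"], of "(a1, a2)"] by (simp add: C1_def comp_uv_def P_def T_def diff_op_def)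
  qed
  have C2: "C2 = T 0 (T h P)"
  proof (intro ext, clarify)
    fix a1 a2 b show "C2 (a1, a2, b) = T 0 (T h P) (a1, a2, b)"
      using fun_cong[OF H1(2)[of "B b x"], of "(a1, a2)"] by (simp add: C2_def comp_vu_def P_def T_def diff_op_def)
  qed
  have R1: "R1 = T 0 (T (- h) Q)"
  proof (intro ext, clarify)
    fix a1 a2 b show "R1 (a1, a2, b) = T 0 (T (- h) Q) (a1, a2, b)"
      using arg_cong[OF fun_cong[OF H1(1)[of x], of "(a1, a2)"], of "B b"] by (simp add: R1_def comp_uv_def Q_def T_def diff_op_def linB A_linear_two[OF alB])
  qed
  have R2: "R2 = T 0 (T h Q)"
  proof (intro ext, clarify)
    fix a1 a2 b show "R2 (a1, a2, b) = T 0 (T h Q) (a1, a2, b)"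
      using arg_cong[OF fun_cong[OF H1(2)[of x], of "(a1, a2)"], of "B b"] by (simp add: R2_def comp_vu_def Q_def T_def diff_op_def linB A_linear_two[OF alB])
  qed
  have W2G1: "W2 (h / 2) G1 = W2 (- (h / 2)) C1"
  proof (intro ext, clarify)
    fix a1 a2 b show "W2 (h / 2) G1 (a1, a2, b) = W2 (- (h / 2)) C1 (a1, a2, b)"
      using arg_cong[OF fun_cong[OF H2[of x], of "(a2, b)"], of "A a1"] by (simp add: G1_def C1_def comp_uv_def comp_vu_def W2_def diff_op_def linA)
  qed
  have W1G2: "W1 (h / 2) G2 = W1 (- (h / 2)) C2"
  proof (intro ext, clarify)
    fix a1 a2 b show "W1 (h / 2) G2 (a1, a2, b) = W1 (- (h / 2)) C2 (a1, a2, b)"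
      using arg_cong[OF fun_cong[OF H2[of x], of "(a1, b)"], of "A a2"] by (simp add: G2_def C2_def comp_uv_def comp_vu_def W1_def diff_op_def linA)
  qed
  have W1G1: "W1 (- (h / 2)) G1 = W1 (h / 2) R1"
  proof (intro ext, clarify)
    fix a1 a2 b show "W1 (- (h / 2)) G1 (a1, a2, b) = W1 (h / 2) R1 (a1, a2, b)"
      using fun_cong[OF H2[of "A a2 x"], of "(a1, b)"] by (simp add: G1_def R1_def comp_uv_def comp_vu_def W1_def diff_op_def)
  qed
  have comm: "T c (W1 d f) = W1 d (T c f)" "T c (W2 d f) = W2 d (T c f)" "W1 c (W2 d f) = W2 d (W1 c f)" "T c (T d f) = T d (T c f)" for c d f
    unfolding defs by (rule diff_op_commute)+
  define x1N where "x1N = W2 (- (h / 2)) P"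
  define x2N where "x2N = W1 (- (h / 2)) P"
  define y1N where "y1N = W2 (h / 2) Q"
  define y2N where "y2N = W1 (h / 2) Q"
  let ?k1 = "fst :: int \<times> int \<times> int \<Rightarrow> int" and ?k2 = "\<lambda>e :: int \<times> int \<times> int. fst (snd e)" and ?k3 = "\<lambda>e :: int \<times> int \<times> int. snd (snd e)"
  have add: "additive_deg ?k1" "additive_deg ?k2" "additive_deg ?k3" by (simp_all add: additive_deg_def)
  have bP: "bounded_deg ?k3 P"
    using bounded_deg_A_linear[OF bounded_deg_comp[OF bB, of ?k3], of "\<lambda>e y. M y (fst e, fst (snd e))", OF alM] by (simp add: P_def case_prod_beta')
  have bQ: "bounded_deg ?k1 Q" "bounded_deg ?k2 Q"
  proof -
    have "bounded_deg ?k1 (\<lambda>e. M x (fst e, fst (snd e)))" "bounded_deg ?k2 (\<lambda>e. M x (fst e, fst (snd e)))"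
      using bM[of x] unfolding bounded_deg_def by (metis fst_conv snd_conv)+
    from this[THEN bounded_deg_A_linear, of "\<lambda>e. B (snd (snd e))", OF alB] show "bounded_deg ?k1 Q" "bounded_deg ?k2 Q"
      by (simp_all add: Q_def case_prod_beta')
  qed
  have bG1: "bounded_deg ?k2 G1"
    using bounded_deg_A_linear[OF bounded_deg_comp[OF bA, of ?k2 x], of "\<lambda>e y. A (fst e) (B (snd (snd e)) y)", OF A_linear_comp[OF alA alB]] by (simp add: G1_def case_prod_beta')
  have bG2: "bounded_deg ?k1 G2"
    using bounded_deg_A_linear[OF bounded_deg_comp[OF bA, of ?k1 x], of "\<lambda>e y. A (fst (snd e)) (B (snd (snd e)) y)", OF A_linear_comp[OF alA alB]] by (simp add: G2_def case_prod_beta')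
  have slQ: "slice_bdd Q" using bQ(2) unfolding slice_bdd_def bounded_deg_def by (auto simp: case_prod_beta') (metis fst_conv snd_conv)
  have slP: "slice_bdd P" using bM(2) by (simp add: slice_bdd_def P_def case_prod_beta')
  note slL = slice_bdd_diff_op
  \<comment> \<open>After multiplication by t(t - h) both sides agree: \<open>B\<close> is moved
    leftwards through the two copies of \<open>A\<close>, one exchange relation at a time.
    \<open>slice_bdd\<close> then permits cancelling the two factors.\<close>
  have NN: "W1 (- (h / 2)) x1N = W1 (h / 2) y1N"
  proof -
    have "T 0 (T (- h) (W1 (- (h / 2)) x1N)) = W1 (- (h / 2)) (W2 (- (h / 2)) C1)"
      by (simp add: comm x1N_def C1)
    also have "\<dots> = W2 (h / 2) (W1 (h / 2) R1)"
      by (simp add: W2G1[symmetric] comm(3) W1G1)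
    also have "\<dots> = T 0 (T (- h) (W1 (h / 2) y1N))"
      by (simp add: comm y1N_def R1)
    finally have "T 0 (T (- h) (W1 (- (h / 2)) x1N)) = T 0 (T (- h) (W1 (h / 2) y1N))" .
    moreover have s: "slice_bdd (W1 (- (h / 2)) x1N)" "slice_bdd (W1 (h / 2) y1N)"
      unfolding defs x1N_def y1N_def by (rule slice_bdd_diff_op, rule slice_bdd_diff_op, rule slP slQ)+
    moreover have "slice_bdd (T (- h) (W1 (- (h / 2)) x1N))" "slice_bdd (T (- h) (W1 (h / 2) y1N))"
      unfolding T_def by (rule slice_bdd_diff_op, rule s)+
    ultimately show ?thesis unfolding T_def using slice_bdd_inj by blast
  qed
  \<comment> \<open>No bound of \<open>P\<close> in u_2 uniform in v is at hand. It comes from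
    \<open>NN\<close>: for low degree in u_2 the right side vanishes up to order p, hence so does
    the multiple of \<open>x1N\<close>, and the bound of \<open>x1N\<close> in v forces
    \<open>x1N\<close> itself to vanish there.\<close>
  have b1: "bounded_deg ?k2 x1N"
  proof (rule bounded_degI)
    fix p
    have "bounded_deg ?k2 (W1 (h / 2) y1N)" unfolding defs y1N_def by (intro bounded_deg_diff_op add bQ)
    then obtain K where K: "\<And>e q. ?k2 e < K \<Longrightarrow> q \<le> p \<Longrightarrow> W1 (h / 2) y1N e $ q = 0"
      using bounded_degE by blast
    have "x1N e $ q = 0" if "?k2 e < K" "q \<le> p" for e q
    proof (rule diff_op_uniq[of ?k3 "(1,0,0)" "(0,0,1)" "{e. ?k2 e < K}" p "- (h / 2)" x1N, OF add(3)])
      show "diff_op (1,0,0) (0,0,1) (- (h / 2)) x1N (e + (1,0,0)) $ q = 0" if "e \<in> {e. ?k2 e < K}" "q \<le> p" for e q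
        using K[of "e + (1,0,0)" q] that fun_cong[OF NN, of "e + (1,0,0)"] by (simp add: W1_def)
      show "\<exists>K'. \<forall>e\<in>{e. ?k2 e < K}. ?k3 e < K' \<longrightarrow> x1N e $ p = 0" for p
      proof -
        have "bounded_deg ?k3 x1N" unfolding defs x1N_def by (intro bounded_deg_diff_op add bP)
        then show ?thesis unfolding bounded_deg_def by blast
      qed
    qed (use that in auto)
    then show "\<exists>K. \<forall>e q. ?k2 e < K \<longrightarrow> q \<le> p \<longrightarrow> x1N e $ q = 0" by blast
  qed
  have NNs: "W2 (- (h / 2)) x2N = W2 (h / 2) y2N" using NN by (simp add: x1N_def x2N_def y1N_def y2N_def comm(3))
  have b2: "bounded_deg ?k1 x2N"
  proof (rule bounded_degI)
    fix p
    have "bounded_deg ?k1 (W2 (h / 2) y2N)" unfolding defs y2N_def by (intro bounded_deg_diff_op add bQ)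
    then obtain K where K: "\<And>e q. ?k1 e < K \<Longrightarrow> q \<le> p \<Longrightarrow> W2 (h / 2) y2N e $ q = 0"
      using bounded_degE by blast
    have "x2N e $ q = 0" if "?k1 e < K" "q \<le> p" for e q
    proof (rule diff_op_uniq[of ?k3 "(0,1,0)" "(0,0,1)" "{e. ?k1 e < K}" p "- (h / 2)" x2N, OF add(3)])
      show "diff_op (0,1,0) (0,0,1) (- (h / 2)) x2N (e + (0,1,0)) $ q = 0" if "e \<in> {e. ?k1 e < K}" "q \<le> p" for e q
        using K[of "e + (0,1,0)" q] that fun_cong[OF NNs, of "e + (0,1,0)"] by (simp add: W2_def)
      show "\<exists>K'. \<forall>e\<in>{e. ?k1 e < K}. ?k3 e < K' \<longrightarrow> x2N e $ p = 0" for p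
      proof -
        have "bounded_deg ?k3 x2N" unfolding defs x2N_def by (intro bounded_deg_diff_op add bP)
        then show ?thesis unfolding bounded_deg_def by blast
      qed
    qed (use that in auto)
    then show "\<exists>K. \<forall>e q. ?k1 e < K \<longrightarrow> q \<le> p \<longrightarrow> x2N e $ q = 0" by blast
  qed
  \<comment> \<open>Let w = u_2 - v + h/2, so that w G1 = t(t - h) x1N by \<open>W2G1\<close>. Here
    t - h = (u_1 - v - h/2) - w, and (u_1 - v - h/2) x1N = w y2N by \<open>NN\<close>; the factor w
    becomes visible, and cancelling it gives this witness.\<close>
  have G1: "G1 = T 0 (\<lambda>e. y2N e - x1N e)"
  proof (rule diff_op_inj[OF add(2), of "(0,1,0)" "(0,0,1)" _ _ "h / 2"])
    show "bounded_deg ?k2 (T 0 (\<lambda>e. y2N e - x1N e))"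
      unfolding T_def y2N_def W1_def by (intro bounded_deg_diff_op add bounded_deg_diff b1 bQ)
    have "W2 (h / 2) (T 0 (\<lambda>e. y2N e - x1N e)) = T 0 (W2 (h / 2) (\<lambda>e. y2N e - x1N e))" by (simp add: comm)
    also have "W2 (h / 2) (\<lambda>e. y2N e - x1N e) = (\<lambda>e. W1 (- (h / 2)) x1N e - W2 (h / 2) x1N e)"
      using NN by (simp add: fun_eq_iff W2_def diff_op_diff) (simp add: W2_def[symmetric] W1_def[symmetric] y1N_def y2N_def comm(3))
    also have "\<dots> = T (- h) x1N" by (rule ext) (simp add: defs diff_op_lin)
    also have "T 0 \<dots> = W2 (- (h / 2)) C1" by (simp add: x1N_def comm C1)
    finally show "diff_op (0,1,0) (0,0,1) (h / 2) G1 = diff_op (0,1,0) (0,0,1) (h / 2) (T 0 (\<lambda>e. y2N e - x1N e))"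
      using W2G1 by (simp add: W2_def)
  qed (simp_all add: bG1)
  have G2: "G2 = T 0 (\<lambda>e. x2N e - y1N e)"
  proof (rule diff_op_inj[OF add(1), of "(1,0,0)" "(0,0,1)" _ _ "h / 2"])
    show "bounded_deg ?k1 (T 0 (\<lambda>e. x2N e - y1N e))"
      unfolding T_def y1N_def W2_def by (intro bounded_deg_diff_op add bounded_deg_diff b2 bQ)
    have "W1 (h / 2) (T 0 (\<lambda>e. x2N e - y1N e)) = T 0 (W1 (h / 2) (\<lambda>e. x2N e - y1N e))" by (simp add: comm)
    also have "W1 (h / 2) (\<lambda>e. x2N e - y1N e) = (\<lambda>e. W1 (h / 2) x2N e - W2 (- (h / 2)) x2N e)"
      using NNs by (simp add: fun_eq_iff W1_def diff_op_diff) (simp add: W2_def[symmetric] W1_def[symmetric] y1N_def y2N_def comm(3))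
    also have "\<dots> = T h x2N" by (rule ext) (simp add: defs diff_op_lin)
    also have "T 0 \<dots> = W1 (- (h / 2)) C2" by (simp add: x2N_def comm C2)
    finally show "diff_op (1,0,0) (0,0,1) (h / 2) G2 = diff_op (1,0,0) (0,0,1) (h / 2) (T 0 (\<lambda>e. x2N e - y1N e))"
      using W1G2 by (simp add: W1_def)
  qed (simp_all add: bG2)
  \<comment> \<open>With t = u_1 - u_2 one has C1 + C2 = 2 t^2 P, R1 + R2 = 2 t^2 Q and G1 + G2 =
    t^2 (P + Q).\<close>
  have fin: "C1 e + C2 e - 2 * G1 e - 2 * G2 e + R1 e + R2 e = 0" for e
    unfolding C1 C2 G1 G2 R1 R2 x1N_def x2N_def y1N_def y2N_def defs
    by (simp add: diff_op_def hb_minus scl_minus algebra_simps)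
  show ?thesis using fin[of "(a1, a2, b)"] by (simp add: C1_def C2_def G1_def G2_def R1_def R2_def)
qed

text \<open>
  \<open>X\<close> and \<open>Y\<close> are the expansions of \<open>N/(u - v + c\<hbar>)\<close> in the two
  regions, so their difference is a delta function, whose row at \<open>u\<^sup>-\<^sup>1\<close> is the value
  \<open>h\<close> of \<open>N\<close> at \<open>u + c\<hbar> = v\<close>.
\<close>

lemma residue_u:
  assumes X: "bounded_deg snd X" "diff_uv c X = N" and Y: "bounded_deg fst Y" "diff_uv c Y = N"
    and N: "\<And>e. N e = (\<lambda>(a, b). if a = 0 then h b else 0) e + diff_uv c K e" and K: "bounded_deg fst K" "bounded_deg snd K"
  shows "X (-1, b) - Y (-1, b) = h b"
proof -
  let ?X = "\<lambda>e. X e - K e" and ?Y = "\<lambda>e. Y e - K e"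
  have LX: "diff_uv c ?X (a, b) = (if a = 0 then h b else 0)" for a b using X(2) N[of "(a, b)"] by (simp add: diff_op_diff)
  have LY: "diff_uv c ?Y (a, b) = (if a = 0 then h b else 0)" for a b using Y(2) N[of "(a, b)"] by (simp add: diff_op_diff)
  \<comment> \<open>The source lies on the row \<open>a = 0\<close> alone. On the half plane
    \<open>0 \<le> a\<close> the recursion reads only rows beyond it, so \<open>?X\<close> solves
    the homogeneous equation and vanishes; \<open>?Y\<close> does so on the complementary half
    plane.\<close>
  have X0: "?X (a, b) = 0" if "0 \<le> a" for a b
  proof (rule fps_ext)
    fix p
    have "?X (a, b) $ p = 0"
    proof (rule diff_op_uniq[of snd "(1,0)" "(0,1)" "{e. 0 \<le> fst e}" p c ?X, OF additive_deg_snd])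
      show "diff_uv c ?X (e + (1, 0)) $ q = 0" if "e \<in> {e. 0 \<le> fst e}" for e q
        using that LX[of "fst e + 1" "snd e"] by (cases e) auto
      show "\<exists>K'. \<forall>e\<in>{e. 0 \<le> fst e}. snd e < K' \<longrightarrow> ?X e $ p = 0" for p
        using bounded_degE[OF bounded_deg_diff[OF X(1) K(2)], of p] by (metis order_refl)
    qed (use that in auto)
    then show "?X (a, b) $ p = 0 $ p" by simp
  qed
  have Y0: "?Y (a, b) = 0" if "a \<le> -1" for a b
  proof (rule fps_ext)
    fix p
    have "?Y (a, b) $ p = 0"
    proof (rule diff_op_uniq[of fst "(0,1)" "(1,0)" "{e. fst e \<le> -1}" p "- c" ?Y, OF additive_deg_fst])
      show "diff_op (0,1) (1,0) (- c) ?Y (e + (0,1)) $ q = 0" if "e \<in> {e. fst e \<le> -1}" for e q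
        using that LY[of "fst e" "snd e + 1"] unfolding diff_op_swap by (cases e) auto
      show "\<exists>K'. \<forall>e\<in>{e. fst e \<le> -1}. fst e < K' \<longrightarrow> ?Y e $ p = 0" for p
        using bounded_degE[OF bounded_deg_diff[OF Y(1) K(1)], of p] by (metis order_refl)
    qed (use that in auto)
    then show "?Y (a, b) $ p = 0 $ p" by simp
  qed
  have "diff_uv c ?X (0, b) = ?X (-1, b) - ?X (0, b - 1) + scl (hb c) * ?X (0, b)" by (simp add: diff_op_def)
  then have "?X (-1, b) = h b" using LX[of 0 b] X0 by simp
  then show ?thesis using Y0[of "-1" b] by (simp add: algebra_simps)
qed

text \<open>Mirror image of \<open>residue_u\<close>: now \<open>h\<close> is the value of
  \<open>N\<close> at v = u + c hbar. It is \<open>?X\<close> that vanishes for b \<le> -1, so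
  \<open>h\<close> is read off from \<open>?Y\<close>, with a minus sign.\<close>

lemma residue_v:
  assumes X: "bounded_deg snd X" "diff_uv c X = N" and Y: "bounded_deg fst Y" "diff_uv c Y = N"
    and N: "\<And>e. N e = (\<lambda>(a, b). if b = 0 then h a else 0) e + diff_uv c K e" and K: "bounded_deg fst K" "bounded_deg snd K"
  shows "X (a, -1) - Y (a, -1) = h a"
proof -
  let ?X = "\<lambda>e. X e - K e" and ?Y = "\<lambda>e. Y e - K e"
  have LX: "diff_uv c ?X (a, b) = (if b = 0 then h a else 0)" for a b using X(2) N[of "(a, b)"] by (simp add: diff_op_diff)
  have LY: "diff_uv c ?Y (a, b) = (if b = 0 then h a else 0)" for a b using Y(2) N[of "(a, b)"] by (simp add: diff_op_diff)
  have X0: "?X (a, b) = 0" if "b \<le> -1" for a b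
  proof (rule fps_ext)
    fix p
    have "?X (a, b) $ p = 0"
    proof (rule diff_op_uniq[of snd "(1,0)" "(0,1)" "{e. snd e \<le> -1}" p c ?X, OF additive_deg_snd])
      show "diff_uv c ?X (e + (1, 0)) $ q = 0" if "e \<in> {e. snd e \<le> -1}" for e q
        using that LX[of "fst e + 1" "snd e"] by (cases e) auto
      show "\<exists>K'. \<forall>e\<in>{e. snd e \<le> -1}. snd e < K' \<longrightarrow> ?X e $ p = 0" for p
        using bounded_degE[OF bounded_deg_diff[OF X(1) K(2)], of p] by (metis order_refl)
    qed (use that in auto)
    then show "?X (a, b) $ p = 0 $ p" by simp
  qed
  have Y0: "?Y (a, b) = 0" if "0 \<le> b" for a b
  proof (rule fps_ext)
    fix p
    have "?Y (a, b) $ p = 0"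
    proof (rule diff_op_uniq[of fst "(0,1)" "(1,0)" "{e. 0 \<le> snd e}" p "- c" ?Y, OF additive_deg_fst])
      show "diff_op (0,1) (1,0) (- c) ?Y (e + (0,1)) $ q = 0" if "e \<in> {e. 0 \<le> snd e}" for e q
        using that LY[of "fst e" "snd e + 1"] unfolding diff_op_swap by (cases e) auto
      show "\<exists>K'. \<forall>e\<in>{e. 0 \<le> snd e}. fst e < K' \<longrightarrow> ?Y e $ p = 0" for p
        using bounded_degE[OF bounded_deg_diff[OF Y(1) K(1)], of p] by (metis order_refl)
    qed (use that in auto)
    then show "?Y (a, b) $ p = 0 $ p" by simp
  qed
  have "diff_uv c ?Y (a, 0) = ?Y (a - 1, 0) - ?Y (a, -1) + scl (hb c) * ?Y (a, 0)" by (simp add: diff_op_def)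
  then have "- ?Y (a, -1) = h a" using LY[of a 0] Y0 by simp
  then show ?thesis using X0[of "-1" a] by (simp add: algebra_simps)
qed

section \<open>Residues of the commutator of \<open>E\<close> and \<open>F\<close>\<close>

type_synonym laurent2 = "((key \<times> (int \<times> int)) \<Rightarrow>\<^sub>0 complex) fps"

lemma subst_v_v_plus_cre_ser: "subst_v (v_plus d) (cre_ser j c) = cre_ser j (c + d)"
  unfolding cre_ser_def subst_v_subst_v[OF in_filt_v_plus in_filt_v_plus] subst_v_v_plus ..

text \<open>At the pole u = v + hbar/2 the factors e^alpha and e^(-alpha) cancel, and the remaining
  creation exponents are those of H^- at v + hbar/4.\<close>

lemma cre_E_cre_F_u: "subst_v (v_plus (1/2)) (cre_E n j) * cre_F n j = subst_v (v_plus (1/4)) (cre_H n j)"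
proof -
  have e_elt: "fps_const (e_elt (alpha n j)) * fps_const (e_elt (- alpha n j)) = 1"
    by (simp add: e_elt_add[symmetric])
  have in_filt: "in_filt 1 (subst_v (v_plus (1/2)) (log_cre_E n j))" by (rule in_filt_subst_v[OF in_filt_v_plus in_filt_log_cre_E])
  have C: "subst_v (v_plus (1/2)) (log_cre_E n j) + log_cre_F n j = subst_v (v_plus (1/4)) (log_cre_H n j)"
    unfolding log_cre_E_def log_cre_F_def log_cre_H_def subst_v_add[OF in_filt_v_plus] subst_v_diff[OF in_filt_v_plus] subst_v_minus[OF in_filt_v_plus] subst_v_sum[OF in_filt_v_plus] subst_v_v_plus_cre_ser
    by (simp add: sum_subtractf)
  have "subst_v (v_plus (1/2)) (cre_E n j) * cre_F n j = (fps_const (e_elt (alpha n j)) * fps_const (e_elt (- alpha n j))) * (EXP (subst_v (v_plus (1/2)) (log_cre_E n j)) * EXP (log_cre_F n j))"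
    unfolding cre_E_def cre_F_def subst_v_const_mult[OF in_filt_v_plus] subst_v_EXP[OF in_filt_v_plus in_filt_log_cre_E] by (simp only: mult_ac)
  then show ?thesis unfolding e_elt EXP_add[OF in_filt in_filt_log_cre_F, symmetric] C cre_H_def subst_v_EXP[OF in_filt_v_plus in_filt_log_cre_H] by simp
qed

text \<open>At the other pole, v = u + hbar/2, all creation exponents cancel as well. This matches
  H^+, which has no creation part.\<close>

lemma cre_E_cre_F_v: "subst_v (v_plus (1/2)) (cre_F n j) * cre_E n j = 1"
proof -
  have e_elt: "fps_const (e_elt (alpha n j)) * fps_const (e_elt (- alpha n j)) = 1"
    by (simp add: e_elt_add[symmetric])
  have in_filt: "in_filt 1 (subst_v (v_plus (1/2)) (log_cre_F n j))" by (rule in_filt_subst_v[OF in_filt_v_plus in_filt_log_cre_F])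
  have C: "subst_v (v_plus (1/2)) (log_cre_F n j) + log_cre_E n j = 0"
    unfolding log_cre_E_def log_cre_F_def subst_v_add[OF in_filt_v_plus] subst_v_diff[OF in_filt_v_plus] subst_v_minus[OF in_filt_v_plus] subst_v_sum[OF in_filt_v_plus] subst_v_v_plus_cre_ser
    by simp
  have "subst_v (v_plus (1/2)) (cre_F n j) * cre_E n j = (fps_const (e_elt (alpha n j)) * fps_const (e_elt (- alpha n j))) * (EXP (subst_v (v_plus (1/2)) (log_cre_F n j)) * EXP (log_cre_E n j))"
    unfolding cre_E_def cre_F_def subst_v_const_mult[OF in_filt_v_plus] subst_v_EXP[OF in_filt_v_plus in_filt_log_cre_F] by (simp only: mult_ac)
  then show ?thesis unfolding e_elt EXP_add[OF in_filt in_filt_log_cre_E, symmetric] C by simp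
qed

text \<open>The quotient of F(u) G(v) by u - v - c hbar, the remainder being F(v + c hbar) G(v). By
  Horner's scheme the coefficient of u^a is the tail of F beyond a, evaluated at v + c hbar, times
  G(v).\<close>

definition div_part :: "complex \<Rightarrow> fock fps \<Rightarrow> fock fps \<Rightarrow> int \<times> int \<Rightarrow> fock" where
  "div_part c F G = (\<lambda>(a, b). if 0 \<le> a \<and> 0 \<le> b then (subst_v (v_plus c) (fps_shift (nat a + 1) F) * G) $ nat b else 0)"

lemma div_u: "to_ser F a * to_ser G b = (if a = 0 then to_ser (subst_v (v_plus c) F * G) b else 0) + diff_uv (- c) (div_part c F G) (a, b)"
proof -
  define S where "S k = subst_v (v_plus c) (fps_shift k F)" for k
  have sh: "fps_shift k F = fps_const (F $ k) + fps_X * fps_shift (k + 1) F" for k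
  proof (rule fps_ext)
    fix m show "fps_shift k F $ m = (fps_const (F $ k) + fps_X * fps_shift (k + 1) F) $ m"
      by (cases m) (simp_all add: One_nat_def)
  qed
  have Sk: "S k = fps_const (F $ k) + v_plus c * S (k + 1)" for k
    using arg_cong[OF sh[of k], of "subst_v (v_plus c)"]
    unfolding S_def subst_v_add[OF in_filt_v_plus] subst_v_const[OF in_filt_v_plus] subst_v_mult[OF in_filt_v_plus] subst_v_X[OF in_filt_v_plus] .
  have y: "(v_plus c * Z) $ m = (if m = 0 then 0 else Z $ (m - 1)) + scl (hb c) * Z $ m" for Z :: "fock fps" and m
    by (cases m) (simp_all add: v_plus_def distrib_right)
  have SG: "(S k * G) $ m = F $ k * G $ m + ((if m = 0 then 0 else (S (k + 1) * G) $ (m - 1)) + scl (hb c) * (S (k + 1) * G) $ m)" for k m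
  proof -
    have "S k * G = fps_const (F $ k) * G + v_plus c * (S (k + 1) * G)"
      by (subst Sk) (simp only: distrib_right mult.assoc)
    then show ?thesis by (simp add: y)
  qed
  show ?thesis
  proof (cases "0 \<le> a \<and> 0 \<le> b")
    case True
    have nb: "b \<noteq> 0 \<Longrightarrow> nat (b - 1) = nat b - 1" and na: "a \<noteq> 0 \<Longrightarrow> nat (a - 1) + 1 = nat a" using True by auto
    have "(if a = 0 then to_ser (subst_v (v_plus c) F * G) b else div_part c F G (a - 1, b)) = (S (nat a) * G) $ nat b"
      using True na by (auto simp: to_ser_def S_def div_part_def)
    also have "\<dots> = to_ser F a * to_ser G b + (div_part c F G (a, b - 1) + scl (hb c) * div_part c F G (a, b))"
      using True nb by (subst SG) (auto simp: to_ser_def S_def div_part_def)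
    finally show ?thesis using True by (auto simp: diff_op_def hb_minus scl_minus div_part_def algebra_simps)
  next
    case False then show ?thesis by (auto simp: diff_op_def div_part_def to_ser_def)
  qed
qed

lemma div_v: "to_ser F a * to_ser G b = (if b = 0 then to_ser (subst_v (v_plus c) G * F) a else 0) + diff_uv c (\<lambda>(a, b). - div_part c G F (b, a)) (a, b)"
  using div_u[of G b F a c] by (simp add: diff_op_def hb_minus scl_minus mult.commute)

lemma bounded_deg_div_part: "bounded_deg fst (div_part c F G)" "bounded_deg snd (div_part c F G)" "bounded_deg fst (\<lambda>(a, b). - div_part c F G (b, a))" "bounded_deg snd (\<lambda>(a, b). - div_part c F G (b, a))"
  by (auto intro!: bounded_degI exI[of _ 0] simp: div_part_def)

lemma dvd_diff_mult: "d dvd a - b \<Longrightarrow> d dvd a' - b' \<Longrightarrow> d dvd a * a' - b * b'" for d :: "'a::comm_ring_1"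
proof -
  assume "d dvd a - b" "d dvd a' - b'"
  then have "d dvd (a - b) * a' + b * (a' - b')" by simp
  then show ?thesis by (simp add: algebra_simps)
qed

text \<open>Congruence modulo \<open>d\<close> is multiplicative and so passes from generators to
  monomials. Basis vectors suffice because the formulas derived from it are A-linear.\<close>

lemma dvd_hom_basis:
  fixes H G :: "fock \<Rightarrow> ('l::comm_monoid_add \<Rightarrow>\<^sub>0 complex) fps"
  assumes "fock_hom H" "fock_hom G" "\<And>jk. d dvd H (a_elt jk) - G (a_elt jk)" "\<And>\<beta>. d dvd H (e_elt \<beta>) - G (e_elt \<beta>)"
  shows "d dvd H (basis k) - G (basis k)"
proof -
  obtain \<mu> \<beta> where k: "k = (\<mu>, \<beta>)" by (cases k)
  have "d dvd H (basis (\<mu>, 0)) - G (basis (\<mu>, 0))"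
  proof (induction \<mu> rule: pm_nat_induct)
    case 1 then show ?case using assms(1,2) by (simp add: basis_0 fock_hom_def flip: zero_prod_def)
  next
    case (2 \<mu> j)
    have e: "basis (Poly_Mapping.single j 1 + \<mu>, 0) = a_elt j * basis (\<mu>, 0)" by (simp add: a_elt_def basis_mult)
    show ?case unfolding e fock_homD(2)[OF assms(1)] fock_homD(2)[OF assms(2)] by (rule dvd_diff_mult[OF assms(3) 2])
  qed
  moreover have "basis k = basis (\<mu>, 0) * e_elt \<beta>" by (simp add: k e_elt_def basis_mult)
  ultimately show ?thesis using assms fock_homD(2)[OF assms(1)] fock_homD(2)[OF assms(2)] by (simp add: dvd_diff_mult)
qed

text \<open>For negative k the values \<open>X k\<close> and \<open>Y k\<close> are units, and X k -
  Y k is, up to sign, their product times X(-k) - Y(-k).\<close>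

lemma dvd_int_powers:
  fixes X Y :: "int \<Rightarrow> 'a::comm_ring_1"
  assumes "\<And>k l. X (k + l) = X k * X l" "\<And>k l. Y (k + l) = Y k * Y l" "X 0 = 1" "Y 0 = 1"
  shows "X 1 - Y 1 dvd X k - Y k"
proof -
  have nat: "X 1 - Y 1 dvd X (int m) - Y (int m)" for m
  proof (induction m)
    case (Suc m)
    have e: "int (Suc m) = 1 + int m" by simp
    show ?case unfolding e assms(1,2) by (rule dvd_diff_mult[OF dvd_refl Suc])
  qed (simp add: assms)
  show ?thesis
  proof (cases "0 \<le> k")
    case True then show ?thesis using nat[of "nat k"] by simp
  next
    case False
    have 1: "X k * X (- k) = 1" "Y k * Y (- k) = 1" using assms(1)[of k "- k"] assms(2)[of k "- k"] assms(3,4) by simp_all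
    have "X 1 - Y 1 dvd (X k * Y k) * (X (- k) - Y (- k))" using nat[of "nat (- k)"] False by simp
    moreover have "(X k * Y k) * (X (- k) - Y (- k)) = (X k * X (- k)) * Y k - (Y k * Y (- k)) * X k" by (simp add: algebra_simps)
    ultimately have "X 1 - Y 1 dvd Y k - X k" unfolding 1 by simp
    then show ?thesis by (metis dvd_minus_iff minus_diff_eq)
  qed
qed

text \<open>The homomorphism of H^+ translated from u to u + hbar/4: the constants are -1/2 + 1/4
  and 1/2 + 1/4 (see \<open>shift_u_hom_H\<close>).\<close>

definition hom_H_shift :: "nat \<Rightarrow> nat \<Rightarrow> fock \<Rightarrow> laurent" where
  "hom_H_shift n j = shift_hom (\<lambda>jk. - (ann_shift j (-1/4) jk - ann_shift j (3/4) jk)) (\<lambda>\<beta>. lin_pow (3/4) (- ip (alpha n j) \<beta>) * lin_pow (-1/4) (ip (alpha n j) \<beta>))"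

lemma mult_hom_Hq: "mult_hom (\<lambda>\<beta>. lin_pow a (- ip \<gamma> \<beta>) * lin_pow b (ip \<gamma> \<beta>) :: laurent)"
  unfolding mult_hom_def
proof (intro conjI allI)
  fix \<beta> \<beta>'
  have "- ip \<gamma> (\<beta> + \<beta>') = - ip \<gamma> \<beta> + - ip \<gamma> \<beta>'" by (simp add: ip_add)
  then show "lin_pow a (- ip \<gamma> (\<beta> + \<beta>')) * lin_pow b (ip \<gamma> (\<beta> + \<beta>')) = (lin_pow a (- ip \<gamma> \<beta>) * lin_pow b (ip \<gamma> \<beta>)) * (lin_pow a (- ip \<gamma> \<beta>') * lin_pow b (ip \<gamma> \<beta>') :: laurent)"
    by (simp only: ip_add lin_pow_add mult_ac)
qed (simp add: lin_pow_0)

abbreviation uv_plus :: "complex \<Rightarrow> ((key \<times> (int \<times> int)) \<Rightarrow>\<^sub>0 complex) fps" where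
  "uv_plus c \<equiv> basis (0, (1, 0)) - basis (0, (0, 1)) + scl (hb c)"

lemma emb_u_emb_v_lin_pow: "emb_u (lin_pow c 1) - emb_v (lin_pow d 1) = uv_plus (c - d)"
  by (simp add: lin_pow_1 A_linear_add[OF A_linear_emb_u] A_linear_add[OF A_linear_emb_v] hb_diff scl_diff)

context fixes n i :: nat
begin

private definition Sg where "Sg = shift_hom2 (fst (field_E n i)) (fst (snd (field_E n i))) (fst (field_F n i)) (fst (snd (field_F n i)))"

private lemma ghomS: "mult_hom (\<lambda>\<beta>. emb_u (fst (snd (field_E n i)) \<beta>) * emb_v (fst (snd (field_F n i)) \<beta>))"
  unfolding field_E_def field_F_def fst_conv snd_conv by (intro mult_hom_mult mult_hom_emb_u mult_hom_emb_v mult_hom_zpow_val)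

private lemma vSg: "fock_hom Sg"
  unfolding Sg_def shift_hom2_def by (rule fock_hom_shift_hom[OF ghomS])

private lemma Sg_a_elt: "Sg (a_elt jk) = emb (a_elt jk) + (if fst jk = i \<and> 0 < snd jk then - emb_u (lin_pow (-1/4) (- int (snd jk))) + emb_v (lin_pow (1/4) (- int (snd jk))) else 0)"
  unfolding Sg_def shift_hom2_def shift_hom_a_elt[OF ghomS] by (simp add: field_E_def field_F_def ann_shift_def A_linear_0[OF A_linear_emb_u] A_linear_0[OF A_linear_emb_v] A_linear_minus[OF A_linear_emb_u])

private lemma Sg_e_elt: "Sg (e_elt \<beta>) = emb (e_elt \<beta>) * (emb_u (lin_pow (-1/4) (ip (alpha n i) \<beta>)) * emb_v (lin_pow (1/4) (- ip (alpha n i) \<beta>)))"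
proof -
  let ?m = "ip (alpha n i) \<beta>" and ?e = "(-1 :: complex) ^ sgn_exp n i"
  have "?e powi ?m * ?e powi (- ?m) = 1" by (simp add: power_int_minus)
  then have 1: "scl (fps_const (?e powi ?m)) * scl (fps_const (?e powi (- ?m))) = (1 :: ((key \<times> (int \<times> int)) \<Rightarrow>\<^sub>0 complex) fps)"
    by (simp flip: scl_mult)
  have "emb_u (zpow_val (sgn_exp n i) (-1/4) (alpha n i) \<beta>) * emb_v (zpow_val (sgn_exp n i) (1/4) (- alpha n i) \<beta>)
    = (scl (fps_const (?e powi ?m)) * scl (fps_const (?e powi (- ?m)))) * (emb_u (lin_pow (-1/4) ?m) * emb_v (lin_pow (1/4) (- ?m)))"
    unfolding zpow_val_def ip_minus emb_u_mult emb_v_mult emb_u_scl emb_v_scl by (simp only: mult_ac)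
  then show ?thesis unfolding Sg_def shift_hom2_def shift_hom_e_elt field_E_def field_F_def fst_conv snd_conv 1 by simp
qed

private lemma X_hom: "emb_u (lin_pow c (k + l)) = emb_u (lin_pow c k) * emb_u (lin_pow c l)" "emb_v (lin_pow c (k + l)) = emb_v (lin_pow c k) * emb_v (lin_pow c l)"
  "emb_u (lin_pow c 0) = 1" "emb_v (lin_pow c 0) = 1"
  by (simp_all add: lin_pow_add emb_u_mult emb_v_mult lin_pow_0)

private lemma dvd1: "uv_plus (-1/2) dvd emb_u (lin_pow (-1/4) k) - emb_v (lin_pow (1/4) k)"
  using dvd_int_powers[of "\<lambda>k. emb_u (lin_pow (-1/4) k) :: laurent2" "\<lambda>k. emb_v (lin_pow (1/4) k)" k] by (simp add: X_hom emb_u_emb_v_lin_pow)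
private lemma dvd2: "uv_plus (1/2) dvd emb_u (lin_pow (3/4) k) - emb_v (lin_pow (1/4) k)"
  using dvd_int_powers[of "\<lambda>k. emb_u (lin_pow (3/4) k) :: laurent2" "\<lambda>k. emb_v (lin_pow (1/4) k)" k] by (simp add: X_hom emb_u_emb_v_lin_pow)

private lemma vik: "fock_hom (emb :: fock \<Rightarrow> ((key \<times> (int \<times> int)) \<Rightarrow>\<^sub>0 complex) fps)"
  by (simp add: fock_hom_def A_linear_emb emb_mult)

text \<open>The annihilation data of E sit at u - hbar/4 and those of F at v + hbar/4, with opposite
  signs; they cancel when u = v + hbar/2.\<close>

private lemma Sg_dvd1: "uv_plus (-1/2) dvd Sg (basis k) - emb (basis k)"
proof (rule dvd_hom_basis[OF vSg vik])
  show "uv_plus (-1/2) dvd Sg (a_elt jk) - emb (a_elt jk)" for jk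
    using dvd_minus_iff[THEN iffD2, OF dvd1[of "- int (snd jk)"]] by (simp add: Sg_a_elt)
  show "uv_plus (-1/2) dvd Sg (e_elt \<beta>) - emb (e_elt \<beta>)" for \<beta>
  proof -
    let ?m = "ip (alpha n i) \<beta>"
    have "emb_v (lin_pow (1/4) ?m) * emb_v (lin_pow (1/4) (- ?m)) = (1 :: laurent2)" using X_hom(2)[of "1/4" ?m "- ?m"] by (simp add: X_hom)
    then have "Sg (e_elt \<beta>) - emb (e_elt \<beta>) = emb (e_elt \<beta>) * emb_v (lin_pow (1/4) (- ?m)) * (emb_u (lin_pow (-1/4) ?m) - emb_v (lin_pow (1/4) ?m))"
      unfolding Sg_e_elt by (simp add: right_diff_distrib mult_ac)
    then show ?thesis using dvd1[of ?m] by simp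
  qed
qed

private lemma vHq: "fock_hom (\<lambda>x. emb_u (hom_H_shift n i x))"
  unfolding hom_H_shift_def fock_hom_def
  by (simp add: A_linear_comp[OF A_linear_emb_u A_linear_shift_hom] shift_hom_mult[OF mult_hom_Hq] shift_hom_1[OF mult_hom_Hq] emb_u_mult)

text \<open>When v = u + hbar/2, the data of F move to u + 3 hbar/4. Together with those of E at u -
  hbar/4 they are the data of H^+ at u + hbar/4.\<close>

private lemma Sg_dvd2: "uv_plus (1/2) dvd Sg (basis k) - emb_u (hom_H_shift n i (basis k))"
proof (rule dvd_hom_basis[OF vSg vHq])
  show "uv_plus (1/2) dvd Sg (a_elt jk) - emb_u (hom_H_shift n i (a_elt jk))" for jk
    using dvd_minus_iff[THEN iffD2, OF dvd2[of "- int (snd jk)"]]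
    by (simp add: Sg_a_elt hom_H_shift_def shift_hom_a_elt[OF mult_hom_Hq] ann_shift_def A_linear_add[OF A_linear_emb_u] A_linear_diff[OF A_linear_emb_u] A_linear_minus[OF A_linear_emb_u] emb_u_emb)
  show "uv_plus (1/2) dvd Sg (e_elt \<beta>) - emb_u (hom_H_shift n i (e_elt \<beta>))" for \<beta>
  proof -
    let ?m = "ip (alpha n i) \<beta>"
    have "Sg (e_elt \<beta>) - emb_u (hom_H_shift n i (e_elt \<beta>)) = - (emb (e_elt \<beta>) * emb_u (lin_pow (-1/4) ?m) * (emb_u (lin_pow (3/4) (- ?m)) - emb_v (lin_pow (1/4) (- ?m))))"
      unfolding Sg_e_elt hom_H_shift_def shift_hom_e_elt emb_u_mult emb_u_emb by (simp add: right_diff_distrib mult_ac)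
    then show ?thesis using dvd2[of "- ?m"] by simp
  qed
qed

private lemma normal_ord_Sg: "normal_ord (field_E n i) (field_F n i) x = ser_act (Sg x) (\<lambda>(a, b). to_ser (cre_E n i) a * to_ser (cre_F n i) b)"
  by (simp add: normal_ord_def normal_prod_def Sg_def field_cre_eqs)

private lemma bounded_deg_N0: "bounded_deg fst (\<lambda>(a, b). to_ser F a * to_ser G b)" "bounded_deg snd (\<lambda>(a, b). to_ser F a * to_ser G b)" for F G :: "fock fps"
  by (auto intro!: bounded_degI exI[of _ 0] simp: to_ser_def)

text \<open>Divisibility treats the annihilation part and \<open>div_u\<close> the creation part;
  together they give the value at u = v + hbar/2 plus a multiple of u - v - hbar/2. The quotient is
  bounded in both variables, as \<open>residue_u\<close> requires.\<close>

lemma normal_ord_EF_u: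
  "\<exists>K. bounded_deg fst K \<and> bounded_deg snd K \<and> (\<forall>e. normal_ord (field_E n i) (field_F n i) (basis k) e =
     (\<lambda>(a, b). if a = 0 then basis k * to_ser (subst_v (v_plus (1/4)) (cre_H n i)) b else 0) e + diff_uv (-1/2) K e)"
proof -
  let ?N0 = "\<lambda>(a, b). to_ser (cre_E n i) a * to_ser (cre_F n i) b"
  let ?\<kappa> = "div_part (1/2) (cre_E n i) (cre_F n i)"
  obtain r where r: "Sg (basis k) - emb (basis k) = uv_plus (-1/2) * r" using Sg_dvd1 by (meson dvdE)
  define K where "K = (\<lambda>e. ser_act r ?N0 e + ser_act (emb (basis k)) ?\<kappa> e)"
  have "bounded_deg fst K" "bounded_deg snd K" unfolding K_def by (intro bounded_deg_add bounded_deg_ser_act additive_deg_fst additive_deg_snd bounded_deg_N0 bounded_deg_div_part)+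
  moreover have "normal_ord (field_E n i) (field_F n i) (basis k) e = (\<lambda>(a, b). if a = 0 then basis k * to_ser (subst_v (v_plus (1/4)) (cre_H n i)) b else 0) e + diff_uv (-1/2) K e" for e
  proof -
    obtain a b where e: "e = (a, b)" by (cases e)
    have s: "Sg (basis k) = uv_plus (-1/2) * r + emb (basis k)" using r by (simp add: algebra_simps)
    have "normal_ord (field_E n i) (field_F n i) (basis k) e = diff_uv (-1/2) (ser_act r ?N0) e + basis k * ?N0 e"
      unfolding normal_ord_Sg s ser_act_add ser_act_mult diff_op_ser_act ser_act_emb ..
    also have "?N0 e = (if a = 0 then to_ser (subst_v (v_plus (1/4)) (cre_H n i)) b else 0) + diff_uv (-1/2) ?\<kappa> e"
      using div_u[of "cre_E n i" a "cre_F n i" b "1/2"] by (simp add: e cre_E_cre_F_u)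
    also have "basis k * ((if a = 0 then to_ser (subst_v (v_plus (1/4)) (cre_H n i)) b else 0) + diff_uv (-1/2) ?\<kappa> e)
       = (if a = 0 then basis k * to_ser (subst_v (v_plus (1/4)) (cre_H n i)) b else 0) + diff_uv (-1/2) (ser_act (emb (basis k)) ?\<kappa>) e"
      unfolding diff_op_ser_act_commute ser_act_emb by (simp add: distrib_left)
    finally show ?thesis by (simp add: e K_def diff_op_add)
  qed
  ultimately show ?thesis by blast
qed

lemma normal_ord_EF_v:
  "\<exists>K. bounded_deg fst K \<and> bounded_deg snd K \<and> (\<forall>e. normal_ord (field_E n i) (field_F n i) (basis k) e =
     (\<lambda>(a, b). if b = 0 then ser_coeff (hom_H_shift n i (basis k)) a else 0) e + diff_uv (1/2) K e)"
proof -
  let ?N0 = "\<lambda>(a, b). to_ser (cre_E n i) a * to_ser (cre_F n i) b"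
  let ?\<kappa> = "\<lambda>(a, b). - div_part (1/2) (cre_F n i) (cre_E n i) (b, a)"
  let ?s = "hom_H_shift n i (basis k)"
  obtain r where r: "Sg (basis k) - emb_u ?s = uv_plus (1/2) * r" using Sg_dvd2 by (meson dvdE)
  define K where "K = (\<lambda>e. ser_act r ?N0 e + ser_act (emb_u ?s) ?\<kappa> e)"
  have "bounded_deg fst K" "bounded_deg snd K" unfolding K_def by (intro bounded_deg_add bounded_deg_ser_act additive_deg_fst additive_deg_snd bounded_deg_N0 bounded_deg_div_part)+
  moreover have "normal_ord (field_E n i) (field_F n i) (basis k) e = (\<lambda>(a, b). if b = 0 then ser_coeff ?s a else 0) e + diff_uv (1/2) K e" for e
  proof -
    obtain a b where e: "e = (a, b)" by (cases e)
    have s: "Sg (basis k) = uv_plus (1/2) * r + emb_u ?s" using r by (simp add: algebra_simps)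
    define \<delta> :: "int \<times> int \<Rightarrow> fock" where "\<delta> = (\<lambda>(a, b). if b = 0 then (if a = 0 then 1 else 0) else 0)"
    have N0: "?N0 = (\<lambda>e. \<delta> e + diff_uv (1/2) ?\<kappa> e)"
    proof
      fix e :: "int \<times> int" obtain a b where e: "e = (a, b)" by (cases e)
      show "?N0 e = \<delta> e + diff_uv (1/2) ?\<kappa> e"
        using div_v[of "cre_E n i" a "cre_F n i" b "1/2"] by (simp add: e cre_E_cre_F_v \<delta>_def to_ser_1)
    qed
    have "normal_ord (field_E n i) (field_F n i) (basis k) e = diff_uv (1/2) (ser_act r ?N0) e + ser_act (emb_u ?s) ?N0 e"
      unfolding normal_ord_Sg s ser_act_add ser_act_mult diff_op_ser_act ..
    also have "ser_act (emb_u ?s) ?N0 e = ser_act (emb_u ?s) \<delta> e + diff_uv (1/2) (ser_act (emb_u ?s) ?\<kappa>) e"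
      by (subst N0) (simp only: ser_act_add2 diff_op_ser_act_commute)
    also have "ser_act (emb_u ?s) \<delta> e = (if b = 0 then ser_coeff ?s a else 0)"
      unfolding e ser_act_emb_u \<delta>_def ser_coeff_def using ser_act_mult2[of ?s 0 "\<lambda>_. 0" a] by simp
    finally show ?thesis by (simp add: e K_def diff_op_add)
  qed
  ultimately show ?thesis by blast
qed

end

context
  fixes n i :: nat assumes n: "3 \<le> n" and i: "i \<in> {1..n}"
begin

private lemma i0: "i \<noteq> 0" using i by auto

text \<open>The operator that acts first provides the bound: its output vanishes to a given order
  for low exponents, whatever A-linear operator follows.\<close>

lemma bounded_deg_comp_uv: "bounded_deg snd (comp_uv (field_op A) (field_op B) x)"
  using bounded_deg_A_linear[OF bounded_deg_comp[OF bounded_deg_field_op, of snd B x], of "\<lambda>e. field_op A (fst e)", OF A_linear_field_op] by (simp add: comp_uv_def case_prod_beta')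
lemma bounded_deg_comp_vu: "bounded_deg fst (comp_vu (field_op A) (field_op B) x)"
  using bounded_deg_A_linear[OF bounded_deg_comp[OF bounded_deg_field_op, of fst A x], of "\<lambda>e. field_op B (snd e)", OF A_linear_field_op] by (simp add: comp_vu_def case_prod_beta')
lemma A_linear_comp_uv: "A_linear (\<lambda>x. comp_uv (field_op A) (field_op B) x e)" 
  unfolding comp_uv_def case_prod_beta by (rule A_linear_comp[OF A_linear_field_op A_linear_field_op])
lemma A_linear_comp_vu: "A_linear (\<lambda>x. comp_vu (field_op A) (field_op B) x e)" 
  unfolding comp_vu_def case_prod_beta by (rule A_linear_comp[OF A_linear_field_op A_linear_field_op])
lemma A_linear_diff_op: "(\<And>e. A_linear (\<lambda>x. f x e)) \<Longrightarrow> A_linear (\<lambda>x. diff_op d1 d2 c (f x) e)"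
  unfolding diff_op_def by (intro A_linear_plus A_linear_minus2 A_linear_mult_left)

private lemmas opE = op_eqs(1)[OF i0]
private lemmas opF = op_eqs(2)[OF i0]

text \<open>The factor u - v + hbar/2 removes one of the two poles; what remains are the two
  expansions of a quotient by u - v - hbar/2, to which \<open>residue_u\<close> applies.\<close>

lemma EF_res_u:
  "diff_uv (1/2) (comp_uv (E_op n i) (F_op n i) x) (-1, b) - diff_uv (1/2) (comp_vu (E_op n i) (F_op n i) x) (-1, b) = x * to_ser (subst_v (v_plus (1/4)) (cre_H n i)) b"
proof (rule A_linear_eqI[of "\<lambda>x. diff_uv (1/2) (comp_uv (E_op n i) (F_op n i) x) (-1, b) - diff_uv (1/2) (comp_vu (E_op n i) (F_op n i) x) (-1, b)"])
  fix k
  obtain K where K: "bounded_deg fst K" "bounded_deg snd K" "\<And>e. normal_ord (field_E n i) (field_F n i) (basis k) e =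
     (\<lambda>(a, b). if a = 0 then basis k * to_ser (subst_v (v_plus (1/4)) (cre_H n i)) b else 0) e + diff_uv (-1/2) K e" using normal_ord_EF_u by blast
  show "diff_uv (1/2) (comp_uv (E_op n i) (F_op n i) (basis k)) (-1, b) - diff_uv (1/2) (comp_vu (E_op n i) (F_op n i) (basis k)) (-1, b) = basis k * to_ser (subst_v (v_plus (1/4)) (cre_H n i)) b"
    by (rule residue_u[OF _ _ _ _ K(3,1,2)])
      (use EF_same[OF n i i refl, of "basis k"] in \<open>simp_all add: opE opF bounded_deg_diff_op[OF additive_deg_snd bounded_deg_comp_uv] bounded_deg_diff_op[OF additive_deg_fst bounded_deg_comp_vu]\<close>)
qed (unfold opE opF, (intro A_linear_minus2 A_linear_diff_op A_linear_comp_uv A_linear_comp_vu A_linear_mult_right A_linear_id)+)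

lemma EF_res_v:
  "diff_uv (-1/2) (comp_uv (E_op n i) (F_op n i) x) (a, -1) - diff_uv (-1/2) (comp_vu (E_op n i) (F_op n i) x) (a, -1) = ser_coeff (hom_H_shift n i x) a"
proof (rule A_linear_eqI[of "\<lambda>x. diff_uv (-1/2) (comp_uv (E_op n i) (F_op n i) x) (a, -1) - diff_uv (-1/2) (comp_vu (E_op n i) (F_op n i) x) (a, -1)"])
  fix k
  obtain K where K: "bounded_deg fst K" "bounded_deg snd K" "\<And>e. normal_ord (field_E n i) (field_F n i) (basis k) e =
     (\<lambda>(a, b). if b = 0 then ser_coeff (hom_H_shift n i (basis k)) a else 0) e + diff_uv (1/2) K e" using normal_ord_EF_v by blast
  show "diff_uv (-1/2) (comp_uv (E_op n i) (F_op n i) (basis k)) (a, -1) - diff_uv (-1/2) (comp_vu (E_op n i) (F_op n i) (basis k)) (a, -1) = ser_coeff (hom_H_shift n i (basis k)) a"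
    by (rule residue_v[OF _ _ _ _ K(3,1,2)])
      (use EF_same[OF n i i refl, of "basis k", unfolded diff_op_commute[of "(1,0)" "(0,1)" "-1/2" "(1,0)" "(0,1)" "1/2"]] in \<open>simp_all add: opE opF bounded_deg_diff_op[OF additive_deg_snd bounded_deg_comp_uv] bounded_deg_diff_op[OF additive_deg_fst bounded_deg_comp_vu]\<close>)
qed (unfold opE opF hom_H_shift_def, (intro A_linear_minus2 A_linear_diff_op A_linear_comp_uv A_linear_comp_vu A_linear_comp[OF A_linear_ser_coeff A_linear_shift_hom])+)

end

section \<open>Translation of the variable u by a multiple of hbar\<close>

definition shift_u :: "complex \<Rightarrow> laurent \<Rightarrow> laurent" where "shift_u c = lin_ext (\<lambda>(k, i). basis (k, 0) * lin_pow c i)"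

lemma A_linear_shift_u: "A_linear (shift_u c)" unfolding shift_u_def by (rule A_linear_lin_ext)

lemma shift_u_mult: "shift_u c (x * y) = shift_u c x * shift_u c y"
  unfolding shift_u_def
proof (rule lin_ext_mult)
  fix k l :: "key \<times> int"
  have "(basis (fst k + fst l, 0) :: laurent) = basis (fst k, 0) * basis (fst l, 0)" by (simp add: basis_mult)
  then show "(case k + l of (k, i) \<Rightarrow> basis (k, 0) * lin_pow c i) = (case k of (k, i) \<Rightarrow> basis (k, 0) * lin_pow c i) * (case l of (k, i) \<Rightarrow> basis (k, 0) * (lin_pow c i :: laurent))"
    by (simp add: case_prod_beta lin_pow_add mult_ac)
qed

lemma shift_u_emb: "shift_u c (emb x) = emb x"
  by (rule A_linear_eqI[OF A_linear_comp[OF A_linear_shift_u A_linear_emb] A_linear_emb]) (simp add: shift_u_def lin_pow_0)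

lemma shift_u_scl: "shift_u c (scl f) = scl f"
  using shift_u_emb[of c "scl f"] by simp

lemma shift_u_lin_pow: "shift_u c (lin_pow d k) = lin_pow (d + c) k"
proof -
  have 1: "shift_u c (lin_pow d 1) = lin_pow (d + c) 1"
    by (simp add: lin_pow_1 A_linear_add[OF A_linear_shift_u] shift_u_scl hb_add scl_add algebra_simps) (simp add: shift_u_def lin_pow_1 basis_0 flip: zero_prod_def)
  have 0: "shift_u c 1 = 1" using shift_u_scl[of c 1] by simp
  have nat: "shift_u c (lin_pow d (int m)) = lin_pow (d + c) (int m)" for m
  proof (induction m)
    case (Suc m)
    have e: "int (Suc m) = 1 + int m" by simp
    show ?case unfolding e lin_pow_add shift_u_mult 1 Suc ..
  qed (simp add: 0 lin_pow_0)
  show ?thesis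
  proof (cases "0 \<le> k")
    case True then show ?thesis using nat[of "nat k"] by simp
  next
    case False
    have "shift_u c (lin_pow d k) * (shift_u c (lin_pow d (- k)) * lin_pow (d + c) k) = lin_pow (d + c) k"
      unfolding mult.assoc[symmetric] shift_u_mult[symmetric] lin_pow_inv using shift_u_scl[of c 1] by simp
    moreover have "shift_u c (lin_pow d (- k)) = lin_pow (d + c) (- k)" using nat[of "nat (- k)"] False by simp
    ultimately show ?thesis by (simp add: lin_pow_inv)
  qed
qed

lemma shift_u_hom_H: "shift_u (1/4) (hom_H n i x) = hom_H_shift n i x"
proof (rule fock_hom_eqI[of "\<lambda>x. shift_u (1/4) (hom_H n i x)"])
  show "A_linear (\<lambda>x. shift_u (1/4) (hom_H n i x))" unfolding hom_H_def by (rule A_linear_comp[OF A_linear_shift_u A_linear_shift_hom])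
  show "shift_u (1/4) (hom_H n i (x * y)) = shift_u (1/4) (hom_H n i x) * shift_u (1/4) (hom_H n i y)" for x y
    by (simp add: hom_H_def shift_hom_mult[OF mult_hom_H_weight] shift_u_mult)
  show "shift_u (1/4) (hom_H n i 1) = 1" using shift_u_emb[of "1/4" 1] by (simp add: hom_H_def shift_hom_1[OF mult_hom_H_weight])
  show "shift_u (1/4) (hom_H n i (a_elt jk)) = hom_H_shift n i (a_elt jk)" for jk
    by (simp add: hom_H_def hom_H_shift_def shift_hom_a_elt mult_hom_H_weight mult_hom_Hq A_linear_add[OF A_linear_shift_u] A_linear_diff[OF A_linear_shift_u] A_linear_minus[OF A_linear_shift_u] A_linear_0[OF A_linear_shift_u] shift_u_emb ann_shift_def shift_u_lin_pow del: emb_basis)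
  show "shift_u (1/4) (hom_H n i (e_elt \<beta>)) = hom_H_shift n i (e_elt \<beta>)" for \<beta>
    by (simp add: hom_H_def hom_H_shift_def shift_hom_e_elt shift_u_mult shift_u_emb H_weight_def shift_u_lin_pow)
qed (simp_all add: hom_H_shift_def A_linear_shift_hom shift_hom_mult[OF mult_hom_Hq] shift_hom_1[OF mult_hom_Hq])

lemma
  shows hsummable_ser_coeff_shift_u: "hsummable (\<lambda>m. scl (pw (hb c) m a) * ser_coeff r m)"
    and ser_coeff_shift_u: "ser_coeff (shift_u c r) a = hsum (\<lambda>m. scl (pw (hb c) m a) * ser_coeff r m)"
proof -
  have al: "A_linear (\<lambda>r. scl (pw (hb c) m a) * ser_coeff r m)" for m by (rule A_linear_mult_left[OF A_linear_ser_coeff])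
  have fin: "finite {m. scl (pw (hb c) m a) * ser_coeff (basis k) m \<noteq> 0}" for k
    by (rule finite_subset[of _ "{snd k}"]) (cases k, auto simp: ser_coeff_basis split: if_splits)
  have hf: "hsummable (\<lambda>m. scl (pw (hb c) m a) * ser_coeff r m)" for r by (rule A_linear_hfinI[OF al fin])
  then show "hsummable (\<lambda>m. scl (pw (hb c) m a) * ser_coeff r m)" .
  show "ser_coeff (shift_u c r) a = hsum (\<lambda>m. scl (pw (hb c) m a) * ser_coeff r m)"
  proof (rule A_linear_eqI[of "\<lambda>r. ser_coeff (shift_u c r) a"])
    fix k :: "key \<times> int" obtain l i where k: "k = (l, i)" by (cases k)
    have "hsum (\<lambda>m. scl (pw (hb c) m a) * ser_coeff (basis k) m) = scl (pw (hb c) i a) * ser_coeff (basis k) i"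
      by (rule hsum_single) (simp add: k ser_coeff_basis)
    moreover have "shift_u c (basis k) = emb (basis l) * lin_pow c i" by (simp add: shift_u_def k)
    ultimately show "ser_coeff (shift_u c (basis k)) a = hsum (\<lambda>m. scl (pw (hb c) m a) * ser_coeff (basis k) m)"
      by (simp add: ser_coeff_emb_mult ser_coeff_lin_pow ser_coeff_basis k mult.commute del: emb_basis)
  qed (intro A_linear_comp[OF A_linear_ser_coeff A_linear_shift_u] A_linear_hsum_fun al hf)+
qed

section \<open>Two-sided series over the free algebra\<close>

text \<open>\<open>Sum_any\<close> returns 0 on a divergent family, so the rules for products of
  two-sided series are tied to convergence. This predicate is carried along in place of a ring
  structure.\<close>

definition conv_fin :: "('e::ab_group_add \<Rightarrow> 'a::semiring_0 fps) \<Rightarrow> ('e \<Rightarrow> 'a fps) \<Rightarrow> bool" where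
  "conv_fin f g \<longleftrightarrow> (\<forall>e. hsummable (\<lambda>i. f i * g (e - i)))"

definition lin_op :: "falg \<Rightarrow> (int \<times> int \<Rightarrow> falg) \<Rightarrow> int \<times> int \<Rightarrow> falg" where
  "lin_op s f e = f (e - (1, 0)) - f (e - (0, 1)) + s * f e"

lemma lin_mult: "lin x y z \<star> g = lin_op (x - y + z) g"
proof
  fix e
  have "(lin x y z \<star> g) e = (\<Sum>i\<in>{(1,0),(0,1),(0,0)}. lin x y z i * g (e - i))"
    unfolding ser_mult_def by (rule hsum_finite) (auto simp: lin_def)
  then show "(lin x y z \<star> g) e = lin_op (x - y + z) g e" by (cases e) (simp add: lin_def lin_op_def)
qed

lemma hsummable_shift: "hsummable f \<Longrightarrow> hsummable (\<lambda>i. f (i - d))" for f :: "'e::ab_group_add \<Rightarrow> 'a::comm_monoid_add fps"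
  unfolding hsummable_def
proof
  fix p assume "\<forall>p. finite {i. f i $ p \<noteq> 0}"
  then have "finite ((\<lambda>i. i + d) ` {i. f i $ p \<noteq> 0})" by simp
  moreover have "{i. f (i - d) $ p \<noteq> 0} \<subseteq> (\<lambda>i. i + d) ` {i. f i $ p \<noteq> 0}"
    by (auto intro!: image_eqI[of _ _ "_ - d"])
  ultimately show "finite {i. f (i - d) $ p \<noteq> 0}" by (rule rev_finite_subset)
qed

lemma hsum_shift: "hsum (\<lambda>i. f (i - d)) = hsum f" for f :: "'e::ab_group_add \<Rightarrow> 'a::comm_monoid_add fps"
  by (rule hsum_reindex) (rule bij_betwI[of _ _ _ "\<lambda>i. i + d"], auto)

lemma
  assumes "conv_fin f g"
  shows lin_op_conv: "lin_op s f \<star> g = lin_op s (f \<star> g)" and conv_fin_lin_op: "conv_fin (lin_op s f) g"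
proof -
  have h: "hsummable (\<lambda>i. f i * g (e - i))" for e using assms unfolding conv_fin_def by blast
  have e1: "(\<lambda>i. f (i - d) * g (e - i)) = (\<lambda>i. (\<lambda>i. f i * g ((e - d) - i)) (i - d))" for d e
    by (simp add: algebra_simps)
  have h1: "hsummable (\<lambda>i. f (i - d) * g (e - i))" for d e unfolding e1 by (rule hsummable_shift[OF h])
  have s1: "hsum (\<lambda>i. f (i - d) * g (e - i)) = (f \<star> g) (e - d)" for d e
    unfolding e1 ser_mult_def by (rule hsum_shift)
  have h2: "hsummable (\<lambda>i. s * (f i * g (e - i)))" for e by (rule hsummable_local_add[OF local_add_mult_left h])
  have s2: "hsum (\<lambda>i. s * (f i * g (e - i))) = s * (f \<star> g) e" for e
    unfolding ser_mult_def by (rule hsum_local_add[OF local_add_mult_left h, symmetric])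
  have ex: "(\<lambda>i. lin_op s f i * g (e - i)) = (\<lambda>i. (f (i - (1, 0)) * g (e - i) - f (i - (0, 1)) * g (e - i)) + s * (f i * g (e - i)))" for e
    by (simp add: lin_op_def fun_eq_iff algebra_simps)
  have h3: "hsummable (\<lambda>i. f (i - (1, 0)) * g (e - i) - f (i - (0, 1)) * g (e - i))" for e
    using hsummable_add[OF h1 hsummable_uminus[OF h1]] by simp
  show "conv_fin (lin_op s f) g" unfolding conv_fin_def ex by (intro allI hsummable_add h3 h2)
  show "lin_op s f \<star> g = lin_op s (f \<star> g)"
  proof
    fix e
    have "(lin_op s f \<star> g) e = hsum (\<lambda>i. (f (i - (1, 0)) * g (e - i) - f (i - (0, 1)) * g (e - i)) + s * (f i * g (e - i)))"
      unfolding ser_mult_def ex ..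
    also have "\<dots> = lin_op s (f \<star> g) e"
      unfolding hsum_add[OF h3 h2] hsum_diff[OF h1 h1] s1 s2 lin_op_def ..
    finally show "(lin_op s f \<star> g) e = lin_op s (f \<star> g) e" .
  qed
qed

lemma conv_fin_finite: assumes "finite {i. f i \<noteq> 0}" shows "conv_fin f g"
  unfolding conv_fin_def by (intro allI hsummable_finite finite_subset[OF _ assms]) auto

lemma finite_lin: "finite {i. lin x y z i \<noteq> 0}"
  by (rule finite_subset[of _ "{(1,0),(0,1),(0,0)}"]) (auto simp: lin_def)

lemma hsum_pair1: assumes "\<And>i j. j \<noteq> b \<Longrightarrow> f (i, j) = 0" shows "hsum f = hsum (\<lambda>i. f (i, b))"
proof (rule fps_ext)
  fix p
  have "{x. f x $ p \<noteq> 0} = (\<lambda>i. (i, b)) ` {i. f (i, b) $ p \<noteq> 0}" using assms by force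
  then show "hsum f $ p = hsum (\<lambda>i. f (i, b)) $ p"
    unfolding hsum_nth Sum_any.expand_set by (simp add: sum.reindex inj_on_def)
qed

lemma hsum_pair2: assumes "\<And>i j. i \<noteq> a \<Longrightarrow> f (i, j) = 0" shows "hsum f = hsum (\<lambda>j. f (a, j))"
proof (rule fps_ext)
  fix p
  have "{x. f x $ p \<noteq> 0} = (\<lambda>i. (a, i)) ` {i. f (a, i) $ p \<noteq> 0}" using assms by force
  then show "hsum f $ p = hsum (\<lambda>i. f (a, i)) $ p"
    unfolding hsum_nth Sum_any.expand_set by (simp add: sum.reindex inj_on_def)
qed

lemma hsummable_pair1: assumes "\<And>i j. j \<noteq> b \<Longrightarrow> f (i, j) = 0" "hsummable (\<lambda>i. f (i, b))" shows "hsummable f"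
  unfolding hsummable_def
proof
  fix p
  have "{x. f x $ p \<noteq> 0} = (\<lambda>i. (i, b)) ` {i. f (i, b) $ p \<noteq> 0}" using assms(1) by force
  then show "finite {x. f x $ p \<noteq> 0}" using assms(2) by (simp add: hsummable_def)
qed

lemma hsummable_pair2: assumes "\<And>i j. i \<noteq> a \<Longrightarrow> f (i, j) = 0" "hsummable (\<lambda>i. f (a, i))" shows "hsummable f"
  unfolding hsummable_def
proof
  fix p
  have "{x. f x $ p \<noteq> 0} = (\<lambda>i. (a, i)) ` {i. f (a, i) $ p \<noteq> 0}" using assms(1) by force
  then show "finite {x. f x $ p \<noteq> 0}" using assms(2) by (simp add: hsummable_def)
qed

lemma conv_in_u: "(h \<star> in_u f) (a, b) = hsum (\<lambda>i. h (i, b) * f (a - i))"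
  unfolding ser_mult_def by (subst hsum_pair1[of b]) (auto simp: in_u_def)
lemma conv_in_v: "(h \<star> in_v f) (a, b) = hsum (\<lambda>j. h (a, j) * f (b - j))"
  unfolding ser_mult_def by (subst hsum_pair2[of a]) (auto simp: in_v_def)

lemma conv_fin_in_u: "(\<And>a b. hsummable (\<lambda>i. h (i, b) * f (a - i))) \<Longrightarrow> conv_fin h (in_u f)"
  unfolding conv_fin_def
proof
  fix e assume h: "\<And>a b. hsummable (\<lambda>i. h (i, b) * f (a - i))"
  show "hsummable (\<lambda>i. h i * in_u f (e - i))"
    by (cases e) (rule hsummable_pair1[of "snd e"], simp_all add: in_u_def h)
qed
lemma conv_fin_in_v: "(\<And>a b. hsummable (\<lambda>j. h (a, j) * f (b - j))) \<Longrightarrow> conv_fin h (in_v f)"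
  unfolding conv_fin_def
proof
  fix e assume h: "\<And>a b. hsummable (\<lambda>j. h (a, j) * f (b - j))"
  show "hsummable (\<lambda>i. h i * in_v f (e - i))"
    by (cases e) (rule hsummable_pair2[of "fst e"], simp_all add: in_v_def h)
qed

lemma conv_uv: "(in_u f \<star> in_v g) (a, b) = f a * g b"
  unfolding conv_in_v by (subst hsum_single[of 0]) (auto simp: in_u_def)
lemma conv_vu: "(in_v g \<star> in_u f) (a, b) = g b * f a"
  unfolding conv_in_u by (subst hsum_single[of 0]) (auto simp: in_v_def)

lemma conv_fin_uv: "conv_fin (in_u f) (in_v g)"
  by (rule conv_fin_in_v, rule hsummable_finite, rule finite_subset[of _ "{0}"]) (auto simp: in_u_def)
lemma conv_fin_vu: "conv_fin (in_v g) (in_u f)"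
  by (rule conv_fin_in_u, rule hsummable_finite, rule finite_subset[of _ "{0}"]) (auto simp: in_v_def)

lemma lin_uv: "lin x y z \<star> in_u f \<star> in_v g = lin_op (x - y + z) (in_u f \<star> in_v g)"
  unfolding lin_mult by (rule lin_op_conv[OF conv_fin_uv])
lemma lin_vu: "lin x y z \<star> in_v g \<star> in_u f = lin_op (x - y + z) (in_v g \<star> in_u f)"
  unfolding lin_mult by (rule lin_op_conv[OF conv_fin_vu])

lemma lin_lin: "lin x y z \<star> lin x' y' z' \<star> h = lin_op (x - y + z) (lin_op (x' - y' + z') h)"
  unfolding lin_mult[of x y z] lin_op_conv[OF conv_fin_finite[OF finite_lin]] lin_mult ..

lemma lin_lin_uv: "lin x y z \<star> lin x' y' z' \<star> in_u f \<star> in_v g = lin_op (x - y + z) (lin_op (x' - y' + z') (in_u f \<star> in_v g))"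
  unfolding lin_lin lin_op_conv[OF conv_fin_lin_op[OF conv_fin_uv]] lin_op_conv[OF conv_fin_uv] ..
lemma lin_lin_vu: "lin x y z \<star> lin x' y' z' \<star> in_v g \<star> in_u f = lin_op (x - y + z) (lin_op (x' - y' + z') (in_v g \<star> in_u f))"
  unfolding lin_lin lin_op_conv[OF conv_fin_lin_op[OF conv_fin_vu]] lin_op_conv[OF conv_fin_vu] ..

text \<open>Inside the half plane of negative exponents of u this is Pascal's rule for the powers of
  v - s; the constant 1 comes from the boundary row \<open>a = 0\<close>, which receives the power
  with exponent 0.\<close>

lemma lin_op_recip_uinf: "lin_op s (recip_uinf s) = ser_one"
proof (intro ext, clarify)
  fix a b :: int
  have P: "pw (- s) (k + 1) b = pw (- s) k (b - 1) - s * pw (- s) k b" for k using pw_Pascal[of "- s" k b] by simp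
  consider "a \<le> -1" | "a = 0" | "0 < a" by linarith
  then show "lin_op s (recip_uinf s) (a, b) = ser_one (a, b)"
  proof cases
    case 1 then show ?thesis using P[of "- a - 1"] by (simp add: lin_op_def recip_uinf_def ser_one_def zero_prod_def)
  qed (auto simp: lin_op_def recip_uinf_def ser_one_def zero_prod_def pw_0)
qed

lemma lin_op_recip_u0: "lin_op s (recip_u0 s) = ser_one"
proof (intro ext, clarify)
  fix a b :: int
  have P: "pw (- s) (k + 1) b = pw (- s) k (b - 1) - s * pw (- s) k b" for k using pw_Pascal[of "- s" k b] by simp
  consider "a \<ge> 1" | "a = 0" | "a < 0" by linarith
  then show "lin_op s (recip_u0 s) (a, b) = ser_one (a, b)"
  proof cases
    case 1 then show ?thesis using P[of "- a - 1"] by (simp add: lin_op_def recip_u0_def ser_one_def zero_prod_def)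
  next
    case 2 then show ?thesis using P[of "-1"] by (simp add: lin_op_def recip_u0_def ser_one_def zero_prod_def pw_0)
  qed (auto simp: lin_op_def recip_u0_def ser_one_def zero_prod_def)
qed

lemma power_nth_0: fixes s :: "'a::ring_1 fps" assumes "s $ 0 = 0" "p < d" shows "(s ^ d) $ p = 0"
  using assms
proof (induction d arbitrary: p)
  case (Suc d)
  have "s $ i * (s ^ d) $ (p - i) = 0" if "i \<in> {0..p}" for i
    using Suc that by (cases "i = 0") auto
  then show ?case by (simp add: fps_mult_nth)
qed simp

lemma fps_mult_nth_0: fixes x :: "'a::ring_1 fps" assumes "\<And>q. q \<le> p \<Longrightarrow> y $ q = 0" shows "(x * y) $ p = 0" "(y * x) $ p = 0"
  using assms by (auto simp: fps_mult_nth)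

lemma pw_nth_0: assumes "s $ 0 = 0" "int p < k - m" shows "pw s k m $ p = 0"
proof (cases "m \<le> k")
  case True
  have "(s ^ nat (k - m)) $ q = 0" if "q \<le> p" for q using that assms True by (intro power_nth_0) auto
  then show ?thesis using True by (simp add: pw_def fps_mult_nth_0)
qed (simp add: pw_def)

lemma recip_conv_conv_fin: "conv_fin (recip_uinf s) (in_v g)"
proof (rule conv_fin_in_v, rule hsummable_finite)
  fix a b
  have "j \<in> {0..- a - 1}" if "recip_uinf s (a, j) \<noteq> 0" for j
    using that pw_nonneg_eq_0[of "- a - 1" j "- s"] by (auto simp: recip_uinf_def pw_def split: if_splits) (meson not_le_imp_less)+
  then have "{j. recip_uinf s (a, j) * g (b - j) \<noteq> 0} \<subseteq> {0..- a - 1}" by (metis (mono_tags, lifting) mem_Collect_eq mult_zero_left subsetI)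
  then show "finite {j. recip_uinf s (a, j) * g (b - j) \<noteq> 0}" by (rule finite_subset) simp
qed

text \<open>Negative powers of v - s have infinitely many terms, so convergence is hbar-adic only:
  the term with s^d begins at order d because s is divisible by hbar.\<close>

lemma recip_u0_conv_conv_fin: assumes "s $ 0 = 0" shows "conv_fin (recip_u0 s) (in_v g)"
proof (rule conv_fin_in_v, rule hsummable_bounded)
  fix a b p
  have "(recip_u0 s (a, j) * g (b - j)) $ p = 0" if "j \<notin> {- a - 1 - int p..- a - 1}" for j
  proof (rule fps_mult_nth_0(2))
    fix q assume "q \<le> p"
    from that have "\<not> (- a - 1 - int p \<le> j \<and> j \<le> - a - 1)" by simp
    then consider "j > - a - 1" | "j < - a - 1 - int p" by linarith
    then show "recip_u0 s (a, j) $ q = 0"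
    proof cases
      case 1 then show ?thesis by (simp add: recip_u0_def pw_def)
    next
      case 2 then show ?thesis using assms \<open>q \<le> p\<close> by (auto simp: recip_u0_def intro!: pw_nth_0)
    qed
  qed
  then show "\<exists>A. finite A \<and> (\<forall>i. i \<notin> A \<longrightarrow> (recip_u0 s (a, i) * g (b - i)) $ p = 0)"
    by (intro exI[of _ "{- a - 1 - int p..- a - 1}"]) auto
qed

lemma delta_finite: "finite {k. pw x (- k - 1) a * pw y k b \<noteq> 0}"
  by (rule finite_subset[of _ "{b..- a - 1}"]) (auto simp: pw_def split: if_splits)

lemma pw_comm: assumes "x * y = y * x" shows "x * pw y k b = pw y k b * x"
proof -
  have "x * y ^ m = y ^ m * x" for m by (metis assms power_commuting_commutes)
  moreover have "x * (of_int z * w) = of_int z * (x * w)" for z w by (metis mult.assoc mult_of_int_commute)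
  ultimately show ?thesis by (simp add: pw_def mult.assoc)
qed

lemma lin_op_delta:
  assumes "x * y = y * x" shows "lin_op (x - y) (delta x y) = (\<lambda>_. 0)"
proof (intro ext, clarify)
  fix a b :: int
  let ?t = "\<lambda>a b k. pw x (- k - 1) a * pw y k b"
  have yx: "y * (pw x k b) = pw x k b * y" for k b by (rule pw_comm[OF assms[symmetric]])
  have hf: "hsummable (?t a b)" for a b by (rule hsummable_finite[OF delta_finite])
  \<comment> \<open>Multiplying by u + x raises the first exponent, multiplying by v + y the second;
    both yield this family up to a shift of k by one. That y can pass the powers of u + x is the
    commutation assumption.\<close>
  define U where "U k = pw x (- k) a * pw y k b" for k
  have hU: "hsummable U" unfolding U_def
    by (rule hsummable_finite, rule finite_subset[of _ "{b..- a}"]) (auto simp: pw_def split: if_splits)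
  have 1: "?t (a - 1) b k + x * ?t a b k = U k" for k
    using pw_Pascal[of x "- k - 1" a] by (simp add: U_def distrib_right mult.assoc)
  have 2: "?t a (b - 1) k + y * ?t a b k = U (k - -1)" for k
    using pw_Pascal[of y k b] by (simp add: U_def distrib_left mult.assoc[symmetric] yx)
  have hx: "hsummable (\<lambda>k. c * ?t a b k)" for c by (rule hsummable_local_add[OF local_add_mult_left hf])
  have sx: "hsum (\<lambda>k. c * ?t a b k) = c * hsum (?t a b)" for c by (rule hsum_local_add[OF local_add_mult_left hf, symmetric])
  have "hsum (?t (a - 1) b) + x * hsum (?t a b) = hsum U"
    using hsum_add[OF hf[of "a - 1" b] hx[of x]] unfolding 1 sx by simp
  moreover have "hsum (?t a (b - 1)) + y * hsum (?t a b) = hsum U"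
    using hsum_add[OF hf[of a "b - 1"] hx[of y]] unfolding 2 sx hsum_shift by simp
  ultimately show "lin_op (x - y) (delta x y) (a, b) = 0"
    by (simp add: lin_op_def delta_def left_diff_distrib algebra_simps)
qed

lemma delta_nth_0: assumes "x $ 0 = 0" "y $ 0 = 0" "a + b + 1 > 0 \<or> int p < - (a + b + 1)" shows "delta x y (a, b) $ p = 0"
proof -
  have z: "(pw x (- k - 1) a * pw y k b) $ p = 0" for k
    unfolding fps_mult_nth
  proof (intro sum.neutral ballI)
    fix i assume "i \<in> {0..p}"
    then have "int (p - i) = int p - int i" by (simp add: of_nat_diff)
    then consider "\<not> a \<le> - k - 1" | "\<not> b \<le> k" | "int i < - k - 1 - a" | "int (p - i) < k - b"
      using assms(3) by linarith
    then show "pw x (- k - 1) a $ i * pw y k b $ (p - i) = 0"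
      by cases (simp_all only: pw_nth_0[OF assms(1)] pw_nth_0[OF assms(2)], simp_all add: pw_def)
  qed
  show ?thesis unfolding delta_def prod.case by (subst hsum_nth_finite[of "{}"]) (simp_all add: z)
qed

text \<open>For k > 0 the power of u + x stays below the exponent -1, and for k < 0 it is a
  polynomial; only k = 0 remains. A multiple of the delta function can thus be identified by this
  single row.\<close>

lemma delta_row: "delta x y (-1, b) = (if b = 0 then 1 else 0)"
proof -
  have "hsum (\<lambda>k. pw x (- k - 1) (-1) * pw y k b) = pw x (- 0 - 1) (-1) * pw y 0 b"
  proof (rule hsum_single)
    fix k :: int assume "k \<noteq> 0"
    then show "pw x (- k - 1) (-1) * pw y k b = 0"
      by (cases "k < 0") (auto simp: pw_nonneg_eq_0, simp add: pw_def)
  qed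
  then show ?thesis by (simp add: delta_def pw_0, simp add: pw_def)
qed

lemma delta_col: "delta x y (a, -1) = (if a = 0 then 1 else 0)"
proof -
  have "hsum (\<lambda>k. pw x (- k - 1) a * pw y k (-1)) = pw x (- (-1) - 1) a * pw y (-1) (-1)"
  proof (rule hsum_single)
    fix k :: int assume "k \<noteq> -1"
    then show "pw x (- k - 1) a * pw y k (-1) = 0"
      by (cases "0 \<le> k") (auto simp: pw_nonneg_eq_0, simp add: pw_def)
  qed
  then show ?thesis by (simp add: delta_def pw_0, simp add: pw_def)
qed

text \<open>Power series in u^t, for t = 1 or -1, read as two-sided series: H^- has t = 1 and H^+
  has t = -1. Inverses are computed among the one-sided series, which form a ring.\<close>

definition side_ser :: "int \<Rightarrow> 'a::zero fps \<Rightarrow> int \<Rightarrow> 'a" where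
  "side_ser t F m = (if 0 \<le> t * m then F $ nat (t * m) else 0)"

lemma side_ser_conv: fixes F :: "'a::semiring_0 fps fps" assumes "t = 1 \<or> t = -1" shows "side_ser t F \<star> side_ser t G = side_ser t (F * G)"
proof
  fix m
  have tt: "t * t = 1" using assms by auto
  show "(side_ser t F \<star> side_ser t G) m = side_ser t (F * G) m"
  proof (cases "0 \<le> t * m")
    case True
    have "(side_ser t F \<star> side_ser t G) m = (\<Sum>i\<in>(\<lambda>i. t * int i) ` {0..nat (t * m)}. side_ser t F i * side_ser t G (m - i))"
      unfolding ser_mult_def
    proof (rule hsum_finite)
      fix i assume "i \<notin> (\<lambda>i. t * int i) ` {0..nat (t * m)}"
      moreover have "i = t * int (nat (t * i))" if "0 \<le> t * i" using that tt by (simp add: mult.assoc[symmetric])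
      ultimately have "\<not> (0 \<le> t * i \<and> t * i \<le> t * m)"
        by (metis atLeastAtMost_iff image_eqI le0 nat_mono)
      then show "side_ser t F i * side_ser t G (m - i) = 0" by (auto simp: side_ser_def right_diff_distrib)
    qed simp
    also have "\<dots> = (\<Sum>i=0..nat (t * m). F $ i * G $ (nat (t * m) - i))"
    proof (subst sum.reindex)
      show "inj_on (\<lambda>i. t * int i) {0..nat (t * m)}" using assms by (auto simp: inj_on_def)
      then show "sum ((\<lambda>i. side_ser t F i * side_ser t G (m - i)) \<circ> (\<lambda>i. t * int i)) {0..nat (t * m)} = (\<Sum>i=0..nat (t * m). F $ i * G $ (nat (t * m) - i))"
        using True assms by (intro sum.cong) (elim disjE; simp add: side_ser_def nat_diff_distrib le_nat_iff)+
    qed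
    finally show ?thesis using True by (simp add: side_ser_def fps_mult_nth)
  next
    case False
    then have "side_ser t F i * side_ser t G (m - i) = 0" for i by (auto simp: side_ser_def right_diff_distrib)
    then show ?thesis using False by (simp add: ser_mult_def side_ser_def)
  qed
qed

lemma side_ser_1: assumes "t = 1 \<or> t = -1" shows "ser_one = side_ser t (1 :: 'a::ring_1 fps fps)"
  using assms by (auto simp: ser_one_def side_ser_def fun_eq_iff)

lemma hsum_Suc_nat: "hsummable f \<Longrightarrow> hsum f = f 0 + hsum (\<lambda>k. f (Suc k))" for f :: "nat \<Rightarrow> 'a::ab_group_add fps"
proof (rule fps_ext)
  fix p assume "hsummable f"
  then have fin: "finite {i. f i $ p \<noteq> 0}" by (simp add: hsummable_def)
  then obtain N where N: "\<And>i. f i $ p \<noteq> 0 \<Longrightarrow> i < N" by (metis (mono_tags) finite_nat_set_iff_bounded mem_Collect_eq)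
  have "hsum f $ p = (\<Sum>i<Suc N. f i $ p)" by (rule hsum_nth_finite) (use N less_SucI in \<open>auto, metis\<close>)
  moreover have "hsum (\<lambda>k. f (Suc k)) $ p = (\<Sum>i<N. f (Suc i) $ p)" by (rule hsum_nth_finite) (use N Suc_lessD in \<open>auto, metis\<close>)
  ultimately show "hsum f $ p = (f 0 + hsum (\<lambda>k. f (Suc k))) $ p" by (simp only: sum.lessThan_Suc_shift fps_add_nth)
qed

text \<open>Modulo hbar the series \<open>F\<close> is 1, so (1 - F)^k vanishes below order k and
  the geometric series converges. Splitting off its first term on either side shows that the sum is
  a two-sided inverse.\<close>

lemma ser_inv_side_ser:
  fixes F :: "'a::ring_1 fps fps"
  assumes t: "t = 1 \<or> t = -1" and F: "\<And>m. F $ m $ 0 = (if m = 0 then 1 else 0)"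
  obtains J where "ser_inv (side_ser t F) = side_ser t J" "F * J = 1" "J * F = 1"
proof -
  define g where "g = 1 - F"
  have g0: "g $ m $ 0 = 0" for m by (simp add: g_def F)
  have gp: "(g ^ k) $ m $ p = 0" if "p < k" for k m p using that
  proof (induction k arbitrary: m p)
    case (Suc k)
    have "(g $ i * (g ^ k) $ (m - i)) $ p = 0" for i
      unfolding fps_mult_nth
    proof (intro sum.neutral ballI)
      fix q assume "q \<in> {0..p}"
      then show "g $ i $ q * (g ^ k) $ (m - i) $ (p - q) = 0" using Suc by (cases "q = 0") (auto simp: g0)
    qed
    then show ?case by (simp add: fps_mult_nth fps_sum_nth)
  qed simp
  have hf: "hsummable (\<lambda>k. (g ^ k) $ m)" for m
    by (rule hsummable_bounded) (metis finite_atMost atMost_iff gp not_le)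
  define J where "J = Abs_fps (\<lambda>m. hsum (\<lambda>k. (g ^ k) $ m))"
  have pw: "(((\<star>) (ser_one - side_ser t F)) ^^ k) ser_one = side_ser t (g ^ k)" for k
  proof -
    have e: "ser_one - side_ser t F = side_ser t g" unfolding side_ser_1[OF t] by (auto simp: side_ser_def g_def fun_eq_iff)
    show ?thesis
      by (induction k) (simp_all only: e side_ser_conv[OF t] funpow.simps o_apply id_apply power_0 power_Suc side_ser_1[OF t, symmetric])
  qed
  have 1: "ser_inv (side_ser t F) = side_ser t J"
    by (rule ext) (auto simp: ser_inv_def pw J_def side_ser_def)
  have gJ: "g * J = J - 1" "J * g = J - 1"
  proof -
    have "(g * J) $ m = hsum (\<lambda>k. (g ^ Suc k) $ m)" for m
    proof -
      have "(g * J) $ m = (\<Sum>i=0..m. hsum (\<lambda>k. g $ i * (g ^ k) $ (m - i)))"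
        by (simp add: fps_mult_nth J_def hsum_local_add[OF local_add_mult_left hf])
      also have "\<dots> = hsum (\<lambda>k. \<Sum>i=0..m. g $ i * (g ^ k) $ (m - i))"
      proof -
        have "finite A \<Longrightarrow> (\<Sum>i\<in>A. hsum (\<lambda>k. g $ i * (g ^ k) $ (m - i))) = hsum (\<lambda>k. \<Sum>i\<in>A. g $ i * (g ^ k) $ (m - i)) \<and> hsummable (\<lambda>k. \<Sum>i\<in>A. g $ i * (g ^ k) $ (m - i))" for A
          by (induction A rule: finite_induct) (auto simp: hsum_add hsummable_add hsummable_local_add[OF local_add_mult_left hf] hsummable_def[of "\<lambda>_. 0"])
        then show ?thesis by simp
      qed
      finally show ?thesis by (simp add: fps_mult_nth)
    qed
    moreover have "(J * g) $ m = hsum (\<lambda>k. (g ^ Suc k) $ m)" for m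
    proof -
      have "(J * g) $ m = (\<Sum>i=0..m. hsum (\<lambda>k. (g ^ k) $ i * g $ (m - i)))"
        by (simp add: fps_mult_nth J_def hsum_local_add[OF local_add_mult_right hf])
      also have "\<dots> = hsum (\<lambda>k. \<Sum>i=0..m. (g ^ k) $ i * g $ (m - i))"
      proof -
        have "finite A \<Longrightarrow> (\<Sum>i\<in>A. hsum (\<lambda>k. (g ^ k) $ i * g $ (m - i))) = hsum (\<lambda>k. \<Sum>i\<in>A. (g ^ k) $ i * g $ (m - i)) \<and> hsummable (\<lambda>k. \<Sum>i\<in>A. (g ^ k) $ i * g $ (m - i))" for A
          by (induction A rule: finite_induct) (auto simp: hsum_add hsummable_add hsummable_local_add[OF local_add_mult_right hf] hsummable_def[of "\<lambda>_. 0"])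
        then show ?thesis by simp
      qed
      finally show ?thesis unfolding power_Suc2 by (simp add: fps_mult_nth)
    qed
    moreover have "J $ m = 1 $ m + hsum (\<lambda>k. (g ^ Suc k) $ m)" for m
      unfolding J_def fps_nth_Abs_fps using hsum_Suc_nat[OF hf[of m]] by simp
    ultimately show "g * J = J - 1" "J * g = J - 1" by (auto intro!: fps_ext)
  qed
  have "F = 1 - g" by (simp add: g_def)
  then have "F * J = 1" "J * F = 1" by (simp_all only: left_diff_distrib right_diff_distrib gJ) simp_all
  with 1 show ?thesis using that by blast
qed

section \<open>The action of the free algebra\<close>

lemma fps_X_mult_shift: "x $ 0 = 0 \<Longrightarrow> fps_X * fps_shift 1 x = x" for x :: "'a::ring_1 fps"
  by (rule fps_ext) (simp add: fps_X_mult_nth)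

lemma fps_X_dvd: "x $ 0 = 0 \<Longrightarrow> fps_X dvd x" for x :: "'a::comm_ring_1 fps"
  by (metis fps_X_mult_shift dvd_triv_left)

lemma A_linear_if: "A_linear (\<lambda>x. if P then x else 0)" by (cases P) (simp_all add: A_linear_id A_linear_zero)

lemma cre_ser_nth_0: "cre_ser j c $ m $ 0 = cre_gen j $ m $ 0"
proof -
  have "cre_ser j c $ m $ 0 = (\<Sum>k\<in>{m}. (cre_gen j $ k * (v_plus c ^ k) $ m) $ 0)"
    unfolding cre_ser_def subst_v_def fps_nth_Abs_fps
    by (rule hsum_nth_finite) (auto simp: v_plus_power pw_hb_nth)
  then show ?thesis by (simp add: v_plus_power pw_hb_nth)
qed

lemma EXP_nth_0:
  assumes "\<And>m. C $ m $ 0 = 0" shows "EXP C $ m $ 0 = (if m = 0 then 1 else 0)"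
proof -
  define D where "D = Abs_fps (\<lambda>m. fps_shift 1 (C $ m))"
  have C: "C = fps_const fps_X * D" by (rule fps_ext) (simp add: D_def fps_X_mult_shift assms)
  have "(C ^ k) $ m $ 0 = 0" if "k \<noteq> 0" for k
    using that by (simp add: C power_mult_distrib fps_const_power)
  then have "EXP C $ m $ 0 = (\<Sum>k\<in>{0}. (scl (fps_const (1 / fact k)) * (C ^ k) $ m) $ 0)"
    unfolding EXP_def fps_nth_Abs_fps by (intro hsum_nth_finite) auto
  then show ?thesis by simp
qed

text \<open>The creation terms come in pairs of opposite sign whose arguments coincide at hbar = 0.
  Therefore H^- is the identity modulo hbar.\<close>

lemma log_cre_H_nth_0: "log_cre_H n j $ m $ 0 = 0"
  by (simp add: log_cre_H_def fps_sum_nth cre_ser_nth_0)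

lemma Hm_op_mult: "Hm_op n j m x = x * to_ser (cre_H n j) m"
  by (simp add: Hm_op_eq field_ser_def ser_act_emb)

lemma Hm_op_nth_0: "Hm_op n j m x $ 0 = (if m = 0 then x $ 0 else 0)"
  by (simp add: Hm_op_mult to_ser_def cre_H_def EXP_nth_0 log_cre_H_nth_0)

lemma Hm_op_neg: "m < 0 \<Longrightarrow> Hm_op n j m x = 0"
  by (simp add: Hm_op_mult to_ser_def)

text \<open>
  The coefficient of \<open>\<hbar>\<^sup>p\<close> has degree at most \<open>-p\<close> in \<open>u\<close>;
  hence \<open>H\<^sup>+\<close> has no positive powers of \<open>u\<close>.
\<close>

definition low_degree :: "laurent \<Rightarrow> bool" where
  "low_degree r \<longleftrightarrow> (\<forall>p. Poly_Mapping.keys (r $ p) \<subseteq> {(k, i). i \<le> - int p})"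

lemma low_degree_add: "low_degree r \<Longrightarrow> low_degree s \<Longrightarrow> low_degree (r + s)"
  unfolding low_degree_def using Poly_Mapping.keys_add by (metis (no_types, lifting) fps_add_nth le_sup_iff order_trans)
lemma low_degree_uminus: "low_degree r \<Longrightarrow> low_degree (- r)" by (simp add: low_degree_def)

lemma low_degree_mult: assumes "low_degree r" "low_degree s" shows "low_degree (r * s)"
  unfolding low_degree_def
proof
  fix p
  have "Poly_Mapping.keys (\<Sum>q=0..p. r $ q * s $ (p - q)) \<subseteq> {(k, i). i \<le> - int p}"
  proof (rule pm_keys_sum)
    fix q assume q: "q \<in> {0..p}"
    show "Poly_Mapping.keys (r $ q * s $ (p - q)) \<subseteq> {(k, i). i \<le> - int p}"
    proof
      fix a assume "a \<in> Poly_Mapping.keys (r $ q * s $ (p - q))"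
      then obtain k l where "a = k + l" "k \<in> Poly_Mapping.keys (r $ q)" "l \<in> Poly_Mapping.keys (s $ (p - q))"
        using keys_mult[of "r $ q" "s $ (p - q)"] by blast
      then show "a \<in> {(k, i). i \<le> - int p}" using assms q unfolding low_degree_def
        by (cases k; cases l) (fastforce simp: of_nat_diff)
    qed
  qed
  then show "Poly_Mapping.keys ((r * s) $ p) \<subseteq> {(k, i). i \<le> - int p}" by (simp add: fps_mult_nth)
qed

lemma low_degree_emb_basis: "low_degree (emb (basis k))"
  unfolding emb_basis by (simp add: low_degree_def basis_def)

lemma low_degree_lin_pow: "k \<le> 0 \<Longrightarrow> low_degree (lin_pow c k)"
  by (auto simp: low_degree_def lin_pow_def split: if_splits)

text \<open>One factor alone may have positive degree in u; the two exponents are opposite, so the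
  total degree at order p is exactly -p.\<close>

lemma low_degree_H_weight: "low_degree (H_weight n j \<beta>)"
  unfolding low_degree_def
proof
  fix p
  have "Poly_Mapping.keys (\<Sum>q=0..p. (lin_pow (1/2) (- ip (alpha n j) \<beta>) :: laurent) $ q * lin_pow (-1/2) (ip (alpha n j) \<beta>) $ (p - q)) \<subseteq> {(k, i). i \<le> - int p}"
    by (rule pm_keys_sum) (auto simp: lin_pow_def mult_single of_nat_diff split: if_splits)
  then show "Poly_Mapping.keys (H_weight n j \<beta> $ p) \<subseteq> {(k, i). i \<le> - int p}" by (simp add: H_weight_def fps_mult_nth)
qed

lemma lin_pow_nth_0: "lin_pow c k $ 0 = Poly_Mapping.single (0, k) 1" by (simp add: lin_pow_def)

lemma fock_hom_hom_H: "fock_hom (hom_H n j)" unfolding hom_H_def by (rule fock_hom_shift_hom[OF mult_hom_H_weight])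

lemma hom_H_a_elt: "hom_H n j (a_elt jk) = emb (a_elt jk) - (ann_shift j (-1/2) jk - ann_shift j (1/2) jk)"
  by (simp add: hom_H_def shift_hom_a_elt[OF mult_hom_H_weight])
lemma hom_H_e_elt: "hom_H n j (e_elt \<beta>) = emb (e_elt \<beta>) * H_weight n j \<beta>"
  by (simp add: hom_H_def shift_hom_e_elt)

lemma low_degree_hom_H_basis: "low_degree (hom_H n j (basis k))"
proof -
  obtain \<mu> \<beta> where k: "k = (\<mu>, \<beta>)" by (cases k)
  have d: "low_degree (ann_shift j c jk)" for c jk by (simp add: ann_shift_def low_degree_lin_pow) (simp add: low_degree_def)
  have "low_degree (hom_H n j (basis (\<mu>, 0)))"
  proof (induction \<mu> rule: pm_nat_induct)
    case 1 then show ?case using fock_homD(3)[OF fock_hom_hom_H] low_degree_emb_basis[of 0] by (simp add: basis_0 flip: zero_prod_def)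
  next
    case (2 \<mu> a)
    have e: "basis (Poly_Mapping.single a 1 + \<mu>, 0) = a_elt a * basis (\<mu>, 0)" by (simp add: a_elt_def basis_mult)
    have "low_degree (hom_H n j (a_elt a))" unfolding hom_H_a_elt diff_conv_add_uminus
      by (intro low_degree_add low_degree_uminus d) (simp_all only: a_elt_def low_degree_emb_basis)
    then show ?case unfolding e fock_homD(2)[OF fock_hom_hom_H] using 2 by (rule low_degree_mult)
  qed
  moreover have "basis k = basis (\<mu>, 0) * e_elt \<beta>" by (simp add: k e_elt_def basis_mult)
  moreover have "low_degree (hom_H n j (e_elt \<beta>))" unfolding hom_H_e_elt unfolding e_elt_def by (intro low_degree_mult low_degree_emb_basis low_degree_H_weight)
  ultimately show ?thesis by (simp add: fock_homD(2)[OF fock_hom_hom_H] low_degree_mult)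
qed

lemma hom_H_basis_nth_0: "hom_H n j (basis k) $ 0 = emb (basis k) $ 0"
proof -
  have "fps_X dvd hom_H n j (basis k) - emb (basis k)"
  proof (rule dvd_hom_basis[OF fock_hom_hom_H fock_hom_emb])
    show "fps_X dvd hom_H n j (a_elt jk) - emb (a_elt jk)" for jk
      by (rule fps_X_dvd) (simp add: hom_H_a_elt ann_shift_def lin_pow_nth_0)
    show "fps_X dvd hom_H n j (e_elt \<beta>) - emb (e_elt \<beta>)" for \<beta>
      by (rule fps_X_dvd) (simp add: hom_H_e_elt H_weight_def lin_pow_nth_0 mult_single flip: zero_prod_def)
  qed
  then obtain y where "hom_H n j (basis k) - emb (basis k) = fps_X * y" by (auto simp: dvd_def)
  then have "(hom_H n j (basis k) - emb (basis k)) $ 0 = 0" by simp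
  then show ?thesis by simp
qed

lemma Hp_op_ser_coeff: "j \<noteq> 0 \<Longrightarrow> Hp_op n j m x = ser_coeff (hom_H n j x) m"
  by (simp add: Hp_op_eq field_ser_def ser_coeff_def to_ser_1)

lemma ser_coeff_emb_basis: "ser_coeff (emb (basis k)) m = (if m = 0 then basis k else 0)" by (simp add: ser_coeff_basis)

text \<open>At order 0 the operator series is the identity, and at order p > 0
  \<open>low_degree\<close> confines its exponents to at most -p.\<close>

lemma Hp_op_nonneg: assumes "j \<noteq> 0" "0 \<le> m" shows "Hp_op n j m x = (if m = 0 then x else 0)"
  unfolding Hp_op_ser_coeff[OF assms(1)]
proof (rule A_linear_eqI[of "\<lambda>x. ser_coeff (hom_H n j x) m" "\<lambda>x. if m = 0 then x else 0"])
  show "A_linear (\<lambda>x. ser_coeff (hom_H n j x) m)" by (rule A_linear_comp[OF A_linear_ser_coeff fock_homD(1)[OF fock_hom_hom_H]])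
  show "A_linear (\<lambda>x. if m = 0 then x else 0)" by (rule A_linear_if)
  fix k :: key
  have "ser_coeff (hom_H n j (basis k)) m $ p = (if m = 0 then basis k else 0) $ p" for p
  proof (cases "p = 0")
    case True
    have "Poly_Mapping.lookup (ser_coeff (hom_H n j (basis k)) m $ 0) l = Poly_Mapping.lookup (ser_coeff (emb (basis k)) m $ 0) l" for l
      by (simp only: ser_coeff_nth hom_H_basis_nth_0)
    then have "ser_coeff (hom_H n j (basis k)) m $ 0 = ser_coeff (emb (basis k)) m $ 0" by (rule poly_mapping_eqI)
    then show ?thesis unfolding ser_coeff_emb_basis True .
  next
    case False
    have "Poly_Mapping.lookup (ser_coeff (hom_H n j (basis k)) m $ p) l = 0" for l
      using low_degree_hom_H_basis[of n j k] assms(2) False unfolding ser_coeff_nth low_degree_def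
      by (metis (no_types, lifting) in_keys_iff mem_Collect_eq case_prod_conv subsetD neg_le_0_iff_le of_nat_0_le_iff of_nat_eq_0_iff order_antisym order_trans neg_0_le_iff_le)
    then show ?thesis using False by (auto simp: basis_def fps_nth_fps_const intro: poly_mapping_eqI)
  qed
  then show "ser_coeff (hom_H n j (basis k)) m = (if m = 0 then basis k else 0)" by (rule fps_ext)
qed

lemma Hp_op_nth_0: assumes "j \<noteq> 0" shows "Hp_op n j m x $ 0 = (if m = 0 then x $ 0 else 0)"
proof -
  let ?T = "\<lambda>x. ser_coeff (hom_H n j x) m - (if m = 0 then x else 0)"
  have T: "A_linear ?T" by (intro A_linear_minus2 A_linear_comp[OF A_linear_ser_coeff fock_homD(1)[OF fock_hom_hom_H]] A_linear_if)
  \<comment> \<open>The quotients by hbar on basis vectors are extended linearly. This divides the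
    whole operator by hbar and so transfers the vanishing at order 0 from basis vectors to
    \<open>x\<close>.\<close>
  have "?T x = fps_X * lin_ext (\<lambda>k. fps_shift 1 (?T (basis k))) x"
  proof (rule A_linear_eqI[OF T A_linear_mult_left[OF A_linear_lin_ext]])
    fix k :: key
    have "Poly_Mapping.lookup (ser_coeff (hom_H n j (basis k)) m $ 0) l = Poly_Mapping.lookup (ser_coeff (emb (basis k)) m $ 0) l" for l
      by (simp only: ser_coeff_nth hom_H_basis_nth_0)
    then have "ser_coeff (hom_H n j (basis k)) m $ 0 = ser_coeff (emb (basis k)) m $ 0" by (rule poly_mapping_eqI)
    then have "?T (basis k) $ 0 = 0" by (simp only: ser_coeff_emb_basis) simp
    then show "?T (basis k) = fps_X * lin_ext (\<lambda>k. fps_shift 1 (?T (basis k))) (basis k)"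
      unfolding lin_ext_basis by (rule fps_X_mult_shift[symmetric])
  qed
  then have "?T x $ 0 = 0" by simp
  then show ?thesis using assms by (simp add: Hp_op_ser_coeff split: if_splits)
qed

lemma A_linear_ops:
  assumes "j \<noteq> 0" shows "A_linear (E_op n j m)" "A_linear (F_op n j m)" "A_linear (Hp_op n j m)" "A_linear (Hm_op n j m)"
  using assms by (simp_all add: op_eqs A_linear_field_op)

text \<open>
  \<^term>\<open>fps_shift 1\<close> is the division by \<open>\<hbar>\<close>, exact because
  \<open>H\<^sup>\<plusminus>\<close> is the identity modulo \<open>\<hbar>\<close>.
\<close>

definition gen_op :: "nat \<Rightarrow> gen \<Rightarrow> fock \<Rightarrow> fock" where
  "gen_op n g x = (if g \<in> gens n then
     (case g of
        HH i r \<Rightarrow> if 0 \<le> r then fps_shift 1 (Hp_op n i (- r - 1) x)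
                  else fps_shift 1 ((if r = -1 then x else 0) - Hm_op n i (- r - 1) x)
      | XP i r \<Rightarrow> E_op n i (- r - 1) x
      | XM i r \<Rightarrow> F_op n i (- r - 1) x
      | CC \<Rightarrow> x)
    else 0)"

lemma A_linear_shift: assumes "A_linear T" "\<And>x. T x $ 0 = 0" shows "A_linear (\<lambda>x. fps_shift 1 (T x))"
proof (rule A_linearI)
  fix f x y
  show "fps_shift 1 (T (x + y)) = fps_shift 1 (T x) + fps_shift 1 (T y)"
    by (simp add: A_linear_add[OF assms(1)] fps_shift_add)
  have "T x = fps_X * fps_shift 1 (T x)" by (rule fps_X_mult_shift[OF assms(2), symmetric])
  then have "T (scl f * x) = scl f * (fps_X * fps_shift 1 (T x))" by (simp only: A_linear_scl[OF assms(1)])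
  also have "\<dots> = fps_X * (scl f * fps_shift 1 (T x))" by (metis scl_X scl_left_comm)
  finally show "fps_shift 1 (T (scl f * x)) = scl f * fps_shift 1 (T x)"
    by (simp add: fps_eq_iff fps_X_mult_nth)
qed

lemma gens_iff [simp]:
  "CC \<in> gens n" "HH i r \<in> gens n \<longleftrightarrow> i \<in> {1..n}" "XP i r \<in> gens n \<longleftrightarrow> i \<in> {1..n}" "XM i r \<in> gens n \<longleftrightarrow> i \<in> {1..n}"
  by (auto simp: gens_def)

lemma A_linear_gen_op: "A_linear (gen_op n g)"
proof (cases "g \<in> gens n")
  case True
  show ?thesis
  proof (cases g)
    case (HH i r)
    then have i: "i \<noteq> 0" using True by auto
    show ?thesis
    proof (cases "0 \<le> r")
      case r: True
      have "A_linear (\<lambda>x. fps_shift 1 (Hp_op n i (- r - 1) x))"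
        by (rule A_linear_shift) (use i r in \<open>auto simp: A_linear_ops Hp_op_nth_0\<close>)
      then show ?thesis using True HH r by (simp add: gen_op_def[abs_def])
    next
      case r: False
      have "A_linear (\<lambda>x. fps_shift 1 ((if r = -1 then x else 0) - Hm_op n i (- r - 1) x))"
        by (rule A_linear_shift) (use i in \<open>auto simp: A_linear_ops Hm_op_nth_0 intro!: A_linear_minus2 A_linear_if\<close>)
      then show ?thesis using True HH r by (simp add: gen_op_def[abs_def])
    qed
  qed (use True in \<open>auto simp: gen_op_def[abs_def] A_linear_ops A_linear_id\<close>)
qed (simp add: gen_op_def[abs_def] A_linear_zero)

text \<open>\<open>foldr\<close> lets the last letter act first, so that concatenation of words
  becomes composition of operators.\<close>

definition free_act :: "nat \<Rightarrow> falg \<Rightarrow> fock \<Rightarrow> fock" where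
  "free_act n x v = lin_ext (\<lambda>w. foldr (gen_op n) (letters w) v) x"

lemma A_linear_free_act: "A_linear (\<lambda>x. free_act n x v)" unfolding free_act_def by (rule A_linear_lin_ext)

lemma free_act_basis: "free_act n (basis w) v = foldr (gen_op n) (letters w) v" by (simp add: free_act_def)

lemma A_linear_foldr: "(\<And>g. A_linear (T g)) \<Longrightarrow> A_linear (foldr T gs)"
  by (induction gs) (simp_all add: A_linear_id id_def comp_def A_linear_comp)

lemma A_linear_Phi2: "A_linear (free_act n x)"
proof (rule A_linearI)
  fix v w f
  have a: "A_linear (\<lambda>v. free_act n (basis u) v)" for u unfolding free_act_basis by (rule A_linear_foldr[OF A_linear_gen_op])
  show "free_act n x (v + w) = free_act n x v + free_act n x w"
    by (rule A_linear_eqI[of "\<lambda>x. free_act n x (v + w)"]) (intro A_linear_plus A_linear_free_act A_linear_add[OF a])+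
  show "free_act n x (scl f * v) = scl f * free_act n x v"
    by (rule A_linear_eqI[of "\<lambda>x. free_act n x (scl f * v)"]) (intro A_linear_mult_left A_linear_free_act A_linear_scl[OF a])+
qed

lemma letters_plus: "letters (v + w) = letters v @ letters w" by (simp add: plus_word_def)

lemma free_act_mult: "free_act n (x * y) v = free_act n x (free_act n y v)"
proof (rule A_linear_eqI[of "\<lambda>x. free_act n (x * y) v" "\<lambda>x. free_act n x (free_act n y v)"])
  fix w
  show "free_act n (basis w * y) v = free_act n (basis w) (free_act n y v)"
    by (rule A_linear_eqI[of "\<lambda>y. free_act n (basis w * y) v" "\<lambda>y. free_act n (basis w) (free_act n y v)"])
      ((intro A_linear_comp[OF A_linear_free_act] A_linear_comp[OF A_linear_Phi2] A_linear_mult_left A_linear_id A_linear_free_act)+, simp add: basis_mult free_act_basis letters_plus)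
qed (intro A_linear_comp[OF A_linear_free_act] A_linear_mult_right A_linear_id A_linear_free_act)+

lemma free_act_1: "free_act n 1 v = v"
  using free_act_basis[of n 0 v] by (simp add: basis_0) (simp add: zero_word_def)

lemma free_act_scl: "free_act n (scl f) v = scl f * v"
  using A_linear_scl[OF A_linear_free_act[of n v], of f 1] by (simp add: free_act_1)

lemma gen_el_basis: "gen_el g = basis (Word [g])" by (simp add: gen_el_def basis_def)

lemma free_act_gen: "free_act n (gen_el g) v = gen_op n g v" by (simp add: gen_el_basis free_act_basis)

lemmas free_act_add = A_linear_add[OF A_linear_free_act]
lemmas free_act_diff = A_linear_diff[OF A_linear_free_act]
lemmas free_act_0 = A_linear_0[OF A_linear_free_act]
lemmas free_act_minus = A_linear_minus[OF A_linear_free_act]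

lemma free_act_X: "free_act n (fps_X * x) v = fps_X * free_act n x v"
  using free_act_scl[of n fps_X] by (simp add: free_act_mult scl_X)

definition H_op :: "int \<Rightarrow> nat \<Rightarrow> nat \<Rightarrow> opser" where "H_op s n i = (if s = 1 then Hp_op n i else Hm_op n i)"

lemma free_act_ser_one: "free_act n (ser_one m) v = (if m = (0::int) then v else 0)"
  by (simp add: ser_one_def free_act_1 free_act_0)

lemma free_act_E: "i \<in> {1..n} \<Longrightarrow> free_act n (Eser i m) v = E_op n i m v"
  by (simp add: Eser_def free_act_gen gen_op_def)
lemma free_act_F: "i \<in> {1..n} \<Longrightarrow> free_act n (Fser i m) v = F_op n i m v"
  by (simp add: Fser_def free_act_gen gen_op_def)

text \<open>On the support of H the factor hbar restores what \<open>gen_op\<close> divided out. Off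
  the support the operator must itself be constant, which is the content of
  \<open>Hp_op_nonneg\<close> and \<open>Hm_op_neg\<close>.\<close>

lemma free_act_H: assumes "i \<in> {1..n}" "s \<in> {1, -1}" shows "free_act n (Hser s i m) v = H_op s n i m v"
proof -
  have i: "i \<noteq> 0" using assms by auto
  show ?thesis
  proof (cases "s = 1")
    case True
    show ?thesis
    proof (cases "m \<le> -1")
      case m: True
      then have "fps_X * fps_shift 1 (Hp_op n i m v) = Hp_op n i m v"
        by (intro fps_X_mult_shift) (simp add: Hp_op_nth_0[OF i])
      then show ?thesis using True assms m by (simp add: Hser_def H_op_def free_act_add free_act_ser_one free_act_X free_act_gen gen_op_def)
    next
      case m: False
      then show ?thesis using True i by (simp add: Hser_def H_op_def free_act_ser_one Hp_op_nonneg)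
    qed
  next
    case False
    then have s: "s = -1" using assms by simp
    show ?thesis
    proof (cases "0 \<le> m")
      case m: True
      then have e: "fps_X * fps_shift 1 ((if m = 0 then v else 0) - Hm_op n i m v) = (if m = 0 then v else 0) - Hm_op n i m v"
        by (intro fps_X_mult_shift) (simp add: Hm_op_nth_0)
      show ?thesis using assms m e by (simp add: s Hser_def H_op_def free_act_diff free_act_ser_one free_act_X free_act_gen gen_op_def)
    next
      case m: False
      then show ?thesis by (simp add: s Hser_def H_op_def free_act_ser_one Hm_op_neg)
    qed
  qed
qed

section \<open>Vanishing of the relators\<close>

text \<open>In the free algebra \<open>hc4\<close> is not a scalar; it acts as hbar/4 because the
  central generator acts as 1. The predicate converts linear factors over the free algebra into
  \<open>diff_op\<close> with a numerical constant.\<close>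

definition acts_scalar :: "nat \<Rightarrow> falg \<Rightarrow> complex \<Rightarrow> bool" where
  "acts_scalar n s c \<longleftrightarrow> (\<forall>v. free_act n s v = scl (hb c) * v)"

lemma acts_scalarD: "acts_scalar n s c \<Longrightarrow> free_act n s v = scl (hb c) * v" by (simp add: acts_scalar_def)

lemma acts_scalar_add: "acts_scalar n s c \<Longrightarrow> acts_scalar n t d \<Longrightarrow> acts_scalar n (s + t) (c + d)"
  by (simp add: acts_scalar_def free_act_add hb_add scl_add distrib_right)
lemma acts_scalar_uminus: "acts_scalar n s c \<Longrightarrow> acts_scalar n (- s) (- c)"
  by (simp add: acts_scalar_def free_act_minus hb_minus scl_minus)
lemma acts_scalar_diff: "acts_scalar n s c \<Longrightarrow> acts_scalar n t d \<Longrightarrow> acts_scalar n (s - t) (c - d)"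
  using acts_scalar_add[of n s c "- t" "- d"] by (simp add: acts_scalar_uminus)
lemma acts_scalar_0: "acts_scalar n 0 0" by (simp add: acts_scalar_def free_act_0)
lemma acts_scalar_hc4: "acts_scalar n hc4 (1/4)"
  by (simp add: acts_scalar_def hc4_def free_act_mult free_act_gen gen_op_def free_act_scl)
lemma acts_scalar_Bh: "acts_scalar n (Bh n i j) (Bform n i j)"
  by (simp add: acts_scalar_def Bh_def free_act_scl)
lemma acts_scalar_sgn: "s \<in> {1, -1} \<Longrightarrow> acts_scalar n (of_int s * hc4) (of_int s / 4)"
  using acts_scalar_hc4 acts_scalar_uminus[OF acts_scalar_hc4] by auto

lemma free_act_lin_op: "acts_scalar n s c \<Longrightarrow> (\<lambda>e. free_act n (lin_op s f e) v) = diff_uv c (\<lambda>e. free_act n (f e) v)"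
  by (simp add: lin_op_def diff_op_def free_act_add free_act_diff free_act_mult acts_scalarD fun_eq_iff)

lemma free_act_of_int: "free_act n (of_int z * x) v = scl (of_int z) * free_act n x v"
  by (simp add: free_act_mult free_act_scl flip: scl_of_int)

lemma free_act_pw: assumes "acts_scalar n s c" shows "free_act n (pw s k m) v = scl (pw (hb c) k m) * v"
proof -
  have "free_act n (s ^ d) v = scl (hb c ^ d) * v" for d
  proof (induction d)
    case 0 then show ?case by (simp add: free_act_1)
  next
    case (Suc d) then show ?case by (simp add: free_act_mult acts_scalarD[OF assms] scl_mult mult.assoc)
  qed
  then show ?thesis by (simp add: pw_def free_act_of_int scl_mult mult.assoc free_act_0)
qed

lemma free_act_uv:
  assumes "\<And>a v. free_act n (f a) v = X a v" "\<And>b v. free_act n (g b) v = Y b v"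
  shows "(\<lambda>e. free_act n ((in_u f \<star> in_v g) e) v) = comp_uv X Y v"
  by (auto simp: fun_eq_iff conv_uv free_act_mult assms comp_uv_def)

lemma free_act_vu:
  assumes "\<And>a v. free_act n (f a) v = X a v" "\<And>b v. free_act n (g b) v = Y b v"
  shows "(\<lambda>e. free_act n ((in_v g \<star> in_u f) e) v) = comp_vu X Y v"
  by (auto simp: fun_eq_iff conv_vu free_act_mult assms comp_vu_def)

lemma free_act_commutator: "free_act n (commutator x y) v = free_act n x (free_act n y v) - free_act n y (free_act n x v)"
  by (simp add: commutator_def free_act_diff free_act_mult)

lemma free_act_central_0: "free_act n (commutator (gen_el CC) (gen_el g)) v = 0"
  by (simp add: free_act_commutator free_act_gen gen_op_def)

lemma A_linear_diff_uv_in: assumes "A_linear T" shows "diff_uv c (\<lambda>e. T (f e)) = (\<lambda>e. T (diff_uv c f e))"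
  by (simp add: diff_op_def fun_eq_iff A_linear_add[OF assms] A_linear_diff[OF assms] A_linear_scl[OF assms])

lemma scl_hb_inf_div: 
  fixes f :: "int \<Rightarrow> ('k::monoid_add \<Rightarrow>\<^sub>0 complex) fps"
  assumes "\<And>b. f b = scl (hb c) * f (g b)" shows "f b = 0"
proof -
  have "f b $ p = 0" for p
  proof (induction p arbitrary: b rule: less_induct)
    case (less p)
    have "f b = fps_X * (scl (fps_const c) * f (g b))"
      by (subst assms) (simp add: hb_def scl_mult scl_X scl_left_comm[of fps_X] mult.assoc)
    then have "f b $ p = (if p = 0 then 0 else Poly_Mapping.single 0 c * f (g b) $ (p - 1))"
      by (metis fps_X_mult_nth fps_scl_const_mult_nth)
    then show ?case using less by simp
  qed
  then show ?thesis by (intro fps_ext) simp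
qed

text \<open>One row determines a solution. The recursion gives the row below directly; in the row
  above, each entry is a multiple of hbar times its neighbour and is hence divisible by every power
  of hbar.\<close>

lemma diff_uv_zero_row:
  assumes "diff_uv c f = (\<lambda>_. 0)" "\<And>b. f (a0, b) = 0" shows "f = (\<lambda>_. 0)"
proof -
  have r: "f (a - 1, b) - f (a, b - 1) + scl (hb c) * f (a, b) = 0" for a b
    using fun_cong[OF assms(1), of "(a, b)"] by (simp add: diff_op_def)
  have d: "\<forall>b. f (a - 1, b) = 0" if "\<forall>b. f (a, b) = 0" for a using r[of a] that by simp
  have u: "\<forall>b. f (a + 1, b) = 0" if "\<forall>b. f (a, b) = 0" for a
  proof
    have "f (a + 1, b) = scl (hb c) * f (a + 1, b + 1)" for b using r[of "a + 1" "b + 1"] that by simp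
    then show "f (a + 1, b) = 0" for b by (rule scl_hb_inf_div)
  qed
  have "\<forall>b. f (a, b) = 0" for a by (induction a rule: int_induct[of _ a0]) (use assms(2) d u in blast)+
  then show ?thesis by auto
qed

lemma diff_uv_zero_col:
  assumes "diff_uv c f = (\<lambda>_. 0)" "\<And>a. f (a, b0) = 0" shows "f = (\<lambda>_. 0)"
proof -
  have r: "f (a - 1, b) - f (a, b - 1) + scl (hb c) * f (a, b) = 0" for a b
    using fun_cong[OF assms(1), of "(a, b)"] by (simp add: diff_op_def)
  have d: "\<forall>a. f (a, b - 1) = 0" if "\<forall>a. f (a, b) = 0" for b using r[of _ b] that by simp
  have u: "\<forall>a. f (a, b + 1) = 0" if "\<forall>a. f (a, b) = 0" for b
  proof
    have "f (a, b + 1) = scl (hb (- c)) * f (a + 1, b + 1)" for a using r[of "a + 1" "b + 1"] that by (simp add: hb_minus scl_minus add_eq_0_iff2)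
    then show "f (a, b + 1) = 0" for a by (rule scl_hb_inf_div)
  qed
  have "\<forall>a. f (a, b) = 0" for b by (induction b rule: int_induct[of _ b0]) (use assms(2) d u in blast)+
  then show ?thesis by auto
qed

lemma diff_uv_diff: "diff_uv c (\<lambda>e. f e - g e) = (\<lambda>e. diff_uv c f e - diff_uv c g e)"
  by (rule ext) (rule diff_op_diff)

lemma diff_uv_eq_row: assumes "diff_uv c f = diff_uv c g" "\<And>b. f (a0, b) = g (a0, b)" shows "f = g"
  using diff_uv_zero_row[of c "\<lambda>e. f e - g e" a0] assms by (simp add: diff_uv_diff fun_eq_iff)
lemma diff_uv_eq_col: assumes "diff_uv c f = diff_uv c g" "\<And>a. f (a, b0) = g (a, b0)" shows "f = g"
  using diff_uv_zero_col[of c "\<lambda>e. f e - g e" b0] assms by (simp add: diff_uv_diff fun_eq_iff)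

text \<open>Multiplication by a one-sided series in u^t whose k-th coefficient has been absorbed
  into \<open>Z k\<close>; it is applied to the inverse of H.\<close>

definition conj_sum :: "int \<Rightarrow> (nat \<Rightarrow> int \<times> int \<Rightarrow> fock) \<Rightarrow> int \<times> int \<Rightarrow> fock" where
  "conj_sum t Z = (\<lambda>(a, b). hsum (\<lambda>k. Z k (a - t * int k, b)))"

definition fin_conj :: "int \<Rightarrow> (nat \<Rightarrow> int \<times> int \<Rightarrow> fock) \<Rightarrow> bool" where
  "fin_conj t Z \<longleftrightarrow> (\<forall>a b. finite {k. Z k (a - t * int k, b) \<noteq> 0})"

lemma hsummable_diff: "hsummable f \<Longrightarrow> hsummable g \<Longrightarrow> hsummable (\<lambda>i. f i - g i)" for f :: "'i \<Rightarrow> 'a::ab_group_add fps"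
  using hsummable_add[of f "\<lambda>i. - g i"] hsummable_uminus[of g] by simp

lemma diff_uv_conj_sum: assumes "fin_conj t Z" shows "diff_uv c (conj_sum t Z) = conj_sum t (\<lambda>k. diff_uv c (Z k))"
proof (intro ext, clarify)
  fix a b
  have f: "hsummable (\<lambda>k. Z k (a - t * int k, b))" for a b using assms by (intro hsummable_finite) (simp add: fin_conj_def)
  have s: "a - t * int k - 1 = a - 1 - t * int k" for k by simp
  have "hsum (\<lambda>k. Z k (a - 1 - t * int k, b) - Z k (a - t * int k, b - 1) + scl (hb c) * Z k (a - t * int k, b))
      = hsum (\<lambda>k. Z k (a - 1 - t * int k, b)) - hsum (\<lambda>k. Z k (a - t * int k, b - 1)) + scl (hb c) * hsum (\<lambda>k. Z k (a - t * int k, b))"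
    unfolding hsum_add[OF hsummable_diff[OF f f] hsummable_local_add[OF local_add_mult_left f]] hsum_diff[OF f f] hsum_local_add[OF local_add_mult_left f] ..
  then show "diff_uv c (conj_sum t Z) (a, b) = conj_sum t (\<lambda>k. diff_uv c (Z k)) (a, b)" by (simp add: conj_sum_def diff_op_def s)
qed

text \<open>
  Both sides of \<open>H\<^sup>-\<^sup>1 E H = R E\<close> are supported on one side in \<open>u\<close> and
  agree after multiplication by the denominator of \<open>R\<close>.
\<close>

lemma conjugation:
  assumes t: "t = 1 \<or> t = -1" and Z: "fin_conj t Z" "fin_conj t Z'" and r: "\<And>k. diff_uv c1 (Z k) = diff_uv c2 (Z' k)"
    and Z': "\<And>a b. conj_sum t Z' (a, b) = (if a = 0 then G b else 0)"
    and R0: "\<And>a b. diff_uv c1 R0 (a, b) = (if a = 0 then G b else 0)" "\<And>a b. t = 1 \<and> a < 0 \<or> t = -1 \<and> 0 \<le> a \<Longrightarrow> R0 (a, b) = 0"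
    and v: "\<And>a b. t * a < 0 \<Longrightarrow> conj_sum t Z (a, b) = 0"
  shows "conj_sum t Z = diff_uv c2 R0"
proof -
  have eq: "conj_sum t Z' = diff_uv c1 R0" using Z' R0(1) by auto
  have L: "diff_uv c1 (conj_sum t Z) = diff_uv c1 (diff_uv c2 R0)"
    unfolding diff_uv_conj_sum[OF Z(1)] r diff_uv_conj_sum[OF Z(2), symmetric] eq by (rule diff_op_commute)
  have w: "diff_uv c2 R0 (a, b) = 0" if "t * a < 0" for a b using that t by (elim disjE) (simp_all add: diff_op_def R0(2))
  show ?thesis
  proof (cases "t = 1")
    case True
    have b: "bounded_deg fst f" if "\<forall>a b. t * a < 0 \<longrightarrow> f (a, b) = 0" for f :: "int \<times> int \<Rightarrow> fock"
      by (intro bounded_degI exI[of _ 0]) (use that True in auto)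
    show ?thesis
    proof (rule diff_op_inj[OF additive_deg_fst _ b b L])
      show "\<forall>a b. t * a < 0 \<longrightarrow> conj_sum t Z (a, b) = 0" using v by blast
      show "\<forall>a b. t * a < 0 \<longrightarrow> diff_uv c2 R0 (a, b) = 0" using w by blast
    qed simp
  next
    case False
    \<comment> \<open>For t = -1 both sides are supported on a \<le> 0, so a lower bound is replaced
      by the row a = 1, which vanishes on both sides.\<close>
    show ?thesis by (rule diff_uv_eq_row[OF L, of 1]) (use v[of 1] w[of 1] t False in simp)
  qed
qed

lemma hsum_int_nat:
  assumes "t = 1 \<or> t = -1" "\<And>i. t * i < 0 \<Longrightarrow> f i = 0" shows "hsum f = hsum (\<lambda>k::nat. f (t * int k))"
proof (rule fps_ext)
  fix p
  have inj: "inj (\<lambda>k::nat. t * int k)" using assms(1) by (auto simp: inj_on_def)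
  have "{i. f i $ p \<noteq> 0} = (\<lambda>k::nat. t * int k) ` {k. f (t * int k) $ p \<noteq> 0}"
  proof (intro equalityI subsetI)
    fix i assume i: "i \<in> {i. f i $ p \<noteq> 0}"
    have "\<not> t * i < 0"
    proof
      assume "t * i < 0"
      then have "f i = 0" by (rule assms(2))
      then show False using i by simp
    qed
    then have e: "t * int (nat (t * i)) = i" using assms(1) by auto
    show "i \<in> (\<lambda>k::nat. t * int k) ` {k. f (t * int k) $ p \<noteq> 0}"
      by (rule image_eqI[of _ _ "nat (t * i)"]) (use i in \<open>simp_all only: e mem_Collect_eq not_False_eq_True\<close>)
  qed auto
  then show "hsum f $ p = hsum (\<lambda>k::nat. f (t * int k)) $ p"
    unfolding hsum_nth Sum_any.expand_set by (simp add: sum.reindex inj_on_subset[OF inj])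
qed

lemma hsum_reflect: "hsum (\<lambda>i. f (a - i)) = hsum f" for f :: "int \<Rightarrow> 'a::comm_monoid_add fps"
  by (rule hsum_reindex) (rule bij_betwI[of _ _ _ "\<lambda>i. a - i"], auto)

lemma side_ser_nonneg: "t = 1 \<or> t = -1 \<Longrightarrow> side_ser t F (t * int k) = F $ k"
  by (auto simp: side_ser_def)
lemma side_ser_neg: "t * m < 0 \<Longrightarrow> side_ser t F m = 0" by (simp add: side_ser_def)

lemma side_ser_shift_0: assumes "t = 1 \<or> t = -1" "t * a < int k" shows "side_ser t F (a - t * int k) = 0"
  by (rule side_ser_neg) (use assms in auto)

lemma finite_side_ser: assumes "t = 1 \<or> t = -1" "\<And>k. side_ser t F (a - t * int k) = 0 \<Longrightarrow> Q k = 0" shows "finite {k. Q k \<noteq> 0}"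
proof (rule finite_subset)
  show "{k. Q k \<noteq> 0} \<subseteq> {..nat (t * a)}"
  proof
    fix k assume "k \<in> {k. Q k \<noteq> 0}"
    then have "\<not> t * a < int k" using assms(2) side_ser_shift_0[OF assms(1), of a k F] by auto
    then show "k \<in> {..nat (t * a)}" by simp
  qed
qed simp

lemma side_ser_conv1:
  fixes F J :: "'a::semiring_0 fps fps"
  assumes t: "t = 1 \<or> t = -1" shows "hsum (\<lambda>k. J $ k * side_ser t F (a - t * int k)) = side_ser t (J * F) a"
proof -
  have "hsum (\<lambda>i. side_ser t J i * side_ser t F (a - i)) = hsum (\<lambda>k. side_ser t J (t * int k) * side_ser t F (a - t * int k))"
    by (rule hsum_int_nat[OF t]) (simp add: side_ser_neg)
  then show ?thesis unfolding side_ser_conv[OF t, symmetric] ser_mult_def by (simp add: side_ser_nonneg[OF t])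
qed

lemma side_ser_conv2:
  fixes F J :: "'a::semiring_0 fps fps"
  assumes t: "t = 1 \<or> t = -1" shows "hsum (\<lambda>k. side_ser t F (a - t * int k) * J $ k) = side_ser t (F * J) a"
proof -
  have "hsum (\<lambda>i. side_ser t F (a - i) * side_ser t J i) = hsum (\<lambda>k. side_ser t F (a - t * int k) * side_ser t J (t * int k))"
    by (rule hsum_int_nat[OF t]) (simp add: side_ser_neg)
  moreover have "hsum (\<lambda>i. side_ser t F (a - i) * side_ser t J i) = hsum (\<lambda>i. side_ser t F i * side_ser t J (a - i))"
    using hsum_reflect[of "\<lambda>i. side_ser t F i * side_ser t J (a - i)" a] by simp
  ultimately show ?thesis unfolding side_ser_conv[OF t, symmetric] ser_mult_def by (simp add: side_ser_nonneg[OF t])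
qed

context
  fixes n :: nat and t :: int and F J :: "falg fps" and g :: "int \<Rightarrow> falg" and x :: fock
  assumes t: "t = 1 \<or> t = -1"
begin

abbreviation "HF a \<equiv> free_act n (side_ser t F a)"
abbreviation "GF b \<equiv> free_act n (g b)"

text \<open>For E the inverse of H stands on the left, so its coefficients act last. For F
  (\<open>free_act_conj2\<close>) it stands on the right and they act first, on the vector
  \<open>x\<close>.\<close>

lemma free_act_conj1: "(\<lambda>e. free_act n ((in_u (side_ser t J) \<star> in_v g \<star> in_u (side_ser t F)) e) x) = conj_sum t (\<lambda>k e. free_act n (J $ k) (comp_vu HF GF x e))"
proof (intro ext, clarify)
  fix a b
  have "(in_u (side_ser t J) \<star> in_v g \<star> in_u (side_ser t F)) (a, b) = hsum (\<lambda>k. J $ k * g b * side_ser t F (a - t * int k))"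
    unfolding conv_in_u conv_uv by (subst hsum_int_nat[OF t]) (simp_all add: side_ser_nonneg[OF t] side_ser_neg)
  moreover have "finite {k. J $ k * g b * side_ser t F (a - t * int k) \<noteq> 0}" by (rule finite_side_ser[OF t, of F a]) simp
  ultimately show "free_act n ((in_u (side_ser t J) \<star> in_v g \<star> in_u (side_ser t F)) (a, b)) x = conj_sum t (\<lambda>k e. free_act n (J $ k) (comp_vu HF GF x e)) (a, b)"
    by (simp add: A_linear_hsum[OF A_linear_free_act hsummable_finite] conj_sum_def comp_vu_def free_act_mult)
qed

lemma fin_conj1: "fin_conj t (\<lambda>k e. free_act n (J $ k) (comp_vu HF GF x e))" "fin_conj t (\<lambda>k e. free_act n (J $ k) (comp_uv HF GF x e))"
proof -
  have "finite {k. free_act n (J $ k) (GF b (HF (a - t * int k) x)) \<noteq> 0}" "finite {k. free_act n (J $ k) (HF (a - t * int k) (GF b x)) \<noteq> 0}" for a b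
    by (rule finite_side_ser[OF t, of F a], simp add: free_act_0 A_linear_0[OF A_linear_Phi2])+
  then show "fin_conj t (\<lambda>k e. free_act n (J $ k) (comp_vu HF GF x e))" "fin_conj t (\<lambda>k e. free_act n (J $ k) (comp_uv HF GF x e))"
    by (simp_all add: fin_conj_def comp_uv_def comp_vu_def)
qed

lemma conj_sum1_neg: "t * a < 0 \<Longrightarrow> conj_sum t (\<lambda>k e. free_act n (J $ k) (comp_vu HF GF x e)) (a, b) = 0"
  unfolding conj_sum_def comp_vu_def prod.case
  by (subst side_ser_shift_0[OF t]) (simp_all add: free_act_0 A_linear_0[OF A_linear_Phi2])

lemma conj_sum1_inverse: assumes "J * F = 1" shows "conj_sum t (\<lambda>k e. free_act n (J $ k) (comp_uv HF GF x e)) (a, b) = (if a = 0 then GF b x else 0)"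
proof -
  have fin: "finite {k. J $ k * side_ser t F (a - t * int k) \<noteq> 0}" by (rule finite_side_ser[OF t, of F a]) simp
  have "conj_sum t (\<lambda>k e. free_act n (J $ k) (comp_uv HF GF x e)) (a, b) = free_act n (side_ser t (J * F) a) (GF b x)"
    unfolding side_ser_conv1[OF t, symmetric] A_linear_hsum[OF A_linear_free_act hsummable_finite[OF fin]] by (simp add: conj_sum_def comp_uv_def free_act_mult)
  then show ?thesis unfolding assms side_ser_1[OF t, symmetric] free_act_ser_one .
qed

lemma free_act_conj2: "(\<lambda>e. free_act n ((in_u (side_ser t F) \<star> in_v g \<star> in_u (side_ser t J)) e) x) = conj_sum t (\<lambda>k. comp_uv HF GF (free_act n (J $ k) x))"
proof (intro ext, clarify)
  fix a b
  have "(in_u (side_ser t F) \<star> in_v g \<star> in_u (side_ser t J)) (a, b) = hsum (\<lambda>i. side_ser t F (a - i) * g b * side_ser t J i)"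
    unfolding conv_in_u conv_uv using hsum_reflect[of "\<lambda>i. side_ser t F i * g b * side_ser t J (a - i)" a] by simp
  also have "\<dots> = hsum (\<lambda>k. side_ser t F (a - t * int k) * g b * J $ k)"
    by (subst hsum_int_nat[OF t]) (simp_all add: side_ser_nonneg[OF t] side_ser_neg)
  moreover have "finite {k. side_ser t F (a - t * int k) * g b * J $ k \<noteq> 0}" by (rule finite_side_ser[OF t, of F a]) simp
  ultimately show "free_act n ((in_u (side_ser t F) \<star> in_v g \<star> in_u (side_ser t J)) (a, b)) x = conj_sum t (\<lambda>k. comp_uv HF GF (free_act n (J $ k) x)) (a, b)"
    by (simp add: A_linear_hsum[OF A_linear_free_act hsummable_finite] conj_sum_def comp_uv_def free_act_mult)
qed

lemma fin_conj2: "fin_conj t (\<lambda>k. comp_uv HF GF (free_act n (J $ k) x))" "fin_conj t (\<lambda>k. comp_vu HF GF (free_act n (J $ k) x))"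
proof -
  have "finite {k. HF (a - t * int k) (GF b (free_act n (J $ k) x)) \<noteq> 0}" "finite {k. GF b (HF (a - t * int k) (free_act n (J $ k) x)) \<noteq> 0}" for a b
    by (rule finite_side_ser[OF t, of F a], simp add: free_act_0 A_linear_0[OF A_linear_Phi2])+
  then show "fin_conj t (\<lambda>k. comp_uv HF GF (free_act n (J $ k) x))" "fin_conj t (\<lambda>k. comp_vu HF GF (free_act n (J $ k) x))"
    by (simp_all add: fin_conj_def comp_uv_def comp_vu_def)
qed

lemma conj_sum2_neg: "t * a < 0 \<Longrightarrow> conj_sum t (\<lambda>k. comp_uv HF GF (free_act n (J $ k) x)) (a, b) = 0"
  unfolding conj_sum_def comp_uv_def prod.case
  by (subst side_ser_shift_0[OF t]) (simp_all add: free_act_0 A_linear_0[OF A_linear_Phi2])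

lemma conj_sum2_inverse: assumes "F * J = 1" shows "conj_sum t (\<lambda>k. comp_vu HF GF (free_act n (J $ k) x)) (a, b) = (if a = 0 then GF b x else 0)"
proof -
  have fin: "finite {k. side_ser t F (a - t * int k) * J $ k \<noteq> 0}" by (rule finite_side_ser[OF t, of F a]) simp
  have fin': "finite {k. free_act n (side_ser t F (a - t * int k) * J $ k) x \<noteq> 0}" by (rule finite_side_ser[OF t, of F a]) (simp add: free_act_0)
  have "conj_sum t (\<lambda>k. comp_vu HF GF (free_act n (J $ k) x)) (a, b) = GF b (free_act n (side_ser t (F * J) a) x)"
    unfolding side_ser_conv2[OF t, symmetric] A_linear_hsum[OF A_linear_free_act hsummable_finite[OF fin]] A_linear_hsum[OF A_linear_Phi2 hsummable_finite[OF fin']]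
    by (simp add: conj_sum_def comp_vu_def free_act_mult)
  then show ?thesis unfolding assms side_ser_1[OF t, symmetric] free_act_ser_one by (simp add: A_linear_0[OF A_linear_Phi2])
qed

end

lemma Hser_side_ser: assumes "s \<in> {1, -1}"
  obtains F where "Hser s i = side_ser (- s) F" "\<And>m. F $ m $ 0 = (if m = 0 then 1 else 0)"
proof
  let ?F = "Abs_fps (\<lambda>m. Hser s i (- s * int m))"
  show "Hser s i = side_ser (- s) ?F" using assms by (auto simp: fun_eq_iff side_ser_def Hser_def ser_one_def)
  show "?F $ m $ 0 = (if m = 0 then 1 else 0)" for m using assms by (auto simp: Hser_def ser_one_def)
qed

lemma ser_one_in_v: "(ser_one \<star> in_v g) (a, b) = (if a = 0 then g b else 0)"
  unfolding conv_in_v by (subst hsum_single[of 0]) (auto simp: ser_one_def zero_prod_def)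

lemma hc4_nth_0: "hc4 $ 0 = 0" by (simp add: hc4_def hb_def)
lemma Bh_nth_0: "Bh n i j $ 0 = 0" by (simp add: Bh_def hb_def)

lemma recip_props:
  fixes s :: int
  assumes "s \<in> {1, -1}" "recip = (if s = 1 then recip_uinf else recip_u0)" "w $ 0 = 0"
  shows "lin x y z \<star> recip w \<star> in_v g = lin_op (x - y + z) (recip w \<star> in_v g)"
    and "lin_op w (recip w \<star> in_v g) = ser_one \<star> in_v g"
    and "- s = 1 \<and> a < 0 \<or> - s = -1 \<and> 0 \<le> a \<Longrightarrow> (recip w \<star> in_v g) (a, b) = 0"
proof -
  have conv_fin: "conv_fin (recip w) (in_v g)" using assms recip_conv_conv_fin recip_u0_conv_conv_fin by auto
  show "lin x y z \<star> recip w \<star> in_v g = lin_op (x - y + z) (recip w \<star> in_v g)" unfolding lin_mult by (rule lin_op_conv[OF conv_fin])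
  show "lin_op w (recip w \<star> in_v g) = ser_one \<star> in_v g"
    unfolding lin_op_conv[OF conv_fin, symmetric] using assms(1,2) by (auto simp: lin_op_recip_uinf lin_op_recip_u0)
  show "(recip w \<star> in_v g) (a, b) = 0" if c: "- s = 1 \<and> a < 0 \<or> - s = -1 \<and> 0 \<le> a"
  proof -
    consider "s = 1" "0 \<le> a" | "s = -1" "a < 0" using assms(1) c by force
    then show ?thesis by cases (simp_all add: conv_in_v assms(2) recip_uinf_def recip_u0_def)
  qed
qed

section \<open>Relators without delta functions\<close>

context
  fixes n i j :: nat assumes n: "3 \<le> n" and i: "i \<in> {1..n}" and j: "j \<in> {1..n}"
begin

lemma free_act_HH_same_0: assumes "s \<in> {1, -1}"
  shows "free_act n ((in_u (Hser s i) \<star> in_v (Hser s j) - in_v (Hser s j) \<star> in_u (Hser s i)) e) v = 0"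
proof -
  note H = free_act_H[OF i assms] free_act_H[OF j assms]
  have "comp_uv (H_op s n i) (H_op s n j) v = comp_vu (H_op s n i) (H_op s n j) v"
    using Hp_Hp_relabel[OF n i j] Hm_Hm_relabel[OF n i j] by (simp add: H_op_def)
  then show ?thesis
    unfolding fun_diff_def free_act_diff fun_cong[OF free_act_uv[of n "Hser s i" _ "Hser s j", OF H]] fun_cong[OF free_act_vu[of n "Hser s i" _ "Hser s j", OF H]] by simp
qed

lemma free_act_HH_mixed_0: assumes s: "s \<in> {1, -1}" and q: "q = of_int s * hc4" and b: "b = Bh n i j"
  shows "free_act n ((lin q (- q) (- b) \<star> lin (- q) q b \<star> in_u (Hser s i) \<star> in_v (Hser (- s) j)
      - lin q (- q) b \<star> lin (- q) q (- b) \<star> in_v (Hser (- s) j) \<star> in_u (Hser s i)) e) v = 0"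
proof -
  have s': "- s \<in> {1, -1}" using s by auto
  note H = free_act_H[OF i s] free_act_H[OF j s']
  note Q = acts_scalar_sgn[OF s, of n, folded q] and B = acts_scalar_Bh[of n i j, folded b]
  have A: "acts_scalar n (q - - q + - b) (of_int s / 4 - - (of_int s / 4) + - Bform n i j)"
    "acts_scalar n (- q - q + b) (- (of_int s / 4) - of_int s / 4 + Bform n i j)"
    "acts_scalar n (q - - q + b) (of_int s / 4 - - (of_int s / 4) + Bform n i j)"
    "acts_scalar n (- q - q + - b) (- (of_int s / 4) - of_int s / 4 + - Bform n i j)"
    by (intro acts_scalar_add acts_scalar_diff acts_scalar_uminus Q B)+
  have "diff_uv (of_int s / 4 - - (of_int s / 4) + - Bform n i j) (diff_uv (- (of_int s / 4) - of_int s / 4 + Bform n i j) (comp_uv (H_op s n i) (H_op (- s) n j) v))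
    = diff_uv (of_int s / 4 - - (of_int s / 4) + Bform n i j) (diff_uv (- (of_int s / 4) - of_int s / 4 + - Bform n i j) (comp_vu (H_op s n i) (H_op (- s) n j) v))"
    using s Hp_Hm_relabel[OF n i j] Hm_Hp_relabel[OF n i j] by (auto simp: H_op_def add.commute minus_diff_commute)
  then show ?thesis
    unfolding lin_lin_uv lin_lin_vu fun_diff_def free_act_diff
      fun_cong[OF free_act_lin_op[OF A(1)]] free_act_lin_op[OF A(2)] fun_cong[OF free_act_lin_op[OF A(3)]] free_act_lin_op[OF A(4)]
      free_act_uv[of n "Hser s i" _ "Hser (- s) j", OF H] free_act_vu[of n "Hser s i" _ "Hser (- s) j", OF H] by simp
qed

lemma free_act_EE_0: assumes b: "b = Bh n i j"
  shows "free_act n ((lin 0 0 b \<star> in_u (Eser i) \<star> in_v (Eser j) - lin 0 0 (- b) \<star> in_v (Eser j) \<star> in_u (Eser i)) e) v = 0"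
proof -
  note H = free_act_E[OF i] free_act_E[OF j]
  note B = acts_scalar_Bh[of n i j, folded b] acts_scalar_uminus[OF acts_scalar_Bh[of n i j, folded b]]
  show ?thesis
    unfolding lin_uv lin_vu fun_diff_def free_act_diff diff_0_right add_0_left fun_cong[OF free_act_lin_op[OF B(1)]] fun_cong[OF free_act_lin_op[OF B(2)]]
      free_act_uv[of n "Eser i" _ "Eser j", OF H] free_act_vu[of n "Eser i" _ "Eser j", OF H] EE_relabel[OF n i j] by simp
qed

lemma free_act_FF_0: assumes b: "b = Bh n i j"
  shows "free_act n ((lin 0 0 (- b) \<star> in_u (Fser i) \<star> in_v (Fser j) - lin 0 0 b \<star> in_v (Fser j) \<star> in_u (Fser i)) e) v = 0"
proof -
  note H = free_act_F[OF i] free_act_F[OF j]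
  note B = acts_scalar_Bh[of n i j, folded b] acts_scalar_uminus[OF acts_scalar_Bh[of n i j, folded b]]
  show ?thesis
    unfolding lin_uv lin_vu fun_diff_def free_act_diff diff_0_right add_0_left fun_cong[OF free_act_lin_op[OF B(1)]] fun_cong[OF free_act_lin_op[OF B(2)]]
      free_act_uv[of n "Fser i" _ "Fser j", OF H] free_act_vu[of n "Fser i" _ "Fser j", OF H] FF_relabel[OF n i j] by simp
qed

lemma free_act_HE_0:
  assumes s: "s \<in> {1, -1}" and q: "q = of_int s * hc4" and b: "b = Bh n i j" and rc: "recip = (if s = 1 then recip_uinf else recip_u0)"
  shows "free_act n ((in_u (ser_inv (Hser s i)) \<star> in_v (Eser j) \<star> in_u (Hser s i) - lin (- q) 0 b \<star> recip (- q - b) \<star> in_v (Eser j)) e) v = 0"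
proof -
  \<comment> \<open>H^+ is a series in u^(-1) and H^- one in u, so the direction of
    \<open>side_ser\<close> is -s.\<close>
  have t: "- s = 1 \<or> - s = -1" using s by auto
  obtain F where F: "Hser s i = side_ser (- s) F" "\<And>m. F $ m $ 0 = (if m = 0 then 1 else 0)" using Hser_side_ser[OF s] by blast
  obtain J where J: "ser_inv (side_ser (- s) F) = side_ser (- s) J" "F * J = 1" "J * F = 1" using ser_inv_side_ser[OF t F(2)] by blast
  note Q = acts_scalar_sgn[OF s, of n, folded q] and B = acts_scalar_Bh[of n i j, folded b]
  have w0: "(- q - b) $ 0 = 0" using s by (auto simp: q b hc4_nth_0 Bh_nth_0)
  note R = recip_props[OF s rc w0]
  let ?c1 = "- (of_int s / 4) - Bform n i j" and ?c2 = "- (of_int s / 4) - 0 + Bform n i j"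
  have A: "acts_scalar n (- q - b) ?c1" "acts_scalar n (- q - 0 + b) ?c2" by (intro acts_scalar_add acts_scalar_diff acts_scalar_uminus acts_scalar_0 Q B)+
  define R0 where "R0 = (\<lambda>e. free_act n ((recip (- q - b) \<star> in_v (Eser j)) e) v)"
  have HE: "(\<lambda>a. free_act n (side_ser (- s) F a)) = H_op s n i" "(\<lambda>b. free_act n (Eser j b)) = E_op n j"
    by (auto simp: fun_eq_iff free_act_E[OF j] free_act_H[OF i s] simp flip: F(1))
  have r: "diff_uv ?c1 (comp_vu (H_op s n i) (E_op n j) v) = diff_uv ?c2 (comp_uv (H_op s n i) (E_op n j) v)"
    using s Hp_E_relabel[OF n i j] Hm_E_relabel[OF n i j] by (auto simp: H_op_def add.commute)
  have W: "(\<lambda>e. free_act n ((in_u (side_ser (- s) J) \<star> in_v (Eser j) \<star> in_u (side_ser (- s) F)) e) v) = diff_uv ?c2 R0"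
    unfolding free_act_conj1[OF t]
  proof (rule conjugation[OF t fin_conj1[OF t] _ conj_sum1_inverse[OF t J(3)] _ _ conj_sum1_neg[OF t]])
    show "diff_uv ?c1 (\<lambda>e. free_act n (J $ k) (comp_vu (\<lambda>a. free_act n (side_ser (- s) F a)) (\<lambda>b. free_act n (Eser j b)) v e))
      = diff_uv ?c2 (\<lambda>e. free_act n (J $ k) (comp_uv (\<lambda>a. free_act n (side_ser (- s) F a)) (\<lambda>b. free_act n (Eser j b)) v e))" for k
      unfolding HE A_linear_diff_uv_in[OF A_linear_Phi2] r ..
    show "diff_uv ?c1 R0 (a, b) = (if a = 0 then free_act n (Eser j b) v else 0)" for a b
      unfolding R0_def free_act_lin_op[OF A(1), symmetric] R(2) by (simp add: ser_one_in_v free_act_0)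
    show "R0 (a, b) = 0" if "- s = 1 \<and> a < 0 \<or> - s = -1 \<and> 0 \<le> a" for a b
      unfolding R0_def R(3)[OF that] by (rule free_act_0)
  qed
  then show ?thesis
    unfolding fun_diff_def free_act_diff F(1) J(1) R(1) fun_cong[OF free_act_lin_op[OF A(2)]] R0_def[symmetric] using fun_cong[OF W, of e] by simp
qed

lemma free_act_HF_0:
  assumes s: "s \<in> {1, -1}" and q: "q = of_int s * hc4" and b: "b = Bh n i j" and rc: "recip = (if s = 1 then recip_uinf else recip_u0)"
  shows "free_act n ((in_u (Hser s i) \<star> in_v (Fser j) \<star> in_u (ser_inv (Hser s i)) - lin q 0 b \<star> recip (q - b) \<star> in_v (Fser j)) e) v = 0"
proof -
  have t: "- s = 1 \<or> - s = -1" using s by auto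
  obtain F where F: "Hser s i = side_ser (- s) F" "\<And>m. F $ m $ 0 = (if m = 0 then 1 else 0)" using Hser_side_ser[OF s] by blast
  obtain J where J: "ser_inv (side_ser (- s) F) = side_ser (- s) J" "F * J = 1" "J * F = 1" using ser_inv_side_ser[OF t F(2)] by blast
  note Q = acts_scalar_sgn[OF s, of n, folded q] and B = acts_scalar_Bh[of n i j, folded b]
  have w0: "(q - b) $ 0 = 0" using s by (auto simp: q b hc4_nth_0 Bh_nth_0)
  note R = recip_props[OF s rc w0]
  let ?c1 = "of_int s / 4 - Bform n i j" and ?c2 = "of_int s / 4 - 0 + Bform n i j"
  have A: "acts_scalar n (q - b) ?c1" "acts_scalar n (q - 0 + b) ?c2" by (intro acts_scalar_add acts_scalar_diff acts_scalar_0 Q B)+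
  define R0 where "R0 = (\<lambda>e. free_act n ((recip (q - b) \<star> in_v (Fser j)) e) v)"
  have HE: "(\<lambda>a. free_act n (side_ser (- s) F a)) = H_op s n i" "(\<lambda>b. free_act n (Fser j b)) = F_op n j"
    by (auto simp: fun_eq_iff free_act_F[OF j] free_act_H[OF i s] simp flip: F(1))
  have r: "diff_uv ?c1 (comp_uv (H_op s n i) (F_op n j) x) = diff_uv ?c2 (comp_vu (H_op s n i) (F_op n j) x)" for x
    using s Hp_F_relabel[OF n i j] Hm_F_relabel[OF n i j] by (auto simp: H_op_def add.commute)
  have W: "(\<lambda>e. free_act n ((in_u (side_ser (- s) F) \<star> in_v (Fser j) \<star> in_u (side_ser (- s) J)) e) v) = diff_uv ?c2 R0"
    unfolding free_act_conj2[OF t]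
  proof (rule conjugation[OF t fin_conj2[OF t] _ conj_sum2_inverse[OF t J(2)] _ _ conj_sum2_neg[OF t]])
    show "diff_uv ?c1 (comp_uv (\<lambda>a. free_act n (side_ser (- s) F a)) (\<lambda>b. free_act n (Fser j b)) (free_act n (J $ k) v))
      = diff_uv ?c2 (comp_vu (\<lambda>a. free_act n (side_ser (- s) F a)) (\<lambda>b. free_act n (Fser j b)) (free_act n (J $ k) v))" for k
      unfolding HE r ..
    show "diff_uv ?c1 R0 (a, b) = (if a = 0 then free_act n (Fser j b) v else 0)" for a b
      unfolding R0_def free_act_lin_op[OF A(1), symmetric] R(2) by (simp add: ser_one_in_v free_act_0)
    show "R0 (a, b) = 0" if "- s = 1 \<and> a < 0 \<or> - s = -1 \<and> 0 \<le> a" for a b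
      unfolding R0_def R(3)[OF that] by (rule free_act_0)
  qed
  then show ?thesis
    unfolding fun_diff_def free_act_diff F(1) J(1) R(1) fun_cong[OF free_act_lin_op[OF A(2)]] R0_def[symmetric] using fun_cong[OF W, of e] by simp
qed

text \<open>The diagram is simply laced, so m is 1 or 2. For m = 1 the relation is commutation; for
  m = 2 the two permutations of the double commutator add up to the six terms of
  \<open>adj\<close>.\<close>

lemma free_act_serre_gen_0:
  assumes X: "\<And>m v. free_act n (X i m) v = A m v" "\<And>m v. free_act n (X j m) v = B m v" and ij: "i \<noteq> j"
    and far: "i \<notin> nbrs n j \<Longrightarrow> comp_uv A B v = comp_vu A B v"
    and adj: "\<And>a1 a2 b x. i \<in> nbrs n j \<Longrightarrow> A a1 (A a2 (B b x)) + A a2 (A a1 (B b x)) - 2 * A a1 (B b (A a2 x)) - 2 * A a2 (B b (A a1 x)) + B b (A a1 (A a2 x)) + B b (A a2 (A a1 x)) = 0"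
  shows "free_act n (serre X (nat (1 - cartan n i j)) i j r t) v = 0"
proof -
  note ipa = ip_alpha_alpha[OF n i j] ip_alpha_alpha[OF n i i]
  show ?thesis
  proof (cases "i \<in> nbrs n j")
    case True
    have m: "nat (1 - cartan n i j) = 2" using ij True by (simp add: cartan_def ipa)
    have "{1..2::nat} = {1, 2}" by auto
    then have p: "{\<sigma>. \<sigma> permutes {1..2::nat}} = {id, Transposition.transpose 1 2}" by (auto simp: permutes_doubleton_iff)
    have ne: "id \<noteq> Transposition.transpose (1::nat) 2" by (metis id_apply transpose_apply_first one_eq_numeral_iff semiring_norm(85))
    have l: "[1..<Suc 2] = [1, 2]" by (simp add: upt_rec)
    show ?thesis
      unfolding m serre_def p l using ne adj[OF True, of "r 1" "r 2" t v]
      by (simp add: free_act_add free_act_commutator X A_linear_diff[OF A_linear_Phi2, of n "X i _", unfolded X] A_linear_diff[OF A_linear_Phi2, of n "X j _", unfolded X] free_act_diff algebra_simps)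
  next
    case False
    have m: "nat (1 - cartan n i j) = 1" using ij False by (simp add: cartan_def ipa)
    have "comp_uv A B v (r 1, t) = comp_vu A B v (r 1, t)" using far[OF False] by simp
    then show ?thesis unfolding m by (simp add: serre_def permutes_sing upt_rec free_act_commutator X comp_uv_def comp_vu_def)
  qed
qed

lemma free_act_serre_E_0: assumes "i \<noteq> j" shows "free_act n (serre Eser (nat (1 - cartan n i j)) i j r t) v = 0"
proof (rule free_act_serre_gen_0[where A = "E_op n i" and B = "E_op n j"])
  have i0: "i \<noteq> 0" "j \<noteq> 0" using i j by auto
  note o = op_eqs(1)[OF i0(1), of n] op_eqs(1)[OF i0(2), of n]
  fix a1 a2 b x assume adj: "i \<in> nbrs n j"
  show "E_op n i a1 (E_op n i a2 (E_op n j b x)) + E_op n i a2 (E_op n i a1 (E_op n j b x)) - 2 * E_op n i a1 (E_op n j b (E_op n i a2 x)) - 2 * E_op n i a2 (E_op n j b (E_op n i a1 x))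
    + E_op n j b (E_op n i a1 (E_op n i a2 x)) + E_op n j b (E_op n i a2 (E_op n i a1 x)) = 0"
  proof (rule serre_exchange[where h = 1 and M = "normal_ord (field_E n i) (field_E n i)"])
    show "comp_uv (E_op n i) (E_op n i) x = diff_uv 0 (diff_uv (- 1) (normal_ord (field_E n i) (field_E n i) x))" "comp_vu (E_op n i) (E_op n i) x = diff_uv 0 (diff_uv 1 (normal_ord (field_E n i) (field_E n i) x))" for x
      using EE_same[OF n i i refl, of x] by simp_all
    show "diff_uv (- (1 / 2)) (comp_uv (E_op n i) (E_op n j) x) = diff_uv (1 / 2) (comp_vu (E_op n i) (E_op n j) x)" for x
      using EE_adj[OF n i j assms adj, of x] by simp
  qed (simp_all add: o A_linear_field_op A_linear_normal_ord bounded_deg_field_op bounded_deg_normal_ord)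
qed (use assms i j EE_far[OF n i j] in \<open>simp_all add: free_act_E\<close>)

lemma free_act_serre_F_0: assumes "i \<noteq> j" shows "free_act n (serre Fser (nat (1 - cartan n i j)) i j r t) v = 0"
proof (rule free_act_serre_gen_0[where A = "F_op n i" and B = "F_op n j"])
  have i0: "i \<noteq> 0" "j \<noteq> 0" using i j by auto
  note o = op_eqs(2)[OF i0(1), of n] op_eqs(2)[OF i0(2), of n]
  fix a1 a2 b x assume adj: "i \<in> nbrs n j"
  show "F_op n i a1 (F_op n i a2 (F_op n j b x)) + F_op n i a2 (F_op n i a1 (F_op n j b x)) - 2 * F_op n i a1 (F_op n j b (F_op n i a2 x)) - 2 * F_op n i a2 (F_op n j b (F_op n i a1 x))
    + F_op n j b (F_op n i a1 (F_op n i a2 x)) + F_op n j b (F_op n i a2 (F_op n i a1 x)) = 0"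
  \<comment> \<open>The exchange relations of F are those of E with the sign of hbar reversed, so
    the same identity is used with h = -1.\<close>
  proof (rule serre_exchange[where h = "-1" and M = "normal_ord (field_F n i) (field_F n i)"])
    show "comp_uv (F_op n i) (F_op n i) x = diff_uv 0 (diff_uv (- (- 1)) (normal_ord (field_F n i) (field_F n i) x))" "comp_vu (F_op n i) (F_op n i) x = diff_uv 0 (diff_uv (- 1) (normal_ord (field_F n i) (field_F n i) x))" for x
      using FF_same[OF n i i refl, of x] by simp_all
    show "diff_uv (- (- 1 / 2)) (comp_uv (F_op n i) (F_op n j) x) = diff_uv (- 1 / 2) (comp_vu (F_op n i) (F_op n j) x)" for x
      using FF_adj[OF n i j assms adj, of x] by simp
  qed (simp_all add: o A_linear_field_op A_linear_normal_ord bounded_deg_field_op bounded_deg_normal_ord)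
qed (use assms i j FF_far[OF n i j] in \<open>simp_all add: free_act_F\<close>)

lemma free_act_EF_diff_0: assumes "i \<noteq> j"
  shows "free_act n ((in_u (Eser i) \<star> in_v (Fser j) - in_v (Fser j) \<star> in_u (Eser i)) e) v = 0"
  unfolding fun_diff_def free_act_diff fun_cong[OF free_act_uv[of n "Eser i" _ "Fser j", OF free_act_E[OF i] free_act_F[OF j]]] fun_cong[OF free_act_vu[of n "Eser i" _ "Fser j", OF free_act_E[OF i] free_act_F[OF j]]]
    EF_diff[OF n i j assms] by simp

end

section \<open>The delta-function relation between E and F\<close>

lemma fps_X_cancel: "fps_X * x = fps_X * y \<Longrightarrow> x = y" for x y :: "'a::ring_1 fps"
proof (rule fps_ext)
  fix p assume "fps_X * x = fps_X * y"
  then have "(fps_X * x) $ Suc p = (fps_X * y) $ Suc p" by simp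
  then show "x $ p = y $ p" by (simp add: fps_X_mult_nth)
qed

lemma hsum_nth_0_single: assumes "\<And>i. i \<noteq> j \<Longrightarrow> f i $ 0 = 0" shows "hsum f $ 0 = f j $ 0"
  using hsum_nth_finite[of "{j}" f 0] assms by simp

lemma pw_0_nth_0: assumes "s $ 0 = 0" shows "pw s k m $ 0 = (if k = m then 1 else 0)"
  using pw_nth_0[OF assms, of 0 k m] by (cases "m \<le> k"; cases "k = m") (simp_all add: pw_def)

lemma delta_00: assumes "x $ 0 = 0" "y $ 0 = 0" shows "delta x y (a, b) $ 0 = (if a + b + 1 = 0 then 1 else 0)"
proof -
  have "delta x y (a, b) $ 0 = (pw x (- b - 1) a * pw y b b) $ 0"
    unfolding delta_def prod.case by (rule hsum_nth_0_single) (simp add: pw_0_nth_0 assms)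
  then show ?thesis by (auto simp: pw_0_nth_0 assms)
qed

lemma ser_shift_0: assumes "s $ 0 = 0" "\<And>m. f m $ 0 = (if m = 0 then 1 else 0)" shows "ser_shift s f b $ 0 = (if b = 0 then 1 else 0)"
proof -
  have "ser_shift s f b $ 0 = (f b * pw s b b) $ 0"
    unfolding ser_shift_def by (rule hsum_nth_0_single) (simp add: pw_0_nth_0 assms)
  then show ?thesis by (simp add: pw_0_nth_0 assms)
qed

text \<open>At order p the delta function lives in the strip -1 - p \<le> a + b \<le> -1, so for one
  fixed exponent finitely many values of the other contribute.\<close>

lemma delta_conv_conv_fin: assumes "x $ 0 = 0" "y $ 0 = 0" shows "conv_fin (delta x y) (in_v g)" "conv_fin (delta x y) (in_u g)"
proof -
  have z: "(delta x y (a, b) * w) $ p = 0" if "a + b + 1 > 0 \<or> int p < - (a + b + 1)" for a b w p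
    by (rule fps_mult_nth_0(2)) (use that in \<open>auto intro!: delta_nth_0[OF assms]\<close>)
  show "conv_fin (delta x y) (in_v g)"
  proof (intro conv_fin_in_v hsummable_bounded)
    fix a b p show "\<exists>A. finite A \<and> (\<forall>j. j \<notin> A \<longrightarrow> (delta x y (a, j) * g (b - j)) $ p = 0)"
      by (rule exI[of _ "{- a - 1 - int p..- a - 1}"]) (auto intro!: z)
  qed
  show "conv_fin (delta x y) (in_u g)"
  proof (intro conv_fin_in_u hsummable_bounded)
    fix a b p show "\<exists>A. finite A \<and> (\<forall>j. j \<notin> A \<longrightarrow> (delta x y (j, b) * g (a - j)) $ p = 0)"
      by (rule exI[of _ "{- b - 1 - int p..- b - 1}"]) (auto intro!: z)
  qed
qed

lemma delta_conv_row: "(delta x y \<star> in_v g) (-1, b) = g b"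
  unfolding conv_in_v delta_row by (subst hsum_single[of 0]) auto
lemma delta_conv_col: "(delta x y \<star> in_u g) (a, -1) = g a"
  unfolding conv_in_u delta_col by (subst hsum_single[of 0]) auto

lemma delta_conv_00: assumes "x $ 0 = 0" "y $ 0 = 0" "\<And>m. g m $ 0 = (if m = 0 then 1 else 0)"
  shows "(delta x y \<star> in_v g) (a, b) $ 0 = (if a + b + 1 = 0 then 1 else 0)" "(delta x y \<star> in_u g) (a, b) $ 0 = (if a + b + 1 = 0 then 1 else 0)"
proof -
  have "hsum (\<lambda>j. delta x y (a, j) * g (b - j)) $ 0 = (delta x y (a, b) * g (b - b)) $ 0"
    by (rule hsum_nth_0_single) (simp add: assms)
  then show "(delta x y \<star> in_v g) (a, b) $ 0 = (if a + b + 1 = 0 then 1 else 0)" by (simp add: conv_in_v delta_00 assms)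
  have "hsum (\<lambda>j. delta x y (j, b) * g (a - j)) $ 0 = (delta x y (a, b) * g (a - a)) $ 0"
    by (rule hsum_nth_0_single) (simp add: assms)
  then show "(delta x y \<star> in_u g) (a, b) $ 0 = (if a + b + 1 = 0 then 1 else 0)" by (simp add: conv_in_u delta_00 assms)
qed

lemma hsummable_ser_shift: assumes "s $ 0 = 0" "\<And>m. t * m < 0 \<Longrightarrow> f m = 0" shows "hsummable (\<lambda>m. f m * pw s m b)"
proof (rule hsummable_bounded)
  fix p
  have "(f m * pw s m b) $ p = 0" if c: "m \<notin> {b..b + int p}" for m
  proof (rule fps_mult_nth_0(1))
    fix q assume "q \<le> p"
    with c consider "\<not> b \<le> m" | "int q < m - b" by fastforce
    then show "pw s m b $ q = 0" by cases (simp_all add: pw_nth_0[OF assms(1)], simp add: pw_def)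
  qed
  then show "\<exists>A. finite A \<and> (\<forall>i. i \<notin> A \<longrightarrow> (f i * pw s i b) $ p = 0)" by (intro exI[of _ "{b..b + int p}"]) auto
qed

lemma free_act_ser_shift:
  assumes "i \<in> {1..n}" "s \<in> {1, -1}"
  shows "free_act n (ser_shift hc4 (Hser s i) b) v = hsum (\<lambda>m. scl (pw (hb (1/4)) m b) * H_op s n i m v)"
  unfolding ser_shift_def
  by (subst A_linear_hsum[OF A_linear_free_act hsummable_ser_shift[of _ 0]])
    (simp_all add: hc4_nth_0 free_act_mult free_act_pw[OF acts_scalar_hc4] free_act_H[OF assms] A_linear_scl[OF A_linear_Phi2] flip: free_act_H[OF assms])

context
  fixes n i :: nat assumes n: "3 \<le> n" and i: "i \<in> {1..n}"
begin

lemma free_act_ser_shift_Hm: "free_act n (ser_shift hc4 (Hser (-1) i) b) v = v * to_ser (subst_v (v_plus (1/4)) (cre_H n i)) b"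
proof -
  have z: "scl (pw (hb (1/4)) m b) * H_op (-1) n i m v = 0" if "m < 0 \<or> b < 0" for m
    using that pw_nonneg_eq_0[of m b "hb (1/4)"] by (cases "m < 0") (simp_all add: H_op_def Hm_op_neg)
  show ?thesis
  proof (cases "0 \<le> b")
    case True
    have "hsum (\<lambda>m. scl (pw (hb (1/4)) m b) * H_op (-1) n i m v) = hsum (\<lambda>k. scl (pw (hb (1/4)) (int k) b) * H_op (-1) n i (int k) v)"
      using hsum_int_nat[of 1 "\<lambda>m. scl (pw (hb (1/4)) m b) * H_op (-1) n i m v"] z by simp
    also have "\<dots> = hsum (\<lambda>k. v * (cre_H n i $ k * (v_plus (1/4) ^ k) $ nat b))"
      using True by (simp add: H_op_def Hm_op_mult to_ser_def v_plus_power mult_ac)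
    also have "\<dots> = v * to_ser (subst_v (v_plus (1/4)) (cre_H n i)) b"
      using True by (simp add: to_ser_def subst_v_def hsum_local_add[OF local_add_mult_left hsummable_subst_v[OF in_filt_v_plus]])
    finally show ?thesis using i by (simp add: free_act_ser_shift)
  next
    case False
    then show ?thesis using i z by (simp add: free_act_ser_shift to_ser_def)
  qed
qed

lemma free_act_ser_shift_Hp: "free_act n (ser_shift hc4 (Hser 1 i) a) v = ser_coeff (hom_H_shift n i v) a"
  using i by (simp add: free_act_ser_shift H_op_def Hp_op_ser_coeff ser_coeff_shift_u flip: shift_u_hom_H)

text \<open>
  Both delta terms are determined by a single row or column, being annihilated by a linear factor; the
  commutator multiplied by \<open>u - v \<plusminus> \<hbar>/2\<close> satisfies the same conditions, and the
  difference of the two factors is \<open>\<hbar>\<close>.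
\<close>

lemma EF_key:
  "free_act n ((delta (- hc4) hc4 \<star> in_v (ser_shift hc4 (Hser (-1) i)) - delta hc4 (- hc4) \<star> in_u (ser_shift hc4 (Hser 1 i))) e) v
    = fps_X * (comp_uv (E_op n i) (F_op n i) v e - comp_vu (E_op n i) (F_op n i) v e)"
proof -
  define D1 where "D1 = delta (- hc4) hc4 \<star> in_v (ser_shift hc4 (Hser (-1) i))"
  define D2 where "D2 = delta hc4 (- hc4) \<star> in_u (ser_shift hc4 (Hser 1 i))"
  let ?u = "comp_uv (E_op n i) (F_op n i) v" and ?v = "comp_vu (E_op n i) (F_op n i) v"
  let ?w = "\<lambda>e. ?u e - ?v e"
  have S: "acts_scalar n (- hc4 - hc4) (- 1/4 - 1/4)" "acts_scalar n (hc4 - - hc4) (1/4 - - (1/4))"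
    using acts_scalar_diff[OF acts_scalar_uminus[OF acts_scalar_hc4] acts_scalar_hc4, of n] acts_scalar_diff[OF acts_scalar_hc4 acts_scalar_uminus[OF acts_scalar_hc4], of n] by simp_all
  have L1: "lin_op (- hc4 - hc4) D1 = (\<lambda>_. 0)" unfolding D1_def
    by (subst lin_op_conv[symmetric]) (simp_all add: delta_conv_conv_fin hc4_nth_0 lin_op_delta, simp add: ser_mult_def fun_eq_iff)
  have conv_fin: "conv_fin (delta hc4 (- hc4)) (in_u (ser_shift hc4 (Hser 1 i)))" by (rule delta_conv_conv_fin) (simp_all add: hc4_nth_0)
  have diff_uv: "lin_op (hc4 - - hc4) D2 = (\<lambda>_. 0)"
    unfolding D2_def lin_op_conv[OF conv_fin, symmetric] by (subst lin_op_delta) (simp_all add: ser_mult_def fun_eq_iff)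
  have 1: "(\<lambda>e. free_act n (D1 e) v) = diff_uv (1/2) ?w"
  proof (rule diff_uv_eq_row[where c = "-1/2" and ?a0.0 = "-1"])
    show "diff_uv (-1/2) (\<lambda>e. free_act n (D1 e) v) = diff_uv (-1/2) (diff_uv (1/2) ?w)"
      using free_act_lin_op[OF S(1), of D1 v] EF_same[OF n i i refl, of v] by (simp add: L1 free_act_0 diff_uv_diff fun_eq_iff)
    show "free_act n (D1 (-1, b)) v = diff_uv (1/2) ?w (-1, b)" for b
      unfolding diff_op_diff EF_res_u[OF n i] by (simp add: D1_def delta_conv_row free_act_ser_shift_Hm)
  qed
  have 2: "(\<lambda>e. free_act n (D2 e) v) = diff_uv (-1/2) ?w"
  proof (rule diff_uv_eq_col[where c = "1/2" and ?b0.0 = "-1"])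
    have "diff_uv (1/2) (\<lambda>e. free_act n (D2 e) v) = (\<lambda>_. 0)" using free_act_lin_op[OF S(2), of D2 v] unfolding diff_uv free_act_0 by simp
    moreover have "diff_uv (1/2) (diff_uv (-1/2) ?w) = (\<lambda>_. 0)"
      unfolding diff_op_commute[of _ _ "1/2"] diff_uv_diff EF_same[OF n i i refl] by simp
    ultimately show "diff_uv (1/2) (\<lambda>e. free_act n (D2 e) v) = diff_uv (1/2) (diff_uv (-1/2) ?w)" by simp
    show "free_act n (D2 (a, -1)) v = diff_uv (-1/2) ?w (a, -1)" for a
      unfolding diff_op_diff EF_res_v[OF n i] by (simp add: D2_def delta_conv_col free_act_ser_shift_Hp)
  qed
  have "diff_uv (1/2) ?w e - diff_uv (-1/2) ?w e = scl (hb (1/2 - -1/2)) * ?w e"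
    by (simp only: diff_op_def hb_diff scl_diff left_diff_distrib) simp
  then have 3: "diff_uv (1/2) ?w e - diff_uv (-1/2) ?w e = fps_X * ?w e" by (simp add: hb_def scl_X)
  show ?thesis unfolding D1_def[symmetric] D2_def[symmetric] fun_diff_def free_act_diff using fun_cong[OF 1, of e] fun_cong[OF 2, of e] 3 by simp
qed

lemma free_act_EF_same_0:
  "free_act n ((in_u (Eser i) \<star> in_v (Fser i) - in_v (Fser i) \<star> in_u (Eser i)) e
     - fps_shift 1 ((delta (- hc4) hc4 \<star> in_v (ser_shift hc4 (Hser (-1) i)) - delta hc4 (- hc4) \<star> in_u (ser_shift hc4 (Hser 1 i))) e)) v = 0"
proof -
  let ?D = "(delta (- hc4) hc4 \<star> in_v (ser_shift hc4 (Hser (-1) i)) - delta hc4 (- hc4) \<star> in_u (ser_shift hc4 (Hser 1 i))) e"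
  have H0: "Hser s i m $ 0 = (if m = 0 then 1 else 0)" for s m by (simp add: Hser_def ser_one_def)
  \<comment> \<open>At hbar = 0 the series H^+ and H^- are 1 and both terms reduce to the same delta
    function; this makes the division by hbar exact.\<close>
  have "?D $ 0 = 0" by (cases e) (simp add: delta_conv_00 ser_shift_0 H0 hc4_nth_0)
  then have "?D = fps_X * fps_shift 1 ?D" by (rule fps_X_mult_shift[symmetric])
  then have "fps_X * free_act n (fps_shift 1 ?D) v = fps_X * (comp_uv (E_op n i) (F_op n i) v e - comp_vu (E_op n i) (F_op n i) v e)"
    unfolding EF_key[symmetric] free_act_X[symmetric] by simp
  then have "free_act n (fps_shift 1 ?D) v = comp_uv (E_op n i) (F_op n i) v e - comp_vu (E_op n i) (F_op n i) v e"
    by (rule fps_X_cancel)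
  then show ?thesis
    unfolding free_act_diff fun_diff_def fun_cong[OF free_act_uv[of n "Eser i" _ "Fser i", OF free_act_E[OF i] free_act_F[OF i]]] fun_cong[OF free_act_vu[of n "Eser i" _ "Fser i", OF free_act_E[OF i] free_act_F[OF i]]]
    by simp
qed

end

theorem free_act_relators:
  assumes "3 \<le> n" "x \<in> relators n" shows "free_act n x v = 0"
  using assms(2)
proof cases
  case (central g) then show ?thesis by (simp add: free_act_central_0)
next
  case (HH_same i j s e) then show ?thesis using free_act_HH_same_0 assms(1) by blast
next
  case (HH_mixed i j s q b e) then show ?thesis using free_act_HH_mixed_0 assms(1) by blast
next
  case (HE i j s q b recip e) then show ?thesis using free_act_HE_0 assms(1) by blast
next
  case (HF i j s q b recip e) then show ?thesis using free_act_HF_0 assms(1) by blast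
next
  case (EE i j b e) then show ?thesis using free_act_EE_0 assms(1) by blast
next
  case (FF i j b e) then show ?thesis using free_act_FF_0 assms(1) by blast
next
  case (serre_E i j r t) then show ?thesis using free_act_serre_E_0 assms(1) by blast
next
  case (serre_F i j r t) then show ?thesis using free_act_serre_F_0 assms(1) by blast
next
  case (EF i j e)
  then show ?thesis using free_act_EF_diff_0[OF assms(1), of i j] free_act_EF_same_0[OF assms(1), of i] by (cases "i = j") auto
qed

section \<open>The module structure\<close>

definition fock_keys :: "nat \<Rightarrow> key set" where
  "fock_keys n = {(\<mu>, \<beta>). Poly_Mapping.keys \<mu> \<subseteq> {1..n} \<times> {1..} \<and> \<beta> \<in> root_lattice n}"

lemma Fock_iff: "x \<in> Fock n \<longleftrightarrow> supp_in (fock_keys n) x"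
  by (simp only: Fock_def supp_in_def fock_keys_def subset_iff mem_Collect_eq Ball_def)

section \<open>Stability of the Fock space under the operators\<close>

lemma root_lattice_0: "0 \<in> root_lattice n"
  unfolding root_lattice_def by (auto intro!: exI[of _ "\<lambda>_. 0"])
lemma root_lattice_add: assumes "\<beta> \<in> root_lattice n" "\<gamma> \<in> root_lattice n" shows "\<beta> + \<gamma> \<in> root_lattice n"
proof -
  obtain c d where "\<forall>l. Poly_Mapping.lookup \<beta> l = (\<Sum>i\<in>{1..n}. c i * Poly_Mapping.lookup (alpha n i) l)"
    "\<forall>l. Poly_Mapping.lookup \<gamma> l = (\<Sum>i\<in>{1..n}. d i * Poly_Mapping.lookup (alpha n i) l)"
    using assms unfolding root_lattice_def by blast
  then show ?thesis unfolding root_lattice_def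
    by (auto intro!: exI[of _ "\<lambda>i. c i + d i"] simp: lookup_add distrib_right sum.distrib)
qed
lemma root_lattice_uminus: assumes "\<beta> \<in> root_lattice n" shows "- \<beta> \<in> root_lattice n"
proof -
  obtain c where "\<forall>l. Poly_Mapping.lookup \<beta> l = (\<Sum>i\<in>{1..n}. c i * Poly_Mapping.lookup (alpha n i) l)"
    using assms unfolding root_lattice_def by blast
  then show ?thesis unfolding root_lattice_def
    by (auto intro!: exI[of _ "\<lambda>i. - c i"] simp: sum_negf)
qed
lemma root_lattice_alpha: assumes "j \<in> {1..n}" shows "alpha n j \<in> root_lattice n"
  unfolding root_lattice_def
proof (intro CollectI exI[of _ "\<lambda>i. if i = j then 1 else 0"] allI)
  fix l
  have "(\<Sum>i\<in>{1..n}. (if i = j then 1 else 0) * Poly_Mapping.lookup (alpha n i) l) = (\<Sum>i\<in>{1..n}. if i = j then Poly_Mapping.lookup (alpha n i) l else 0)"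
    by (rule sum.cong) auto
  then show "Poly_Mapping.lookup (alpha n j) l = (\<Sum>i\<in>{1..n}. (if i = j then 1 else 0) * Poly_Mapping.lookup (alpha n i) l)"
    using assms by simp
qed

lemma fock_keys_0: "0 \<in> fock_keys n" by (simp add: fock_keys_def zero_prod_def root_lattice_0)
lemma fock_keys_add: "k \<in> fock_keys n \<Longrightarrow> l \<in> fock_keys n \<Longrightarrow> k + l \<in> fock_keys n"
  using Poly_Mapping.keys_add[of "fst k" "fst l"] by (cases k; cases l) (auto simp: fock_keys_def root_lattice_add)

lemma keys_add_nat: "Poly_Mapping.keys (\<mu> + \<nu>) = Poly_Mapping.keys \<mu> \<union> Poly_Mapping.keys \<nu>" for \<mu> \<nu> :: "'a \<Rightarrow>\<^sub>0 nat"
  by (auto simp: in_keys_iff lookup_add)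

lemmas supp_mult_fock_keys = supp_in_mult[of "fock_keys n" _ "fock_keys n" _ "fock_keys n", OF _ _ fock_keys_add] for n

lemma supp_scalar_ser: assumes "scalar_ser s" shows "supp_in (fock_keys n \<times> UNIV) s"
  using assms fock_keys_0[of n] unfolding scalar_ser_def supp_in_def by blast

lemma supp_mult_laurent: "supp_in (fock_keys n \<times> UNIV) r \<Longrightarrow> supp_in (fock_keys n \<times> UNIV) s \<Longrightarrow> supp_in (fock_keys n \<times> UNIV) (r * s)"
  by (erule supp_in_mult, assumption) (simp add: mem_Times_iff fock_keys_add)

text \<open>Generators are changed only by adding or multiplying scalar series, which carry the
  label 0; neither a foreign generator nor a weight outside the root lattice can appear.\<close>

lemma supp_field_hom:
  assumes A: "field_good A" and x: "supp_in (fock_keys n) x" shows "supp_in (fock_keys n \<times> UNIV) (field_hom A x)"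
proof (rule supp_in_A_linear[OF _ _ x])
  have g: "scalar_ser (fst A a)" "scalar_ser (fst (snd A) \<beta>)" "mult_hom (fst (snd A))" for a \<beta>
    by (rule good_shiftD[OF A[unfolded field_good_def]])+
  show "A_linear (field_hom A)" unfolding field_hom_def by (rule A_linear_shift_hom)
  note v = fock_hom_shift_hom[OF g(3), of "fst A", folded field_hom_def]
  fix k assume k: "k \<in> fock_keys n"
  obtain \<mu> \<beta> where kk: "k = (\<mu>, \<beta>)" by (cases k)
  have \<mu>: "Poly_Mapping.keys \<mu> \<subseteq> {1..n} \<times> {1..}" and \<beta>: "(0, \<beta>) \<in> fock_keys n" using k by (auto simp: kk fock_keys_def)
  from \<mu> have "supp_in (fock_keys n \<times> UNIV) (field_hom A (basis (\<mu>, 0)))"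
  proof (induction \<mu> rule: pm_nat_induct)
    case 1
    have "field_hom A (basis (0, 0)) = basis (0, 0)" using fock_homD(3)[OF v] by (simp add: basis_0 flip: zero_prod_def)
    then show ?case by (simp add: supp_in_basis fock_keys_0)
  next
    case (2 \<mu> a)
    have e: "basis (Poly_Mapping.single a 1 + \<mu>, 0) = a_elt a * basis (\<mu>, 0)" by (simp add: a_elt_def basis_mult)
    have a: "(Poly_Mapping.single a 1, 0) \<in> fock_keys n" using 2(2) by (simp add: keys_add_nat fock_keys_def root_lattice_0)
    have "supp_in (fock_keys n \<times> UNIV) (field_hom A (a_elt a))"
      unfolding field_hom_def shift_hom_a_elt[OF g(3)] by (rule supp_in_add[OF _ supp_scalar_ser[OF g(1)]]) (simp add: a_elt_def supp_in_basis a)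
    then show ?case unfolding e fock_homD(2)[OF v] using 2 by (intro supp_mult_laurent) (auto simp: keys_add_nat)
  qed
  moreover have "basis k = basis (\<mu>, 0) * e_elt \<beta>" by (simp add: kk e_elt_def basis_mult)
  moreover have "supp_in (fock_keys n \<times> UNIV) (field_hom A (e_elt \<beta>))"
    unfolding field_hom_def shift_hom_e_elt by (rule supp_mult_laurent[OF _ supp_scalar_ser[OF g(2)]]) (simp add: e_elt_def supp_in_basis \<beta>)
  ultimately show "supp_in (fock_keys n \<times> UNIV) (field_hom A (basis k))" by (simp add: fock_homD(2)[OF v] supp_mult_laurent)
qed

definition coeffs_fock :: "nat \<Rightarrow> fock fps \<Rightarrow> bool" where "coeffs_fock n F \<longleftrightarrow> (\<forall>m. supp_in (fock_keys n) (F $ m))"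

lemma supp_field_op:
  assumes A: "field_good A" and F: "coeffs_fock n (field_cre A)" and x: "supp_in (fock_keys n) x" shows "supp_in (fock_keys n) (field_op A m x)"
  unfolding field_op_def field_ser_def
proof (rule supp_in_A_linear[OF A_linear_ser_act _ supp_field_hom[OF A x]])
  fix k :: "key \<times> int" assume "k \<in> fock_keys n \<times> UNIV"
  moreover have "supp_in (fock_keys n) (to_ser (field_cre A) i)" for i using F by (simp add: coeffs_fock_def to_ser_def)
  ultimately show "supp_in (fock_keys n) (ser_act (basis k) (to_ser (field_cre A)) m)"
    by (cases k) (auto simp: ser_act_basis supp_in_basis intro!: supp_mult_fock_keys)
qed

lemma supp_1: "supp_in (fock_keys n) 1" using supp_in_basis[of "fock_keys n" 0] by (simp add: basis_0 fock_keys_0)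
lemma coeffs_fock_1: "coeffs_fock n 1" by (simp add: coeffs_fock_def supp_1)
lemma coeffs_fock_add: "coeffs_fock n F \<Longrightarrow> coeffs_fock n G \<Longrightarrow> coeffs_fock n (F + G)" by (simp add: coeffs_fock_def supp_in_add)
lemma coeffs_fock_uminus: "coeffs_fock n F \<Longrightarrow> coeffs_fock n (- F)" by (simp add: coeffs_fock_def supp_in_uminus)
lemma coeffs_fock_diff: "coeffs_fock n F \<Longrightarrow> coeffs_fock n G \<Longrightarrow> coeffs_fock n (F - G)" by (simp add: coeffs_fock_def supp_in_diff)
lemma coeffs_fock_sum: "(\<And>i. i \<in> A \<Longrightarrow> coeffs_fock n (f i)) \<Longrightarrow> coeffs_fock n (sum f A)"
  by (simp add: coeffs_fock_def fps_sum_nth supp_in_sum)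
lemma coeffs_fock_mult: "coeffs_fock n F \<Longrightarrow> coeffs_fock n G \<Longrightarrow> coeffs_fock n (F * G)"
  by (simp add: coeffs_fock_def fps_mult_nth supp_in_sum supp_mult_fock_keys)
lemma coeffs_fock_EXP: assumes "coeffs_fock n C" shows "coeffs_fock n (EXP C)"
proof -
  have "coeffs_fock n (C ^ k)" for k by (induction k) (simp_all add: coeffs_fock_1 coeffs_fock_mult assms)
  then show ?thesis by (simp add: coeffs_fock_def EXP_def supp_in_hsum supp_in_scl)
qed
text \<open>The index 0 is included because vertex 1 lists 0 among its neighbours; its creation
  series is 0.\<close>

lemma coeffs_fock_cre_ser: assumes "j \<le> n" shows "coeffs_fock n (cre_ser j c)"
proof -
  have "supp_in (fock_keys n) (cre_gen j $ k)" for k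
  proof (cases "j = 0 \<or> k = 0")
    case False
    then have "(Poly_Mapping.single (j, k) 1, 0) \<in> fock_keys n" using assms by (simp add: fock_keys_def root_lattice_0)
    then show ?thesis using False by (simp add: cre_gen_def supp_in_scl a_elt_def supp_in_basis)
  qed (auto simp: cre_gen_def)
  then show ?thesis by (simp add: coeffs_fock_def cre_ser_def subst_v_def v_plus_power supp_in_hsum supp_in_scl scl_comm[symmetric])
qed

lemma coeffs_fock_field_cre:
  assumes "3 \<le> n" "j \<in> {1..n}"
  shows "coeffs_fock n (field_cre (field_E n j))" "coeffs_fock n (field_cre (field_F n j))" "coeffs_fock n (field_cre (field_Hp n j))" "coeffs_fock n (field_cre (field_Hm n j))"
proof -
  have nb: "coeffs_fock n (cre_ser i c)" if "i \<in> nbrs n j" for i c using that nbrs_subset[OF assms] by (intro coeffs_fock_cre_ser) auto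
  have j: "coeffs_fock n (cre_ser j c)" for c using assms by (intro coeffs_fock_cre_ser) simp
  have e: "coeffs_fock n (fps_const (e_elt \<beta>))" if "\<beta> \<in> root_lattice n" for \<beta>
    using that by (auto simp: coeffs_fock_def e_elt_def supp_in_basis fock_keys_def)
  have C: "coeffs_fock n (log_cre_E n j)" "coeffs_fock n (log_cre_F n j)" "coeffs_fock n (log_cre_H n j)"
    unfolding log_cre_E_def log_cre_F_def log_cre_H_def by (intro coeffs_fock_add coeffs_fock_diff coeffs_fock_uminus coeffs_fock_sum j nb; assumption)+
  note al = root_lattice_alpha[OF assms(2)]
  show "coeffs_fock n (field_cre (field_E n j))" "coeffs_fock n (field_cre (field_F n j))" "coeffs_fock n (field_cre (field_Hp n j))" "coeffs_fock n (field_cre (field_Hm n j))"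
    unfolding field_cre_eqs cre_E_def cre_F_def cre_H_def
    by (intro coeffs_fock_mult e coeffs_fock_EXP C al root_lattice_uminus coeffs_fock_1)+
qed

lemma supp_ops:
  assumes "3 \<le> n" "j \<in> {1..n}" "supp_in (fock_keys n) x"
  shows "supp_in (fock_keys n) (E_op n j m x)" "supp_in (fock_keys n) (F_op n j m x)" "supp_in (fock_keys n) (Hp_op n j m x)" "supp_in (fock_keys n) (Hm_op n j m x)"
proof -
  have j: "j \<noteq> 0" using assms by auto
  show "supp_in (fock_keys n) (E_op n j m x)" "supp_in (fock_keys n) (F_op n j m x)" "supp_in (fock_keys n) (Hp_op n j m x)" "supp_in (fock_keys n) (Hm_op n j m x)"
    unfolding op_eqs(1)[OF j] op_eqs(2)[OF j] op_eqs(3)[OF j] op_eqs(4)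
    by (intro supp_field_op field_good_eqs coeffs_fock_field_cre assms)+
qed

lemma supp_shift: "supp_in S x \<Longrightarrow> supp_in S (fps_shift k x)" by (simp add: supp_in_def)

lemma supp_gen_op: assumes "3 \<le> n" "supp_in (fock_keys n) x" shows "supp_in (fock_keys n) (gen_op n g x)"
proof (cases "g \<in> gens n")
  case True
  then show ?thesis using assms
    by (cases g) (auto simp: gen_op_def supp_ops supp_in_uminus intro!: supp_shift supp_in_diff)
qed (simp add: gen_op_def)

lemma free_act_Fock: assumes "3 \<le> n" "v \<in> Fock n" shows "free_act n x v \<in> Fock n"
  unfolding Fock_iff
proof (rule supp_in_A_linear[OF A_linear_free_act, of UNIV])
  fix w
  have "supp_in (fock_keys n) (foldr (gen_op n) l v)" for l
    by (induction l) (use assms in \<open>simp_all add: Fock_iff supp_gen_op\<close>)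
  then show "supp_in (fock_keys n) (free_act n (basis w) v)" by (simp add: free_act_basis)
qed (simp add: supp_in_def)

section \<open>The free algebra as a ring and the kernel of its action\<close>

definition gen_words :: "nat \<Rightarrow> word set" where "gen_words n = {w. set (letters w) \<subseteq> gens n}"

lemma carrier_iff: "x \<in> carrier (free_alg n) \<longleftrightarrow> supp_in (gen_words n) x"
  by (auto simp: free_alg_def supp_in_def gen_words_def)

lemma free_alg_sel [simp]:
  "mult (free_alg n) = (*)" "one (free_alg n) = 1" "zero (free_alg n) = 0" "add (free_alg n) = (+)"
  by (simp_all add: free_alg_def)

abbreviation in_free :: "nat \<Rightarrow> falg \<Rightarrow> bool" where "in_free n \<equiv> supp_in (gen_words n)"

lemma in_free_mult: "in_free n x \<Longrightarrow> in_free n y \<Longrightarrow> in_free n (x * y)"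
  by (erule supp_in_mult, assumption) (simp add: gen_words_def letters_plus)
lemma in_free_1: "in_free n 1"
  using supp_in_basis[of "gen_words n" 0] by (simp add: basis_0) (simp add: gen_words_def zero_word_def)
lemma in_free_scl: "in_free n (scl f)" using supp_in_scl[OF in_free_1, of n f] by simp
lemma in_free_gen: "g \<in> gens n \<Longrightarrow> in_free n (gen_el g)" by (simp add: gen_el_basis supp_in_basis gen_words_def)

lemma ring_free_alg: "ring (free_alg n)"
proof (rule ringI)
  show "abelian_group (free_alg n)"
  proof (rule abelian_groupI)
    fix x assume "x \<in> carrier (free_alg n)"
    then show "\<exists>y\<in>carrier (free_alg n). y \<oplus>\<^bsub>free_alg n\<^esub> x = \<zero>\<^bsub>free_alg n\<^esub>"
      by (intro bexI[of _ "- x"]) (simp_all add: carrier_iff supp_in_uminus)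
  qed (simp_all add: carrier_iff supp_in_add add.assoc add.commute)
  show "Group.monoid (free_alg n)"
    by (rule monoidI) (auto simp: carrier_iff in_free_mult in_free_1 mult.assoc)
qed (auto simp: distrib_left distrib_right)

lemma a_inv_free_alg: assumes "in_free n x" shows "a_inv (free_alg n) x = - x"
proof -
  interpret ring "free_alg n" by (rule ring_free_alg)
  show ?thesis by (rule minus_equality) (use assms in \<open>simp_all add: carrier_iff supp_in_uminus\<close>)
qed

text \<open>The distance of two series is 2^(-m), m being the first order at which they differ. To
  be a limit of \<open>I\<close> therefore means to agree with an element of \<open>I\<close> up to
  each order.\<close>

lemma closed_fpsI:
  fixes I :: "'a::group_add fps set"
  assumes "\<And>x. (\<And>p. \<exists>y\<in>I. \<forall>q\<le>p. x $ q = y $ q) \<Longrightarrow> x \<in> I" shows "closed I"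
  unfolding closed_def open_fps_def
proof safe
  fix a assume "a \<notin> I"
  then have "\<not> (\<forall>p. \<exists>y\<in>I. \<forall>q\<le>p. a $ q = y $ q)" using assms[of a] by metis
  then obtain p where p: "\<And>y. y \<in> I \<Longrightarrow> \<exists>q\<le>p. a $ q \<noteq> y $ q" by metis
  have "y \<notin> I" if "dist y a < inverse (2 ^ p)" for y
  proof
    assume y: "y \<in> I"
    then obtain q where q: "q \<le> p" "a $ q \<noteq> y $ q" using p by blast
    then have ne: "y \<noteq> a" and "(y - a) $ q \<noteq> 0" by auto
    then have "subdegree (y - a) \<le> p" using subdegree_leI q(1) le_trans by blast
    then have "inverse (2 ^ p :: real) \<le> inverse (2 ^ subdegree (y - a))" by (simp add: le_imp_inverse_le)
    then show False using that ne by (simp add: dist_fps_def)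
  qed
  then show "\<exists>r>0. {y. dist y a < r} \<subseteq> - I" by (intro exI[of _ "inverse (2 ^ p)"]) auto
qed

definition kernel_ideal :: "nat \<Rightarrow> falg set" where "kernel_ideal n = {x. in_free n x \<and> (\<forall>v. free_act n x v = 0)}"

lemma ideal_kernel_ideal: "ideal (kernel_ideal n) (free_alg n)"
proof (rule idealI[OF ring_free_alg])
  show "subgroup (kernel_ideal n) (add_monoid (free_alg n))"
  proof (rule subgroup.intro)
    show "kernel_ideal n \<subseteq> carrier (add_monoid (free_alg n))" by (auto simp: kernel_ideal_def carrier_iff)
    show "\<one>\<^bsub>add_monoid (free_alg n)\<^esub> \<in> kernel_ideal n" by (simp add: kernel_ideal_def free_act_0)
    show "inv\<^bsub>add_monoid (free_alg n)\<^esub> a \<in> kernel_ideal n" if "a \<in> kernel_ideal n" for a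
      using that a_inv_free_alg[of n a, unfolded a_inv_def] by (simp add: kernel_ideal_def free_act_minus supp_in_uminus)
    show "a \<otimes>\<^bsub>add_monoid (free_alg n)\<^esub> b \<in> kernel_ideal n" if "a \<in> kernel_ideal n" "b \<in> kernel_ideal n" for a b
      using that by (simp add: kernel_ideal_def free_act_add supp_in_add)
  qed
qed (auto simp: kernel_ideal_def carrier_iff in_free_mult free_act_mult A_linear_0[OF A_linear_Phi2])

text \<open>Order p of the result depends only on the orders up to p of the acting element, so an
  element approximated by the kernel to every order acts as 0.\<close>

lemma closed_kernel_ideal: "closed (kernel_ideal n)"
proof (rule closed_fpsI)
  fix x assume a: "\<And>p. \<exists>y\<in>kernel_ideal n. \<forall>q\<le>p. x $ q = y $ q"
  have "Poly_Mapping.keys (x $ p) \<subseteq> gen_words n" for p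
  proof -
    obtain y where "in_free n y" "x $ p = y $ p" using a[of p] by (auto simp: kernel_ideal_def)
    then show ?thesis by (simp add: supp_in_def)
  qed
  moreover have "free_act n x v $ p = 0" for v p
  proof -
    obtain y where y: "y \<in> kernel_ideal n" "\<And>q. q \<le> p \<Longrightarrow> x $ q = y $ q" using a[of p] by blast
    have "trunc p x = trunc p y" by (rule fps_ext) (simp add: trunc_nth y(2))
    then have "free_act n x v $ p = free_act n y v $ p" using A_linear_trunc[OF A_linear_free_act, of n x v p] A_linear_trunc[OF A_linear_free_act, of n y v p] by simp
    then show ?thesis using y(1) by (simp add: kernel_ideal_def)
  qed
  ultimately show "x \<in> kernel_ideal n" by (auto simp: kernel_ideal_def supp_in_def intro: fps_ext)
qed

definition ser_free :: "nat \<Rightarrow> ('e \<Rightarrow> falg) \<Rightarrow> bool" where "ser_free n f \<longleftrightarrow> (\<forall>e. in_free n (f e))"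

lemma ser_free_conv: "ser_free n f \<Longrightarrow> ser_free n g \<Longrightarrow> ser_free n (f \<star> g)"
  by (simp add: ser_free_def ser_mult_def supp_in_hsum in_free_mult)
lemma ser_free_in_u: "ser_free n f \<Longrightarrow> ser_free n (in_u f)" and ser_free_in_v: "ser_free n f \<Longrightarrow> ser_free n (in_v f)"
  by (auto simp: ser_free_def in_u_def in_v_def)
lemma ser_free_diff: "ser_free n f \<Longrightarrow> ser_free n g \<Longrightarrow> ser_free n (f - g)" by (simp add: ser_free_def supp_in_diff)
lemma ser_free_one: "ser_free n ser_one" by (simp add: ser_free_def ser_one_def in_free_1)
lemma ser_free_inv: assumes "ser_free n f" shows "ser_free n (ser_inv f)"
proof -
  have "ser_free n ((((\<star>) (ser_one - f)) ^^ k) ser_one)" for k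
    by (induction k) (simp_all only: funpow.simps id_apply o_apply ser_free_one ser_free_conv ser_free_diff assms)
  then show ?thesis by (simp add: ser_free_def ser_inv_def supp_in_hsum)
qed
lemma ser_free_lin: "in_free n x \<Longrightarrow> in_free n y \<Longrightarrow> in_free n z \<Longrightarrow> ser_free n (lin x y z)"
  by (simp add: ser_free_def lin_def in_free_1 supp_in_add supp_in_diff supp_in_uminus)
lemma in_free_of_int: "in_free n (of_int k)" using in_free_scl[of n "of_int k"] by (simp add: scl_of_int)
lemma in_free_power: "in_free n x \<Longrightarrow> in_free n (x ^ k)" by (induction k) (simp_all add: in_free_1 in_free_mult)
lemma in_free_pw: "in_free n s \<Longrightarrow> in_free n (pw s k m)" by (simp add: pw_def in_free_mult in_free_of_int in_free_power)
lemma ser_free_recip: "in_free n s \<Longrightarrow> ser_free n (recip_uinf s)" "in_free n s \<Longrightarrow> ser_free n (recip_u0 s)"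
  by (auto simp: ser_free_def recip_uinf_def recip_u0_def in_free_pw supp_in_uminus)
lemma ser_free_delta: "in_free n x \<Longrightarrow> in_free n y \<Longrightarrow> ser_free n (delta x y)"
  by (auto simp: ser_free_def delta_def in_free_mult in_free_pw supp_in_hsum)
lemma ser_free_ser_shift: "in_free n s \<Longrightarrow> ser_free n f \<Longrightarrow> ser_free n (ser_shift s f)"
  by (simp add: ser_free_def ser_shift_def in_free_mult in_free_pw supp_in_hsum)
lemma in_free_X: "in_free n fps_X" using in_free_scl[of n fps_X] by (simp add: scl_X)
lemma ser_free_gen: assumes "i \<in> {1..n}" shows "ser_free n (Eser i)" "ser_free n (Fser i)" "ser_free n (Hser s i)"
  using assms ser_free_one[of n] by (auto simp: ser_free_def Eser_def Fser_def Hser_def in_free_gen in_free_mult in_free_X supp_in_add supp_in_diff)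
lemma in_free_hc4: "in_free n hc4" by (simp add: hc4_def in_free_mult in_free_scl in_free_gen)
lemma in_free_Bh: "in_free n (Bh n i j)" by (simp add: Bh_def in_free_scl)
lemma in_free_commutator: "in_free n x \<Longrightarrow> in_free n y \<Longrightarrow> in_free n (commutator x y)"
  by (simp add: commutator_def in_free_mult supp_in_diff)

lemma in_free_serre: assumes "ser_free n (X i)" "ser_free n (X j)" shows "in_free n (serre X m i j r t)"
proof -
  have "in_free n (foldr (\<lambda>k y. commutator (X i (r (\<sigma> k))) y) l (X j t))" for \<sigma> l
    by (induction l) (use assms in \<open>simp_all add: ser_free_def in_free_commutator\<close>)
  then show ?thesis unfolding serre_def by (intro supp_in_sum)
qed

lemma ser_freeD: "ser_free n f \<Longrightarrow> in_free n (f e)" by (simp add: ser_free_def)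

lemmas in_free_intros = ser_freeD[OF ser_free_diff] ser_free_conv ser_free_in_u ser_free_in_v ser_free_lin ser_free_gen ser_free_inv ser_free_ser_shift ser_free_delta ser_free_recip
  in_free_hc4 in_free_Bh supp_in_add supp_in_uminus supp_in_diff in_free_mult in_free_of_int supp_in_0

text \<open>The defining ideal is an intersection of ideals of \<open>free_alg n\<close> that
  contain the relators; for the kernel to be among them, the relators have to lie in the
  carrier.\<close>

lemma in_free_relators: assumes "x \<in> relators n" shows "in_free n x"
  using assms
proof cases
  case (central g) then show ?thesis by (simp add: in_free_commutator in_free_gen)
next
  case (HH_same i j s e) then show ?thesis unfolding HH_same(1) by (intro in_free_intros)
next
  case (HH_mixed i j s q b e) then show ?thesis unfolding HH_mixed(1) HH_mixed(5,6) by (intro in_free_intros)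
next
  case (HE i j s q b recip e)
  have r: "in_free n w \<Longrightarrow> ser_free n (recip w)" for w using HE(7) by (simp add: ser_free_recip)
  show ?thesis unfolding HE(1) HE(5,6) by (intro in_free_intros r HE)
next
  case (HF i j s q b recip e)
  have r: "in_free n w \<Longrightarrow> ser_free n (recip w)" for w using HF(7) by (simp add: ser_free_recip)
  show ?thesis unfolding HF(1) HF(5,6) by (intro in_free_intros r HF)
next
  case (EE i j b e) show ?thesis unfolding EE(1) EE(4) by (intro in_free_intros EE)
next
  case (FF i j b e) show ?thesis unfolding FF(1) FF(4) by (intro in_free_intros FF)
next
  case (serre_E i j r t) then show ?thesis by (simp add: in_free_serre ser_free_gen)
next
  case (serre_F i j r t) then show ?thesis by (simp add: in_free_serre ser_free_gen)
next
  case (EF i j e)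
  have "in_free n (fps_shift 1 ((delta (- hc4) hc4 \<star> in_v (ser_shift hc4 (Hser (-1) i)) - delta hc4 (- hc4) \<star> in_u (ser_shift hc4 (Hser 1 i))) e))"
    by (intro supp_shift in_free_intros EF(2))
  then have "in_free n (if i = j then fps_shift 1 ((delta (- hc4) hc4 \<star> in_v (ser_shift hc4 (Hser (-1) i)) - delta hc4 (- hc4) \<star> in_u (ser_shift hc4 (Hser 1 i))) e) else 0)"
    by (cases "i = j") simp_all
  moreover have "in_free n ((in_u (Eser i) \<star> in_v (Fser j) - in_v (Fser j) \<star> in_u (Eser i)) e)"
    using EF by (intro in_free_intros)
  ultimately show ?thesis unfolding EF(1) by (rule supp_in_diff[rotated])
qed

lemma relators_kernel_ideal: assumes "3 \<le> n" shows "relators n \<subseteq> kernel_ideal n"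
  by (auto simp: kernel_ideal_def in_free_relators free_act_relators[OF assms])

lemma DY_ideal_subset: assumes "3 \<le> n" shows "DY_ideal n \<subseteq> kernel_ideal n"
  unfolding DY_ideal_def by (rule Inter_lower) (simp add: ideal_kernel_ideal closed_kernel_ideal relators_kernel_ideal[OF assms])

lemma ideal_DY: assumes "3 \<le> n" shows "ideal (DY_ideal n) (free_alg n)"
proof -
  interpret ring "free_alg n" by (rule ring_free_alg)
  \<comment> \<open>The family must be nonempty for its intersection to be an ideal; the kernel of
    the action is a member.\<close>
  have "kernel_ideal n \<in> {I. ideal I (free_alg n) \<and> closed I \<and> relators n \<subseteq> I}"
    by (simp add: ideal_kernel_ideal closed_kernel_ideal relators_kernel_ideal[OF assms])
  then show ?thesis unfolding DY_ideal_def by (intro i_Intersect) auto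
qed

text \<open>Any representative of the class may be chosen, since the ideal acts as 0
  (\<open>free_act_cls\<close>). The value \<open>undefined\<close> outside the carrier makes the
  map extensional, so that uniqueness is meaningful.\<close>

definition fock_rep :: "nat \<Rightarrow> falg set \<Rightarrow> fock \<Rightarrow> fock" where
  "fock_rep n C = (if C \<in> carrier (DY n) then restrict (free_act n (SOME x. x \<in> C)) (Fock n) else undefined)"

context fixes n :: nat assumes n: "3 \<le> n"
begin

lemma cls_hom: "cls n \<in> ring_hom (free_alg n) (DY n)"
  using ideal.rcos_ring_hom[OF ideal_DY[OF n]] unfolding DY_def cls_def[abs_def] .

lemma DY_carrier: "C \<in> carrier (DY n) \<longleftrightarrow> (\<exists>x. in_free n x \<and> C = cls n x)"
  by (auto simp: DY_def FactRing_def A_RCOSETS_def' cls_def carrier_iff)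

lemma cls_carrier: "in_free n x \<Longrightarrow> cls n x \<in> carrier (DY n)" using DY_carrier by blast

lemma free_act_cls: assumes "in_free n x" "y \<in> cls n x" shows "free_act n y v = free_act n x v"
proof -
  obtain i where "i \<in> DY_ideal n" "y = i + x" using assms(2) by (auto simp: cls_def a_r_coset_def')
  then show ?thesis using DY_ideal_subset[OF n] by (auto simp: kernel_ideal_def free_act_add)
qed

lemma fock_rep_cls: assumes "in_free n x" shows "fock_rep n (cls n x) = restrict (free_act n x) (Fock n)"
proof -
  interpret ideal "DY_ideal n" "free_alg n" by (rule ideal_DY[OF n])
  have "0 \<in> DY_ideal n" using additive_subgroup.zero_closed[OF additive_subgroup_axioms] by simp
  then have "x \<in> cls n x" by (auto simp: cls_def a_r_coset_def')
  then have "(SOME y. y \<in> cls n x) \<in> cls n x" by (rule someI)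
  then have "free_act n (SOME y. y \<in> cls n x) = free_act n x" using free_act_cls[OF assms] by blast
  then show ?thesis using cls_carrier[OF assms] by (simp add: fock_rep_def)
qed

lemma End_carrier: "restrict (free_act n x) (Fock n) \<in> carrier (End_Fock n)"
proof -
  have "v + w \<in> Fock n" "scl f * v \<in> Fock n" if "v \<in> Fock n" "w \<in> Fock n" for v w f
    using that by (simp_all add: Fock_iff supp_in_add supp_in_scl)
  then show ?thesis
    by (auto simp: End_Fock_def free_act_Fock[OF n] A_linear_add[OF A_linear_Phi2] A_linear_scl[OF A_linear_Phi2])
qed

lemma fock_rep_hom: "fock_rep n \<in> ring_hom (DY n) (End_Fock n)"
proof (rule ring_hom_memI)
  fix C D assume "C \<in> carrier (DY n)" "D \<in> carrier (DY n)"
  then obtain x y where x: "in_free n x" "C = cls n x" and y: "in_free n y" "D = cls n y" using DY_carrier by metis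
  have c: "x \<in> carrier (free_alg n)" "y \<in> carrier (free_alg n)" using x y by (auto simp: carrier_iff)
  show "fock_rep n (C \<otimes>\<^bsub>DY n\<^esub> D) = fock_rep n C \<otimes>\<^bsub>End_Fock n\<^esub> fock_rep n D"
    using ring_hom_mult[OF cls_hom c] x y
    by (simp add: fock_rep_cls in_free_mult flip: ring_hom_mult[OF cls_hom c]) (auto simp: End_Fock_def compose_def fun_eq_iff free_act_mult free_act_Fock[OF n])
  show "fock_rep n (C \<oplus>\<^bsub>DY n\<^esub> D) = fock_rep n C \<oplus>\<^bsub>End_Fock n\<^esub> fock_rep n D"
    using x y by (simp add: fock_rep_cls supp_in_add flip: ring_hom_add[OF cls_hom c]) (auto simp: End_Fock_def fun_eq_iff free_act_add)
next
  show "fock_rep n C \<in> carrier (End_Fock n)" if "C \<in> carrier (DY n)" for C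
    using that DY_carrier[of C] fock_rep_cls End_carrier by auto
  have "fock_rep n (cls n 1) = (\<lambda>x\<in>Fock n. x)" by (simp add: fock_rep_cls in_free_1 free_act_1 restrict_def fun_eq_iff)
  then show "fock_rep n \<one>\<^bsub>DY n\<^esub> = \<one>\<^bsub>End_Fock n\<^esub>" using ring_hom_one[OF cls_hom] by (simp add: End_Fock_def)
qed

lemma fock_rep_spec:
  "fock_rep n \<in> extensional (carrier (DY n)) \<and> DY_module n (fock_rep n) \<and>
    fock_rep n (cls n (gen_el CC)) = (\<lambda>x\<in>Fock n. x) \<and>
    (\<forall>j\<in>{1..n}. \<forall>m.
      fock_rep n (cls n (Eser j m)) = restrict (E_op n j m) (Fock n) \<and>
      fock_rep n (cls n (Fser j m)) = restrict (F_op n j m) (Fock n) \<and>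
      fock_rep n (cls n (Hser (-1) j m)) = restrict (Hm_op n j m) (Fock n) \<and>
      fock_rep n (cls n (Hser 1 j m)) = restrict (Hp_op n j m) (Fock n))"
proof (intro conjI ballI allI)
  show "fock_rep n \<in> extensional (carrier (DY n))" by (simp add: extensional_def fock_rep_def)
  show "DY_module n (fock_rep n)" unfolding DY_module_def
    using fock_rep_hom by (simp add: fock_rep_cls in_free_scl free_act_scl restrict_def fun_eq_iff)
  show "fock_rep n (cls n (gen_el CC)) = (\<lambda>x\<in>Fock n. x)"
    by (simp add: fock_rep_cls in_free_gen free_act_gen gen_op_def restrict_def fun_eq_iff)
  fix j m assume j: "j \<in> {1..n}"
  note g = ser_free_gen[OF j, THEN ser_freeD]
  show "fock_rep n (cls n (Eser j m)) = restrict (E_op n j m) (Fock n)"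
    unfolding fock_rep_cls[OF g(1)] by (simp add: restrict_def fun_eq_iff free_act_E[OF j])
  show "fock_rep n (cls n (Fser j m)) = restrict (F_op n j m) (Fock n)"
    unfolding fock_rep_cls[OF g(2)] by (simp add: restrict_def fun_eq_iff free_act_F[OF j])
  show "fock_rep n (cls n (Hser (-1) j m)) = restrict (Hm_op n j m) (Fock n)"
    unfolding fock_rep_cls[OF g(3)] by (simp add: restrict_def fun_eq_iff free_act_H[OF j] H_op_def)
  show "fock_rep n (cls n (Hser 1 j m)) = restrict (Hp_op n j m) (Fock n)"
    unfolding fock_rep_cls[OF g(3)] by (simp add: restrict_def fun_eq_iff free_act_H[OF j] H_op_def)
qed

lemma DY_module_unique:
  assumes ext: "\<rho> \<in> extensional (carrier (DY n))" and mod: "DY_module n \<rho>"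
    and C: "\<rho> (cls n (gen_el CC)) = (\<lambda>x\<in>Fock n. x)"
    and E: "\<And>j m. j \<in> {1..n} \<Longrightarrow> \<rho> (cls n (Eser j m)) = restrict (E_op n j m) (Fock n)"
    and F: "\<And>j m. j \<in> {1..n} \<Longrightarrow> \<rho> (cls n (Fser j m)) = restrict (F_op n j m) (Fock n)"
    and H: "\<And>j m. j \<in> {1..n} \<Longrightarrow> \<rho> (cls n (Hser (-1) j m)) = restrict (Hm_op n j m) (Fock n)"
    "\<And>j m. j \<in> {1..n} \<Longrightarrow> \<rho> (cls n (Hser 1 j m)) = restrict (Hp_op n j m) (Fock n)"
  shows "\<rho> = fock_rep n"
proof -
  define R where "R x v = \<rho> (cls n x) v" for x v
  have hom: "\<rho> \<in> ring_hom (DY n) (End_Fock n)" and scl: "\<And>f. \<rho> (cls n (scl f)) = (\<lambda>x\<in>Fock n. scl f * x)"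
    using mod by (auto simp: DY_module_def)
  have Fk: "\<rho> (cls n x) \<in> Fock n \<rightarrow>\<^sub>E Fock n" if "in_free n x" for x
    using ring_hom_closed[OF hom cls_carrier[OF that]] by (simp add: End_Fock_def)
  have RF: "R x v \<in> Fock n" if "in_free n x" "v \<in> Fock n" for x v
    using Fk[OF that(1)] that(2) unfolding R_def by (auto simp: PiE_def)
  have Radd: "R (x + y) v = R x v + R y v" if "in_free n x" "in_free n y" "v \<in> Fock n" for x y v
    using ring_hom_add[OF cls_hom, of x y] ring_hom_add[OF hom cls_carrier[OF that(1)] cls_carrier[OF that(2)]] that
    by (simp add: carrier_iff R_def End_Fock_def)
  have Rmult: "R (x * y) v = R x (R y v)" if "in_free n x" "in_free n y" "v \<in> Fock n" for x y v
    using ring_hom_mult[OF cls_hom, of x y] ring_hom_mult[OF hom cls_carrier[OF that(1)] cls_carrier[OF that(2)]] that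
    by (simp add: carrier_iff R_def End_Fock_def compose_def)
  have Rscl: "R (scl f) v = scl f * v" if "v \<in> Fock n" for f v using that by (simp add: R_def scl)
  have Rsm: "R (scl f * x) v = scl f * R x v" if "in_free n x" "v \<in> Fock n" for f x v
    using that by (simp add: Rmult in_free_scl Rscl RF)
  have Rsum: "R (\<Sum>i\<in>A. f i) v = (\<Sum>i\<in>A. R (f i) v)" if "finite A" "\<And>i. i \<in> A \<Longrightarrow> in_free n (f i)" "v \<in> Fock n" for A :: "'i set" and f v
    using that
  proof (induction A rule: finite_induct)
    case empty then show ?case using Rscl[of v 0] by simp
  next
    case (insert a A) then show ?case by (simp add: Radd supp_in_sum)
  qed
  have gen: "R (gen_el g) v = free_act n (gen_el g) v" if g: "g \<in> gens n" and v: "v \<in> Fock n" for g v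
  proof (cases g)
    case (HH i r)
    then have i: "i \<in> {1..n}" using g by simp
    note fg = in_free_gen[OF g]
    have X: "R (fps_X * gen_el g) v = fps_X * R (gen_el g) v" using Rsm[OF fg v, of fps_X] by (simp add: scl_X)
    have "fps_X * R (gen_el g) v = fps_X * free_act n (gen_el g) v"
    proof (cases "0 \<le> r")
      case True
      then have h: "Hser 1 i (- r - 1) = fps_X * gen_el g" by (simp add: Hser_def ser_one_def HH)
      have "R (Hser 1 i (- r - 1)) v = free_act n (Hser 1 i (- r - 1)) v" using v by (simp add: R_def H(2)[OF i] free_act_H[OF i] H_op_def)
      then show ?thesis unfolding h X free_act_X .
    next
      case False
      let ?m = "- r - 1"
      \<comment> \<open>H^- carries its generators with a minus sign, so the generator is isolated
        by addition. The constant series on the left is a scalar, whose action is prescribed by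
        \<open>DY_module\<close>.\<close>
      have h: "ser_one ?m = Hser (-1) i ?m + fps_X * gen_el g" using False by (simp add: Hser_def HH)
      have s: "ser_one ?m = scl (if ?m = 0 then 1 else 0)" by (simp add: ser_one_def)
      have "R (ser_one ?m) v = free_act n (ser_one ?m) v" unfolding s using v by (simp only: Rscl free_act_scl)
      moreover have "R (Hser (-1) i ?m) v = free_act n (Hser (-1) i ?m) v" using v by (simp add: R_def H(1)[OF i] free_act_H[OF i] H_op_def)
      ultimately show ?thesis
        unfolding h free_act_add free_act_X using Radd[OF ser_freeD[OF ser_free_gen(3)[OF i]] in_free_mult[OF in_free_X fg] v] X by simp
    qed
    then show ?thesis by (rule fps_X_cancel)
  next
    case (XP i r)
    then have i: "i \<in> {1..n}" and e: "gen_el g = Eser i (- r - 1)" using g by (simp_all add: Eser_def)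
    show ?thesis unfolding e using v by (simp add: R_def E[OF i] free_act_E[OF i])
  next
    case (XM i r)
    then have i: "i \<in> {1..n}" and e: "gen_el g = Fser i (- r - 1)" using g by (simp_all add: Fser_def)
    show ?thesis unfolding e using v by (simp add: R_def F[OF i] free_act_F[OF i])
  next
    case CC then show ?thesis using v by (simp add: R_def C free_act_gen gen_op_def)
  qed
  have word: "R (basis (Word l)) v = free_act n (basis (Word l)) v" if "set l \<subseteq> gens n" "v \<in> Fock n" for l v
    using that
  proof (induction l)
    case Nil
    have e: "basis (Word []) = scl 1" unfolding zero_word_def[symmetric] by (simp add: basis_0)
    show ?case unfolding e Rscl[OF Nil(2)] free_act_scl ..
  next
    case (Cons g l)
    have e: "basis (Word (g # l)) = gen_el g * basis (Word l)" by (simp add: gen_el_basis basis_mult plus_word_def)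
    have "in_free n (gen_el g)" using Cons.prems by (simp add: in_free_gen)
    moreover have "in_free n (basis (Word l))" using Cons.prems by (simp add: supp_in_basis gen_words_def)
    ultimately have "in_free n (gen_el g)" "in_free n (basis (Word l))" .
    then show ?case unfolding e using Cons by (simp add: Rmult gen free_act_mult free_act_Fock[OF n])
  qed
  have fin: "R (trunc p x) v = free_act n (trunc p x) v" and ft: "in_free n (trunc p x)" if x: "in_free n x" and v: "v \<in> Fock n" for p x v
  proof -
    have k: "k \<in> gen_words n" if "k \<in> Poly_Mapping.keys (x $ q)" for k q using x that by (auto simp: supp_in_def)
    have w: "in_free n (scl f * basis k)" "R (scl f * basis k) v = free_act n (scl f * basis k) v" if "k \<in> gen_words n" for k f
      using that word[of "letters k" v] v by (cases k; simp add: supp_in_basis supp_in_scl Rsm A_linear_scl[OF A_linear_free_act] gen_words_def)+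
    show "R (trunc p x) v = free_act n (trunc p x) v"
      unfolding trunc_def using k w v by (simp add: Rsum A_linear_sum[OF A_linear_free_act] supp_in_sum)
    show "in_free n (trunc p x)" unfolding trunc_def by (intro supp_in_sum w k)
  qed
  have all: "R x v = free_act n x v" if x: "in_free n x" and v: "v \<in> Fock n" for x v
  proof (rule fps_ext)
    fix p
    let ?y = "fps_shift (Suc p) x"
    \<comment> \<open>Linearity takes the place of continuity: the tail is hbar^(p+1) times an
      element of the carrier, and its image does not reach order p.\<close>
    have e: "x = trunc p x + scl (fps_X ^ Suc p) * ?y"
      by (rule fps_ext) (simp add: trunc_nth scl_power scl_X fps_X_power_mult_nth del: power_Suc)
    have fy: "in_free n ?y" by (rule supp_shift[OF x])
    have "R x v = R (trunc p x) v + scl (fps_X ^ Suc p) * R ?y v"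
      using Radd[OF ft[OF x v, of p] supp_in_scl[OF fy] v, of "fps_X ^ Suc p"] unfolding e[symmetric] Rsm[OF fy v] .
    then have "R x v $ p = free_act n (trunc p x) v $ p"
      by (simp add: fin[OF x v] scl_power scl_X fps_X_power_mult_nth del: power_Suc)
    then show "R x v $ p = free_act n x v $ p" using A_linear_trunc[OF A_linear_free_act, of n x v p] by simp
  qed
  show ?thesis
  proof (rule extensionalityI[OF ext])
    show "fock_rep n \<in> extensional (carrier (DY n))" by (simp add: extensional_def fock_rep_def)
    fix D assume "D \<in> carrier (DY n)"
    then obtain x where x: "in_free n x" "D = cls n x" using DY_carrier by blast
    show "\<rho> D = fock_rep n D"
      unfolding x(2) fock_rep_cls[OF x(1)]
      by (rule extensionalityI[of _ "Fock n"]) (use Fk[OF x(1)] all[OF x(1)] in \<open>auto simp: PiE_def R_def\<close>)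
  qed
qed

end

theorem theorem7p3:
  fixes n :: nat
  assumes "n \<ge> 3"
  shows "\<exists>!\<rho>. \<rho> \<in> extensional (carrier (DY n)) \<and> DY_module n \<rho> \<and>
    \<rho> (cls n (gen_el CC)) = (\<lambda>x\<in>Fock n. x) \<and>
    (\<forall>j\<in>{1..n}. \<forall>m.
      \<rho> (cls n (Eser j m)) = restrict (E_op n j m) (Fock n) \<and>
      \<rho> (cls n (Fser j m)) = restrict (F_op n j m) (Fock n) \<and>
      \<rho> (cls n (Hser (-1) j m)) = restrict (Hm_op n j m) (Fock n) \<and>
      \<rho> (cls n (Hser 1 j m)) = restrict (Hp_op n j m) (Fock n))"
proof (rule ex1I[of _ "fock_rep n"])
  show "fock_rep n \<in> extensional (carrier (DY n)) \<and> DY_module n (fock_rep n) \<and>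
    fock_rep n (cls n (gen_el CC)) = (\<lambda>x\<in>Fock n. x) \<and>
    (\<forall>j\<in>{1..n}. \<forall>m.
      fock_rep n (cls n (Eser j m)) = restrict (E_op n j m) (Fock n) \<and>
      fock_rep n (cls n (Fser j m)) = restrict (F_op n j m) (Fock n) \<and>
      fock_rep n (cls n (Hser (-1) j m)) = restrict (Hm_op n j m) (Fock n) \<and>
      fock_rep n (cls n (Hser 1 j m)) = restrict (Hp_op n j m) (Fock n))"
    by (rule fock_rep_spec[OF assms])
qed (rule DY_module_unique[OF assms]; blast)

end
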